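(* Let $a,b,p,w,Z$ be real parameters with $p>1$, and consider the Cauchy problem $$u_t+(A_Z-w)u=au^p+bu^{2p-1},\qquad u(0)=g\in H^1(\mathbb{R}).$$ (i) For $Z>0$ and $\frac{Z^2}{4}<-w$, the solution of the Cauchy problem is globally well defined in $H^1(\mathbb{R})$ provided the norm of the initial datum $u(0)=g$ is small in $H^1(\mathbb{R})$. (ii) For $Z\leq 0$ and $0<-w$, the solution of the Cauchy problem is globally well defined in $H^1(\mathbb{R})$ provided the norm of the initial datum $u(0)=g$ is small in $H^1(\mathbb{R})$.
   Context: $A_Z=-\frac{d^2}{dx^2}-Z\delta(x)$, with $\delta$ the Dirac distribution at $0$, denotes the self-adjoint operator on $L^2(\mathbb{R})$ acting as $g\mapsto -g''$ on $\mathbb{R}\setminus\{0\}$ with domain $$D(A_Z)=\{g\in H^1(\mathbb{R})\cap H^2(\mathbb{R}\setminus\{0\}) : g'(0+)-g'(0-)=-Zg(0)\}.$$ "The solution" is the unique local solution of the Cauchy problem with values in $H^1(\mathbb{R})$; "globally well defined" means that it exists in $H^1(\mathbb{R})$ for all $t\geq 0$. *)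

theory Defs
  imports "HOL-Analysis.Analysis"
begin

text \<open>
  Elements of the function spaces are represented by Borel functions \<open>real \<Rightarrow> real\<close>, with
  almost-everywhere equality in place of equality. All notions below depend only on the
  almost-everywhere class.
\<close>

definition L2 :: "real set \<Rightarrow> (real \<Rightarrow> real) set" where
  "L2 \<Omega> = {f. set_borel_measurable lborel \<Omega> f \<and> set_integrable lborel \<Omega> (\<lambda>x. (f x)\<^sup>2)}"

definition L2_norm_on :: "real set \<Rightarrow> (real \<Rightarrow> real) \<Rightarrow> real" where
  "L2_norm_on \<Omega> f = sqrt (LINT x:\<Omega>|lborel. (f x)\<^sup>2)"

definition test_functions :: "real set \<Rightarrow> (real \<Rightarrow> real) set" where
  "test_functions \<Omega> =
     {\<phi>. (\<forall>k x. (deriv ^^ k) \<phi> field_differentiable at x) \<and>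
         (\<exists>K. compact K \<and> K \<subseteq> \<Omega> \<and> (\<forall>x. x \<notin> K \<longrightarrow> \<phi> x = 0))}"

definition has_weak_deriv :: "real set \<Rightarrow> (real \<Rightarrow> real) \<Rightarrow> (real \<Rightarrow> real) \<Rightarrow> bool" where
  "has_weak_deriv \<Omega> f f' \<longleftrightarrow>
     (\<forall>\<phi>\<in>test_functions \<Omega>.
        (LINT x:\<Omega>|lborel. f x * deriv \<phi> x) = - (LINT x:\<Omega>|lborel. f' x * \<phi> x))"

primrec sobolev :: "nat \<Rightarrow> real set \<Rightarrow> (real \<Rightarrow> real) set" where
  "sobolev 0 \<Omega> = L2 \<Omega>"
| "sobolev (Suc k) \<Omega> = {f \<in> L2 \<Omega>. \<exists>f'\<in>sobolev k \<Omega>. has_weak_deriv \<Omega> f f'}"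

text \<open>On \<open>sobolev (Suc k) \<Omega>\<close> with \<open>\<Omega>\<close> open, the choice is unique almost everywhere on \<open>\<Omega>\<close>.\<close>

definition weak_deriv :: "real set \<Rightarrow> (real \<Rightarrow> real) \<Rightarrow> real \<Rightarrow> real" where
  "weak_deriv \<Omega> f = (SOME f'. f' \<in> L2 \<Omega> \<and> has_weak_deriv \<Omega> f f')"

abbreviation H1 :: "(real \<Rightarrow> real) set" where
  "H1 \<equiv> sobolev 1 UNIV"

definition H1_norm :: "(real \<Rightarrow> real) \<Rightarrow> real" where
  "H1_norm f = sqrt ((L2_norm_on UNIV f)\<^sup>2 + (L2_norm_on UNIV (weak_deriv UNIV f))\<^sup>2)"

text \<open>
  Point values and one-sided limits of Sobolev functions are those of the continuous
  representative, which is unique on \<open>\<Omega>\<close> for open \<open>\<Omega>\<close>.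
\<close>

definition cont_rep :: "real set \<Rightarrow> (real \<Rightarrow> real) \<Rightarrow> real \<Rightarrow> real" where
  "cont_rep \<Omega> f = (SOME h. continuous_on \<Omega> h \<and> (AE x in lborel. x \<in> \<Omega> \<longrightarrow> h x = f x))"

text \<open>
  The operator \<open>- d\<^sup>2/dx\<^sup>2 - Z \<delta>(x)\<close>: its domain, and its action, which does not involve \<open>Z\<close>.
  In the jump condition, both one-sided limits exist because \<open>g\<close> is in \<open>H\<^sup>2\<close> off the origin.
\<close>

definition dom_A :: "real \<Rightarrow> (real \<Rightarrow> real) set" where
  "dom_A Z =
     {g \<in> sobolev 1 UNIV \<inter> sobolev 2 (- {0}).
        Lim (at_right 0) (cont_rep (- {0}) (weak_deriv (- {0}) g))
        - Lim (at_left 0) (cont_rep (- {0}) (weak_deriv (- {0}) g))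
        = - Z * cont_rep UNIV g 0}"

definition op_A :: "(real \<Rightarrow> real) \<Rightarrow> real \<Rightarrow> real" where
  "op_A g = (\<lambda>x. - weak_deriv (- {0}) (weak_deriv (- {0}) g) x)"

text \<open>
  \<open>u\<close> solves \<open>u\<^sub>t + (A\<^sub>Z - w) u = F(u)\<close>, \<open>u(0) = g\<close> on the time interval \<open>I\<close> (of the form
  \<open>[0, T)\<close> or \<open>[0, \<infinity>)\<close>): \<open>u\<close> is continuous from \<open>I\<close> into \<open>H\<^sup>1\<close>, and for positive times it takes
  values in the domain of the operator, is differentiable in \<open>L\<^sup>2\<close>, and satisfies the equation
  in \<open>L\<^sup>2\<close>.
\<close>

definition cauchy_solution ::
  "real \<Rightarrow> real \<Rightarrow> (real \<Rightarrow> real) \<Rightarrow> (real \<Rightarrow> real) \<Rightarrow> real set \<Rightarrow> (real \<Rightarrow> real \<Rightarrow> real) \<Rightarrow> bool" where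
  "cauchy_solution Z w F g I u \<longleftrightarrow>
     (\<forall>t\<in>I. u t \<in> H1) \<and>
     (\<forall>t\<in>I. ((\<lambda>s. H1_norm (\<lambda>x. u s x - u t x)) \<longlongrightarrow> 0) (at t within I)) \<and>
     (AE x in lborel. u 0 x = g x) \<and>
     (\<forall>t\<in>I. t > 0 \<longrightarrow>
        u t \<in> dom_A Z \<and>
        (\<exists>ut \<in> L2 UNIV.
           ((\<lambda>h. L2_norm_on UNIV (\<lambda>x. (u (t + h) x - u t x) / h - ut x)) \<longlongrightarrow> 0) (at 0) \<and>
           (AE x in lborel. ut x + (op_A (u t) x - w * u t x) = F (u t x))))"

text \<open>
  The unique local solution exists for all \<open>t \<ge> 0\<close>: there is a solution on \<open>[0, \<infinity>)\<close>, and every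
  solution on some \<open>[0, T)\<close> is a restriction of it.
\<close>

definition globally_well_defined ::
  "real \<Rightarrow> real \<Rightarrow> (real \<Rightarrow> real) \<Rightarrow> (real \<Rightarrow> real) \<Rightarrow> bool" where
  "globally_well_defined Z w F g \<longleftrightarrow>
     (\<exists>u. cauchy_solution Z w F g {0..} u \<and>
        (\<forall>T>0. \<forall>v. cauchy_solution Z w F g {0..<T} v \<longrightarrow>
           (\<forall>t\<in>{0..<T}. AE x in lborel. v t x = u t x)))"

text \<open>
  For real \<open>q\<close> and sign-changing \<open>u\<close>, the power \<open>u\<^sup>q\<close> is to be read as an extension of
  \<open>s \<mapsto> s\<^sup>q\<close> from \<open>s \<ge> 0\<close> to negative arguments. Both usual extensions, the odd one
  \<open>|s|\<^bsup>q-1\<^esup> s\<close> and the even one \<open>|s|\<^sup>q\<close>, are admitted; for a positive integer \<open>q\<close> the ordinary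
  power is one of them.
\<close>

definition is_real_power :: "real \<Rightarrow> (real \<Rightarrow> real) \<Rightarrow> bool" where
  "is_real_power q P \<longleftrightarrow>
     (\<forall>s\<ge>0. P s = s powr q) \<and>
     ((\<forall>s. P (- s) = P s) \<or> (\<forall>s. P (- s) = - P s))"

lemma is_real_power_nat: "n > 0 \<Longrightarrow> is_real_power (real n) (\<lambda>s. s ^ n)"
  by (cases "even n") (auto simp: is_real_power_def powr_realpow' power_minus_odd)

lemma is_real_power_odd: "is_real_power q (\<lambda>s. sgn s * \<bar>s\<bar> powr q)"
  by (auto simp: is_real_power_def sgn_if)

lemma is_real_power_even: "is_real_power q (\<lambda>s. \<bar>s\<bar> powr q)"
  by (auto simp: is_real_power_def)

end

theory Submission
  imports Defs "HOL-Real_Asymp.Real_Asymp"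
begin

text \<open>
  Put \<open>B = A\<^sub>Z - w\<close>. It is the self-adjoint operator of the form
  \<open>e(u, v) = \<integral>u' v' - Z u(0) v(0) - w \<integral>u v\<close> on \<open>H\<^sup>1\<close>. The bound \<open>u(0)\<^sup>2 \<le> \<parallel>u\<parallel> \<parallel>u'\<parallel>\<close>
  with the sharp constant (\<open>cont_square_le\<close>) makes \<open>e\<close> equivalent to the square of the \<open>H\<^sup>1\<close>
  norm as soon as \<open>(max Z 0)\<^sup>2 / 4 < - w\<close>, which covers both parts of the theorem
  (\<open>form_coercive\<close>); so \<open>B \<ge> \<theta>\<close> for some \<open>\<theta> > 0\<close>.

  The nonlinearity \<open>F\<close> vanishes at \<open>0\<close> faster than linearly, so its Lipschitz constant on
  \<open>[-R, R]\<close> is below \<open>\<theta>\<close> for a small \<open>R\<close>. Composing \<open>F\<close> with the truncation to \<open>[-R, R]\<close>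
  gives a map \<open>F\<^sub>R\<close> on \<open>L\<^sup>2\<close> with Lipschitz constant \<open>\<eta> < \<theta>\<close>. A solution of \<open>u' + B u = F\<^sub>R(u)\<close>
  satisfies \<open>(e(u, u))' = 2 \<langle>B u, F\<^sub>R(u) - B u\<rangle> \<le> 0\<close>, because
  \<open>\<parallel>F\<^sub>R(u)\<parallel> \<le> \<eta> \<parallel>u\<parallel> \<le> (\<eta> / \<theta>) \<parallel>B u\<parallel>\<close>. Hence \<open>u\<close> stays as small in \<open>H\<^sup>1\<close> as its initial
  value, in particular bounded by \<open>R\<close> pointwise, the truncation is never felt, and \<open>u\<close> solves
  the original equation for all times (\<open>small_data_global\<close>). Uniqueness is Gronwall's
  argument: a solution that is continuous into \<open>H\<^sup>1\<close> is bounded on compact time intervals,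
  and \<open>F\<close> is Lipschitz on bounded sets (\<open>strong_solutions_unique\<close>).

  The truncated equation is solved in an abstract Hilbert space
  (\<open>semilinear_global_solution\<close>). The form has an inverse operator \<open>B\<^sup>-\<^sup>1\<close> by the Riesz
  representation theorem (\<open>Riesz\<close>), and \<open>K = \<theta> B\<^sup>-\<^sup>1\<close> is symmetric with \<open>0 \<le> K \<le> 1\<close>. The
  Bernstein polynomials of \<open>K\<close> are positive operators with sum \<open>1\<close>; this yields a functional
  calculus \<open>f \<mapsto> f(K)\<close> for continuous \<open>f\<close> on \<open>[0, 1]\<close> with \<open>\<parallel>f(K)\<parallel> \<le> sup \<bar>f\<bar>\<close>, and all
  facts on the semigroup \<open>exp(- t B)\<close> become estimates of functions of one real variable. A
  mild solution is a fixed point of a contraction on all of \<open>[0, \<infinity>)\<close>, since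
  \<open>\<parallel>exp(- t B)\<parallel> \<le> exp(- \<theta> t)\<close> and \<open>\<eta> < \<theta>\<close>. It is Hoelder continuous in time with exponent
  \<open>1/2\<close>, which suffices for it to take values in the domain of \<open>B\<close> and to be differentiable at
  positive times (\<open>conv_regularity\<close>, \<open>strong_solution_exists\<close>).

  The link to the concrete operator is the lemma of du Bois-Reymond: functions with a weak
  derivative are indefinite integrals, so one may integrate by parts on each half-line. The
  boundary terms at \<open>0\<close> show that the jump condition is the natural boundary condition of
  \<open>e\<close>, so that \<open>dom_A Z\<close> is the domain of \<open>B\<close> and \<open>op_A u - w u = B u\<close> there
  (\<open>dom_A_imp_form\<close>, \<open>form_imp_dom_A\<close>).
\<close>

section \<open>A continuous functional calculus\<close>

definition bernstein_poly :: "nat \<Rightarrow> nat \<Rightarrow> real poly" where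
  "bernstein_poly n k = smult (of_nat (n choose k)) ([:0, 1:] ^ k * [:1, -1:] ^ (n - k))"

lemma poly_bernstein_poly: "poly (bernstein_poly n k) x = Bernstein n k x"
  by (simp add: bernstein_poly_def Bernstein_def)

lemma sum_bernstein_poly: "(\<Sum>k\<le>n. bernstein_poly n k) = 1"
  by (rule poly_eq_poly_eq_iff[THEN iffD1], rule ext)
     (simp add: poly_sum poly_bernstein_poly)

text \<open>
  The factor \<open>k / n\<close> in front of a Bernstein polynomial turns into multiplication by the
  variable: the recursion that lets Bernstein sums be compared with polynomials of an operator.
\<close>

lemma bernstein_poly_shift:
  assumes "0 < n"
  shows "smult ((real k + 1) / real n) (bernstein_poly n (Suc k)) = [:0, 1:] * bernstein_poly (n - 1) k"
proof -
  obtain m where n: "n = Suc m" using assms by (cases n) auto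
  have "(real k + 1) * real (Suc m choose Suc k) = real (Suc m) * real (m choose k)"
    using arg_cong[OF Suc_times_binomial[of k m], of real] by (simp only: of_nat_mult of_nat_Suc add.commute)
  then have "(real k + 1) / real n * real (n choose Suc k) = real (m choose k)"
    by (simp add: n field_simps)
  then show ?thesis
    by (simp add: n bernstein_poly_def)
qed

locale positive_contraction =
  fixes K :: "'a::{real_inner,banach} \<Rightarrow> 'a"
  assumes lin: "linear K"
    and sym: "inner (K x) y = inner x (K y)"
    and pos: "0 \<le> inner (K x) x"
    and le_one: "inner (K x) x \<le> inner x x"
begin

text \<open>
  The value \<open>p(K) x\<close>, by Horner's rule.
\<close>

definition ev :: "real poly \<Rightarrow> 'a \<Rightarrow> 'a" where
  "ev p x = fold_coeffs (\<lambda>a r. a *\<^sub>R x + K r) p 0"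

lemma K_simps: "K 0 = 0" "K (x + y) = K x + K y" "K (c *\<^sub>R x) = c *\<^sub>R K x" "K (x - y) = K x - K y"
  "K (- x) = - K x"
  using lin by (simp_all add: linear_0 linear_add linear_scale linear_diff linear_neg)

lemma ev_0 [simp]: "ev 0 x = 0"
  by (simp add: ev_def)

lemma ev_pCons [simp]: "ev (pCons a p) x = a *\<^sub>R x + K (ev p x)"
  by (cases "p = 0 \<and> a = 0") (auto simp: ev_def K_simps)

lemma ev_add: "ev (p + q) x = ev p x + ev q x"
  by (induction p q rule: poly_induct2) (auto simp: K_simps algebra_simps)

lemma ev_smult: "ev (smult c p) x = c *\<^sub>R ev p x"
  by (induction p) (auto simp: K_simps algebra_simps)

lemma ev_mult: "ev (p * q) x = ev p (ev q x)"
  by (induction p) (auto simp: ev_add ev_smult K_simps)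

lemma ev_one [simp]: "ev 1 x = x"
  by (simp add: one_pCons K_simps)

lemma ev_sum: "ev (\<Sum>i\<in>A. f i) x = (\<Sum>i\<in>A. ev (f i) x)"
  by (induction A rule: infinite_finite_induct) (auto simp: ev_add)

lemma linear_ev: "linear (ev p)"
  by (induction p) (auto simp: linear_iff K_simps algebra_simps)

lemma ev_K: "ev p (K x) = K (ev p x)"
  by (induction p) (auto simp: K_simps)

lemma ev_sym: "inner (ev p x) y = inner x (ev p y)"
  by (induction p arbitrary: x y) (auto simp: inner_add_left inner_add_right sym ev_K)

lemma ev_nonneg_square: 
  assumes "\<And>y. 0 \<le> inner (ev p y) y" shows "0 \<le> inner (ev (q * q * p) x) x"
proof -
  have "inner (ev (q * q * p) x) x = inner (ev q (ev (p * q) x)) x"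
    by (metis ev_mult mult.assoc mult.commute)
  also have "\<dots> = inner (ev (p * q) x) (ev q x)"
    by (simp add: ev_sym)
  finally show ?thesis using assms by (simp add: ev_mult)
qed

text \<open>
  After splitting off squares, \<open>X\<^sup>i (1 - X)\<^sup>j\<close> has exponents at most \<open>1\<close>, and
  \<open>X (1 - X) = X\<^sup>2 (1 - X) + (1 - X)\<^sup>2 X\<close> reduces the mixed case to \<open>X\<close> and \<open>1 - X\<close>.
\<close>

lemma ev_nonneg_bernstein: "0 \<le> inner (ev (bernstein_poly n k) x) x"
proof -
  let ?X = "[:0, 1:] :: real poly" and ?Y = "[:1, -1:] :: real poly"
  have X: "0 \<le> inner (ev ?X y) y" for y
    using pos by (simp add: K_simps)
  have Y: "0 \<le> inner (ev ?Y y) y" for y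
    using le_one by (simp add: K_simps inner_diff_left)
  have XY: "0 \<le> inner (ev (?X * ?Y) y) y" for y
  proof -
    have "?X * ?Y = ?X * ?X * ?Y + ?Y * ?Y * ?X"
      by simp
    then have "inner (ev (?X * ?Y) y) y = inner (ev (?X * ?X * ?Y) y) y + inner (ev (?Y * ?Y * ?X) y) y"
      by (metis ev_add inner_add_left)
    then show ?thesis using ev_nonneg_square[OF X] ev_nonneg_square[OF Y] by (simp only: add_nonneg_nonneg)
  qed
  have one: "0 \<le> inner (ev 1 y) y" for y by simp
  have "0 \<le> inner (ev (?X ^ i * ?Y ^ j) x) x" for i j
  proof -
    define q where "q = ?X ^ (i div 2) * ?Y ^ (j div 2)"
    define p where "p = ?X ^ (i mod 2) * ?Y ^ (j mod 2)"
    have s: "z ^ m = z ^ (m div 2) * z ^ (m div 2) * z ^ (m mod 2)" for z :: "real poly" and m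
      by (simp add: power_add[symmetric] mult_2[symmetric])
    have "?X ^ i * ?Y ^ j = q * q * p"
      unfolding q_def p_def by (subst s[of _ i], subst s[of _ j]) (simp only: ac_simps)
    moreover have "0 \<le> inner (ev p y) y" for y
    proof -
      have "i mod 2 = 0 \<or> i mod 2 = 1" "j mod 2 = 0 \<or> j mod 2 = 1" by auto
      then show ?thesis
        using one X Y XY unfolding p_def
        by (elim disjE) (simp_all only: power_0 power_one_right mult_1_left mult_1_right)
    qed
    ultimately show ?thesis using ev_nonneg_square by metis
  qed
  then show ?thesis
    by (simp add: bernstein_poly_def ev_smult)
qed

definition T :: "nat \<Rightarrow> (real \<Rightarrow> real) \<Rightarrow> 'a \<Rightarrow> 'a" where
  "T n f x = (\<Sum>k\<le>n. f (real k / real n) *\<^sub>R ev (bernstein_poly n k) x)"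

text \<open>
  This additive form of the Cauchy-Schwarz inequality can be summed over operators.
\<close>

lemma nonneg_Cauchy_Schwarz:
  assumes lin: "linear E" and E_sym: "\<And>x y. inner (E x) y = inner x (E y)" and E_pos: "\<And>x. 0 \<le> inner (E x) x"
  shows "\<bar>inner (E x) y\<bar> \<le> (inner (E x) x + inner (E y) y) / 2"
proof -
  have "0 \<le> inner (E (x + y)) (x + y)" "0 \<le> inner (E (x - y)) (x - y)"
    using E_pos by auto
  moreover have "inner (E y) x = inner (E x) y"
    using E_sym[of y x] by (simp add: inner_commute)
  ultimately show ?thesis
    by (simp add: linear_add[OF lin] linear_diff[OF lin] inner_add_left inner_add_right inner_diff_left inner_diff_right)
qed

lemma T_bound_inner:
  assumes "\<And>k. k \<le> n \<Longrightarrow> \<bar>f (real k / real n)\<bar> \<le> M"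
  shows "\<bar>inner (T n f x) y\<bar> \<le> M * (inner x x + inner y y) / 2"
proof -
  let ?E = "\<lambda>k. ev (bernstein_poly n k)"
  have M: "0 \<le> M" using assms[of 0] by auto
  have "\<bar>inner (T n f x) y\<bar> = \<bar>\<Sum>k\<le>n. f (real k / real n) * inner (?E k x) y\<bar>"
    by (simp add: T_def inner_sum_left)
  also have "\<dots> \<le> (\<Sum>k\<le>n. \<bar>f (real k / real n) * inner (?E k x) y\<bar>)"
    by (rule sum_abs)
  also have "\<dots> \<le> (\<Sum>k\<le>n. M * ((inner (?E k x) x + inner (?E k y) y) / 2))"
    unfolding abs_mult
    by (intro sum_mono mult_mono assms M nonneg_Cauchy_Schwarz linear_ev ev_sym ev_nonneg_bernstein) auto
  also have "\<dots> = M * ((\<Sum>k\<le>n. inner (?E k x) x) + (\<Sum>k\<le>n. inner (?E k y) y)) / 2"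
    by (simp only: sum_distrib_left[symmetric] sum_divide_distrib[symmetric] sum.distrib)
  also have "\<dots> = M * (inner x x + inner y y) / 2"
    by (simp only: inner_sum_left[symmetric] ev_sum[symmetric] sum_bernstein_poly ev_one)
  finally show ?thesis .
qed

lemma T_scale: "T n f (c *\<^sub>R x) = c *\<^sub>R T n f x" and T_plus: "T n f (x + y) = T n f x + T n f y"
  using linear_ev 
  by (auto simp: T_def linear_scale linear_add scaleR_sum_right sum.distrib algebra_simps)

text \<open>
  The operators \<open>ev (bernstein_poly n k)\<close> are a positive resolution of the identity, so
  averaging values of \<open>f\<close> with them cannot exceed the supremum of \<open>\<bar>f\<bar>\<close>.
\<close>

lemma T_bound:
  assumes "\<And>k. k \<le> n \<Longrightarrow> \<bar>f (real k / real n)\<bar> \<le> M"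
  shows "norm (T n f x) \<le> M * norm x"
proof -
  have unit: "norm (T n f x) \<le> M" if "norm x = 1" for x
  proof (cases "T n f x = 0")
    case True
    then show ?thesis using assms[of 0] by auto
  next
    case False
    define y where "y = T n f x /\<^sub>R norm (T n f x)"
    have "norm y = 1" using False by (simp add: y_def)
    then have "\<bar>inner (T n f x) y\<bar> \<le> M"
      using T_bound_inner[of n f M x y, OF assms] that by (simp add: dot_square_norm)
    moreover have "inner (T n f x) y = norm (T n f x)"
      using False by (simp add: y_def dot_square_norm power2_eq_square)
    ultimately show ?thesis by simp
  qed
  show ?thesis
  proof (cases "x = 0")
    case True
    then show ?thesis using T_scale[of n f 0 x] by simp
  next
    case False
    have "norm (T n f (x /\<^sub>R norm x)) \<le> M"
      by (rule unit) (use False in simp)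
    then show ?thesis using False by (simp add: T_scale field_simps)
  qed
qed

lemma norm_K_le: "norm (K x) \<le> norm x"
proof -
  have "T 1 (\<lambda>r. r) x = K x"
    by (simp add: T_def bernstein_poly_def ev_smult K_simps)
  then show ?thesis using T_bound[of 1 "\<lambda>r. r" 1 x] by simp
qed

lemma T_diff_bound:
  assumes "\<And>k. k \<le> n \<Longrightarrow> \<bar>f (real k / real n) - g (real k / real n)\<bar> \<le> M"
  shows "norm (T n f x - T n g x) \<le> M * norm x"
proof -
  have "T n f x - T n g x = T n (\<lambda>r. f r - g r) x"
    by (simp add: T_def sum_subtractf algebra_simps)
  then show ?thesis using T_bound[of n "\<lambda>r. f r - g r" M x] assms by simp
qed

text \<open>
  By \<open>bernstein_poly_shift\<close>, the left-hand side evaluates \<open>f\<close> at \<open>(k + 1) / n\<close> instead of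
  \<open>k / (n - 1)\<close>, and these nodes differ by at most \<open>1 / n\<close>.
\<close>

lemma T_shift:
  assumes lip: "\<And>r s. r \<in> {0..1} \<Longrightarrow> s \<in> {0..1} \<Longrightarrow> \<bar>f r - f s\<bar> \<le> L * \<bar>r - s\<bar>" and n: "1 < n"
  shows "norm (T n (\<lambda>r. r * f r) x - K (T (n - 1) f x)) \<le> L / real n * norm x"
proof -
  obtain m where m: "n = Suc m" "0 < m" using n by (cases n) auto
  define g where "g r = f ((r * real m + 1) / real n)" for r
  have "T n (\<lambda>r. r * f r) x = (\<Sum>k\<le>m. ((real k + 1) / real n * f ((real k + 1) / real n)) *\<^sub>R ev (bernstein_poly n (Suc k)) x)"
    unfolding T_def m(1) sum.atMost_Suc_shift by (simp add: algebra_simps)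
  also have "\<dots> = (\<Sum>k\<le>m. f ((real k + 1) / real n) *\<^sub>R ev (smult ((real k + 1) / real n) (bernstein_poly n (Suc k))) x)"
    by (simp add: ev_smult mult.commute)
  also have "\<dots> = (\<Sum>k\<le>m. f ((real k + 1) / real n) *\<^sub>R K (ev (bernstein_poly m k) x))"
    by (subst bernstein_poly_shift) (use m in \<open>simp_all add: ev_mult K_simps del: mult_pCons_left\<close>)
  also have "\<dots> = K (T m g x)"
    using m by (simp add: T_def g_def linear_sum[OF lin] K_simps)
  finally have "T n (\<lambda>r. r * f r) x - K (T (n - 1) f x) = K (T m g x - T m f x)"
    by (simp add: m K_simps)
  also have "norm \<dots> \<le> norm (T m g x - T m f x)"
    by (rule norm_K_le)
  also have "\<dots> \<le> L / real n * norm x"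
  proof (rule T_diff_bound)
    fix k assume k: "k \<le> m"
    have eq: "(real k / real m * real m + 1) / real n - real k / real m = (real m - real k) / (real m * real n)"
      using m by (simp add: field_simps)
    have L0: "0 \<le> L" using lip[of 0 1] by auto
    have "\<bar>g (real k / real m) - f (real k / real m)\<bar> \<le> L * \<bar>(real k / real m * real m + 1) / real n - real k / real m\<bar>"
      unfolding g_def by (rule lip) (use k m in \<open>auto simp: field_simps\<close>)
    also have "\<dots> \<le> L * (1 / real n)"
    proof (intro mult_left_mono L0)
      have "(real m - real k) / (real m * real n) \<le> real m / (real m * real n)"
        using k by (intro divide_right_mono) auto
      then show "\<bar>(real k / real m * real m + 1) / real n - real k / real m\<bar> \<le> 1 / real n"
        unfolding eq using k m by simp
    qed
    finally show "\<bar>g (real k / real m) - f (real k / real m)\<bar> \<le> L / real n" by simp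
  qed
  finally show ?thesis .
qed

lemma poly_Lipschitz_unit: "\<exists>L. \<forall>r\<in>{0..1}. \<forall>s\<in>{0..1}. \<bar>poly p r - poly p s\<bar> \<le> L * \<bar>r - (s::real)\<bar>"
proof -
  have "compact (poly (pderiv p) ` {0..1})"
    by (intro compact_continuous_image continuous_intros) auto
  then obtain L where L: "\<And>r. r \<in> {0..1} \<Longrightarrow> norm (poly (pderiv p) r) \<le> L"
    using compact_imp_bounded by (fastforce simp: bounded_iff)
  show ?thesis
  proof (intro exI ballI)
    fix r s :: real assume rs: "r \<in> {0..1}" "s \<in> {0..1}"
    show "\<bar>poly p r - poly p s\<bar> \<le> L * \<bar>r - s\<bar>"
      using field_differentiable_bound[of "{0..1}" "poly p" "poly (pderiv p)" L r s] L rs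
      by (simp add: DERIV_subset[OF poly_DERIV])
  qed
qed

text \<open>
  Induction over the coefficients; each step is one application of \<open>T_shift\<close>.
\<close>

lemma T_poly_tendsto: "(\<lambda>n. T n (poly p) x) \<longlonglongrightarrow> ev p x"
proof (induction p)
  case 0
  then show ?case by (simp add: T_def)
next
  case (pCons a p)
  obtain L where L: "\<forall>r\<in>{0..1}. \<forall>s\<in>{0..1}. \<bar>poly p r - poly p s\<bar> \<le> L * \<bar>r - s\<bar>"
    using poly_Lipschitz_unit by blast
  have split: "T n (poly (pCons a p)) x = a *\<^sub>R x + T n (\<lambda>r. r * poly p r) x" for n
  proof -
    have "(\<Sum>k\<le>n. a *\<^sub>R ev (bernstein_poly n k) x) = a *\<^sub>R x"
      by (simp only: scaleR_sum_right[symmetric] ev_sum[symmetric] sum_bernstein_poly ev_one)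
    then show ?thesis by (simp add: T_def scaleR_left_distrib sum.distrib)
  qed
  have "(\<lambda>n. T n (\<lambda>r. r * poly p r) x - K (T (n - 1) (poly p) x)) \<longlonglongrightarrow> 0"
  proof (rule Lim_null_comparison)
    show "\<forall>\<^sub>F n in sequentially. norm (T n (\<lambda>r. r * poly p r) x - K (T (n - 1) (poly p) x)) \<le> L / real n * norm x"
      using eventually_gt_at_top[of 1] by eventually_elim (rule T_shift, use L in auto)
    show "(\<lambda>n. L / real n * norm x) \<longlonglongrightarrow> 0"
      by (rule tendsto_mult_left_zero, rule lim_const_over_n)
  qed
  moreover have "(\<lambda>n. K (T (n - 1) (poly p) x)) \<longlonglongrightarrow> K (ev p x)"
  proof -
    have "bounded_linear K"
      by (rule bounded_linear_intro[of _ 1]) (use norm_K_le in \<open>auto simp: K_simps\<close>)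
    moreover have "(\<lambda>n. T (n - 1) (poly p) x) \<longlonglongrightarrow> ev p x"
      by (rule LIMSEQ_offset[where k=1]) (use pCons in simp)
    ultimately show ?thesis by (rule bounded_linear.tendsto)
  qed
  ultimately have "(\<lambda>n. T n (\<lambda>r. r * poly p r) x - K (T (n - 1) (poly p) x) + K (T (n - 1) (poly p) x)) \<longlonglongrightarrow> 0 + K (ev p x)"
    by (rule tendsto_add)
  then have "(\<lambda>n. T n (\<lambda>r. r * poly p r) x) \<longlonglongrightarrow> K (ev p x)" by simp
  then show ?case
    by (simp add: split tendsto_add del: poly_pCons)
qed

definition \<Phi> :: "(real \<Rightarrow> real) \<Rightarrow> 'a \<Rightarrow> 'a" where
  "\<Phi> f x = lim (\<lambda>n. T n f x)"

lemma poly_approx: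
  assumes "continuous_on {0..1} f" "0 < e"
  shows "\<exists>p. \<forall>r\<in>{0..1}. \<bar>f r - poly p r\<bar> < (e::real)"
proof -
  obtain N where "\<forall>n r. N \<le> n \<and> r \<in> {0..1} \<longrightarrow> \<bar>f r - (\<Sum>k\<le>n. f (k/n) * Bernstein n k r)\<bar> < e"
    using Bernstein_Weierstrass[OF assms] by auto
  then have "\<forall>r\<in>{0..1}. \<bar>f r - poly (\<Sum>k\<le>N. smult (f (k/N)) (bernstein_poly N k)) r\<bar> < e"
    by (auto simp: poly_sum poly_bernstein_poly)
  then show ?thesis by blast
qed

lemma node_unit: "k \<le> n \<Longrightarrow> real k / real n \<in> {0..1}"
  by (auto simp: divide_le_eq)

lemma T_approx:
  assumes "\<forall>r\<in>{0..1}. \<bar>f r - g r\<bar> < e"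
  shows "norm (T n f x - T n g x) \<le> e * norm x"
  using assms node_unit by (intro T_diff_bound) (blast intro: less_imp_le)

text \<open>
  \<open>f\<close> is a uniform limit of polynomials, for which the sums converge, and \<open>T_bound\<close> makes the
  error uniform in \<open>n\<close>.
\<close>

lemma T_tendsto:
  assumes f: "continuous_on {0..1} f"
  shows "(\<lambda>n. T n f x) \<longlonglongrightarrow> \<Phi> f x"
proof -
  have "Cauchy (\<lambda>n. T n f x)"
  proof (rule CauchyI)
    fix e :: real assume e: "0 < e"
    define d where "d = e / (4 * (norm x + 1))"
    have d: "0 < d" using e by (simp add: d_def add_nonneg_pos)
    have dx: "d * norm x \<le> e / 4"
    proof -
      have "d * norm x \<le> d * (norm x + 1)" using d by simp
      also have "\<dots> = e / 4"
        using norm_ge_zero[of x] by (simp add: d_def field_simps add_nonneg_eq_0_iff)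
      finally show ?thesis .
    qed
    obtain p where p: "\<forall>r\<in>{0..1}. \<bar>f r - poly p r\<bar> < d"
      using poly_approx[OF f d] by blast
    obtain N where N: "\<And>m n. N \<le> m \<Longrightarrow> N \<le> n \<Longrightarrow> norm (T m (poly p) x - T n (poly p) x) < e / 2"
      using LIMSEQ_imp_Cauchy[OF T_poly_tendsto[of p x]] e unfolding Cauchy_iff by (meson half_gt_zero)
    have "norm (T m f x - T n f x) < e" if "N \<le> m" "N \<le> n" for m n
    proof -
      have eq: "T m f x - T n f x = (T m f x - T m (poly p) x) + (T m (poly p) x - T n (poly p) x) - (T n f x - T n (poly p) x)"
        by simp
      have "norm (T m f x - T n f x) \<le> norm (T m f x - T m (poly p) x) + norm (T m (poly p) x - T n (poly p) x) + norm (T n f x - T n (poly p) x)"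
        using norm_triangle_ineq4[of "(T m f x - T m (poly p) x) + (T m (poly p) x - T n (poly p) x)" "T n f x - T n (poly p) x"]
          norm_triangle_ineq[of "T m f x - T m (poly p) x" "T m (poly p) x - T n (poly p) x"] by simp
      then show ?thesis
        using T_approx[OF p, of m x] T_approx[OF p, of n x] N[OF that] dx by linarith
    qed
    then show "\<exists>M. \<forall>m\<ge>M. \<forall>n\<ge>M. norm (T m f x - T n f x) < e" by blast
  qed
  then show ?thesis
    unfolding \<Phi>_def by (simp add: Cauchy_convergent_iff convergent_LIMSEQ_iff)
qed

lemma \<Phi>_poly: "\<Phi> (poly p) x = ev p x"
  unfolding \<Phi>_def using T_poly_tendsto limI by blast

lemma \<Phi>_cong:
  assumes "\<And>r. r \<in> {0..1} \<Longrightarrow> f r = g r"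
  shows "\<Phi> f x = \<Phi> g x"
proof -
  have "T n f x = T n g x" for n
    unfolding T_def by (intro sum.cong) (use assms node_unit in auto)
  then show ?thesis by (simp add: \<Phi>_def)
qed

lemma \<Phi>_one: "\<Phi> (\<lambda>r. 1) x = x" and \<Phi>_id: "\<Phi> (\<lambda>r. r) x = K x"
proof -
  have "poly 1 = (\<lambda>r::real. 1)" "poly [:0, 1:] = (\<lambda>r::real. r)" by auto
  then show "\<Phi> (\<lambda>r. 1) x = x" "\<Phi> (\<lambda>r. r) x = K x"
    using \<Phi>_poly[of 1 x] \<Phi>_poly[of "[:0, 1:]" x] by (simp_all add: K_simps)
qed

lemma \<Phi>_bound:
  assumes "continuous_on {0..1} f" "\<And>r. r \<in> {0..1} \<Longrightarrow> \<bar>f r\<bar> \<le> M"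
  shows "norm (\<Phi> f x) \<le> M * norm x"
proof (rule LIMSEQ_le_const2[OF tendsto_norm[OF T_tendsto[OF assms(1)]]])
  show "\<exists>N. \<forall>n\<ge>N. norm (T n f x) \<le> M * norm x"
    using T_bound[of _ f M x] assms(2) node_unit by blast
qed

lemma \<Phi>_add:
  assumes "continuous_on {0..1} f" "continuous_on {0..1} g"
  shows "\<Phi> (\<lambda>r. f r + g r) x = \<Phi> f x + \<Phi> g x"
proof -
  have "T n (\<lambda>r. f r + g r) x = T n f x + T n g x" for n
    by (simp add: T_def sum.distrib algebra_simps)
  then have "(\<lambda>n. T n (\<lambda>r. f r + g r) x) \<longlonglongrightarrow> \<Phi> f x + \<Phi> g x"
    using tendsto_add[OF assms[THEN T_tendsto]] by simp
  then show ?thesis unfolding \<Phi>_def by (rule limI)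
qed

lemma \<Phi>_cmult:
  assumes "continuous_on {0..1} f"
  shows "\<Phi> (\<lambda>r. c * f r) x = c *\<^sub>R \<Phi> f x"
proof -
  have "T n (\<lambda>r. c * f r) x = c *\<^sub>R T n f x" for n
    by (simp add: T_def scaleR_sum_right)
  then have "(\<lambda>n. T n (\<lambda>r. c * f r) x) \<longlonglongrightarrow> c *\<^sub>R \<Phi> f x"
    using tendsto_scaleR[OF tendsto_const T_tendsto[OF assms]] by simp
  then show ?thesis unfolding \<Phi>_def by (rule limI)
qed

lemma \<Phi>_diff:
  assumes "continuous_on {0..1} f" "continuous_on {0..1} g"
  shows "\<Phi> (\<lambda>r. f r - g r) x = \<Phi> f x - \<Phi> g x"
  using \<Phi>_add[of f "\<lambda>r. - 1 * g r" x] \<Phi>_cmult[of g "- 1" x] assms by (simp add: continuous_on_minus)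

lemma linear_\<Phi>:
  assumes "continuous_on {0..1} f"
  shows "linear (\<Phi> f)"
proof (rule linearI)
  show "\<Phi> f (x + y) = \<Phi> f x + \<Phi> f y" for x y
    using tendsto_add[OF T_tendsto[OF assms] T_tendsto[OF assms], of x y]
    unfolding T_plus[symmetric] by (metis \<Phi>_def limI)
  show "\<Phi> f (c *\<^sub>R x) = c *\<^sub>R \<Phi> f x" for c x
    using tendsto_scaleR[OF tendsto_const T_tendsto[OF assms], of c x]
    unfolding T_scale[symmetric] by (metis \<Phi>_def limI)
qed

lemma bounded_linear_\<Phi>:
  assumes "continuous_on {0..1} f"
  shows "bounded_linear (\<Phi> f)"
proof -
  have "compact (f ` {0..1})"
    using assms by (intro compact_continuous_image) auto
  then obtain M where M: "\<And>r. r \<in> {0..1} \<Longrightarrow> norm (f r) \<le> M"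
    using compact_imp_bounded by (fastforce simp: bounded_iff)
  show ?thesis
    using linear_\<Phi>[OF assms] \<Phi>_bound[OF assms, of M] M
    by (intro bounded_linear_intro[of _ M]) (auto simp: linear_add linear_scale mult.commute)
qed

lemma \<Phi>_sym:
  assumes "continuous_on {0..1} f"
  shows "inner (\<Phi> f x) y = inner x (\<Phi> f y)"
proof -
  have "inner (T n f x) y = inner x (T n f y)" for n
    by (simp add: T_def inner_sum_left inner_sum_right ev_sym)
  then show ?thesis
    using tendsto_inner[OF T_tendsto[OF assms] tendsto_const, of x y]
      tendsto_inner[OF tendsto_const T_tendsto[OF assms], of x y] LIMSEQ_unique by fastforce
qed

lemma \<Phi>_nonneg:
  assumes "continuous_on {0..1} f" "\<And>r. r \<in> {0..1} \<Longrightarrow> 0 \<le> f r"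
  shows "0 \<le> inner (\<Phi> f x) x"
proof (rule LIMSEQ_le_const[OF tendsto_inner[OF T_tendsto[OF assms(1)] tendsto_const]])
  have "0 \<le> inner (T n f x) x" for n
    unfolding T_def inner_sum_left inner_scaleR_left
    by (intro sum_nonneg mult_nonneg_nonneg assms(2) node_unit ev_nonneg_bernstein) auto
  then show "\<exists>N. \<forall>n\<ge>N. 0 \<le> inner (T n f x) x" by blast
qed

text \<open>
  Both sides depend continuously on \<open>f\<close> and \<open>g\<close> in the supremum norm, and they agree for
  polynomials by \<open>ev_mult\<close>.
\<close>

lemma \<Phi>_mult:
  assumes f: "continuous_on {0..1} f" and g: "continuous_on {0..1} g"
  shows "\<Phi> (\<lambda>r. f r * g r) x = \<Phi> f (\<Phi> g x)"
proof -
  define e where "e n = inverse (real (Suc n))" for n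
  have e: "0 < e n" "e n \<le> 1" for n
    by (auto simp: e_def field_simps)
  have e0: "e \<longlonglongrightarrow> 0"
    unfolding e_def by (rule LIMSEQ_inverse_real_of_nat)
  have "\<exists>p q. (\<forall>r\<in>{0..1}. \<bar>f r - poly p r\<bar> < e n) \<and> (\<forall>r\<in>{0..1}. \<bar>g r - poly q r\<bar> < e n)" for n
    using poly_approx[OF f e(1)] poly_approx[OF g e(1)] by blast
  then obtain p q where p: "\<And>n r. r \<in> {0..1} \<Longrightarrow> \<bar>f r - poly (p n) r\<bar> < e n" 
    and q: "\<And>n r. r \<in> {0..1} \<Longrightarrow> \<bar>g r - poly (q n) r\<bar> < e n"
    by metis
  have "compact (f ` {0..1})" "compact (g ` {0..1})"
    using f g by (auto intro!: compact_continuous_image)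
  then obtain A B where A: "\<And>r. r \<in> {0..1} \<Longrightarrow> \<bar>f r\<bar> \<le> A" and B: "\<And>r. r \<in> {0..1} \<Longrightarrow> \<bar>g r\<bar> \<le> B"
    using compact_imp_bounded by (fastforce simp: bounded_iff)
  have poly_cont: "continuous_on {0..1} (poly p)" for p :: "real poly"
    by (intro continuous_intros)
  have B0: "0 \<le> B" using B[of 0] by auto
  have 1: "norm (\<Phi> g x - ev (q n) x) \<le> e n * norm x" for n
    using \<Phi>_bound[OF continuous_on_diff[OF g poly_cont], of "q n" "e n" x] q[of _ n]
    by (simp add: \<Phi>_diff[OF g poly_cont] \<Phi>_poly less_imp_le)
  have 2: "norm (\<Phi> f y - ev (p n) y) \<le> e n * norm y" for n y
    using \<Phi>_bound[OF continuous_on_diff[OF f poly_cont], of "p n" "e n" y] p[of _ n]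
    by (simp add: \<Phi>_diff[OF f poly_cont] \<Phi>_poly less_imp_le)
  have 3: "norm (\<Phi> (\<lambda>r. f r * g r) x - ev (p n * q n) x) \<le> (A * e n + e n * (B + 1)) * norm x" for n
  proof -
    have fg: "continuous_on {0..1} (\<lambda>r. f r * g r)" using f g by (rule continuous_on_mult)
    have "\<bar>f r * g r - poly (p n * q n) r\<bar> \<le> A * e n + e n * (B + 1)" if r: "r \<in> {0..1}" for r
    proof -
      have "f r * g r - poly (p n * q n) r = f r * (g r - poly (q n) r) + (f r - poly (p n) r) * poly (q n) r"
        by (simp add: algebra_simps)
      also have "\<bar>\<dots>\<bar> \<le> \<bar>f r\<bar> * \<bar>g r - poly (q n) r\<bar> + \<bar>f r - poly (p n) r\<bar> * \<bar>poly (q n) r\<bar>"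
        by (metis abs_mult abs_triangle_ineq)
      also have "\<dots> \<le> A * e n + e n * (B + 1)"
      proof (intro add_mono mult_mono)
        show "\<bar>poly (q n) r\<bar> \<le> B + 1" using q[OF r, of n] B[OF r] e(2)[of n] by linarith
      qed (use A[OF r] p[OF r, of n] q[OF r, of n] e(1)[of n] B0 in auto)
      finally show ?thesis .
    qed
    then show ?thesis
      using \<Phi>_bound[OF continuous_on_diff[OF fg poly_cont], of "p n * q n" "A * e n + e n * (B + 1)" x]
      by (simp only: \<Phi>_diff[OF fg poly_cont] \<Phi>_poly)
  qed
  have A0: "0 \<le> A" using A[of 0] by auto
  have 4: "norm (\<Phi> (\<lambda>r. f r * g r) x - \<Phi> f (\<Phi> g x)) \<le> ((A * e n + e n * (B + 1)) + e n * (B + 1) + A * e n) * norm x" for n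
  proof -
    have "norm (ev (q n) x) \<le> (B + 1) * norm x"
      using \<Phi>_bound[OF poly_cont, of "q n" "B + 1" x] q[of _ n] B e(2)[of n]
      by (force simp: \<Phi>_poly)
    then have a: "norm (\<Phi> f (ev (q n) x) - ev (p n) (ev (q n) x)) \<le> e n * ((B + 1) * norm x)"
      using 2[of "ev (q n) x" n] e(1)[of n] by (meson less_imp_le mult_left_mono order_trans)
    have "norm (\<Phi> f (\<Phi> g x - ev (q n) x)) \<le> A * norm (\<Phi> g x - ev (q n) x)"
      by (rule \<Phi>_bound[OF f A])
    also have "\<dots> \<le> A * (e n * norm x)"
      by (intro mult_left_mono 1 A0)
    finally have b: "norm (\<Phi> f (\<Phi> g x) - \<Phi> f (ev (q n) x)) \<le> A * (e n * norm x)"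
      by (simp add: linear_diff[OF linear_\<Phi>[OF f]])
    have "norm (\<Phi> (\<lambda>r. f r * g r) x - \<Phi> f (\<Phi> g x)) \<le> norm (\<Phi> (\<lambda>r. f r * g r) x - ev (p n * q n) x)
       + norm (\<Phi> f (ev (q n) x) - ev (p n) (ev (q n) x)) + norm (\<Phi> f (\<Phi> g x) - \<Phi> f (ev (q n) x))"
    proof -
      have tri: "norm (a - b) \<le> norm (a - c) + norm (d - c) + norm (b - d)" for a b c d :: 'a
      proof -
        have "a - b = (a - c) - (d - c) - (b - d)" by simp
        then show ?thesis
          using norm_triangle_ineq4[of "(a - c) - (d - c)" "b - d"] norm_triangle_ineq4[of "a - c" "d - c"] by simp
      qed
      show ?thesis using tri by (simp add: ev_mult)
    qed
    also have "\<dots> \<le> (A * e n + e n * (B + 1)) * norm x + e n * ((B + 1) * norm x) + A * (e n * norm x)"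
      using 3[of n] a b by linarith
    finally show ?thesis by (simp add: algebra_simps)
  qed
  have "(\<lambda>n. ((A * e n + e n * (B + 1)) + e n * (B + 1) + A * e n) * norm x) \<longlonglongrightarrow> ((A * 0 + 0 * (B + 1)) + 0 * (B + 1) + A * 0) * norm x"
    by (intro tendsto_intros e0)
  then have "norm (\<Phi> (\<lambda>r. f r * g r) x - \<Phi> f (\<Phi> g x)) \<le> 0"
    using LIMSEQ_le_const[of _ 0] 4 by fastforce
  then show ?thesis by simp
qed

end

section \<open>The semigroup of a coercive operator\<close>

lemma exp_minus_bounds:
  fixes y :: real assumes "0 \<le> y"
  shows "y * exp (- y) \<le> 1" "y\<^sup>2 * exp (- y) \<le> 2" "sqrt y * exp (- y) \<le> 1" "1 - exp (- y) \<le> sqrt y"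
proof -
  have e: "1 + y + y\<^sup>2 / 2 \<le> exp y" using assms by (rule exp_lower_Taylor_quadratic)
  show "y * exp (- y) \<le> 1" "y\<^sup>2 * exp (- y) \<le> 2"
    using e assms zero_le_power2[of y] unfolding exp_minus
    by (simp_all only: divide_inverse[symmetric] divide_le_eq exp_gt_zero if_True)
  have s: "sqrt y \<le> 1 + y" 
    using assms by (intro real_le_lsqrt) (auto simp: power2_eq_square algebra_simps)
  then show "sqrt y * exp (- y) \<le> 1"
    using e assms zero_le_power2[of y] unfolding exp_minus 
    by (simp only: divide_inverse[symmetric] divide_le_eq exp_gt_zero if_True)
  have l: "1 - y \<le> exp (- y)" using exp_ge_add_one_self[of "- y"] by simp
  show "1 - exp (- y) \<le> sqrt y"
  proof (cases "y \<le> 1")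
    case True
    then have "y \<le> sqrt y" using assms by (intro real_le_rsqrt) (simp add: power2_eq_square mult_left_le)
    then show ?thesis using l by linarith
  next
    case False
    then have "1 \<le> sqrt y" by simp
    then show ?thesis using exp_gt_zero[of "- y"] by linarith
  qed
qed

lemma exp_minus_Taylor:
  fixes y z :: real assumes "0 \<le> m" "m \<le> y" "m \<le> z"
  shows "\<bar>exp (- y) - exp (- z)\<bar> \<le> \<bar>y - z\<bar> * exp (- m)"
    and "\<bar>exp (- y) - exp (- z) + (y - z) * exp (- z)\<bar> \<le> (y - z)\<^sup>2 * exp (- m)"
proof -
  have *: "\<bar>exp (- y) - exp (- z)\<bar> \<le> \<bar>y - z\<bar> * exp (- m)" if "m \<le> y" "m \<le> z" for y z
  proof -
    have "norm (exp (- y) - exp (- z)) \<le> exp (- m) * norm (y - z)"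
      by (rule field_differentiable_bound[of "{m..}" _ "\<lambda>y. - exp (- y)"])
         (use that in \<open>auto intro!: derivative_eq_intros\<close>)
    then show ?thesis by (simp add: mult.commute)
  qed
  then show "\<bar>exp (- y) - exp (- z)\<bar> \<le> \<bar>y - z\<bar> * exp (- m)" using assms by blast
  let ?h = "\<lambda>v. exp (- v) + v * exp (- z)"
  have "norm (?h y - ?h z) \<le> (\<bar>y - z\<bar> * exp (- m)) * norm (y - z)"
  proof (rule field_differentiable_bound[of "closed_segment y z" ?h "\<lambda>v. - exp (- v) + exp (- z)"])
    fix v assume v: "v \<in> closed_segment y z"
    then have v2: "m \<le> v" "\<bar>v - z\<bar> \<le> \<bar>y - z\<bar>" using assms by (auto simp: closed_segment_eq_real_ivl split: if_splits)
    have "norm (- exp (- v) + exp (- z)) \<le> \<bar>v - z\<bar> * exp (- m)"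
      using *[OF v2(1) assms(3)] by (simp add: abs_minus_commute)
    also have "\<dots> \<le> \<bar>y - z\<bar> * exp (- m)" using v2 by (intro mult_right_mono) auto
    finally show "norm (- exp (- v) + exp (- z)) \<le> \<bar>y - z\<bar> * exp (- m)" .
  qed (auto intro!: derivative_eq_intros)
  moreover have "\<bar>y - z\<bar> * exp (- m) * \<bar>y - z\<bar> = (y - z)\<^sup>2 * exp (- m)"
    by (simp add: power2_eq_square abs_mult_self_eq mult.assoc mult.left_commute flip: abs_mult)
  ultimately show "\<bar>exp (- y) - exp (- z) + (y - z) * exp (- z)\<bar> \<le> (y - z)\<^sup>2 * exp (- m)"
    by (simp add: algebra_simps)
qed

text \<open>
  With \<open>b = \<mu> / r\<close> as the spectral variable of \<open>B\<close> when \<open>r\<close> is that of \<open>K = \<mu> B\<^sup>-\<^sup>1\<close>, this is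
  \<open>b\<^sup>j exp(- t b)\<close>. The value at \<open>r = 0\<close>, that is \<open>b = \<infinity>\<close>, is the limit for \<open>t > 0\<close>.
\<close>

definition heat_symbol :: "real \<Rightarrow> nat \<Rightarrow> real \<Rightarrow> real \<Rightarrow> real" where
  "heat_symbol \<mu> j t r = (if r \<le> 0 then 0 else (\<mu> / r) ^ j * exp (- t * (\<mu> / r)))"

lemma continuous_heat_symbol:
  assumes "0 < \<mu>" "0 < t" 
  shows "continuous_on {0..1} (heat_symbol \<mu> j t)"
proof -
  have lim: "((\<lambda>r. (\<mu> / r) ^ j * exp (- t * (\<mu> / r))) \<longlongrightarrow> 0) (at_right 0)"
    using assms by real_asymp
  have "continuous (at r within {0..1}) (heat_symbol \<mu> j t)" if r: "r \<in> {0..1}" for r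
  proof (cases "r = 0")
    case True
    have "(heat_symbol \<mu> j t \<longlongrightarrow> 0) (at_right 0)"
      by (rule Lim_transform_eventually[OF lim]) (auto simp: heat_symbol_def eventually_at_right_less intro: eventually_mono[OF eventually_at_right_less])
    then have "(heat_symbol \<mu> j t \<longlongrightarrow> heat_symbol \<mu> j t 0) (at 0 within {0..1})"
      using at_within_Icc_at_right[of 0 "1::real"] by (simp add: heat_symbol_def)
    then show ?thesis using True by (simp add: continuous_within)
  next
    case False
    then have "0 < r" using r by simp
    have "isCont (\<lambda>r. (\<mu> / r) ^ j * exp (- t * (\<mu> / r))) r"
      using False by (intro continuous_intros) auto
    moreover have "\<forall>\<^sub>F s in nhds r. heat_symbol \<mu> j t s = (\<mu> / s) ^ j * exp (- t * (\<mu> / s))"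
      using eventually_nhds_in_open[of "{0<..}" r] \<open>0 < r\<close> by (auto simp: heat_symbol_def elim!: eventually_mono)
    ultimately have "isCont (heat_symbol \<mu> j t) r"
      using isCont_cong[of "heat_symbol \<mu> j t" "\<lambda>s. (\<mu> / s) ^ j * exp (- t * (\<mu> / s))" r] by simp
    then show ?thesis by (rule continuous_at_imp_continuous_at_within)
  qed
  then show ?thesis by (simp add: continuous_on_eq_continuous_within)
qed

text \<open>
  Here \<open>K\<close> is \<open>\<mu> B\<^sup>-\<^sup>1\<close> for a self-adjoint operator \<open>B \<ge> \<mu>\<close>. The operator \<open>B\<close> itself does not
  appear: its domain is the range of \<open>R = B\<^sup>-\<^sup>1\<close>, and \<open>R y = x\<close> stands for \<open>B x = y\<close>.
\<close>

locale coercive_inverse = positive_contraction +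
  fixes \<mu> :: real
  assumes \<mu>: "0 < \<mu>" and inj: "K x = 0 \<Longrightarrow> x = 0"
begin

definition R :: "'a \<Rightarrow> 'a" where "R x = K x /\<^sub>R \<mu>"

text \<open>
  \<open>S t = exp(- t B)\<close>, and below \<open>G t = B exp(- t B)\<close>. The symbol of \<open>S 0\<close> would be
  discontinuous at \<open>r = 0\<close>, so the identity is given separately.
\<close>

definition S :: "real \<Rightarrow> 'a \<Rightarrow> 'a" where
  "S t x = (if t \<le> 0 then x else \<Phi> (heat_symbol \<mu> 0 t) x)"

definition G :: "real \<Rightarrow> 'a \<Rightarrow> 'a" where
  "G t x = \<Phi> (heat_symbol \<mu> 1 t) x"

lemmas cont_symbol [simp] = continuous_heat_symbol[OF \<mu>]

lemma R_inj: "R x = R y \<longleftrightarrow> x = y"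
proof
  assume "R x = R y"
  then have "K (x - y) = 0" using \<mu> by (simp add: R_def K_simps)
  then show "x = y" using inj by fastforce
qed simp

lemma linear_R: "linear R"
  by (intro linearI) (simp_all add: R_def K_simps algebra_simps)

lemma bounded_linear_R: "bounded_linear R"
proof (rule bounded_linear_intro[of _ "inverse \<mu>"])
  show "norm (R x) \<le> norm x * inverse \<mu>" for x
    using norm_K_le[of x] \<mu> by (simp add: R_def field_simps)
qed (simp_all add: linear_R linear_add linear_scale)

lemma norm_R_le: "norm (R x) \<le> norm x / \<mu>"
  using norm_K_le[of x] \<mu> by (simp add: R_def field_simps)

lemma S_0 [simp]: "S 0 x = x" by (simp add: S_def)

lemma bounded_linear_S: "bounded_linear (S t)"
  by (cases "t \<le> 0") (auto simp: S_def[abs_def] bounded_linear_ident intro!: bounded_linear_\<Phi>)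

lemma linear_S: "linear (S t)"
  using bounded_linear_S by (rule bounded_linear.linear)

lemma bounded_linear_G: "0 < t \<Longrightarrow> bounded_linear (G t)"
  unfolding G_def[abs_def] by (intro bounded_linear_\<Phi>) simp

lemma S_sym: "inner (S t x) y = inner x (S t y)"
  by (simp add: S_def \<Phi>_sym)

lemma heat_symbol_mult: "heat_symbol \<mu> i t r * heat_symbol \<mu> j s r = heat_symbol \<mu> (i + j) (t + s) r"
  by (simp add: heat_symbol_def power_add exp_add[symmetric] algebra_simps add_divide_distrib)

lemma S_add: "0 \<le> t \<Longrightarrow> 0 \<le> s \<Longrightarrow> S (t + s) x = S t (S s x)"
  using \<Phi>_mult[of "heat_symbol \<mu> 0 t" "heat_symbol \<mu> 0 s" x]
  by (cases "t = 0"; cases "s = 0") (simp_all add: S_def heat_symbol_mult)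

lemma G_add: 
  assumes "0 < t" "0 \<le> s" 
  shows "G (t + s) x = G t (S s x)" "G (t + s) x = S s (G t x)"
  using assms \<Phi>_mult[of "heat_symbol \<mu> 1 t" "heat_symbol \<mu> 0 s" x] \<Phi>_mult[of "heat_symbol \<mu> 0 s" "heat_symbol \<mu> 1 t" x]
  by (cases "s = 0"; simp add: S_def G_def heat_symbol_mult add.commute)+

lemma symbol_bound:
  assumes "0 \<le> r" "r \<le> 1" "0 < t"
  shows "\<bar>heat_symbol \<mu> 0 t r\<bar> \<le> exp (- \<mu> * t)" "\<bar>heat_symbol \<mu> 1 t r\<bar> \<le> 1 / t"
    "0 \<le> heat_symbol \<mu> j t r"
proof -
  show "0 \<le> heat_symbol \<mu> j t r" using \<mu> by (simp add: heat_symbol_def)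
  have "\<mu> * t \<le> t * (\<mu> / r)" if "0 < r"
    using assms \<mu> that by (simp add: field_simps mult_left_le)
  then show "\<bar>heat_symbol \<mu> 0 t r\<bar> \<le> exp (- \<mu> * t)"
    by (simp add: heat_symbol_def)
  show "\<bar>heat_symbol \<mu> 1 t r\<bar> \<le> 1 / t"
    using exp_minus_bounds(1)[of "t * (\<mu> / r)"] assms \<mu> 
    by (simp add: heat_symbol_def field_simps)
qed

lemma norm_S_le: "0 \<le> t \<Longrightarrow> norm (S t x) \<le> exp (- \<mu> * t) * norm x"
proof (cases "t = 0")
  case False assume "0 \<le> t"
  then show ?thesis using False \<Phi>_bound[of "heat_symbol \<mu> 0 t" "exp (- \<mu> * t)" x] symbol_bound
    by (simp add: S_def)
qed simp

lemma norm_S_le1: "norm (S t x) \<le> norm x"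
proof (cases "t \<le> 0")
  case False
  then have "norm (S t x) \<le> exp (- \<mu> * t) * norm x" by (intro norm_S_le) simp
  also have "\<dots> \<le> 1 * norm x" using False \<mu> by (intro mult_right_mono) auto
  finally show ?thesis by simp
qed (simp add: S_def)

lemma norm_G_le: "0 < t \<Longrightarrow> norm (G t x) \<le> norm x / t"
  using \<Phi>_bound[of "heat_symbol \<mu> 1 t" "1 / t" x] symbol_bound by (simp add: G_def)

lemma R_G: "0 < t \<Longrightarrow> R (G t x) = S t x"
proof -
  assume t: "0 < t"
  have "K (G t x) = \<Phi> (\<lambda>r. r * heat_symbol \<mu> 1 t r) x"
    using \<Phi>_mult[of "\<lambda>r. r" "heat_symbol \<mu> 1 t" x] t by (simp add: G_def \<Phi>_id)
  also have "\<dots> = \<Phi> (\<lambda>r. \<mu> * heat_symbol \<mu> 0 t r) x"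
    by (rule \<Phi>_cong) (auto simp: heat_symbol_def)
  also have "\<dots> = \<mu> *\<^sub>R S t x"
    using t by (simp add: \<Phi>_cmult S_def)
  finally show ?thesis using \<mu> by (simp add: R_def)
qed

lemma G_R: "0 < t \<Longrightarrow> G t (R x) = S t x"
proof -
  assume t: "0 < t"
  have "G t (K x) = \<Phi> (\<lambda>r. heat_symbol \<mu> 1 t r * r) x"
    using \<Phi>_mult[of "heat_symbol \<mu> 1 t" "\<lambda>r. r" x] t by (simp add: G_def \<Phi>_id)
  also have "\<dots> = \<Phi> (\<lambda>r. \<mu> * heat_symbol \<mu> 0 t r) x"
    by (rule \<Phi>_cong) (auto simp: heat_symbol_def)
  also have "\<dots> = \<mu> *\<^sub>R S t x"
    using t by (simp add: \<Phi>_cmult S_def)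
  finally show ?thesis using \<mu> t by (simp add: R_def linear_scale[OF bounded_linear.linear[OF bounded_linear_G]])
qed

lemma S_R: "S t (R x) = R (S t x)"
proof (cases "t \<le> 0")
  case False
  then show ?thesis using R_G[of t "R x"] G_R[of t x] by simp
qed (simp add: S_def)

lemma symbol_Taylor:
  assumes "0 < m" "m \<le> t" "m \<le> s"
  shows "\<bar>heat_symbol \<mu> 0 t r - heat_symbol \<mu> 0 s r + (t - s) * heat_symbol \<mu> 1 s r\<bar> \<le> (t - s)\<^sup>2 * (2 / m\<^sup>2)"
    and "\<bar>heat_symbol \<mu> 1 t r - heat_symbol \<mu> 1 s r\<bar> \<le> \<bar>t - s\<bar> * (2 / m\<^sup>2)"
proof -
  define b where "b = \<mu> / r"
  have b2: "b\<^sup>2 * exp (- (m * b)) \<le> 2 / m\<^sup>2" if "0 \<le> b"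
    using exp_minus_bounds(2)[of "m * b"] that assms by (simp add: field_simps power_mult_distrib)
  show "\<bar>heat_symbol \<mu> 0 t r - heat_symbol \<mu> 0 s r + (t - s) * heat_symbol \<mu> 1 s r\<bar> \<le> (t - s)\<^sup>2 * (2 / m\<^sup>2)"
  proof (cases "r \<le> 0")
    case False
    then have b: "0 \<le> b" using \<mu> by (simp add: b_def)
    have "\<bar>exp (- (t * b)) - exp (- (s * b)) + (t * b - s * b) * exp (- (s * b))\<bar> \<le> (t * b - s * b)\<^sup>2 * exp (- (m * b))"
      by (rule exp_minus_Taylor) (use b assms in \<open>auto intro: mult_right_mono\<close>)
    also have "\<dots> = (t - s)\<^sup>2 * (b\<^sup>2 * exp (- (m * b)))"
      by (simp add: power2_eq_square algebra_simps)
    also have "\<dots> \<le> (t - s)\<^sup>2 * (2 / m\<^sup>2)" by (intro mult_left_mono b2 b) auto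
    finally show ?thesis using False by (simp add: heat_symbol_def b_def[symmetric] algebra_simps)
  qed (simp add: heat_symbol_def)
  show "\<bar>heat_symbol \<mu> 1 t r - heat_symbol \<mu> 1 s r\<bar> \<le> \<bar>t - s\<bar> * (2 / m\<^sup>2)"
  proof (cases "r \<le> 0")
    case False
    then have b: "0 \<le> b" using \<mu> by (simp add: b_def)
    have "\<bar>b * exp (- (t * b)) - b * exp (- (s * b))\<bar> = b * \<bar>exp (- (t * b)) - exp (- (s * b))\<bar>"
      using b by (simp add: right_diff_distrib[symmetric] abs_mult)
    also have "\<dots> \<le> b * (\<bar>t * b - s * b\<bar> * exp (- (m * b)))"
      by (intro mult_left_mono b exp_minus_Taylor) (use b assms in \<open>auto intro: mult_right_mono\<close>)
    also have "\<dots> = \<bar>t - s\<bar> * (b\<^sup>2 * exp (- (m * b)))"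
      using b by (simp add: power2_eq_square left_diff_distrib[symmetric] abs_mult)
    also have "\<dots> \<le> \<bar>t - s\<bar> * (2 / m\<^sup>2)" by (intro mult_left_mono b2 b) auto
    finally show ?thesis using False by (simp add: heat_symbol_def b_def[symmetric])
  qed (simp add: heat_symbol_def)
qed

lemma S_derivative:
  assumes s: "0 < s"
  shows "((\<lambda>t. S t x) has_vector_derivative - G s x) (at s)"
proof -
  define m where "m = s / 2"
  have m: "0 < m" "m < s" using s by (auto simp: m_def)
  define C where "C = 2 / m\<^sup>2 * norm x"
  have bound: "norm (S t x - S s x + (t - s) *\<^sub>R G s x) \<le> C * (t - s)\<^sup>2" if "m \<le> t" for t
  proof -
    let ?f = "\<lambda>r. heat_symbol \<mu> 0 t r - heat_symbol \<mu> 0 s r + (t - s) * heat_symbol \<mu> 1 s r"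
    have t: "0 < t" using m that by simp
    have "\<Phi> ?f x = S t x - S s x + (t - s) *\<^sub>R G s x"
      using s t by (simp add: \<Phi>_add \<Phi>_diff \<Phi>_cmult S_def G_def continuous_on_diff continuous_on_mult_left)
    moreover have "norm (\<Phi> ?f x) \<le> ((t - s)\<^sup>2 * (2 / m\<^sup>2)) * norm x"
      using symbol_Taylor(1)[OF m(1) that, of s] m s t 
      by (intro \<Phi>_bound) (auto intro!: continuous_intros)
    ultimately show ?thesis by (simp add: C_def mult.commute mult.left_commute)
  qed
  show ?thesis
    unfolding has_vector_derivative_def has_derivative_at_within
  proof (intro conjI)
    show "bounded_linear (\<lambda>h. h *\<^sub>R - G s x)" by (rule bounded_linear_scaleR_left)
    show "((\<lambda>t. (S t x - S s x - (t - s) *\<^sub>R - G s x) /\<^sub>R norm (t - s)) \<longlongrightarrow> 0) (at s)"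
    proof (rule Lim_null_comparison)
      show "\<forall>\<^sub>F t in at s. norm ((S t x - S s x - (t - s) *\<^sub>R - G s x) /\<^sub>R norm (t - s)) \<le> C * \<bar>t - s\<bar>"
        unfolding eventually_at
      proof (intro exI[of _ "s - m"] conjI ballI impI)
        fix t assume t: "t \<noteq> s \<and> dist t s < s - m"
        then have "norm (S t x - S s x + (t - s) *\<^sub>R G s x) \<le> C * (t - s)\<^sup>2"
          by (intro bound) (auto simp: dist_real_def)
        then show "norm ((S t x - S s x - (t - s) *\<^sub>R - G s x) /\<^sub>R norm (t - s)) \<le> C * \<bar>t - s\<bar>"
        proof -
          have "norm ((S t x - S s x - (t - s) *\<^sub>R - G s x) /\<^sub>R norm (t - s)) = norm (S t x - S s x + (t - s) *\<^sub>R G s x) / \<bar>t - s\<bar>"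
            by (simp add: divide_inverse mult.commute)
          also have "\<dots> \<le> C * (t - s)\<^sup>2 / \<bar>t - s\<bar>"
            using \<open>_ \<le> C * (t - s)\<^sup>2\<close> by (intro divide_right_mono) auto
          also have "\<dots> = C * \<bar>t - s\<bar>"
            using t by (simp add: field_simps power2_eq_square abs_mult_self_eq)
          finally show ?thesis .
        qed
      qed (use m in auto)
      show "((\<lambda>t. C * \<bar>t - s\<bar>) \<longlongrightarrow> 0) (at s)"
        by (auto intro!: tendsto_eq_intros)
    qed
  qed
qed

lemma continuous_on_G: "continuous_on {0<..} (\<lambda>t. G t x)"
proof (rule continuous_at_imp_continuous_on, rule ballI)
  fix s :: real assume "s \<in> {0<..}"
  then have s: "0 < s" by simp
  define m where "m = s / 2"
  have m: "0 < m" "m < s" using s by (auto simp: m_def)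
  have bound: "norm (G t x - G s x) \<le> \<bar>t - s\<bar> * (2 / m\<^sup>2) * norm x" if "m \<le> t" for t
  proof -
    let ?f = "\<lambda>r. heat_symbol \<mu> 1 t r - heat_symbol \<mu> 1 s r"
    have t: "0 < t" using m that by simp
    have "\<Phi> ?f x = G t x - G s x"
      using s t by (simp add: \<Phi>_diff G_def)
    moreover have "norm (\<Phi> ?f x) \<le> (\<bar>t - s\<bar> * (2 / m\<^sup>2)) * norm x"
      using symbol_Taylor(2)[OF m(1) that, of s] m s t 
      by (intro \<Phi>_bound) (auto intro!: continuous_intros)
    ultimately show ?thesis by simp
  qed
  have "((\<lambda>t. G t x - G s x) \<longlongrightarrow> 0) (at s)"
  proof (rule Lim_null_comparison)
    show "\<forall>\<^sub>F t in at s. norm (G t x - G s x) \<le> \<bar>t - s\<bar> * (2 / m\<^sup>2) * norm x"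
      using eventually_at_in_open'[of "{m<..}" s] m bound by (auto elim!: eventually_mono)
    show "((\<lambda>t. \<bar>t - s\<bar> * (2 / m\<^sup>2) * norm x) \<longlongrightarrow> 0) (at s)"
      using m by (auto intro!: tendsto_eq_intros)
  qed
  then show "isCont (\<lambda>t. G t x) s"
    by (simp add: isCont_def LIM_zero_iff)
qed

lemma S_decreasing:
  assumes "0 \<le> s" "s \<le> t"
  shows "inner (S t x) x \<le> inner (S s x) x"
proof (cases "s = 0")
  case True
  have "inner (S t x) x \<le> norm (S t x) * norm x" by (rule norm_cauchy_schwarz)
  also have "\<dots> \<le> norm x * norm x" by (intro mult_right_mono norm_S_le1) simp
  finally show ?thesis using True by (simp add: dot_square_norm power2_eq_square)
next
  case False
  then have st: "0 < s" "0 < t" using assms by auto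
  have "0 \<le> inner (\<Phi> (\<lambda>r. heat_symbol \<mu> 0 s r - heat_symbol \<mu> 0 t r) x) x"
  proof (rule \<Phi>_nonneg)
    show "0 \<le> heat_symbol \<mu> 0 s r - heat_symbol \<mu> 0 t r" for r
      using assms \<mu> by (auto simp: heat_symbol_def divide_right_mono)
  qed (use st in \<open>auto intro!: continuous_on_diff\<close>)
  then show ?thesis using st by (simp add: \<Phi>_diff S_def inner_diff_left)
qed

lemma G_decreasing:
  assumes "0 < s" "s \<le> t"
  shows "inner (G t x) x \<le> inner (G s x) x" "0 \<le> inner (G t x) x"
proof -
  have st: "0 < s" "0 < t" using assms by auto
  have "0 \<le> inner (\<Phi> (\<lambda>r. heat_symbol \<mu> 1 s r - heat_symbol \<mu> 1 t r) x) x"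
  proof (rule \<Phi>_nonneg)
    show "0 \<le> heat_symbol \<mu> 1 s r - heat_symbol \<mu> 1 t r" for r
      using assms \<mu> by (auto simp: heat_symbol_def divide_right_mono)
  qed (use st in \<open>auto intro!: continuous_on_diff\<close>)
  then show "inner (G t x) x \<le> inner (G s x) x" using st by (simp add: \<Phi>_diff G_def inner_diff_left)
  show "0 \<le> inner (G t x) x" 
    unfolding G_def by (rule \<Phi>_nonneg) (use st symbol_bound in auto)
qed

lemma inner_S_S: "0 \<le> s \<Longrightarrow> 0 \<le> t \<Longrightarrow> inner (S s x) (S t x) = inner (S (s + t) x) x"
  using S_sym[of t "S s x" x] S_add[of t s x] by (simp add: add.commute)

lemma S_defect: 
  assumes "0 \<le> t" 
  shows "(norm (S t x - x))\<^sup>2 \<le> inner x x - inner (S t x) x"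
proof -
  have "(norm (S t x - x))\<^sup>2 = inner (S t x) (S t x) - 2 * inner (S t x) x + inner x x"
    by (simp add: power2_norm_eq_inner inner_diff_left inner_diff_right inner_commute)
  also have "inner (S t x) (S t x) = inner (S (t + t) x) x"
    using assms inner_S_S by blast
  also have "\<dots> \<le> inner (S t x) x" using assms by (intro S_decreasing) auto
  finally show ?thesis by simp
qed

lemma S_diff_R: "0 \<le> t \<Longrightarrow> norm (S t (R x) - R x) \<le> t * norm x"
proof (cases "t = 0")
  case False assume "0 \<le> t"
  then have t: "0 < t" using False by simp
  let ?f = "\<lambda>r. (heat_symbol \<mu> 0 t r - 1) * r"
  have "\<Phi> ?f x = S t (K x) - K x"
    using t by (simp add: \<Phi>_mult \<Phi>_diff \<Phi>_one \<Phi>_id S_def continuous_on_diff continuous_on_id)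
  moreover have "norm (\<Phi> ?f x) \<le> (\<mu> * t) * norm x"
  proof (rule \<Phi>_bound)
    fix r :: real assume r: "r \<in> {0..1}"
    show "\<bar>?f r\<bar> \<le> \<mu> * t"
    proof (cases "r = 0")
      case False
      then have r0: "0 < r" using r by simp
      have "1 - t * (\<mu> / r) \<le> exp (- (t * (\<mu> / r)))" using exp_ge_add_one_self[of "- (t * (\<mu> / r))"] by simp
      moreover have "exp (- (t * (\<mu> / r))) \<le> 1" using t \<mu> r0 by simp
      ultimately have "\<bar>heat_symbol \<mu> 0 t r - 1\<bar> \<le> t * (\<mu> / r)"
        using r0 by (simp add: heat_symbol_def)
      then have "\<bar>heat_symbol \<mu> 0 t r - 1\<bar> * r \<le> t * (\<mu> / r) * r"
        using r0 by (intro mult_right_mono) auto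
      then show ?thesis using r0 by (simp add: abs_mult mult.commute)
    qed (use \<mu> t in simp)
  qed (use t in \<open>auto intro!: continuous_intros\<close>)
  ultimately have "norm (S t (K x) - K x) \<le> (\<mu> * t) * norm x" by simp
  moreover
  have "S t (R x) - R x = (S t (K x) - K x) /\<^sub>R \<mu>"
    by (simp add: R_def linear_scale[OF linear_S] scaleR_diff_right)
  then have "norm (S t (R x) - R x) = norm (S t (K x) - K x) / \<mu>"
    using \<mu> by (simp add: divide_inverse mult.commute)
  ultimately show ?thesis
    using \<mu> by (simp add: divide_le_eq mult.commute mult.left_commute)
qed simp

text \<open>
  \<open>\<langle>S t x, x\<rangle>\<close> increases as \<open>t\<close> decreases to \<open>0\<close>. Its convergence makes \<open>S t x\<close> a Cauchy
  family, and the limit is \<open>x\<close> because \<open>R (S t x)\<close> tends to \<open>R x\<close> and \<open>R\<close> is injective.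
\<close>

lemma S_defect_tendsto: "((\<lambda>t. inner x x - inner (S t x) x) \<longlongrightarrow> 0) (at_right 0)"
proof -
  let ?d = "\<lambda>t. inner x x - inner (S t x) x"
  define a where "a n = S (inverse (real (Suc n))) x" for n
  obtain l where l: "(\<lambda>n. inner (S (inverse (real (Suc n))) x) x) \<longlonglongrightarrow> l"
  proof (rule incseq_convergent)
    show "incseq (\<lambda>n. inner (S (inverse (real (Suc n))) x) x)"
      by (intro incseq_SucI S_decreasing) (auto intro: le_imp_inverse_le)
    show "\<forall>n. inner (S (inverse (real (Suc n))) x) x \<le> inner x x"
      using S_decreasing[of 0 _ x] by (auto simp del: of_nat_Suc)
  qed metis
  have low: "inner (S t x) x \<le> l" if "0 < t" for t
  proof -
    have "\<forall>\<^sub>F n in sequentially. inverse (real (Suc n)) < t"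
      using order_tendstoD(2)[OF LIMSEQ_inverse_real_of_nat that] .
    then have "\<forall>\<^sub>F n in sequentially. inner (S t x) x \<le> inner (S (inverse (real (Suc n))) x) x"
      by eventually_elim (auto intro!: S_decreasing simp del: of_nat_Suc)
    then show ?thesis using l tendsto_lowerbound by (metis sequentially_bot)
  qed
  have dist: "(norm (a m - a n))\<^sup>2 \<le> 2 * (l - inner (S (2 * inverse (real (Suc (min m n)))) x) x)" for m n
  proof -
    let ?m = "inverse (real (Suc m))" and ?n = "inverse (real (Suc n))" and ?k = "inverse (real (Suc (min m n)))"
    have "(norm (a m - a n))\<^sup>2 = inner (S (?m + ?m) x) x + inner (S (?n + ?n) x) x - 2 * inner (S (?m + ?n) x) x"
      unfolding a_def power2_norm_eq_inner inner_diff_left inner_diff_right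
      using inner_S_S[of ?m ?m x] inner_S_S[of ?n ?n x] inner_S_S[of ?m ?n x] inner_commute[of "S ?m x" "S ?n x"] 
      by (simp del: of_nat_Suc)
    also have "\<dots> \<le> l + l - 2 * inner (S (2 * ?k) x) x"
    proof -
      have "inner (S (2 * ?k) x) x \<le> inner (S (?m + ?n) x) x"
        by (rule S_decreasing) (auto simp: min_def intro!: add_mono le_imp_inverse_le simp del: of_nat_Suc)
      then show ?thesis using low[of "?m + ?m"] low[of "?n + ?n"] by simp
    qed
    finally show ?thesis by simp
  qed
  have half: "(\<lambda>n. inner (S (2 * inverse (real (Suc n))) x) x) \<longlonglongrightarrow> l"
  proof (rule tendsto_sandwich[OF _ _ _ tendsto_const])
    show "\<forall>\<^sub>F n in sequentially. inner (S (2 * inverse (real (Suc n))) x) x \<le> l"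
      using low by simp
    show "(\<lambda>n. inner (S (inverse (real (Suc (n div 2 - 1)))) x) x) \<longlonglongrightarrow> l"
    proof (rule filterlim_compose[OF l])
      show "filterlim (\<lambda>n::nat. n div 2 - 1) sequentially sequentially"
        unfolding filterlim_at_top
      proof
        fix Z :: nat
        show "\<forall>\<^sub>F n in sequentially. Z \<le> n div 2 - 1"
          by (rule eventually_sequentiallyI[of "2 * Z + 2"]) auto
      qed
    qed
    show "\<forall>\<^sub>F n in sequentially. inner (S (inverse (real (Suc (n div 2 - 1)))) x) x \<le> inner (S (2 * inverse (real (Suc n))) x) x"
    proof (rule eventually_sequentiallyI[of 4])
      fix n :: nat assume "4 \<le> n"
      then have "2 * Suc (n div 2 - 1) \<le> Suc n" by auto
      then have "2 * real (Suc (n div 2 - 1)) \<le> real (Suc n)"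
        by (metis of_nat_le_iff of_nat_mult of_nat_numeral)
      then show "inner (S (inverse (real (Suc (n div 2 - 1)))) x) x \<le> inner (S (2 * inverse (real (Suc n))) x) x"
        by (intro S_decreasing) (auto simp: field_simps simp del: of_nat_Suc)
    qed
  qed
  have "Cauchy a"
  proof (rule CauchyI)
    fix e :: real assume e: "0 < e"
    have "\<forall>\<^sub>F n in sequentially. l - e\<^sup>2 / 2 < inner (S (2 * inverse (real (Suc n))) x) x"
      using order_tendstoD(1)[OF half, of "l - e\<^sup>2 / 2"] e by simp
    then obtain N where N: "\<And>n. N \<le> n \<Longrightarrow> l - e\<^sup>2 / 2 < inner (S (2 * inverse (real (Suc n))) x) x"
      by (auto simp: eventually_sequentially)
    have "norm (a m - a n) < e" if "N \<le> m" "N \<le> n" for m n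
    proof -
      have "(norm (a m - a n))\<^sup>2 < e\<^sup>2"
        using dist[of m n] N[of "min m n"] that by simp
      then show ?thesis using e by (simp add: power_less_imp_less_base)
    qed
    then show "\<exists>M. \<forall>m\<ge>M. \<forall>n\<ge>M. norm (a m - a n) < e" by blast
  qed
  then obtain y where y: "a \<longlonglongrightarrow> y" by (auto simp: Cauchy_convergent_iff convergent_def)
  have "(\<lambda>n. R (a n)) \<longlonglongrightarrow> R y" by (rule bounded_linear.tendsto[OF bounded_linear_R y])
  moreover have "(\<lambda>n. R (a n)) \<longlonglongrightarrow> R x"
  proof (rule LIM_zero_cancel, rule Lim_null_comparison)
    show "\<forall>\<^sub>F n in sequentially. norm (R (a n) - R x) \<le> inverse (real (Suc n)) * norm x"
      using S_diff_R by (auto simp: a_def S_R[symmetric] simp del: of_nat_Suc)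
    show "(\<lambda>n. inverse (real (Suc n)) * norm x) \<longlonglongrightarrow> 0"
      by (rule tendsto_mult_left_zero[OF LIMSEQ_inverse_real_of_nat])
  qed
  ultimately have "y = x" using LIMSEQ_unique R_inj by blast
  then have "(\<lambda>n. inner (a n) x) \<longlonglongrightarrow> inner x x" using y by (auto intro!: tendsto_intros)
  then have lx: "l = inner x x" using l LIMSEQ_unique by (simp add: a_def del: of_nat_Suc)
  show ?thesis
  proof (rule order_tendstoI)
    fix e :: real assume "e < 0"
    show "\<forall>\<^sub>F t in at_right 0. e < ?d t"
    proof (rule eventually_mono[OF eventually_at_right_less[of 0]])
      fix t :: real assume "0 < t"
      then show "e < ?d t" using low[of t] lx \<open>e < 0\<close> by linarith
    qed
  next
    fix e :: real assume "0 < e"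
    then have "\<forall>\<^sub>F n in sequentially. l - e < inner (S (inverse (real (Suc n))) x) x"
      using order_tendstoD(1)[OF l, of "l - e"] by simp
    then obtain n where n: "l - e < inner (S (inverse (real (Suc n))) x) x"
      by (auto simp: eventually_sequentially)
    have "\<forall>\<^sub>F t in at_right 0. t \<in> {0<..<inverse (real (Suc n))}"
      by (rule eventually_at_right_real) (simp del: of_nat_Suc)
    then show "\<forall>\<^sub>F t in at_right 0. ?d t < e"
    proof eventually_elim
      case (elim t)
      then have "inner (S (inverse (real (Suc n))) x) x \<le> inner (S t x) x"
        by (intro S_decreasing) auto
      then show ?case using n lx by simp
    qed
  qed
qed

lemma S_tendsto_0: "((\<lambda>t. S t x) \<longlongrightarrow> x) (at_right 0)"
proof (rule LIM_zero_cancel, rule Lim_null_comparison)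
  show "\<forall>\<^sub>F t in at_right 0. norm (S t x - x) \<le> sqrt (inner x x - inner (S t x) x)"
    using eventually_at_right_less[of 0] by eventually_elim (auto intro!: real_le_rsqrt S_defect)
  show "((\<lambda>t. sqrt (inner x x - inner (S t x) x)) \<longlongrightarrow> 0) (at_right 0)"
    using tendsto_real_sqrt[OF S_defect_tendsto] by simp
qed

lemma S_joint_tendsto:
  assumes t: "(t \<longlongrightarrow> 0) F" "\<forall>\<^sub>F i in F. 0 \<le> t i" and x: "(x \<longlongrightarrow> z) F"
  shows "((\<lambda>i. S (t i) (x i)) \<longlongrightarrow> z) F"
proof -
  have 0: "((\<lambda>t. S t z) \<longlongrightarrow> z) (at 0 within {0..})"
    using S_tendsto_0 by (simp add: at_within_Ici_at_right)
  have "((\<lambda>i. S (t i) z) \<longlongrightarrow> z) F"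
    using continuous_within_tendsto_compose[of 0 "{0..}" "\<lambda>t. S t z", OF _ _ t(1)] 0 t(2)
    by (simp add: continuous_within)
  moreover have "((\<lambda>i. S (t i) (x i) - S (t i) z) \<longlongrightarrow> 0) F"
  proof (rule Lim_null_comparison)
    show "\<forall>\<^sub>F i in F. norm (S (t i) (x i) - S (t i) z) \<le> norm (x i - z)"
      using norm_S_le1 by (simp add: linear_diff[OF linear_S, symmetric])
    show "((\<lambda>i. norm (x i - z)) \<longlongrightarrow> 0) F"
      using x by (simp add: tendsto_norm_zero_iff LIM_zero)
  qed
  ultimately show ?thesis using tendsto_add by fastforce
qed

lemma S_diff_le: 
  assumes "0 \<le> s" "0 \<le> t" shows "norm (S t x - S s x) \<le> norm (S \<bar>t - s\<bar> x - x)"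
proof (cases "s \<le> t")
  case True
  have "S t x - S s x = S s (S (t - s) x - x)"
    using S_add[of s "t - s" x] True assms by (simp add: linear_diff[OF linear_S])
  then show ?thesis using True norm_S_le1 by simp
next
  case False
  have "S s x - S t x = S t (S (s - t) x - x)"
    using S_add[of t "s - t" x] False assms by (simp add: linear_diff[OF linear_S])
  then show ?thesis using False norm_S_le1[of t "S (s - t) x - x"] by (simp add: norm_minus_commute)
qed

lemma continuous_on_S: 
  assumes t: "continuous_on A t" "\<And>i. i \<in> A \<Longrightarrow> 0 \<le> t i" and x: "continuous_on A x"
  shows "continuous_on A (\<lambda>i. S (t i) (x i))"
  unfolding continuous_on_def
proof
  fix i assume i: "i \<in> A"
  let ?F = "at i within A"
  have ev: "\<forall>\<^sub>F j in ?F. j \<in> A" by (simp add: eventually_at_filter)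
  have xt: "(x \<longlongrightarrow> x i) ?F" "(t \<longlongrightarrow> t i) ?F" using x t(1) i by (auto simp: continuous_on_def)
  have "((\<lambda>j. S \<bar>t j - t i\<bar> (x i)) \<longlongrightarrow> x i) ?F"
    using xt by (intro S_joint_tendsto) (auto intro!: tendsto_eq_intros)
  then have A: "((\<lambda>j. norm (S \<bar>t j - t i\<bar> (x i) - x i)) \<longlongrightarrow> 0) ?F"
    by (simp add: tendsto_norm_zero_iff LIM_zero)
  have B: "((\<lambda>j. norm (x j - x i)) \<longlongrightarrow> 0) ?F"
    using xt by (simp add: tendsto_norm_zero_iff LIM_zero)
  have "((\<lambda>j. S (t j) (x j) - S (t i) (x i)) \<longlongrightarrow> 0) ?F"
  proof (rule Lim_null_comparison[OF _ tendsto_add_zero[OF B A]])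
    show "\<forall>\<^sub>F j in ?F. norm (S (t j) (x j) - S (t i) (x i)) \<le> norm (x j - x i) + norm (S \<bar>t j - t i\<bar> (x i) - x i)"
      using ev
    proof eventually_elim
      case (elim j)
      have "S (t j) (x j) - S (t i) (x i) = S (t j) (x j - x i) + (S (t j) (x i) - S (t i) (x i))"
        by (simp add: linear_diff[OF linear_S])
      also have "norm \<dots> \<le> norm (S (t j) (x j - x i)) + norm (S (t j) (x i) - S (t i) (x i))"
        by (rule norm_triangle_ineq)
      also have "\<dots> \<le> norm (x j - x i) + norm (S \<bar>t j - t i\<bar> (x i) - x i)"
        by (intro add_mono norm_S_le1 S_diff_le t(2) i elim)
      finally show ?case .
    qed
  qed
  then show "((\<lambda>j. S (t j) (x j)) \<longlongrightarrow> S (t i) (x i)) ?F" by (rule LIM_zero_cancel)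
qed

text \<open>
  From \<open>1 - exp(- h b) \<le> sqrt (h b)\<close> and \<open>sqrt (\<tau> b) exp(- \<tau> b) \<le> 1\<close>. The power \<open>1/2\<close> of \<open>1 / \<tau>\<close>
  is integrable at \<open>\<tau> = 0\<close>.
\<close>

lemma S_minus_id_S:
  assumes "0 \<le> h" "0 < \<tau>" 
  shows "norm (S h (S \<tau> x) - S \<tau> x) \<le> sqrt (h / \<tau>) * norm x"
proof (cases "h = 0")
  case False
  then have h: "0 < h" using assms by simp
  let ?f = "\<lambda>r. heat_symbol \<mu> 0 h r * heat_symbol \<mu> 0 \<tau> r - heat_symbol \<mu> 0 \<tau> r"
  have "\<Phi> ?f x = S h (S \<tau> x) - S \<tau> x"
    using h assms by (simp add: \<Phi>_diff \<Phi>_mult S_def continuous_on_mult)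
  moreover have "norm (\<Phi> ?f x) \<le> sqrt (h / \<tau>) * norm x"
  proof (rule \<Phi>_bound)
    fix r :: real assume r: "r \<in> {0..1}"
    show "\<bar>?f r\<bar> \<le> sqrt (h / \<tau>)"
    proof (cases "r = 0")
      case False
      define b where "b = \<mu> / r"
      have b: "0 < b" using False r \<mu> by (simp add: b_def)
      have "\<bar>exp (- (h * b)) * exp (- (\<tau> * b)) - exp (- (\<tau> * b))\<bar> = (1 - exp (- (h * b))) * exp (- (\<tau> * b))"
        using h b assms by (simp add: left_diff_distrib abs_if mult_le_cancel_right1)
      also have "\<dots> \<le> sqrt (h * b) * exp (- (\<tau> * b))"
        using h b by (intro mult_right_mono exp_minus_bounds) auto
      also have "\<dots> = sqrt (h / \<tau>) * (sqrt (\<tau> * b) * exp (- (\<tau> * b)))"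
        using h b assms by (simp add: real_sqrt_mult real_sqrt_divide)
      also have "\<dots> \<le> sqrt (h / \<tau>) * 1"
        using h b assms by (intro mult_left_mono exp_minus_bounds) auto
      finally show ?thesis using False r by (simp add: heat_symbol_def b_def)
    qed (use assms in \<open>simp add: heat_symbol_def\<close>)
  qed (use h assms in \<open>auto intro!: continuous_on_diff continuous_on_mult\<close>)
  ultimately show ?thesis by simp
qed simp

text \<open>
  The hypothesis says that \<open>x\<close> has energy at most \<open>E\<close>; on the energy space the semigroup is
  Hoelder continuous with exponent \<open>1/2\<close> up to time \<open>0\<close>.
\<close>

lemma S_minus_id_energy:
  assumes "0 \<le> h" and E: "\<And>t. 0 < t \<Longrightarrow> inner (G t x) x \<le> E"
  shows "norm (S h x - x) \<le> sqrt h * sqrt E"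
proof (cases "h = 0")
  case False
  then have h: "0 < h" using assms by simp
  have step: "inner (S (2 * d) x) x - inner (S (h + 2 * d) x) x \<le> h * E" if d: "0 < d" for d
  proof -
    let ?f = "\<lambda>r. h * heat_symbol \<mu> 1 (2 * d) r - (heat_symbol \<mu> 0 (2 * d) r - heat_symbol \<mu> 0 (h + 2 * d) r)"
    have "0 \<le> inner (\<Phi> ?f x) x"
    proof (rule \<Phi>_nonneg)
      fix r :: real assume r: "r \<in> {0..1}"
      show "0 \<le> ?f r"
      proof (cases "r = 0")
        case False
        define b where "b = \<mu> / r"
        have "1 - h * b \<le> exp (- (h * b))" using exp_ge_add_one_self[of "- (h * b)"] by simp
        then have "0 \<le> (h * b - (1 - exp (- (h * b)))) * exp (- (2 * d * b))" by simp
        also have "\<dots> = h * (b * exp (- (2 * d * b))) - (exp (- (2 * d * b)) - exp (- ((h + 2 * d) * b)))"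
          by (simp add: algebra_simps flip: exp_add)
        finally have "0 \<le> h * (b * exp (- (2 * d) * b)) - (exp (- (2 * d) * b) - exp (- (h + 2 * d) * b))"
          by (simp only: minus_mult_left)
        then show ?thesis using False r by (simp only: heat_symbol_def b_def power_0 power_one_right mult_1_left) simp
      qed (simp add: heat_symbol_def)
    qed (use h d in \<open>auto intro!: continuous_on_diff continuous_on_mult_left\<close>)
    moreover have "\<Phi> ?f x = h *\<^sub>R G (2 * d) x - (S (2 * d) x - S (h + 2 * d) x)"
      using h d by (simp add: \<Phi>_diff \<Phi>_cmult S_def G_def continuous_on_diff continuous_on_mult_left)
    ultimately have "inner (S (2 * d) x) x - inner (S (h + 2 * d) x) x \<le> h * inner (G (2 * d) x) x"
      by (simp add: inner_diff_left)
    also have "\<dots> \<le> h * E" using E d h by (intro mult_left_mono) auto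
    finally show ?thesis .
  qed
  have lim: "((\<lambda>d. inner (S (2 * d) x) x - inner (S (h + 2 * d) x) x) \<longlongrightarrow> inner (S (2 * 0) x) x - inner (S (h + 2 * 0) x) x) (at 0 within {0..})"
  proof -
    have "continuous_on {0..} (\<lambda>d. S (2 * d) x)" "continuous_on {0..} (\<lambda>d. S (h + 2 * d) x)"
      by (rule continuous_on_S; use h in \<open>auto intro!: continuous_intros\<close>)+
    then have "((\<lambda>d. S (2 * d) x) \<longlongrightarrow> S (2 * 0) x) (at 0 within {0..})"
      "((\<lambda>d. S (h + 2 * d) x) \<longlongrightarrow> S (h + 2 * 0) x) (at 0 within {0..})"
      unfolding continuous_on_def by blast+
    then show ?thesis by (intro tendsto_intros)
  qed
  have "inner (S (2 * 0) x) x - inner (S (h + 2 * 0) x) x \<le> h * E"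
  proof (rule tendsto_upperbound[OF lim])
    show "\<forall>\<^sub>F d in at 0 within {0..}. inner (S (2 * d) x) x - inner (S (h + 2 * d) x) x \<le> h * E"
      using step by (auto simp: eventually_at_filter)
    show "at (0::real) within {0..} \<noteq> bot" by (simp add: at_within_Ici_at_right)
  qed
  then have "(norm (S h x - x))\<^sup>2 \<le> h * E"
    using S_defect[of h x] h by simp
  then show ?thesis by (simp add: real_le_rsqrt flip: real_sqrt_mult)
qed simp

end

section \<open>Duhamel integrals and mild solutions\<close>

text \<open>
  The value \<open>d\<close> at the singular end point is arbitrary; it is used where a bound must also hold
  there.
\<close>

lemma has_integral_inverse_sqrt:
  fixes t :: real assumes "a \<le> b" "b \<le> t"
  shows "((\<lambda>s. if s < t then c / sqrt (t - s) else d) has_integral 2 * c * (sqrt (t - a) - sqrt (t - b))) {a..b}"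
proof -
  have "((\<lambda>s. if s < t then c / sqrt (t - s) else d) has_integral (- 2 * c * sqrt (t - b) - - 2 * c * sqrt (t - a))) {a..b}"
    using assms
    by (intro fundamental_theorem_of_calculus_interior)
       (auto intro!: continuous_intros derivative_eq_intros simp: has_real_derivative_iff_has_vector_derivative[symmetric] field_simps)
  then show ?thesis by (simp add: algebra_simps)
qed

context coercive_inverse
begin

text \<open>
  The Duhamel integral, which solves \<open>u' + B u = f\<close>, \<open>u(0) = 0\<close>.
\<close>

definition conv :: "(real \<Rightarrow> 'a) \<Rightarrow> real \<Rightarrow> 'a" where
  "conv f t = integral {0..t} (\<lambda>s. S (t - s) (f s))"

lemma continuous_conv_integrand:
  assumes "continuous_on {0..} f" "0 \<le> a" "b \<le> c"
  shows "continuous_on {a..b} (\<lambda>s. S (c - s) (f s))"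
  by (rule continuous_on_S) (use assms in \<open>auto intro!: continuous_intros intro: continuous_on_subset\<close>)

lemma conv_0 [simp]: "conv f 0 = 0"
  by (simp add: conv_def)

lemma conv_split:
  assumes f: "continuous_on {0..} f" and ab: "0 \<le> a" "a \<le> b"
  shows "conv f b = S (b - a) (conv f a) + integral {a..b} (\<lambda>s. S (b - s) (f s))"
proof -
  have "conv f b = integral {0..a} (\<lambda>s. S (b - s) (f s)) + integral {a..b} (\<lambda>s. S (b - s) (f s))"
    unfolding conv_def using ab
    by (intro Henstock_Kurzweil_Integration.integral_combine[symmetric] integrable_continuous_real continuous_conv_integrand f) auto
  also have "integral {0..a} (\<lambda>s. S (b - s) (f s)) = integral {0..a} (S (b - a) \<circ> (\<lambda>s. S (a - s) (f s)))"
  proof (rule Henstock_Kurzweil_Integration.integral_cong)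
    fix s assume "s \<in> {0..a}"
    then show "S (b - s) (f s) = (S (b - a) \<circ> (\<lambda>s. S (a - s) (f s))) s"
      using S_add[of "b - a" "a - s" "f s"] ab by simp
  qed
  also have "\<dots> = S (b - a) (conv f a)"
    unfolding conv_def
    by (rule integral_linear[OF integrable_continuous_real bounded_linear_S], rule continuous_conv_integrand) (use ab f in auto)
  finally show ?thesis .
qed

lemma norm_conv_integrand_le:
  assumes f: "continuous_on {0..} f" and ab: "0 \<le> a" "a \<le> b" and M: "\<And>s. 0 \<le> s \<Longrightarrow> norm (f s) \<le> M"
  shows "norm (integral {a..b} (\<lambda>s. S (b - s) (f s))) \<le> M * (b - a)"
proof (rule integral_bound[OF ab(2) continuous_conv_integrand])
  show "norm (S (b - t) (f t)) \<le> M" if "t \<in> {a..b}" for t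
    using order_trans[OF norm_S_le1 M] that ab by auto
qed (use f ab in auto)

lemma norm_conv_le:
  assumes f: "continuous_on {0..} f" and t: "0 \<le> t" and N: "\<And>s. 0 \<le> s \<Longrightarrow> norm (f s) \<le> N"
  shows "norm (conv f t) \<le> N / \<mu>"
proof -
  have N0: "0 \<le> N" using N[of 0] norm_ge_zero[of "f 0"] by linarith
  have "((\<lambda>s. exp (- \<mu> * (t - s)) * N) has_integral (exp (- \<mu> * (t - t)) * N / \<mu> - exp (- \<mu> * (t - 0)) * N / \<mu>)) {0..t}"
    using t \<mu> by (intro fundamental_theorem_of_calculus)
       (auto intro!: derivative_eq_intros simp: has_real_derivative_iff_has_vector_derivative[symmetric])
  then have I: "((\<lambda>s. exp (- \<mu> * (t - s)) * N) has_integral (N / \<mu> - exp (- \<mu> * t) * N / \<mu>)) {0..t}"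
    by simp
  have "norm (conv f t) \<le> integral {0..t} (\<lambda>s. exp (- \<mu> * (t - s)) * N)"
    unfolding conv_def
  proof (rule integral_norm_bound_integral)
    show "(\<lambda>s. S (t - s) (f s)) integrable_on {0..t}"
      by (intro integrable_continuous_real continuous_conv_integrand f) auto
    show "(\<lambda>s. exp (- \<mu> * (t - s)) * N) integrable_on {0..t}" using I by blast
    fix s assume s: "s \<in> {0..t}"
    have "norm (S (t - s) (f s)) \<le> exp (- \<mu> * (t - s)) * norm (f s)"
      using s by (intro norm_S_le) auto
    also have "\<dots> \<le> exp (- \<mu> * (t - s)) * N"
      using s by (intro mult_left_mono N) auto
    finally show "norm (S (t - s) (f s)) \<le> exp (- \<mu> * (t - s)) * N" .
  qed
  also have "\<dots> = N / \<mu> - exp (- \<mu> * t) * N / \<mu>" using I by (rule integral_unique)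
  also have "\<dots> \<le> N / \<mu>" using N0 \<mu> by simp
  finally show ?thesis .
qed

lemma conv_diff:
  assumes f: "continuous_on {0..} f" and g: "continuous_on {0..} g" and t: "0 \<le> t"
  shows "conv f t - conv g t = conv (\<lambda>s. f s - g s) t"
  unfolding conv_def linear_diff[OF linear_S]
  by (rule integral_diff[symmetric]; intro integrable_continuous_real continuous_conv_integrand f g; simp)

lemma S_minus_id_conv:
  assumes f: "continuous_on {0..} f" and t: "0 \<le> t" and h: "0 \<le> h" and M: "\<And>s. 0 \<le> s \<Longrightarrow> norm (f s) \<le> M"
  shows "norm (S h (conv f t) - conv f t) \<le> 2 * M * (sqrt h * sqrt t)"
proof -
  have M0: "0 \<le> M" using M[of 0] norm_ge_zero[of "f 0"] by linarith
  let ?D = "\<lambda>x. S h x - x"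
  have D: "bounded_linear ?D" by (intro bounded_linear_sub bounded_linear_S bounded_linear_ident)
  have cont: "continuous_on {0..t} (\<lambda>s. S (t - s) (f s))" by (intro continuous_conv_integrand f) auto
  have "?D (conv f t) = integral {0..t} (?D \<circ> (\<lambda>s. S (t - s) (f s)))"
    unfolding conv_def by (rule integral_linear[OF integrable_continuous_real D, symmetric]) (rule cont)
  moreover have "norm (integral {0..t} (?D \<circ> (\<lambda>s. S (t - s) (f s)))) \<le> integral {0..t} (\<lambda>s. if s < t then (sqrt h * M) / sqrt (t - s) else 2 * M)"
  proof (rule integral_norm_bound_integral)
    show "?D \<circ> (\<lambda>s. S (t - s) (f s)) integrable_on {0..t}"
      using integrable_linear[OF integrable_continuous_real[OF cont] D] .
    show "(\<lambda>s. if s < t then (sqrt h * M) / sqrt (t - s) else 2 * M) integrable_on {0..t}"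
      using has_integral_inverse_sqrt[of 0 t t "sqrt h * M" "2 * M"] t by blast
    fix s assume s: "s \<in> {0..t}"
    show "norm ((?D \<circ> (\<lambda>s. S (t - s) (f s))) s) \<le> (if s < t then (sqrt h * M) / sqrt (t - s) else 2 * M)"
    proof (cases "s < t")
      case True
      have "norm (S h (S (t - s) (f s)) - S (t - s) (f s)) \<le> sqrt (h / (t - s)) * norm (f s)"
        using True h by (intro S_minus_id_S) auto
      also have "\<dots> \<le> sqrt (h / (t - s)) * M"
        using True h M s by (intro mult_left_mono) auto
      finally show ?thesis using True by (simp add: real_sqrt_divide)
    next
      case False
      then have "s = t" using s by simp
      then have "norm ((?D \<circ> (\<lambda>s. S (t - s) (f s))) s) \<le> norm (S h (f t)) + norm (f t)"
        using norm_triangle_ineq4[of "S h (f t)" "f t"] by simp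
      also have "\<dots> \<le> 2 * M" using norm_S_le1[of h "f t"] M[OF t] by linarith
      finally show ?thesis using False by simp
    qed
  qed
  moreover have "integral {0..t} (\<lambda>s. if s < t then (sqrt h * M) / sqrt (t - s) else 2 * M) \<le> 2 * M * (sqrt h * sqrt t)"
    using integral_unique[OF has_integral_inverse_sqrt[of 0 t t "sqrt h * M" "2 * M"]] t by simp
  ultimately show ?thesis by simp
qed

lemma conv_Hoelder:
  assumes f: "continuous_on {0..} f" and st: "0 \<le> s" "s \<le> t" and M: "\<And>s. 0 \<le> s \<Longrightarrow> norm (f s) \<le> M"
  shows "norm (conv f t - conv f s) \<le> 2 * M * (sqrt (t - s) * sqrt s) + M * (t - s)"
proof -
  have "conv f t - conv f s = (S (t - s) (conv f s) - conv f s) + integral {s..t} (\<lambda>r. S (t - r) (f r))"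
    using conv_split[OF f st] by simp
  then have "norm (conv f t - conv f s) \<le> norm (S (t - s) (conv f s) - conv f s) + norm (integral {s..t} (\<lambda>r. S (t - r) (f r)))"
    by (simp only: norm_triangle_ineq)
  also have "\<dots> \<le> 2 * M * (sqrt (t - s) * sqrt s) + M * (t - s)"
    using st by (intro add_mono S_minus_id_conv norm_conv_integrand_le f M) auto
  finally show ?thesis .
qed

lemma continuous_on_conv:
  assumes f: "continuous_on {0..} f" and M: "\<And>s. 0 \<le> s \<Longrightarrow> norm (f s) \<le> M"
  shows "continuous_on {0..} (conv f)"
  unfolding continuous_on_def
proof
  fix t :: real assume t: "t \<in> {0..}"
  have M0: "0 \<le> M" using M[of 0] norm_ge_zero[of "f 0"] by linarith
  have "((\<lambda>s. conv f s - conv f t) \<longlongrightarrow> 0) (at t within {0..})"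
  proof (rule Lim_null_comparison)
    show "\<forall>\<^sub>F s in at t within {0..}. norm (conv f s - conv f t) \<le> 2 * M * (sqrt \<bar>s - t\<bar> * sqrt (max s t)) + M * \<bar>s - t\<bar>"
      unfolding eventually_at_filter
    proof (rule always_eventually, intro allI impI)
      fix s :: real assume s: "s \<in> {0..}"
      show "norm (conv f s - conv f t) \<le> 2 * M * (sqrt \<bar>s - t\<bar> * sqrt (max s t)) + M * \<bar>s - t\<bar>"
      proof (cases "s \<le> t")
        case True
        have "norm (conv f s - conv f t) \<le> 2 * M * (sqrt (t - s) * sqrt s) + M * (t - s)"
          using conv_Hoelder[OF f _ True M] s by (simp add: norm_minus_commute)
        also have "\<dots> \<le> 2 * M * (sqrt (t - s) * sqrt (max s t)) + M * (t - s)"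
          using M0 True by (intro add_mono mult_left_mono) auto
        finally show ?thesis using True by simp
      next
        case False
        have "norm (conv f s - conv f t) \<le> 2 * M * (sqrt (s - t) * sqrt t) + M * (s - t)"
          using conv_Hoelder[OF f, of t s] False t M by simp
        also have "\<dots> \<le> 2 * M * (sqrt (s - t) * sqrt (max s t)) + M * (s - t)"
          using M0 False by (intro add_mono mult_left_mono) auto
        finally show ?thesis using False by simp
      qed
    qed
    have "((\<lambda>s. 2 * M * (sqrt \<bar>s - t\<bar> * sqrt (max s t)) + M * \<bar>s - t\<bar>) \<longlongrightarrow> 2 * M * (sqrt \<bar>t - t\<bar> * sqrt (max t t)) + M * \<bar>t - t\<bar>) (at t within {0..})"
      by (intro tendsto_intros)
    then show "((\<lambda>s. 2 * M * (sqrt \<bar>s - t\<bar> * sqrt (max s t)) + M * \<bar>s - t\<bar>) \<longlongrightarrow> 0) (at t within {0..})"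
      by simp
  qed
  then show "(conv f \<longlongrightarrow> conv f t) (at t within {0..})" by (rule LIM_zero_cancel)
qed

text \<open>
  The right-hand side is a contraction with factor \<open>\<eta> / \<mu>\<close> on the bounded continuous functions,
  by \<open>norm_conv_le\<close>. The functions live on the whole line; \<open>max 0 t\<close> extends them by their value
  at \<open>0\<close>.
\<close>

lemma mild_solution_exists:
  assumes lip: "\<And>x y. norm (F x - F y) \<le> \<eta> * norm (x - y)" and \<eta>: "\<eta> < \<mu>" and F0: "F 0 = 0"
  shows "\<exists>u. continuous_on {0..} u \<and> bounded (u ` {0..}) \<and> (\<forall>t\<ge>0. u t = S t g + conv (\<lambda>s. F (u s)) t)"
proof -
  have \<eta>': "0 \<le> max 0 \<eta>" "max 0 \<eta> < \<mu>" using \<eta> \<mu> by auto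
  have lip': "norm (F x - F y) \<le> max 0 \<eta> * norm (x - y)" for x y
    by (rule order_trans[OF lip]) (auto intro: mult_right_mono)
  have contF: "continuous_on UNIV F"
  proof (rule lipschitz_on_continuous_on[of "max 0 \<eta>"])
    show "(max 0 \<eta>)-lipschitz_on UNIV F" using lip' by (auto simp: lipschitz_on_def dist_norm)
  qed
  have fcont: "continuous_on {0..} (\<lambda>s. F (apply_bcontfun v s))" for v
    by (rule continuous_on_compose2[OF contF]) auto
  have fbound: "norm (F (apply_bcontfun v s)) \<le> max 0 \<eta> * norm v" for v and s :: real
  proof -
    have "norm (F (apply_bcontfun v s)) \<le> max 0 \<eta> * norm (apply_bcontfun v s)"
      using lip'[of "apply_bcontfun v s" 0] by (simp add: F0)
    also have "\<dots> \<le> max 0 \<eta> * norm v" by (intro mult_left_mono norm_bounded) auto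
    finally show ?thesis .
  qed
  define P where "P v t = S (max 0 t) g + conv (\<lambda>s. F (apply_bcontfun v s)) (max 0 t)" for v and t :: real
  have P: "P v \<in> bcontfun" for v
  proof (rule bcontfun_normI)
    have "continuous_on UNIV (\<lambda>t. S (max 0 t) g)"
      by (rule continuous_on_S) (auto intro!: continuous_intros)
    moreover have "continuous_on UNIV (\<lambda>t::real. conv (\<lambda>s. F (apply_bcontfun v s)) (max 0 t))"
      by (rule continuous_on_compose2[OF continuous_on_conv[OF fcont fbound]]) (auto intro!: continuous_intros)
    ultimately show "continuous_on UNIV (P v)" unfolding P_def[abs_def] by (rule continuous_on_add)
    show "norm (P v t) \<le> norm g + (max 0 \<eta> * norm v) / \<mu>" for t
      unfolding P_def
      by (rule order_trans[OF norm_triangle_ineq]) (intro add_mono norm_S_le1 norm_conv_le fcont fbound; simp)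
  qed
  have "\<exists>!v. Bcontfun (P v) = v"
  proof (rule banach_fix_type[of "max 0 \<eta> / \<mu>"])
    show "0 \<le> max 0 \<eta> / \<mu>" "max 0 \<eta> / \<mu> < 1" using \<eta>' \<mu> by auto
    show "\<forall>v w. dist (Bcontfun (P v)) (Bcontfun (P w)) \<le> max 0 \<eta> / \<mu> * dist v w"
    proof (intro allI dist_bound)
      fix v w :: "real \<Rightarrow>\<^sub>C 'a" and t :: real
      have b: "norm (F (apply_bcontfun v s) - F (apply_bcontfun w s)) \<le> max 0 \<eta> * dist v w" for s
      proof -
        have "norm (F (apply_bcontfun v s) - F (apply_bcontfun w s)) \<le> max 0 \<eta> * dist (apply_bcontfun v s) (apply_bcontfun w s)"
          unfolding dist_norm by (rule lip')
        also have "\<dots> \<le> max 0 \<eta> * dist v w" by (intro mult_left_mono dist_bounded) auto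
        finally show ?thesis .
      qed
      have "dist (P v t) (P w t) = norm (conv (\<lambda>s. F (apply_bcontfun v s) - F (apply_bcontfun w s)) (max 0 t))"
        by (simp add: P_def dist_norm conv_diff[OF fcont fcont, symmetric])
      also have "\<dots> \<le> (max 0 \<eta> * dist v w) / \<mu>"
        by (rule norm_conv_le) (use b in \<open>auto intro!: continuous_on_diff fcont\<close>)
      finally show "dist (apply_bcontfun (Bcontfun (P v)) t) (apply_bcontfun (Bcontfun (P w)) t) \<le> max 0 \<eta> / \<mu> * dist v w"
        by (simp add: Bcontfun_inverse[OF P])
    qed
  qed
  then obtain v where v: "Bcontfun (P v) = v" by blast
  have fixed: "P v = apply_bcontfun v" using Bcontfun_inverse[OF P[of v]] v by simp
  have "apply_bcontfun v t = S t g + conv (\<lambda>s. F (apply_bcontfun v s)) t" if "0 \<le> t" for t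
    using fun_cong[OF fixed, of t, symmetric] that unfolding P_def by (simp only: max_absorb2)
  moreover have "bounded (apply_bcontfun v ` {0..})"
    using norm_bounded[of v] by (auto simp: bounded_iff)
  ultimately show ?thesis by (intro exI[of _ "apply_bcontfun v"]) auto
qed

text \<open>
  Formally \<open>B (conv f t) = \<integral>G (t - s) (f s) ds\<close>, where \<open>\<parallel>G \<tau>\<parallel> \<le> 1 / \<tau>\<close> is not integrable. Subtracting
  \<open>f t\<close> from \<open>f s\<close> gains \<open>sqrt (t - s)\<close>, and the part with \<open>f t\<close> is integrated explicitly, since
  \<open>G\<close> is the derivative of \<open>- S\<close>.
\<close>

lemma conv_regularity:
  assumes f: "continuous_on {0..} f" and M: "\<And>s. 0 \<le> s \<Longrightarrow> norm (f s) \<le> M"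
    and C: "0 \<le> C" "\<And>s t. 0 \<le> s \<Longrightarrow> s \<le> t \<Longrightarrow> t \<le> L \<Longrightarrow> norm (f t - f s) \<le> C * sqrt (t - s)"
  shows "\<exists>w. continuous_on {0<..L} w \<and>
    (\<forall>t\<in>{0<..L}. R (w t) = conv f t \<and> norm (w t) \<le> 2 * M + 2 * C * sqrt t)"
proof -
  \<comment> \<open>\<open>q \<epsilon> t\<close> is \<open>B\<close> applied to the Duhamel integral up to time \<open>t - \<epsilon>\<close>. Only after \<open>S \<epsilon> (f t)\<close> is
    subtracted does it converge uniformly in \<open>t\<close>.\<close>
  define q where "q \<epsilon> t = G \<epsilon> (conv f (t - \<epsilon>))" for \<epsilon> t
  define p where "p \<epsilon> t = q \<epsilon> t - S \<epsilon> (f t)" for \<epsilon> t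
  have est: "norm (p \<delta> t - p \<epsilon> t) \<le> 2 * C * sqrt \<epsilon>" if d: "0 < \<delta>" "\<delta> \<le> \<epsilon>" "\<epsilon> \<le> t" "t \<le> L" for \<delta> \<epsilon> t
  proof -
    have \<epsilon>: "0 < \<epsilon>" using d by simp
    have cont1: "continuous_on {t - \<epsilon>..t - \<delta>} (\<lambda>s. S (t - \<delta> - s) (f s))"
      by (rule continuous_conv_integrand[OF f]) (use d in auto)
    have "conv f (t - \<delta>) = S (\<epsilon> - \<delta>) (conv f (t - \<epsilon>)) + integral {t - \<epsilon>..t - \<delta>} (\<lambda>s. S (t - \<delta> - s) (f s))"
      using conv_split[OF f, of "t - \<epsilon>" "t - \<delta>"] d by simp
    then have "q \<delta> t = G \<delta> (S (\<epsilon> - \<delta>) (conv f (t - \<epsilon>))) + G \<delta> (integral {t - \<epsilon>..t - \<delta>} (\<lambda>s. S (t - \<delta> - s) (f s)))"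
      using linear_add[OF bounded_linear.linear[OF bounded_linear_G[OF d(1)]]] by (simp add: q_def)
    also have "G \<delta> (S (\<epsilon> - \<delta>) (conv f (t - \<epsilon>))) = q \<epsilon> t"
      using G_add(1)[of \<delta> "\<epsilon> - \<delta>" "conv f (t - \<epsilon>)"] d by (simp add: q_def)
    also have "G \<delta> (integral {t - \<epsilon>..t - \<delta>} (\<lambda>s. S (t - \<delta> - s) (f s))) = integral {t - \<epsilon>..t - \<delta>} (G \<delta> \<circ> (\<lambda>s. S (t - \<delta> - s) (f s)))"
      by (rule integral_linear[OF integrable_continuous_real[OF cont1] bounded_linear_G[OF d(1)], symmetric])
    also have "\<dots> = integral {t - \<epsilon>..t - \<delta>} (\<lambda>s. G (t - s) (f s))"
    proof (rule Henstock_Kurzweil_Integration.integral_cong)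
      fix s assume "s \<in> {t - \<epsilon>..t - \<delta>}"
      then show "(G \<delta> \<circ> (\<lambda>s. S (t - \<delta> - s) (f s))) s = G (t - s) (f s)"
        using G_add(1)[of \<delta> "t - \<delta> - s" "f s"] d by simp
    qed
    finally have q: "q \<delta> t - q \<epsilon> t = integral {t - \<epsilon>..t - \<delta>} (\<lambda>s. G (t - s) (f s))" by simp
    have int1: "(\<lambda>s. G (t - s) (f s)) integrable_on {t - \<epsilon>..t - \<delta>}"
    proof (rule integrable_eq)
      show "(G \<delta> \<circ> (\<lambda>s. S (t - \<delta> - s) (f s))) integrable_on {t - \<epsilon>..t - \<delta>}"
        by (rule integrable_linear[OF integrable_continuous_real[OF cont1] bounded_linear_G[OF d(1)]])
      fix s assume "s \<in> {t - \<epsilon>..t - \<delta>}"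
      then show "(G \<delta> \<circ> (\<lambda>s. S (t - \<delta> - s) (f s))) s = G (t - s) (f s)"
        using G_add(1)[of \<delta> "t - \<delta> - s" "f s"] d by simp
    qed
    have int2: "((\<lambda>s. G (t - s) (f t)) has_integral (S (t - (t - \<delta>)) (f t) - S (t - (t - \<epsilon>)) (f t))) {t - \<epsilon>..t - \<delta>}"
    proof (rule fundamental_theorem_of_calculus)
      fix s assume s: "s \<in> {t - \<epsilon>..t - \<delta>}"
      have "((\<lambda>s. t - s) has_real_derivative - 1) (at s within {t - \<epsilon>..t - \<delta>})"
        by (auto intro!: derivative_eq_intros)
      then have "((\<lambda>s. S (t - s) (f t)) has_vector_derivative (- 1) *\<^sub>R - G (t - s) (f t)) (at s within {t - \<epsilon>..t - \<delta>})"
        using vector_diff_chain_within[of "\<lambda>s. t - s" "- 1" s "{t - \<epsilon>..t - \<delta>}" "\<lambda>r. S r (f t)" "- G (t - s) (f t)"]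
          has_vector_derivative_at_within[OF S_derivative[of "t - s" "f t"]] s d
        by (simp add: has_real_derivative_iff_has_vector_derivative o_def)
      then show "((\<lambda>s. S (t - s) (f t)) has_vector_derivative G (t - s) (f t)) (at s within {t - \<epsilon>..t - \<delta>})"
        by simp
    qed (use d in simp)
    have lin: "G (t - s) (f s) - G (t - s) (f t) = G (t - s) (f s - f t)" if "s \<in> {t - \<epsilon>..t - \<delta>}" for s
      using that d linear_diff[OF bounded_linear.linear[OF bounded_linear_G[of "t - s"]]] by simp
    have "p \<delta> t - p \<epsilon> t = integral {t - \<epsilon>..t - \<delta>} (\<lambda>s. G (t - s) (f s) - G (t - s) (f t))"
      using q integral_unique[OF int2] integral_diff[OF int1 has_integral_integrable[OF int2]]
      by (simp add: p_def)
    also have "norm \<dots> \<le> integral {t - \<epsilon>..t - \<delta>} (\<lambda>s. if s < t then C / sqrt (t - s) else 0)"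
    proof (rule integral_norm_bound_integral)
      show "(\<lambda>s. G (t - s) (f s) - G (t - s) (f t)) integrable_on {t - \<epsilon>..t - \<delta>}"
        by (intro integrable_diff int1 has_integral_integrable[OF int2])
      show "(\<lambda>s. if s < t then C / sqrt (t - s) else 0) integrable_on {t - \<epsilon>..t - \<delta>}"
        using has_integral_inverse_sqrt[of "t - \<epsilon>" "t - \<delta>" t C 0] d by auto
      fix s assume s: "s \<in> {t - \<epsilon>..t - \<delta>}"
      have st: "0 < t - s" using s d by auto
      have "norm (G (t - s) (f s - f t)) \<le> norm (f s - f t) / (t - s)"
        using st by (rule norm_G_le)
      also have "\<dots> \<le> C * sqrt (t - s) / (t - s)"
        using C(2)[of s t] s d st by (intro divide_right_mono) (auto simp: norm_minus_commute)
      also have "\<dots> = C / sqrt (t - s)"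
        using st by (simp add: field_simps flip: power2_eq_square)
      finally show "norm (G (t - s) (f s) - G (t - s) (f t)) \<le> (if s < t then C / sqrt (t - s) else 0)"
        using st lin[OF s] by simp
    qed
    also have "\<dots> = 2 * C * (sqrt \<epsilon> - sqrt \<delta>)"
      using integral_unique[OF has_integral_inverse_sqrt[of "t - \<epsilon>" "t - \<delta>" t C 0]] d by simp
    also have "\<dots> \<le> 2 * C * sqrt \<epsilon>"
      using C(1) d by (intro mult_left_mono) auto
    finally show ?thesis .
  qed
  define \<epsilon> where "\<epsilon> n = inverse (real (Suc n))" for n
  have \<epsilon>: "0 < \<epsilon> n" for n by (simp add: \<epsilon>_def)
  have \<epsilon>0: "\<epsilon> \<longlonglongrightarrow> 0" unfolding \<epsilon>_def by (rule LIMSEQ_inverse_real_of_nat)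
  have \<epsilon>mono: "\<epsilon> n \<le> \<epsilon> m" if "m \<le> n" for m n using that by (simp add: \<epsilon>_def field_simps)
  have sq0: "(\<lambda>n. 2 * C * sqrt (\<epsilon> n)) \<longlonglongrightarrow> 0"
    using tendsto_mult_right_zero[OF tendsto_real_sqrt[OF \<epsilon>0, simplified]] by simp
  have conv: "convergent (\<lambda>n. p (\<epsilon> n) t)" if t: "0 < t" "t \<le> L" for t
  proof -
    have "Cauchy (\<lambda>n. p (\<epsilon> n) t)"
    proof (rule CauchyI)
      fix e :: real assume e: "0 < e"
      obtain N where N: "\<epsilon> N < t" "2 * C * sqrt (\<epsilon> N) < e / 2"
        using eventually_conj[OF order_tendstoD(2)[OF \<epsilon>0 t(1)] order_tendstoD(2)[OF sq0, of "e / 2"]] e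
        by (auto simp: eventually_sequentially)
      have half: "norm (p (\<epsilon> m) t - p (\<epsilon> N) t) < e / 2" if "N \<le> m" for m
        using est[of "\<epsilon> m" "\<epsilon> N" t] \<epsilon> \<epsilon>mono[OF that] N t by force
      then have "norm (p (\<epsilon> m) t - p (\<epsilon> n) t) < e" if "N \<le> m" "N \<le> n" for m n
      proof -
        have "norm (p (\<epsilon> m) t - p (\<epsilon> n) t) \<le> norm (p (\<epsilon> m) t - p (\<epsilon> N) t) + norm (p (\<epsilon> n) t - p (\<epsilon> N) t)"
          using norm_triangle_ineq4[of "p (\<epsilon> m) t - p (\<epsilon> N) t" "p (\<epsilon> n) t - p (\<epsilon> N) t"] by simp
        then show ?thesis using half[OF that(1)] half[OF that(2)] by linarith
      qed
      then show "\<exists>M. \<forall>m\<ge>M. \<forall>n\<ge>M. norm (p (\<epsilon> m) t - p (\<epsilon> n) t) < e" by blast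
    qed
    then show ?thesis by (rule Cauchy_convergent)
  qed
  define p0 where "p0 t = lim (\<lambda>n. p (\<epsilon> n) t)" for t
  have p0: "(\<lambda>n. p (\<epsilon> n) t) \<longlonglongrightarrow> p0 t" if "0 < t" "t \<le> L" for t
    using conv[OF that] by (simp add: p0_def convergent_LIMSEQ_iff)
  have est0: "norm (p0 t - p e t) \<le> 2 * C * sqrt e" if e: "0 < e" "e \<le> t" "t \<le> L" for e t
  proof (rule tendsto_upperbound)
    show "(\<lambda>n. norm (p (\<epsilon> n) t - p e t)) \<longlonglongrightarrow> norm (p0 t - p e t)"
      using e by (intro tendsto_intros p0) auto
    show "\<forall>\<^sub>F n in sequentially. norm (p (\<epsilon> n) t - p e t) \<le> 2 * C * sqrt e"
      using order_tendstoD(2)[OF \<epsilon>0 e(1)]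
      by eventually_elim (use est e \<epsilon> in auto)
  qed simp
  have contp: "continuous_on {a..L} (p e)" if e: "0 < e" "e \<le> a" for a e
  proof -
    have "continuous_on {a..L} (\<lambda>t. conv f (t - e))"
      by (rule continuous_on_compose2[OF continuous_on_conv[OF f M]]) (use e in \<open>auto intro!: continuous_intros\<close>)
    then have "continuous_on {a..L} (q e)"
      unfolding q_def by (rule bounded_linear.continuous_on[OF bounded_linear_G[OF e(1)]])
    moreover have "continuous_on {a..L} (\<lambda>t. S e (f t))"
      by (rule bounded_linear.continuous_on[OF bounded_linear_S]) (rule continuous_on_subset[OF f], use e in auto)
    ultimately show ?thesis unfolding p_def[abs_def] by (rule continuous_on_diff)
  qed
  have contp0: "continuous_on {a..L} p0" if a: "0 < a" for a
  proof (rule uniform_limit_theorem[of _ "\<lambda>n. p (\<epsilon> n)" sequentially])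
    have ev: "\<forall>\<^sub>F n in sequentially. \<epsilon> n < a" using order_tendstoD(2)[OF \<epsilon>0 a] .
    then show "\<forall>\<^sub>F n in sequentially. continuous_on {a..L} (p (\<epsilon> n))"
      by eventually_elim (rule contp, use \<epsilon> in auto)
    show "uniform_limit {a..L} (\<lambda>n. p (\<epsilon> n)) p0 sequentially"
      unfolding uniform_limit_iff
    proof (intro allI impI)
      fix e :: real assume "0 < e"
      then have "\<forall>\<^sub>F n in sequentially. 2 * C * sqrt (\<epsilon> n) < e" using order_tendstoD(2)[OF sq0] by blast
      then show "\<forall>\<^sub>F n in sequentially. \<forall>t\<in>{a..L}. dist (p (\<epsilon> n) t) (p0 t) < e"
        using ev
      proof eventually_elim
        case (elim n)
        show ?case
        proof
          fix t assume "t \<in> {a..L}"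
          then have "norm (p0 t - p (\<epsilon> n) t) \<le> 2 * C * sqrt (\<epsilon> n)"
            using elim \<epsilon> by (intro est0) auto
          then show "dist (p (\<epsilon> n) t) (p0 t) < e"
            using elim by (simp add: dist_norm norm_minus_commute)
        qed
      qed
    qed
  qed simp
  show ?thesis
  proof (intro exI conjI ballI)
    have "continuous_on {0<..<L+1} (\<lambda>t. p0 (min t L))" if "0 < L"
    proof (rule continuous_at_imp_continuous_on, rule ballI)
      fix t assume t: "t \<in> {0<..<L+1}"
      have *: "continuous_on {t/2..} (\<lambda>t. p0 (min t L))" if "t / 2 \<le> L"
        by (rule continuous_on_compose2[OF contp0[of "t/2"]]) (use t that in \<open>auto intro!: continuous_intros\<close>)
      show "isCont (\<lambda>t. p0 (min t L)) t"
      proof (cases "t / 2 \<le> L")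
        case True
        show ?thesis using * True t by (intro continuous_on_interior[of "{t/2..}"]) (auto simp: interior_Ici)
      next
        case False
        have "isCont (\<lambda>t. p0 (min t L)) t = isCont (\<lambda>t. p0 L) t"
          using False t by (intro isCont_cong) (auto intro!: eventually_mono[OF eventually_nhds_in_open[of "{L<..}" t]])
        then show ?thesis by simp
      qed
    qed
    then have "continuous_on {0<..L} (\<lambda>t. p0 (min t L))" 
      by (cases "0 < L") (auto intro: continuous_on_subset)
    then have "continuous_on {0<..L} p0" by (rule continuous_on_eq) auto
    then show "continuous_on {0<..L} (\<lambda>t. p0 t + f t)"
      by (intro continuous_on_add continuous_on_subset[OF f]) auto
  next
    fix t assume "t \<in> {0<..L}"
    then have t: "0 < t" "t \<le> L" by auto
    have "(\<lambda>n. R (p (\<epsilon> n) t)) \<longlonglongrightarrow> R (p0 t)"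
      using bounded_linear.tendsto[OF bounded_linear_R p0[OF t]] .
    moreover have "(\<lambda>n. R (p (\<epsilon> n) t)) \<longlonglongrightarrow> conv f t - R (f t)"
    proof (rule Lim_transform_eventually)
      show "\<forall>\<^sub>F n in sequentially. S (\<epsilon> n) (conv f (t - \<epsilon> n)) - S (\<epsilon> n) (R (f t)) = R (p (\<epsilon> n) t)"
        using \<epsilon> by (simp add: p_def q_def linear_diff[OF linear_R] R_G S_R)
      show "(\<lambda>n. S (\<epsilon> n) (conv f (t - \<epsilon> n)) - S (\<epsilon> n) (R (f t))) \<longlonglongrightarrow> conv f t - R (f t)"
      proof (intro tendsto_diff S_joint_tendsto \<epsilon>0 tendsto_const)
        have "continuous (at t) (conv f)"
          by (rule continuous_on_interior[OF continuous_on_conv[OF f M]]) (use t in \<open>auto simp: interior_Ici\<close>)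
        moreover have "(\<lambda>n. t - \<epsilon> n) \<longlonglongrightarrow> t" using tendsto_diff[OF tendsto_const[of t] \<epsilon>0] by simp
        ultimately show "(\<lambda>n. conv f (t - \<epsilon> n)) \<longlonglongrightarrow> conv f t" by (rule isCont_tendsto_compose)
      qed (auto intro!: always_eventually less_imp_le \<epsilon>)
    qed
    ultimately have "R (p0 t) = conv f t - R (f t)" using LIMSEQ_unique by blast
    then show "R (p0 t + f t) = conv f t" by (simp add: linear_add[OF linear_R])
    \<comment> \<open>The case \<open>\<epsilon> = t\<close>, where the integral is empty, bounds the limit.\<close>
    have "p t t = - S t (f t)"
      using linear_0[OF bounded_linear.linear[OF bounded_linear_G[OF t(1)]]] by (simp add: p_def q_def)
    then have "norm (p t t) \<le> M" using order_trans[OF norm_S_le1 M, of t t] t by simp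
    moreover have "norm (p0 t - p t t) \<le> 2 * C * sqrt t" using est0[of t t] t by simp
    moreover have "norm (f t) \<le> M" using M t by simp
    moreover have "norm (p0 t + f t) \<le> norm (p0 t - p t t) + norm (p t t) + norm (f t)"
      using norm_triangle_ineq[of "p0 t" "f t"] norm_triangle_sub[of "p0 t" "p t t"] by simp
    ultimately show "norm (p0 t + f t) \<le> 2 * M + 2 * C * sqrt t" by linarith
  qed
qed

end

section \<open>Strong solutions\<close>

context coercive_inverse
begin

lemma integral_S:
  assumes "a \<le> b"
  shows "((\<lambda>s. S (b - s) y) has_integral (R y - S (b - a) (R y))) {a..b}"
proof -
  have "((\<lambda>s. S (b - s) y) has_integral (S (b - b) (R y) - S (b - a) (R y))) {a..b}"
  proof (rule fundamental_theorem_of_calculus_interior[OF assms])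
    show "continuous_on {a..b} (\<lambda>s. S (b - s) (R y))"
      by (rule continuous_on_S) (auto intro!: continuous_intros)
    fix s assume s: "s \<in> {a<..<b}"
    have "((\<lambda>s. b - s) has_real_derivative - 1) (at s)"
      by (auto intro!: derivative_eq_intros)
    then have "((\<lambda>s. S (b - s) (R y)) has_vector_derivative (- 1) *\<^sub>R - G (b - s) (R y)) (at s)"
      using vector_diff_chain_at[of "\<lambda>s. b - s" "- 1" s "\<lambda>r. S r (R y)" "- G (b - s) (R y)"]
        S_derivative[of "b - s" "R y"] s
      by (simp add: has_real_derivative_iff_has_vector_derivative o_def)
    then show "((\<lambda>s. S (b - s) (R y)) has_vector_derivative S (b - s) y) (at s)"
      using s by (simp add: G_R)
  qed
  then show ?thesis by simp
qed

text \<open>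
  The increment is \<open>\<integral>S (b - s) (f s - y) ds\<close> over \<open>[a, b]\<close> with \<open>y = B (u a)\<close>; so \<open>u\<close> has derivative
  \<open>z\<close> at any point where this integrand is close to \<open>z\<close>.
\<close>

lemma mild_increment:
  assumes f: "continuous_on {0..} f" and ab: "0 \<le> a" "a \<le> b"
    and u: "u a = S a g + conv f a" "u b = S b g + conv f b" and W: "R y = u a"
    and e: "\<And>s. s \<in> {a..b} \<Longrightarrow> norm (S (b - s) (f s - y) - z) \<le> e"
  shows "norm (u b - u a - (b - a) *\<^sub>R z) \<le> e * (b - a)"
proof -
  have i1: "(\<lambda>s. S (b - s) (f s)) integrable_on {a..b}"
    by (intro integrable_continuous_real continuous_conv_integrand f ab) simp
  have "u b = S (b - a) (u a) + integral {a..b} (\<lambda>s. S (b - s) (f s))"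
    using conv_split[OF f ab] S_add[of "b - a" a g] ab u by (simp add: linear_add[OF linear_S])
  then have "u b - u a = integral {a..b} (\<lambda>s. S (b - s) (f s)) - (R y - S (b - a) (R y))"
    using W by simp
  then have "((\<lambda>s. S (b - s) (f s) - S (b - s) y) has_integral (u b - u a)) {a..b}"
    using has_integral_diff[OF integrable_integral[OF i1] integral_S[OF ab(2), of y]] by simp
  then have "((\<lambda>s. S (b - s) (f s - y) - z) has_integral (u b - u a - (b - a) *\<^sub>R z)) {a..b}"
    using has_integral_diff[OF _ has_integral_const_real[of z a b]] ab
    by (simp add: linear_diff[OF linear_S])
  then have eq: "integral {a..b} (\<lambda>s. S (b - s) (f s - y) - z) = u b - u a - (b - a) *\<^sub>R z"
    by (rule integral_unique)
  have "continuous_on {a..b} (\<lambda>s. S (b - s) (f s - y))"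
    by (rule continuous_conv_integrand[of "\<lambda>s. f s - y"]) (use ab in \<open>auto intro!: continuous_on_diff f\<close>)
  then have "norm (integral {a..b} (\<lambda>s. S (b - s) (f s - y) - z)) \<le> e * (b - a)"
    by (intro integral_bound ab e continuous_on_diff) auto
  then show ?thesis unfolding eq .
qed

text \<open>
  The mild solution is Hoelder continuous: the part \<open>S t g\<close> because \<open>g\<close> has finite energy, the
  Duhamel part by \<open>conv_Hoelder\<close>. Therefore \<open>conv_regularity\<close> applies to \<open>F \<circ> u\<close>. In the
  statement \<open>W t\<close> is \<open>B (u t)\<close>; the last bound controls the energy of \<open>u t - S t g\<close> near \<open>t = 0\<close>.
\<close>

lemma strong_solution_exists:
  assumes lip: "\<And>x y. norm (F x - F y) \<le> \<eta> * norm (x - y)" and \<eta>: "0 \<le> \<eta>" "\<eta> < \<mu>" and F0: "F 0 = 0"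
    and E: "\<And>t. 0 < t \<Longrightarrow> inner (G t g) g \<le> E"
  shows "\<exists>u W B. u 0 = g \<and> continuous_on {0..} u \<and> continuous_on {0<..} W \<and>
    (\<forall>t>0. R (W t) = u t \<and> (u has_vector_derivative (F (u t) - W t)) (at t)) \<and>
    (\<forall>t\<in>{0<..1}. norm (W t - G t g) \<le> B)"
proof -
  obtain u where u: "continuous_on {0..} u" "bounded (u ` {0..})"
    and ueq: "\<And>t. 0 \<le> t \<Longrightarrow> u t = S t g + conv (\<lambda>s. F (u s)) t"
    using mild_solution_exists[OF lip \<eta>(2) F0, of g] by blast
  define f where "f = (\<lambda>s. F (u s))"
  have contF: "continuous_on UNIV F"
    by (rule lipschitz_on_continuous_on[of \<eta>]) (use lip \<eta> in \<open>auto simp: lipschitz_on_def dist_norm\<close>)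
  have f: "continuous_on {0..} f"
    unfolding f_def by (rule continuous_on_compose2[OF contF u(1)]) auto
  obtain U where U: "\<And>t. 0 \<le> t \<Longrightarrow> norm (u t) \<le> U"
    using u(2) by (auto simp: bounded_iff)
  have Fle: "norm (F x) \<le> \<eta> * norm x" for x using lip[of x 0] F0 by simp
  define M where "M = \<eta> * U"
  have M: "norm (f s) \<le> M" if "0 \<le> s" for s
    unfolding f_def M_def by (rule order_trans[OF Fle]) (intro mult_left_mono U that \<eta>)
  have M0: "0 \<le> M" using M[of 0] norm_ge_zero[of "f 0"] by linarith
  have E0: "0 \<le> E" using E[of 1] G_decreasing(2)[of 1 1 g] by simp
  \<comment> \<open>The constant grows with \<open>L\<close>, which is harmless as regularity is a local question in time.\<close>
  have Hoelder: "norm (u t - u s) \<le> (sqrt E + 3 * M * sqrt L) * sqrt (t - s)" if st: "0 \<le> s" "s \<le> t" "t \<le> L" for s t L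
  proof -
    have "u t - u s = S s (S (t - s) g - g) + (conv f t - conv f s)"
      using ueq[of t] ueq[of s] S_add[of s "t - s" g] st by (simp add: linear_diff[OF linear_S] f_def)
    then have "norm (u t - u s) \<le> norm (S s (S (t - s) g - g)) + norm (conv f t - conv f s)"
      by (simp add: norm_triangle_ineq)
    also have "norm (S s (S (t - s) g - g)) \<le> sqrt (t - s) * sqrt E"
      using st by (intro order_trans[OF norm_S_le1] S_minus_id_energy E) auto
    also have "norm (conv f t - conv f s) \<le> 2 * M * (sqrt (t - s) * sqrt s) + M * (t - s)"
      using st by (intro conv_Hoelder f M)
    also have "2 * M * (sqrt (t - s) * sqrt s) \<le> 2 * M * (sqrt (t - s) * sqrt L)"
      using st M0 by (intro mult_left_mono) auto
    also have "M * (t - s) \<le> M * (sqrt (t - s) * sqrt L)"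
    proof (intro mult_left_mono M0)
      have "t - s = sqrt (t - s) * sqrt (t - s)" using st by simp
      also have "\<dots> \<le> sqrt (t - s) * sqrt L" using st by (intro mult_left_mono) auto
      finally show "t - s \<le> sqrt (t - s) * sqrt L" .
    qed
    finally show ?thesis by (simp add: algebra_simps)
  qed
  define C where "C L = \<eta> * (sqrt E + 3 * M * sqrt (max 0 L))" for L
  have C: "0 \<le> C L" for L using \<eta> E0 M0 by (simp add: C_def)
  have fH: "norm (f t - f s) \<le> C L * sqrt (t - s)" if st: "0 \<le> s" "s \<le> t" "t \<le> L" for s t L
  proof -
    have "norm (f t - f s) \<le> \<eta> * norm (u t - u s)" unfolding f_def by (rule lip)
    also have "\<dots> \<le> \<eta> * ((sqrt E + 3 * M * sqrt L) * sqrt (t - s))"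
      using st by (intro mult_left_mono Hoelder \<eta>)
    finally show ?thesis using st by (simp add: C_def mult.assoc)
  qed
  have "\<exists>w. \<forall>L. continuous_on {0<..L} (w L) \<and>
    (\<forall>t\<in>{0<..L}. R (w L t) = conv f t \<and> norm (w L t) \<le> 2 * M + 2 * C L * sqrt t)"
  proof (rule choice, rule allI)
    show "\<exists>w. continuous_on {0<..L} w \<and>
      (\<forall>t\<in>{0<..L}. R (w t) = conv f t \<and> norm (w t) \<le> 2 * M + 2 * C L * sqrt t)" for L
      by (rule conv_regularity[OF f M C fH]) auto
  qed
  then obtain w where wc: "\<And>L. continuous_on {0<..L} (w L)" 
    and w: "\<And>L t. t \<in> {0<..L} \<Longrightarrow> R (w L t) = conv f t \<and> norm (w L t) \<le> 2 * M + 2 * C L * sqrt t"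
    by blast
  define W where "W t = G t g + w t t" for t
  have W_eq: "W t = G t g + w L t" if "t \<in> {0<..L}" for t L
  proof -
    have "R (w t t) = R (w L t)" using w[of t t] w[OF that] that by simp
    then show ?thesis by (simp only: R_inj W_def)
  qed
  have RW: "R (W t) = u t" if "0 < t" for t
    using w[of t t] ueq[of t] that by (simp add: W_def linear_add[OF linear_R] R_G f_def)
  have Wc: "continuous_on {0<..} W"
  proof (rule continuous_at_imp_continuous_on, rule ballI)
    fix t :: real assume t: "t \<in> {0<..}"
    have "continuous_on {0<..t + 1} (\<lambda>s. G s g + w (t + 1) s)"
      by (intro continuous_on_add wc continuous_on_subset[OF continuous_on_G]) auto
    then have "continuous_on {0<..t + 1} W"
      by (rule continuous_on_eq) (rule W_eq[symmetric])
    then have "continuous_on {0<..<t + 1} W" by (rule continuous_on_subset) auto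
    then show "isCont W t" using t by (simp add: continuous_on_eq_continuous_at)
  qed
  have deriv: "(u has_vector_derivative (F (u t) - W t)) (at t)" if t: "0 < t" for t
  proof -
    define z where "z = f t - W t"
    have "(u has_derivative (\<lambda>h. h *\<^sub>R z)) (at t)"
      unfolding has_derivative_at_alt
    proof (intro conjI allI impI)
      show "bounded_linear (\<lambda>h. h *\<^sub>R z)" by (rule bounded_linear_scaleR_left)
      fix e :: real assume e: "0 < e"
      have "isCont f t" by (rule continuous_on_interior[OF f]) (use t in \<open>auto simp: interior_Ici\<close>)
      then obtain d1 where d1: "0 < d1" "\<And>s. dist s t < d1 \<Longrightarrow> dist (f s) (f t) < e / 3"
        using e unfolding continuous_at_eps_delta by (metis divide_pos_pos zero_less_numeral)
      have "isCont W t" using Wc t by (simp add: continuous_on_eq_continuous_at)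
      then obtain d2 where d2: "0 < d2" "\<And>s. dist s t < d2 \<Longrightarrow> dist (W s) (W t) < e / 3"
        using e unfolding continuous_at_eps_delta by (metis divide_pos_pos zero_less_numeral)
      have "\<forall>\<^sub>F s in at_right 0. dist (S s z) z < e / 3"
        using tendstoD[OF S_tendsto_0[of z], of "e / 3"] e by simp
      then obtain d3 where d3: "0 < d3" "\<And>s. 0 < s \<Longrightarrow> s < d3 \<Longrightarrow> dist (S s z) z < e / 3"
        unfolding eventually_at_right_field by auto
      define d where "d = min (min d1 d2) (min d3 t)"
      have main: "norm (u b - u a - (b - a) *\<^sub>R z) \<le> e * (b - a)"
        if ab: "0 < a" "a \<le> b" "b - a < d" "t = a \<or> t = b" for a b
      proof (rule mild_increment[OF f, where y = "W a" and g = g])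
        fix s assume s: "s \<in> {a..b}"
        have "S (b - s) (f s - W a) - z = S (b - s) ((f s - f t) - (W a - W t)) + (S (b - s) z - z)"
          by (simp add: z_def linear_diff[OF linear_S] linear_add[OF linear_S] algebra_simps)
        also have "norm \<dots> \<le> norm (S (b - s) ((f s - f t) - (W a - W t))) + norm (S (b - s) z - z)"
          by (rule norm_triangle_ineq)
        also have "norm (S (b - s) ((f s - f t) - (W a - W t))) \<le> norm (f s - f t) + norm (W a - W t)"
          by (rule order_trans[OF norm_S_le1 norm_triangle_ineq4])
        also have "norm (f s - f t) \<le> e / 3"
          using d1(2)[of s] s ab by (auto simp: d_def dist_norm)
        also have "norm (W a - W t) \<le> e / 3"
          using d2(2)[of a] ab by (auto simp: d_def dist_norm)
        also have "norm (S (b - s) z - z) \<le> e / 3"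
          using d3(2)[of "b - s"] s ab e by (cases "s = b") (auto simp: d_def dist_norm intro: less_imp_le)
        finally show "norm (S (b - s) (f s - W a) - z) \<le> e" by simp
      qed (use ab ueq RW in \<open>auto simp: f_def\<close>)
      have "norm (u y - u t - (y - t) *\<^sub>R z) \<le> e * norm (y - t)" if y: "norm (y - t) < d" for y
      proof (cases "t \<le> y")
        case True
        then show ?thesis using main[of t y] y t by simp
      next
        case False
        then have "norm (u t - u y - (t - y) *\<^sub>R z) \<le> e * (t - y)"
          using main[of y t] y by (auto simp: d_def)
        moreover have "u y - u t - (y - t) *\<^sub>R z = - (u t - u y - (t - y) *\<^sub>R z)"
          by (simp add: algebra_simps)
        ultimately show ?thesis using False by (simp only: norm_minus_cancel) simp
      qed
      moreover have "0 < d" using d1 d2 d3 t by (simp add: d_def)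
      ultimately show "\<exists>d>0. \<forall>y. norm (y - t) < d \<longrightarrow> norm (u y - u t - (y - t) *\<^sub>R z) \<le> e * norm (y - t)" by blast
    qed
    then show ?thesis by (simp add: has_vector_derivative_def z_def f_def)
  qed
  have "norm (W t - G t g) \<le> 2 * M + 2 * C 1" if t: "t \<in> {0<..1}" for t
  proof -
    have "norm (W t - G t g) \<le> 2 * M + 2 * C 1 * sqrt t" using w[OF t] W_eq[OF t] by simp
    also have "\<dots> \<le> 2 * M + 2 * C 1 * 1" using t C[of 1] by (intro add_left_mono mult_left_mono) auto
    finally show ?thesis by simp
  qed
  then show ?thesis
    using ueq[of 0] u(1) Wc RW deriv by (intro exI[of _ u] exI[of _ W] exI[of _ "2 * M + 2 * C 1"]) auto
qed

end

section \<open>Coercive forms\<close>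

lemma vector_difference_quotient_tendsto:
  assumes "(u has_vector_derivative z) (at t)"
  shows "((\<lambda>s. (u s - u t) /\<^sub>R (s - t)) \<longlongrightarrow> z) (at t)"
proof -
  have "((\<lambda>s. norm (u s - u t - (s - t) *\<^sub>R z) / norm (s - t)) \<longlongrightarrow> 0) (at t)"
    using assms by (simp add: has_vector_derivative_def has_derivative_iff_norm)
  then have "((\<lambda>s. (u s - u t) /\<^sub>R (s - t) - z) \<longlongrightarrow> 0) (at t)"
  proof (rule Lim_null_comparison[rotated])
    show "\<forall>\<^sub>F s in at t. norm ((u s - u t) /\<^sub>R (s - t) - z) \<le> norm (u s - u t - (s - t) *\<^sub>R z) / norm (s - t)"
      unfolding eventually_at_filter
    proof (intro always_eventually allI impI)
      fix s assume "s \<noteq> t"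
      then have "(u s - u t) /\<^sub>R (s - t) - z = (u s - u t - (s - t) *\<^sub>R z) /\<^sub>R (s - t)"
        by (simp add: scaleR_diff_right)
      then show "norm ((u s - u t) /\<^sub>R (s - t) - z) \<le> norm (u s - u t - (s - t) *\<^sub>R z) / norm (s - t)"
        by (simp add: divide_inverse mult.commute)
    qed
  qed
  then show ?thesis by (rule LIM_zero_cancel)
qed

text \<open>
  The form domain \<open>V\<close> is a subset, not a type, so that one inner product on the ambient space
  serves for the operator of the form. The condition \<open>total\<close> is the density of \<open>V\<close>; it makes
  the inverse of this operator injective.
\<close>

locale coercive_form =
  fixes V :: "'a::{real_inner,banach} set" and e :: "'a \<Rightarrow> 'a \<Rightarrow> real" and \<mu> :: real
  assumes \<mu>_pos: "0 < \<mu>" and V: "subspace V"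
    and e_sym: "u \<in> V \<Longrightarrow> v \<in> V \<Longrightarrow> e u v = e v u"
    and e_add: "u \<in> V \<Longrightarrow> u' \<in> V \<Longrightarrow> v \<in> V \<Longrightarrow> e (u + u') v = e u v + e u' v"
    and e_scale: "u \<in> V \<Longrightarrow> v \<in> V \<Longrightarrow> e (c *\<^sub>R u) v = c * e u v"
    and coercive: "v \<in> V \<Longrightarrow> \<mu> * (norm v)\<^sup>2 \<le> e v v"
    and complete: "(\<And>n. x n \<in> V) \<Longrightarrow> (\<And>\<epsilon>. 0 < \<epsilon> \<Longrightarrow> \<exists>N. \<forall>m\<ge>N. \<forall>n\<ge>N. e (x m - x n) (x m - x n) < \<epsilon>) \<Longrightarrow>
      \<exists>v\<in>V. (\<lambda>n. e (x n - v) (x n - v)) \<longlonglongrightarrow> 0"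
    and total: "(\<And>v. v \<in> V \<Longrightarrow> inner h v = 0) \<Longrightarrow> h = 0"
begin

lemmas V_add [simp, intro] = subspace_add[OF V] and V_diff [simp, intro] = subspace_diff[OF V]
  and V_scale [simp, intro] = subspace_scale[OF V] and V_0 [simp] = subspace_0[OF V]

lemma e_add_right: "u \<in> V \<Longrightarrow> u' \<in> V \<Longrightarrow> v \<in> V \<Longrightarrow> e v (u + u') = e v u + e v u'"
  using e_sym e_add by (metis V_add)

lemma e_scale_right: "u \<in> V \<Longrightarrow> v \<in> V \<Longrightarrow> e v (c *\<^sub>R u) = c * e v u"
  using e_sym e_scale by (metis V_scale)

lemma e_diff: "u \<in> V \<Longrightarrow> u' \<in> V \<Longrightarrow> v \<in> V \<Longrightarrow> e (u - u') v = e u v - e u' v"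
  using e_add[of u "- 1 *\<^sub>R u'" v] e_scale[of u' v "- 1"] V_scale[of u' "- 1"] by simp

lemma e_diff_right: "u \<in> V \<Longrightarrow> u' \<in> V \<Longrightarrow> v \<in> V \<Longrightarrow> e v (u - u') = e v u - e v u'"
  using e_sym e_diff by (metis V_diff)

lemmas e_simps = e_add e_add_right e_scale e_scale_right e_diff e_diff_right

lemma e_nonneg: "v \<in> V \<Longrightarrow> 0 \<le> e v v"
  using coercive[of v] \<mu>_pos by (meson less_imp_le mult_nonneg_nonneg order_trans zero_le_power2)

lemma e_Cauchy_Schwarz_square: 
  assumes "u \<in> V" "v \<in> V" shows "(e u v)\<^sup>2 \<le> e u u * e v v"
proof -
  have nn: "0 \<le> e v v * (e u u * e v v - (e u v)\<^sup>2)"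
  proof -
    have "0 \<le> e (e v v *\<^sub>R u - e u v *\<^sub>R v) (e v v *\<^sub>R u - e u v *\<^sub>R v)"
      using assms by (intro e_nonneg) auto
    also have "\<dots> = e v v * (e u u * e v v - (e u v)\<^sup>2)"
      using assms e_sym[of v u] by (simp add: e_simps power2_eq_square algebra_simps)
    finally show ?thesis .
  qed
  show ?thesis
  proof (cases "e v v = 0")
    case True
    have "\<mu> * (norm v)\<^sup>2 \<le> 0" using coercive[OF assms(2)] True by simp
    then have "v = 0" using \<mu>_pos by (simp add: mult_le_0_iff)
    then have "e u v = 0" using e_scale_right[of u u 0] assms e_scale_right[of v u 0] by simp
    then show ?thesis using True by simp
  next
    case False
    then have "0 < e v v" using e_nonneg[OF assms(2)] by simp
    then show ?thesis using nn by (simp add: zero_le_mult_iff)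
  qed
qed

lemma e_Cauchy_Schwarz: 
  assumes "u \<in> V" "v \<in> V" shows "\<bar>e u v\<bar> \<le> sqrt (e u u) * sqrt (e v v)"
  using real_sqrt_le_mono[OF e_Cauchy_Schwarz_square[OF assms]] by (simp add: real_sqrt_mult)

lemma e_tendsto:
  assumes x: "\<And>i. x i \<in> V" and r: "r \<in> V" and v: "v \<in> V" and lim: "((\<lambda>i. e (x i - r) (x i - r)) \<longlongrightarrow> 0) F"
  shows "((\<lambda>i. e (x i) v) \<longlongrightarrow> e r v) F" "(x \<longlongrightarrow> r) F"
proof -
  have "((\<lambda>i. sqrt (e (x i - r) (x i - r)) * sqrt (e v v)) \<longlongrightarrow> 0) F"
    using tendsto_mult_left_zero[OF tendsto_real_sqrt[OF lim, simplified]] by simp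
  then have "((\<lambda>i. e (x i) v - e r v) \<longlongrightarrow> 0) F"
    by (rule Lim_null_comparison[rotated])
       (use e_Cauchy_Schwarz x r v in \<open>auto simp: e_diff[symmetric]\<close>)
  then show "((\<lambda>i. e (x i) v) \<longlongrightarrow> e r v) F" by (rule LIM_zero_cancel)
  have "((\<lambda>i. sqrt (e (x i - r) (x i - r) / \<mu>)) \<longlongrightarrow> 0) F"
    using tendsto_real_sqrt[OF tendsto_divide[OF lim tendsto_const[of \<mu>]]] \<mu>_pos by simp
  then have "((\<lambda>i. x i - r) \<longlongrightarrow> 0) F"
    by (rule Lim_null_comparison[rotated])
       (use coercive x r \<mu>_pos in \<open>auto intro!: always_eventually real_le_rsqrt simp: field_simps\<close>)
  then show "(x \<longlongrightarrow> r) F" by (rule LIM_zero_cancel)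
qed

text \<open>
  A minimizing sequence of \<open>e v v - 2 \<langle>h, v\<rangle>\<close> is a Cauchy sequence by the parallelogram law, and
  its limit represents \<open>h\<close>.
\<close>

lemma Riesz: "\<exists>r\<in>V. \<forall>v\<in>V. e r v = inner h v"
proof -
  define J where "J v = e v v - 2 * inner h v" for v
  have J_low: "- (norm h)\<^sup>2 / \<mu> \<le> J v" if "v \<in> V" for v
  proof -
    have "0 \<le> \<mu> * (norm v - norm h / \<mu>)\<^sup>2" using \<mu>_pos by simp
    also have "\<dots> = \<mu> * (norm v)\<^sup>2 - 2 * norm h * norm v + (norm h)\<^sup>2 / \<mu>"
      using \<mu>_pos by (simp add: power2_diff power2_eq_square field_simps)
    also have "\<dots> \<le> J v + (norm h)\<^sup>2 / \<mu>"
      using coercive[OF that] norm_cauchy_schwarz[of h v] by (simp add: J_def)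
    finally show ?thesis by simp
  qed
  define m where "m = Inf (J ` V)"
  have bdd: "bdd_below (J ` V)" using J_low by (meson bdd_belowI2)
  have m_le: "m \<le> J v" if "v \<in> V" for v
    unfolding m_def using that bdd by (intro cInf_lower) auto
  define \<delta> where "\<delta> n = inverse (real (Suc n))" for n
  have \<delta>: "0 < \<delta> n" for n by (simp add: \<delta>_def)
  have \<delta>0: "\<delta> \<longlonglongrightarrow> 0" unfolding \<delta>_def by (rule LIMSEQ_inverse_real_of_nat)
  have "\<exists>x\<in>V. J x < m + \<delta> n" for n
  proof -
    have "J ` V \<noteq> {}" using V_0 by blast
    then show ?thesis using cInf_lessD[of "J ` V" "m + \<delta> n"] \<delta>[of n] unfolding m_def by auto
  qed
  then obtain x where x: "\<And>n. x n \<in> V" "\<And>n. J (x n) < m + \<delta> n" by metis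
  have par: "e (x i - x j) (x i - x j) \<le> 2 * \<delta> i + 2 * \<delta> j" for i j
  proof -
    have "e (x i - x j) (x i - x j) = 2 * J (x i) + 2 * J (x j) - 4 * J ((1/2) *\<^sub>R (x i + x j))"
      using x(1)[of i] x(1)[of j] by (simp add: J_def e_simps inner_add_right inner_scaleR_right algebra_simps)
    moreover have "m \<le> J ((1/2) *\<^sub>R (x i + x j))" using x(1) by (intro m_le) auto
    ultimately show ?thesis using x(2)[of i] x(2)[of j] by linarith
  qed
  have "\<exists>r\<in>V. (\<lambda>n. e (x n - r) (x n - r)) \<longlonglongrightarrow> 0"
  proof (rule complete[OF x(1)])
    fix \<epsilon> :: real assume "0 < \<epsilon>"
    then obtain N where N: "\<And>n. N \<le> n \<Longrightarrow> \<delta> n < \<epsilon> / 4"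
      using order_tendstoD(2)[OF \<delta>0, of "\<epsilon> / 4"] by (auto simp: eventually_sequentially)
    show "\<exists>N. \<forall>i\<ge>N. \<forall>j\<ge>N. e (x i - x j) (x i - x j) < \<epsilon>"
    proof (intro exI[of _ N] allI impI)
      fix i j assume "N \<le> i" "N \<le> j"
      then show "e (x i - x j) (x i - x j) < \<epsilon>" using par[of i j] N[of i] N[of j] by linarith
    qed
  qed
  then obtain r where r: "r \<in> V" "(\<lambda>n. e (x n - r) (x n - r)) \<longlonglongrightarrow> 0" by blast
  have "e r v = inner h v" if v: "v \<in> V" for v
  proof -
    have sq: "(e (x n) v - inner h v)\<^sup>2 \<le> \<delta> n * (e v v + 1)" for n
    proof -
      define d where "d = e (x n) v - inner h v"
      have pos: "0 < e v v + 1" using e_nonneg[OF v] by simp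
      \<comment> \<open>The minimizer of the quadratic in \<open>t\<close> below; adding \<open>1\<close> avoids a case distinction on \<open>v = 0\<close>.\<close>
      define t where "t = - d / (e v v + 1)"
      have "m \<le> J (x n + t *\<^sub>R v)" using x(1) v by (intro m_le) auto
      also have "\<dots> = J (x n) + 2 * t * d + t\<^sup>2 * e v v"
        using x(1)[of n] v e_sym[of v "x n"] by (simp add: J_def d_def e_simps inner_add_right power2_eq_square algebra_simps)
      also have "\<dots> \<le> J (x n) + 2 * t * d + t\<^sup>2 * (e v v + 1)"
        by (intro add_left_mono mult_left_mono) auto
      finally have low: "m \<le> J (x n) + 2 * t * d + t\<^sup>2 * (e v v + 1)" .
      have "2 * t * d + t\<^sup>2 * (e v v + 1) = - d\<^sup>2 / (e v v + 1)"
      proof -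
        have "t * (e v v + 1) = - d" using pos by (simp add: t_def)
        then have "t\<^sup>2 * (e v v + 1) = t * (- d)" by (simp add: power2_eq_square mult.assoc)
        then have "2 * t * d + t\<^sup>2 * (e v v + 1) = t * d" by simp
        also have "\<dots> = - d\<^sup>2 / (e v v + 1)" by (simp add: t_def power2_eq_square)
        finally show ?thesis .
      qed
      then have "d\<^sup>2 / (e v v + 1) < \<delta> n" using low x(2)[of n] by linarith
      then show ?thesis using pos by (simp add: d_def field_simps)
    qed
    have "(\<lambda>n. (e (x n) v - inner h v)\<^sup>2) \<longlonglongrightarrow> (e r v - inner h v)\<^sup>2"
      by (intro tendsto_intros e_tendsto x r v)
    moreover have "(\<lambda>n. \<delta> n * (e v v + 1)) \<longlonglongrightarrow> 0"
      by (rule tendsto_mult_left_zero[OF \<delta>0])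
    ultimately have "(e r v - inner h v)\<^sup>2 \<le> 0"
      using sq by (intro LIMSEQ_le[of _ _ "\<lambda>n. \<delta> n * (e v v + 1)"]) auto
    then show ?thesis by simp
  qed
  then show ?thesis using r by blast
qed

definition Rz :: "'a \<Rightarrow> 'a" where "Rz h = (SOME r. r \<in> V \<and> (\<forall>v\<in>V. e r v = inner h v))"

lemma Rz: "Rz h \<in> V" "v \<in> V \<Longrightarrow> e (Rz h) v = inner h v"
  using someI_ex[of "\<lambda>r. r \<in> V \<and> (\<forall>v\<in>V. e r v = inner h v)"] Riesz[of h] unfolding Rz_def by blast+

lemma Rz_unique:
  assumes r: "r \<in> V" and "\<And>v. v \<in> V \<Longrightarrow> e r v = inner h v" shows "r = Rz h"
proof -
  have "e (r - Rz h) (r - Rz h) = 0" using assms Rz(1)[of h] Rz(2)[of "r - Rz h" h] by (simp add: e_diff)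
  then have "\<mu> * (norm (r - Rz h))\<^sup>2 \<le> 0" using coercive[of "r - Rz h"] r Rz(1) by simp
  then show ?thesis using \<mu>_pos by (simp add: mult_le_0_iff)
qed

definition K\<^sub>V :: "'a \<Rightarrow> 'a" where "K\<^sub>V h = \<mu> *\<^sub>R Rz h"

sublocale coercive_inverse K\<^sub>V \<mu>
proof (intro coercive_inverse.intro positive_contraction.intro coercive_inverse_axioms.intro)
  have add: "Rz (x + y) = Rz x + Rz y" for x y
    by (rule Rz_unique[symmetric]) (use Rz in \<open>simp_all add: e_simps inner_add_left\<close>)
  have scale: "Rz (c *\<^sub>R x) = c *\<^sub>R Rz x" for x c
    by (rule Rz_unique[symmetric]) (use Rz in \<open>simp_all add: e_simps\<close>)
  show "linear K\<^sub>V" by (intro linearI) (simp_all add: K\<^sub>V_def add scale algebra_simps)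
  show "inner (K\<^sub>V x) y = inner x (K\<^sub>V y)" for x y
    using Rz(2)[of "Rz x" y] Rz(2)[of "Rz y" x] e_sym[of "Rz x" "Rz y"] Rz(1) by (simp add: K\<^sub>V_def inner_commute)
  have ip: "inner x (Rz x) = e (Rz x) (Rz x)" for x using Rz by simp
  show "0 \<le> inner (K\<^sub>V x) x" for x
    using ip[of x] e_nonneg[OF Rz(1)[of x]] \<mu>_pos by (simp add: K\<^sub>V_def inner_commute)
  show "inner (K\<^sub>V x) x \<le> inner x x" for x
  proof -
    have "\<mu> * (norm (Rz x))\<^sup>2 \<le> norm x * norm (Rz x)"
      using coercive[OF Rz(1)[of x]] ip[of x] norm_cauchy_schwarz[of x "Rz x"] by linarith
    then have "\<mu> * norm (Rz x) \<le> norm x"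
      by (cases "Rz x = 0") (simp_all add: power2_eq_square mult.assoc[symmetric])
    have "inner (K\<^sub>V x) x = \<mu> * inner x (Rz x)" by (simp add: K\<^sub>V_def inner_commute)
    also have "\<dots> \<le> \<mu> * (norm x * norm (Rz x))" using \<mu>_pos norm_cauchy_schwarz by (intro mult_left_mono) auto
    also have "\<dots> = norm x * (\<mu> * norm (Rz x))" by simp
    also have "\<dots> \<le> norm x * norm x" by (intro mult_left_mono \<open>\<mu> * norm (Rz x) \<le> norm x\<close>) simp
    finally show ?thesis by (simp add: dot_square_norm power2_eq_square)
  qed
  show "0 < \<mu>" by (rule \<mu>_pos)
  show "x = 0" if "K\<^sub>V x = 0" for x
  proof (rule total)
    fix v assume "v \<in> V"
    have "Rz x = 0" using that \<mu>_pos by (simp add: K\<^sub>V_def)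
    then show "inner x v = 0" using Rz(2)[OF \<open>v \<in> V\<close>, of x] e_scale[of v v 0] \<open>v \<in> V\<close> by simp
  qed
qed

lemma R_eq_Rz: "R x = Rz x"
  using \<mu>_pos by (simp add: R_def K\<^sub>V_def)

lemma R_V [simp]: "R x \<in> V" and e_R: "v \<in> V \<Longrightarrow> e (R x) v = inner x v"
  by (simp_all add: R_eq_Rz Rz)

lemma S_V: "0 < t \<Longrightarrow> S t x \<in> V"
  using R_G[of t x] R_V[of "G t x"] by simp

lemma e_S: "0 < t \<Longrightarrow> v \<in> V \<Longrightarrow> e (S t x) v = inner (G t x) v"
  using e_R[of v "G t x"] by (simp add: R_G)

lemma inner_G_S: "0 < s \<Longrightarrow> 0 \<le> t \<Longrightarrow> inner (G s x) (S t x) = inner (G (s + t) x) x"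
  using S_sym[of t "G s x" x] G_add(2)[of s t x] by simp

text \<open>
  \<open>\<phi> t = \<langle>G t g, g\<rangle>\<close> is \<open>e (S t g) g\<close>, and \<open>e (S t g) (S t g) = \<phi> (2 t) \<le> \<phi> t\<close>; the claim is then
  the Cauchy-Schwarz inequality for \<open>e\<close>.
\<close>

lemma G_energy_le:
  assumes g: "g \<in> V" and t: "0 < t"
  shows "inner (G t g) g \<le> e g g"
proof -
  let ?\<phi> = "inner (G t g) g"
  have 0: "0 \<le> ?\<phi>" using G_decreasing(2) t by blast
  have "?\<phi> = e (S t g) g" using e_S[OF t g] by simp
  then have "?\<phi>\<^sup>2 \<le> e (S t g) (S t g) * e g g"
    using e_Cauchy_Schwarz_square[OF S_V[OF t] g, of g] by simp
  also have "e (S t g) (S t g) = inner (G (t + t) g) g"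
    using e_S[OF t S_V[OF t]] inner_G_S[of t t g] t by simp
  also have "inner (G (t + t) g) g * e g g \<le> ?\<phi> * e g g"
    using t e_nonneg[OF g] by (intro mult_right_mono G_decreasing) auto
  finally show ?thesis using 0 e_nonneg[OF g] by (cases "?\<phi> = 0") (auto simp: power2_eq_square mult_le_cancel_left)
qed

text \<open>
  All energies of differences of \<open>S t g\<close> are expressed by the bounded monotone function
  \<open>\<phi> t = \<langle>G t g, g\<rangle>\<close>, so \<open>S t g\<close> is a Cauchy family for \<open>e\<close> as \<open>t \<rightarrow> 0\<close>; its limit can only be \<open>g\<close>.
\<close>

lemma S_tendsto_V:
  assumes g: "g \<in> V"
  shows "((\<lambda>t. e (S t g - g) (S t g - g)) \<longlongrightarrow> 0) (at_right 0)"
proof -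
  define \<phi> where "\<phi> t = inner (G t g) g" for t
  have \<phi>_le: "\<phi> t \<le> e g g" if "0 < t" for t using G_energy_le[OF g that] by (simp add: \<phi>_def)
  have \<phi>_dec: "\<phi> t \<le> \<phi> s" if "0 < s" "s \<le> t" for s t using G_decreasing that by (simp add: \<phi>_def)
  have eSS: "e (S s g) (S t g) = \<phi> (s + t)" if "0 < s" "0 < t" for s t
    using e_S[OF that(1) S_V[OF that(2)]] inner_G_S[of s t g] that by (simp add: \<phi>_def)
  have eSg: "e (S s g) g = \<phi> s" if "0 < s" for s using e_S[OF that g] by (simp add: \<phi>_def)
  have diff: "e (S s g - S t g) (S s g - S t g) = \<phi> (s + s) + \<phi> (t + t) - 2 * \<phi> (s + t)" if "0 < s" "0 < t" for s t
    using that S_V e_sym[of "S s g" "S t g"] by (simp add: e_simps eSS add.commute)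
  define \<delta> where "\<delta> n = inverse (real (Suc n))" for n
  have \<delta>: "0 < \<delta> n" for n by (simp add: \<delta>_def)
  have \<delta>0: "\<delta> \<longlonglongrightarrow> 0" unfolding \<delta>_def by (rule LIMSEQ_inverse_real_of_nat)
  have "\<exists>l. (\<lambda>n. \<phi> (2 * \<delta> n)) \<longlonglongrightarrow> l"
  proof (rule incseq_convergent)
    show "incseq (\<lambda>n. \<phi> (2 * \<delta> n))"
      by (intro incseq_SucI \<phi>_dec) (auto simp: \<delta>_def field_simps)
    show "\<forall>n. \<phi> (2 * \<delta> n) \<le> e g g" using \<phi>_le \<delta> by simp
  qed metis
  then obtain l where l: "(\<lambda>n. \<phi> (2 * \<delta> n)) \<longlonglongrightarrow> l" by blast
  have \<phi>l: "\<phi> t \<le> l" if "0 < t" for t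
  proof (rule tendsto_lowerbound[OF l])
    show "\<forall>\<^sub>F n in sequentially. \<phi> t \<le> \<phi> (2 * \<delta> n)"
      using order_tendstoD(2)[OF \<delta>0, of "t / 2"] that by (auto elim!: eventually_mono intro!: \<phi>_dec mult_pos_pos \<delta>)
  qed simp
  have "\<exists>y\<in>V. (\<lambda>n. e (S (\<delta> n) g - y) (S (\<delta> n) g - y)) \<longlonglongrightarrow> 0"
  proof (rule complete)
    show "S (\<delta> n) g \<in> V" for n using S_V \<delta> by blast
    fix \<epsilon> :: real assume "0 < \<epsilon>"
    then obtain N where N: "l - \<epsilon> / 2 < \<phi> (2 * \<delta> N)"
      using order_tendstoD(1)[OF l, of "l - \<epsilon> / 2"] by (auto simp: eventually_sequentially)
    have "e (S (\<delta> i) g - S (\<delta> j) g) (S (\<delta> i) g - S (\<delta> j) g) < \<epsilon>" if "N \<le> i" "N \<le> j" for i j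
    proof -
      have "\<delta> i \<le> \<delta> N" "\<delta> j \<le> \<delta> N" using that by (auto simp: \<delta>_def field_simps)
      then have "\<phi> (2 * \<delta> N) \<le> \<phi> (\<delta> i + \<delta> j)" using \<delta>[of i] \<delta>[of j] by (intro \<phi>_dec) auto
      then show ?thesis using diff[of "\<delta> i" "\<delta> j"] \<delta> \<phi>l[of "\<delta> i + \<delta> i"] \<phi>l[of "\<delta> j + \<delta> j"] N
        by (simp add: add_pos_pos)
    qed
    then show "\<exists>N. \<forall>i\<ge>N. \<forall>j\<ge>N. e (S (\<delta> i) g - S (\<delta> j) g) (S (\<delta> i) g - S (\<delta> j) g) < \<epsilon>" by blast
  qed
  then obtain y where y: "y \<in> V" "(\<lambda>n. e (S (\<delta> n) g - y) (S (\<delta> n) g - y)) \<longlonglongrightarrow> 0" by blast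
  have "(\<lambda>n. S (\<delta> n) g) \<longlonglongrightarrow> y"
    by (rule e_tendsto(2)[OF _ y(1) y(1) y(2)]) (use S_V \<delta> in blast)
  moreover have "(\<lambda>n. S (\<delta> n) g) \<longlonglongrightarrow> g"
    by (rule S_joint_tendsto[OF \<delta>0]) (use \<delta> in \<open>auto intro!: always_eventually less_imp_le\<close>)
  ultimately have "y = g" using LIMSEQ_unique by blast
  then have "(\<lambda>n. e (S (\<delta> n) g) g) \<longlonglongrightarrow> e g g"
    using y S_V \<delta> by (intro e_tendsto(1)) auto
  then have \<phi>g: "(\<lambda>n. \<phi> (\<delta> n)) \<longlonglongrightarrow> e g g" using eSg \<delta> by simp
  have lim: "(\<phi> \<longlongrightarrow> e g g) (at_right 0)"
  proof (rule order_tendstoI)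
    fix a assume "a < e g g"
    then obtain n where n: "a < \<phi> (\<delta> n)"
      using order_tendstoD(1)[OF \<phi>g] by (auto simp: eventually_sequentially)
    have "\<forall>\<^sub>F t in at_right 0. t \<in> {0<..<\<delta> n}" by (rule eventually_at_right_real[OF \<delta>])
    then show "\<forall>\<^sub>F t in at_right 0. a < \<phi> t"
    proof eventually_elim
      case (elim t)
      then show ?case using n \<phi>_dec[of t "\<delta> n"] by auto
    qed
  next
    fix a assume a: "e g g < a"
    show "\<forall>\<^sub>F t in at_right 0. \<phi> t < a"
      by (rule eventually_mono[OF eventually_at_right_less[of 0]]) (use \<phi>_le a in force)
  qed
  have lim2: "((\<lambda>t. \<phi> (2 * t)) \<longlongrightarrow> e g g) (at_right 0)"
  proof (rule filterlim_compose[OF lim])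
    show "filterlim (\<lambda>t::real. 2 * t) (at_right 0) (at_right 0)"
      by (auto simp: filterlim_at intro!: tendsto_eq_intros eventually_mono[OF eventually_at_right_less[of 0]])
  qed
  have "((\<lambda>t. \<phi> (2 * t) - 2 * \<phi> t + e g g) \<longlongrightarrow> 0) (at_right 0)"
    by (rule tendsto_eq_intros lim lim2 | simp)+
  then show ?thesis
  proof (rule Lim_transform_eventually)
    show "\<forall>\<^sub>F t in at_right 0. \<phi> (2 * t) - 2 * \<phi> t + e g g = e (S t g - g) (S t g - g)"
    proof (rule eventually_mono[OF eventually_at_right_less[of 0]])
      fix t :: real assume t: "0 < t"
      show "\<phi> (2 * t) - 2 * \<phi> t + e g g = e (S t g - g) (S t g - g)"
        using t g S_V[OF t, of g] e_sym[of g "S t g"] eSS[OF t t] eSg[OF t] by (simp add: e_simps)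
    qed
  qed
qed

text \<open>
  The strong solution of \<open>strong_solution_exists\<close> is continuous in energy at positive times
  since \<open>e (u s - u t) (u s - u t) = \<langle>W s - W t, u s - u t\<rangle>\<close>, and at \<open>0\<close> since \<open>u t - S t g\<close> has energy
  at most \<open>B \<parallel>u t - S t g\<parallel>\<close>. The energy of \<open>u\<close> has derivative \<open>2 \<langle>W, F u - W\<rangle>\<close>, which is not
  positive because \<open>\<parallel>F u\<parallel> \<le> \<eta> \<parallel>u\<parallel> \<le> (\<eta> / \<mu>) \<parallel>W\<parallel>\<close>.
\<close>

theorem semilinear_global_solution:
  assumes lip: "\<And>x y. norm (F x - F y) \<le> \<eta> * norm (x - y)" and \<eta>: "0 \<le> \<eta>" "\<eta> < \<mu>" and F0: "F 0 = 0"
    and g: "g \<in> V"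
  shows "\<exists>u. u 0 = g \<and> (\<forall>t\<ge>0. u t \<in> V \<and> e (u t) (u t) \<le> e g g \<and>
      ((\<lambda>s. e (u s - u t) (u s - u t)) \<longlongrightarrow> 0) (at t within {0..})) \<and>
    (\<forall>t>0. \<exists>h. (\<forall>v\<in>V. e (u t) v = inner h v) \<and> (u has_vector_derivative (F (u t) - h)) (at t))"
proof -
  obtain u W B where u0: "u 0 = g" and uc: "continuous_on {0..} u" and Wc: "continuous_on {0<..} W"
    and RW: "\<And>t. 0 < t \<Longrightarrow> R (W t) = u t"
    and du: "\<And>t. 0 < t \<Longrightarrow> (u has_vector_derivative (F (u t) - W t)) (at t)"
    and B: "\<And>t. t \<in> {0<..1} \<Longrightarrow> norm (W t - G t g) \<le> B"
    using strong_solution_exists[OF lip \<eta> F0 G_energy_le[OF g]] by blast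
  have uV: "u t \<in> V" if "0 \<le> t" for t
    using RW[of t] R_V[of "W t"] u0 g that by (cases "t = 0") auto
  have eu: "e (u t) v = inner (W t) v" if "0 < t" "v \<in> V" for t v
    using e_R[OF that(2), of "W t"] RW[OF that(1)] by simp
  have diff: "e (u s - u t) (u s - u t) = inner (W s - W t) (u s - u t)" if "0 < s" "0 < t" for s t
    using that uV by (simp add: e_diff eu inner_diff_left)
  have cont_pos: "((\<lambda>s. e (u s - u t) (u s - u t)) \<longlongrightarrow> 0) (at t)" if t: "0 < t" for t
  proof (rule Lim_transform_eventually)
    have "isCont W t" "isCont u t"
      using Wc t has_vector_derivative_continuous[OF du[OF t]] by (auto simp: continuous_on_eq_continuous_at)
    then have "((\<lambda>s. inner (W s - W t) (u s - u t)) \<longlongrightarrow> inner (W t - W t) (u t - u t)) (at t)"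
      by (intro tendsto_intros) (auto simp: isCont_def)
    then show "((\<lambda>s. inner (W s - W t) (u s - u t)) \<longlongrightarrow> 0) (at t)" by simp
    show "\<forall>\<^sub>F s in at t. inner (W s - W t) (u s - u t) = e (u s - u t) (u s - u t)"
      using eventually_at_in_open'[of "{0<..}" t] t diff by (auto elim!: eventually_mono)
  qed
  have cont_0: "((\<lambda>s. e (u s - g) (u s - g)) \<longlongrightarrow> 0) (at_right 0)"
  proof -
    define d where "d s = u s - S s g" for s
    have d0: "(d \<longlongrightarrow> 0) (at_right 0)"
    proof -
      have "(u \<longlongrightarrow> g) (at_right 0)"
        using uc[unfolded continuous_on_def, rule_format, of 0] u0 by (simp add: at_within_Ici_at_right)
      then show ?thesis using tendsto_diff[OF _ S_tendsto_0[of g], of u g] by (simp add: d_def[abs_def])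
    qed
    have "((\<lambda>s. e (d s) (d s)) \<longlongrightarrow> 0) (at_right 0)"
    proof (rule Lim_null_comparison)
      show "((\<lambda>s. B * norm (d s)) \<longlongrightarrow> 0) (at_right 0)"
        using tendsto_mult_right_zero[OF tendsto_norm_zero[OF d0]] .
      have "\<forall>\<^sub>F s in at_right 0. s \<in> {0<..<1::real}" by (rule eventually_at_right_real) simp
      then show "\<forall>\<^sub>F s in at_right 0. norm (e (d s) (d s)) \<le> B * norm (d s)"
      proof eventually_elim
        case (elim s)
        then have s: "0 < s" "s \<in> {0<..1}" by auto
        have dV: "d s \<in> V" using uV S_V s by (simp add: d_def)
        have "e (d s) (d s) = inner (W s - G s g) (d s)"
          using s dV uV[of s] S_V[of s g] eu[OF s(1) dV] e_S[OF s(1) dV] 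
          by (simp add: d_def e_diff inner_diff_left)
        also have "\<dots> \<le> norm (W s - G s g) * norm (d s)" by (rule norm_cauchy_schwarz)
        also have "\<dots> \<le> B * norm (d s)" by (intro mult_right_mono B s) auto
        finally show ?case using e_nonneg[OF dV] by simp
      qed
    qed
    then have *: "((\<lambda>s. 2 * e (d s) (d s) + 2 * e (S s g - g) (S s g - g)) \<longlongrightarrow> 2 * 0 + 2 * 0) (at_right 0)"
      by (intro tendsto_intros S_tendsto_V g)
    show ?thesis
    proof (rule Lim_null_comparison)
      show "((\<lambda>s. 2 * e (d s) (d s) + 2 * e (S s g - g) (S s g - g)) \<longlongrightarrow> 0) (at_right 0)" using * by simp
      show "\<forall>\<^sub>F s in at_right 0. norm (e (u s - g) (u s - g)) \<le> 2 * e (d s) (d s) + 2 * e (S s g - g) (S s g - g)"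
      proof (rule eventually_mono[OF eventually_at_right_less[of 0]])
        fix s :: real assume s: "0 < s"
        define a b where "a = d s" and "b = S s g - g"
        have ab: "a \<in> V" "b \<in> V" using uV S_V s g by (auto simp: a_def b_def d_def)
        have "0 \<le> e (a - b) (a - b)" using ab by (intro e_nonneg) auto
        then have "e (a + b) (a + b) \<le> 2 * e a a + 2 * e b b"
          using ab by (simp add: e_simps)
        moreover have "u s - g = a + b" by (simp add: a_def b_def d_def)
        moreover have "0 \<le> e (a + b) (a + b)" using ab by (intro e_nonneg) auto
        ultimately show "norm (e (u s - g) (u s - g)) \<le> 2 * e (d s) (d s) + 2 * e (S s g - g) (S s g - g)"
          unfolding a_def[symmetric] b_def[symmetric] by simp
      qed
    qed
  qed
  have energy_deriv: "((\<lambda>s. e (u s) (u s)) has_real_derivative 2 * inner (W t) (F (u t) - W t)) (at t)" if t: "0 < t" for t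
  proof -
    have "((\<lambda>s. (u s - u t) /\<^sub>R (s - t)) \<longlongrightarrow> F (u t) - W t) (at t)"
      by (rule vector_difference_quotient_tendsto[OF du[OF t]])
    moreover have "(W \<longlongrightarrow> W t) (at t)"
      using Wc t by (auto simp: continuous_on_eq_continuous_at isCont_def)
    ultimately have "((\<lambda>s. inner (W s + W t) ((u s - u t) /\<^sub>R (s - t))) \<longlongrightarrow> inner (W t + W t) (F (u t) - W t)) (at t)"
      by (intro tendsto_intros)
    then have "((\<lambda>s. (e (u s) (u s) - e (u t) (u t)) / (s - t)) \<longlongrightarrow> inner (W t + W t) (F (u t) - W t)) (at t)"
    proof (rule Lim_transform_eventually)
      have "inner (W s + W t) ((u s - u t) /\<^sub>R (s - t)) = (e (u s) (u s) - e (u t) (u t)) / (s - t)" if s: "0 < s" for s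
        using s t uV[of s] uV[of t] eu[of s "u t"] eu[of t "u s"] e_sym[of "u s" "u t"] eu[of s "u s"] eu[of t "u t"]
        by (simp add: inner_add_left inner_diff_right divide_inverse algebra_simps)
      then show "\<forall>\<^sub>F s in at t. inner (W s + W t) ((u s - u t) /\<^sub>R (s - t)) = (e (u s) (u s) - e (u t) (u t)) / (s - t)"
        using eventually_at_in_open'[of "{0<..}" t] t by (auto elim!: eventually_mono)
    qed
    then show ?thesis by (simp add: has_field_derivative_iff inner_add_left)
  qed
  have energy_nonpos: "2 * inner (W t) (F (u t) - W t) \<le> 0" if t: "0 < t" for t
  proof -
    have "norm (F (u t)) \<le> \<eta> * norm (u t)" using lip[of "u t" 0] F0 by simp
    also have "\<dots> \<le> \<eta> * (norm (W t) / \<mu>)" using norm_R_le[of "W t"] RW[OF t] \<eta> by (intro mult_left_mono) auto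
    also have "\<dots> \<le> norm (W t)" using \<eta> \<mu>_pos mult_right_mono[of \<eta> \<mu> "norm (W t)"] by (simp add: field_simps)
    finally have "norm (W t) * norm (F (u t)) \<le> norm (W t) * norm (W t)" by (intro mult_left_mono) auto
    moreover have "inner (W t) (F (u t)) \<le> norm (W t) * norm (F (u t))" by (rule norm_cauchy_schwarz)
    ultimately show ?thesis by (simp add: inner_diff_right dot_square_norm power2_eq_square)
  qed
  have energy_dec: "e (u t) (u t) \<le> e (u s) (u s)" if "0 < s" "s \<le> t" for s t
  proof (rule DERIV_nonpos_imp_nonincreasing[OF that(2)])
    fix r assume "s \<le> r" "r \<le> t"
    then have "0 < r" using that by simp
    then show "\<exists>y. ((\<lambda>s. e (u s) (u s)) has_real_derivative y) (at r) \<and> y \<le> 0"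
      using energy_deriv energy_nonpos by blast
  qed
  have energy: "e (u t) (u t) \<le> e g g" if t: "0 < t" for t
  proof (rule tendsto_lowerbound)
    have lim: "((\<lambda>s. e (u (max 0 s) - g) (u (max 0 s) - g)) \<longlongrightarrow> 0) (at_right 0)"
      by (rule Lim_transform_eventually[OF cont_0]) (auto intro!: eventually_mono[OF eventually_at_right_less[of 0]])
    have "((\<lambda>s. e (u (max 0 s) - g) (u (max 0 s) - g) + 2 * e (u (max 0 s)) g - e g g) \<longlongrightarrow> 0 + 2 * e g g - e g g) (at_right 0)"
      by (intro tendsto_intros lim e_tendsto(1)[OF _ g g lim] uV) auto
    then show "((\<lambda>s. e (u (max 0 s) - g) (u (max 0 s) - g) + 2 * e (u (max 0 s)) g - e g g) \<longlongrightarrow> e g g) (at_right 0)" by simp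
    have "\<forall>\<^sub>F s in at_right 0. s \<in> {0<..<t}" by (rule eventually_at_right_real[OF t])
    then show "\<forall>\<^sub>F s in at_right 0. e (u t) (u t) \<le> e (u (max 0 s) - g) (u (max 0 s) - g) + 2 * e (u (max 0 s)) g - e g g"
    proof eventually_elim
      case (elim s)
      have "e (u s - g) (u s - g) + 2 * e (u s) g - e g g = e (u s) (u s)"
        using uV[of s] elim g e_sym[of g "u s"] by (simp add: e_simps)
      then show ?case using energy_dec[of s t] elim by simp
    qed
  qed simp
  show ?thesis
  proof (intro exI[of _ u] conjI allI impI)
    fix t :: real assume t: "0 \<le> t"
    show "u t \<in> V" using uV t by simp
    show "e (u t) (u t) \<le> e g g" using energy[of t] t u0 by (cases "t = 0") auto
    show "((\<lambda>s. e (u s - u t) (u s - u t)) \<longlongrightarrow> 0) (at t within {0..})"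
    proof (cases "t = 0")
      case True
      then show ?thesis using cont_0 u0 by (simp add: at_within_Ici_at_right)
    next
      case False
      then show ?thesis using cont_pos[of t] t by (auto intro: tendsto_within_subset)
    qed
  next
    fix t :: real assume t: "0 < t"
    show "\<exists>h. (\<forall>v\<in>V. e (u t) v = inner h v) \<and> (u has_vector_derivative (F (u t) - h)) (at t)"
      using eu du t by blast
  qed (rule u0)
qed

end

section \<open>The Hilbert space of square integrable functions\<close>

lemma L2_UNIV_iff: "f \<in> L2 UNIV \<longleftrightarrow> f \<in> borel_measurable borel \<and> integrable lborel (\<lambda>x. (f x)\<^sup>2)"
  by (simp add: L2_def set_borel_measurable_def set_integrable_def)

lemma L2_UNIV_measurable [measurable_dest]: "f \<in> L2 UNIV \<Longrightarrow> f \<in> borel_measurable borel"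
  and L2_UNIV_square: "f \<in> L2 UNIV \<Longrightarrow> integrable lborel (\<lambda>x. (f x)\<^sup>2)"
  by (simp_all add: L2_UNIV_iff)

lemma L2_UNIV_mult:
  assumes "f \<in> L2 UNIV" "g \<in> L2 UNIV"
  shows "integrable lborel (\<lambda>x. f x * g x)"
proof (rule Bochner_Integration.integrable_bound)
  show "integrable lborel (\<lambda>x. (f x)\<^sup>2 + (g x)\<^sup>2)"
    using assms by (simp add: L2_UNIV_iff)
  show "(\<lambda>x. f x * g x) \<in> borel_measurable lborel"
    using assms by (auto simp: L2_UNIV_iff intro!: borel_measurable_times)
  have "\<bar>a * b\<bar> \<le> a\<^sup>2 + b\<^sup>2" for a b :: real
  proof -
    have "2 * (\<bar>a\<bar> * \<bar>b\<bar>) \<le> a\<^sup>2 + b\<^sup>2" using sum_squares_bound[of "\<bar>a\<bar>" "\<bar>b\<bar>"] by simp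
    moreover have "0 \<le> \<bar>a\<bar> * \<bar>b\<bar>" by simp
    ultimately show ?thesis unfolding abs_mult by linarith
  qed
  then show "AE x in lborel. norm (f x * g x) \<le> norm ((f x)\<^sup>2 + (g x)\<^sup>2)"
    by (auto simp: abs_of_nonneg)
qed

lemma L2_UNIV_add: "f \<in> L2 UNIV \<Longrightarrow> g \<in> L2 UNIV \<Longrightarrow> (\<lambda>x. f x + g x) \<in> L2 UNIV"
  using L2_UNIV_mult[of f g] by (auto simp: L2_UNIV_iff power2_sum mult.assoc)

lemma L2_UNIV_cmult: "f \<in> L2 UNIV \<Longrightarrow> (\<lambda>x. c * f x) \<in> L2 UNIV"
  by (auto simp: L2_UNIV_iff power_mult_distrib)

lemma L2_UNIV_diff: "f \<in> L2 UNIV \<Longrightarrow> g \<in> L2 UNIV \<Longrightarrow> (\<lambda>x. f x - g x) \<in> L2 UNIV"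
  using L2_UNIV_add[of f "\<lambda>x. - 1 * g x"] L2_UNIV_cmult[of g "- 1"] by simp

lemma L2_UNIV_0: "(\<lambda>x. 0) \<in> L2 UNIV"
  by (simp add: L2_UNIV_iff)

lemma L2_UNIV_bound:
  assumes "g \<in> L2 UNIV" "f \<in> borel_measurable borel" "\<And>x. \<bar>f x\<bar> \<le> \<bar>g x\<bar>"
  shows "f \<in> L2 UNIV"
  unfolding L2_UNIV_iff
proof
  show "integrable lborel (\<lambda>x. (f x)\<^sup>2)"
    by (rule Bochner_Integration.integrable_bound[OF L2_UNIV_square[OF assms(1)]])
       (use assms(2,3) in \<open>auto simp: abs_le_square_iff\<close>)
qed fact

text \<open>
  Along a rapidly converging subsequence the differences \<open>\<Delta> k\<close> satisfy \<open>\<Sum> 2\<^sup>k \<integral>(\<Delta> k)\<^sup>2 < \<infinity>\<close>. Hence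
  \<open>\<bar>\<Delta> k x\<bar>\<close> decays like \<open>2\<^bsup>-k/2\<^esup>\<close> for almost every \<open>x\<close>, the subsequence converges there, and
  Fatou's lemma bounds the distance to the limit.
\<close>

lemma L2_complete:
  fixes f :: "nat \<Rightarrow> real \<Rightarrow> real"
  assumes f: "\<And>n. f n \<in> L2 UNIV"
    and Cauchy: "\<And>\<epsilon>. 0 < \<epsilon> \<Longrightarrow> \<exists>N. \<forall>m\<ge>N. \<forall>n\<ge>N. (LINT x|lborel. (f m x - f n x)\<^sup>2) < \<epsilon>"
  shows "\<exists>g\<in>L2 UNIV. (\<lambda>n. LINT x|lborel. (f n x - g x)\<^sup>2) \<longlonglongrightarrow> 0"
proof -
  have [measurable]: "f n \<in> borel_measurable borel" for n using f by (simp add: L2_UNIV_iff)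
  have sq: "integrable lborel (\<lambda>x. (f m x - f n x)\<^sup>2)" for m n
    by (rule L2_UNIV_square[OF L2_UNIV_diff[OF f f]])
  have nn: "(\<integral>\<^sup>+x. ennreal ((f m x - f n x)\<^sup>2) \<partial>lborel) = ennreal (LINT x|lborel. (f m x - f n x)\<^sup>2)" for m n
    by (rule nn_integral_eq_integral[OF sq]) simp
  have "\<exists>N. \<forall>m\<ge>N. \<forall>n\<ge>N. (LINT x|lborel. (f m x - f n x)\<^sup>2) < (1 / 4) ^ k" for k :: nat
    by (rule Cauchy) simp
  then obtain N where N: "\<And>k m n. N k \<le> m \<Longrightarrow> N k \<le> n \<Longrightarrow> (LINT x|lborel. (f m x - f n x)\<^sup>2) < (1 / 4) ^ k"
    by metis
  \<comment> \<open>The summand \<open>k\<close> makes \<open>r k\<close> tend to infinity; the sum makes it exceed all thresholds so far.\<close>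
  define r where "r k = k + (\<Sum>i\<le>k. N i)" for k
  have r: "N k \<le> r j" if "k \<le> j" for k j
    unfolding r_def by (rule trans_le_add2, rule member_le_sum) (use that in auto)
  define \<Delta> where "\<Delta> k x = f (r (Suc k)) x - f (r k) x" for k x
  have [measurable]: "\<Delta> k \<in> borel_measurable borel" for k unfolding \<Delta>_def[abs_def] by measurable
  have "(\<integral>\<^sup>+x. (\<Sum>k. ennreal (2 ^ k * (\<Delta> k x)\<^sup>2)) \<partial>lborel) = (\<Sum>k. \<integral>\<^sup>+x. ennreal (2 ^ k * (\<Delta> k x)\<^sup>2) \<partial>lborel)"
    by (rule nn_integral_suminf) simp
  also have "\<dots> \<le> (\<Sum>k. ennreal ((1 / 2) ^ k))"
  proof (rule suminf_le)
    fix k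
    have "(\<integral>\<^sup>+x. ennreal (2 ^ k * (\<Delta> k x)\<^sup>2) \<partial>lborel) = ennreal (2 ^ k) * (\<integral>\<^sup>+x. ennreal ((\<Delta> k x)\<^sup>2) \<partial>lborel)"
      by (subst nn_integral_cmult[symmetric]) (auto simp: ennreal_mult')
    also have "\<dots> = ennreal (2 ^ k * (LINT x|lborel. (\<Delta> k x)\<^sup>2))"
      unfolding \<Delta>_def nn by (simp add: ennreal_mult')
    also have "\<dots> \<le> ennreal (2 ^ k * (1 / 4) ^ k)"
      unfolding \<Delta>_def by (intro ennreal_leI mult_left_mono less_imp_le[OF N] r) auto
    also have "(2::real) ^ k * (1 / 4) ^ k = (1 / 2) ^ k" by (simp flip: power_mult_distrib)
    finally show "(\<integral>\<^sup>+x. ennreal (2 ^ k * (\<Delta> k x)\<^sup>2) \<partial>lborel) \<le> ennreal ((1 / 2) ^ k)" .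
  qed auto
  also have "\<dots> = ennreal (\<Sum>k. (1 / 2) ^ k)"
    by (rule suminf_ennreal2) (auto intro: summable_geometric)
  also have "\<dots> < \<infinity>" by simp
  finally have "AE x in lborel. (\<Sum>k. ennreal (2 ^ k * (\<Delta> k x)\<^sup>2)) \<noteq> \<infinity>"
    by (intro nn_integral_PInf_AE) auto
  \<comment> \<open>A summable sequence is bounded, which gives the geometric decay of \<open>\<Delta> k x\<close>.\<close>
  then have conv: "AE x in lborel. convergent (\<lambda>k. f (r k) x)"
  proof eventually_elim
    case (elim x)
    have s: "summable (\<lambda>k. 2 ^ k * (\<Delta> k x)\<^sup>2)"
      by (rule summable_suminf_not_top) (use elim in auto)
    then obtain C where C: "\<And>k. norm (2 ^ k * (\<Delta> k x)\<^sup>2) \<le> C"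
      using summable_imp_Bseq unfolding Bseq_def by blast
    have "summable (\<lambda>k. \<Delta> k x)"
    proof (rule summable_comparison_test'[where N=0])
      show "summable (\<lambda>k. sqrt C * sqrt (1 / 2) ^ k)"
        by (intro summable_mult summable_geometric) (simp add: real_sqrt_lt_1_iff)
      fix k
      have "(\<Delta> k x)\<^sup>2 \<le> C * (1 / 2) ^ k" using C[of k] by (simp add: field_simps power_divide)
      then have "sqrt ((\<Delta> k x)\<^sup>2) \<le> sqrt (C * (1 / 2) ^ k)" by (rule real_sqrt_le_mono)
      then show "norm (\<Delta> k x) \<le> sqrt C * sqrt (1 / 2) ^ k"
        unfolding real_sqrt_abs real_norm_def by (simp only: real_sqrt_mult real_sqrt_power)
    qed
    then have "convergent (\<lambda>n. f (r 0) x + (\<Sum>k<n. \<Delta> k x))"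
      by (simp add: summable_iff_convergent convergent_add_const_iff)
    moreover have "f (r 0) x + (\<Sum>k<n. \<Delta> k x) = f (r n) x" for n
      unfolding \<Delta>_def using sum_lessThan_telescope[of "\<lambda>k. f (r k) x" n] by simp
    ultimately show ?case by simp
  qed
  define g where "g x = lim (\<lambda>k. f (r k) x)" for x
  have [measurable]: "g \<in> borel_measurable borel"
    unfolding g_def[abs_def] by measurable
  have Fatou: "(\<integral>\<^sup>+x. ennreal ((f m x - g x)\<^sup>2) \<partial>lborel) \<le> ennreal \<epsilon>"
    if m: "\<And>k. k0 \<le> k \<Longrightarrow> (LINT x|lborel. (f m x - f (r k) x)\<^sup>2) \<le> \<epsilon>" for m \<epsilon> k0
  proof -
    have "(\<integral>\<^sup>+x. ennreal ((f m x - g x)\<^sup>2) \<partial>lborel) = (\<integral>\<^sup>+x. liminf (\<lambda>k. ennreal ((f m x - f (r k) x)\<^sup>2)) \<partial>lborel)"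
    proof (rule nn_integral_cong_AE)
      show "AE x in lborel. ennreal ((f m x - g x)\<^sup>2) = liminf (\<lambda>k. ennreal ((f m x - f (r k) x)\<^sup>2))"
        using conv
      proof eventually_elim
        case (elim x)
        then have "(\<lambda>k. f (r k) x) \<longlonglongrightarrow> g x" by (simp add: g_def convergent_LIMSEQ_iff)
        then have "(\<lambda>k. ennreal ((f m x - f (r k) x)\<^sup>2)) \<longlonglongrightarrow> ennreal ((f m x - g x)\<^sup>2)"
          by (intro tendsto_intros)
        then show ?case by (rule lim_imp_Liminf[OF sequentially_bot, symmetric])
      qed
    qed
    also have "\<dots> \<le> liminf (\<lambda>k. \<integral>\<^sup>+x. ennreal ((f m x - f (r k) x)\<^sup>2) \<partial>lborel)"
      by (rule nn_integral_liminf) simp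
    also have "\<dots> \<le> ennreal \<epsilon>"
    proof (rule Liminf_le)
      show "\<forall>\<^sub>F k in sequentially. (\<integral>\<^sup>+x. ennreal ((f m x - f (r k) x)\<^sup>2) \<partial>lborel) \<le> ennreal \<epsilon>"
        unfolding nn using m by (auto intro!: eventually_sequentiallyI[of k0] ennreal_leI)
    qed simp
    finally show ?thesis .
  qed
  have int: "integrable lborel (\<lambda>x. (f (r 0) x - g x)\<^sup>2)"
  proof (rule integrableI_nonneg)
    have "(\<integral>\<^sup>+x. ennreal ((f (r 0) x - g x)\<^sup>2) \<partial>lborel) \<le> ennreal 1"
    proof (rule Fatou[of 0])
      fix k :: nat
      show "(LINT x|lborel. (f (r 0) x - f (r k) x)\<^sup>2) \<le> 1"
        using N[of 0 "r 0" "r k"] r[of 0 0] r[of 0 k] by simp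
    qed
    then show "(\<integral>\<^sup>+x. ennreal ((f (r 0) x - g x)\<^sup>2) \<partial>lborel) < \<infinity>"
      by (simp add: order_le_less_trans)
  qed auto
  then have "(\<lambda>x. f (r 0) x - g x) \<in> L2 UNIV" by (simp add: L2_UNIV_iff)
  then have g: "g \<in> L2 UNIV"
    using L2_UNIV_diff[OF f[of "r 0"], of "\<lambda>x. f (r 0) x - g x"] by simp
  have "(\<lambda>n. LINT x|lborel. (f n x - g x)\<^sup>2) \<longlonglongrightarrow> 0"
  proof (rule LIMSEQ_I)
    fix \<epsilon> :: real assume \<epsilon>: "0 < \<epsilon>"
    obtain M where M: "\<And>m n. M \<le> m \<Longrightarrow> M \<le> n \<Longrightarrow> (LINT x|lborel. (f m x - f n x)\<^sup>2) < \<epsilon> / 2"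
      using Cauchy[of "\<epsilon> / 2"] \<epsilon> by auto
    have "norm ((LINT x|lborel. (f n x - g x)\<^sup>2) - 0) < \<epsilon>" if n: "M \<le> n" for n
    proof -
      have "ennreal (LINT x|lborel. (f n x - g x)\<^sup>2) = (\<integral>\<^sup>+x. ennreal ((f n x - g x)\<^sup>2) \<partial>lborel)"
        by (rule nn_integral_eq_integral[symmetric, OF L2_UNIV_square[OF L2_UNIV_diff[OF f g]]]) simp
      also have "\<dots> \<le> ennreal (\<epsilon> / 2)"
        by (rule Fatou[of M]) (use M n in \<open>auto simp: r_def intro!: less_imp_le\<close>)
      finally have "(LINT x|lborel. (f n x - g x)\<^sup>2) \<le> \<epsilon> / 2"
        using \<epsilon> by (subst (asm) ennreal_le_iff) auto
      moreover have "0 \<le> (LINT x|lborel. (f n x - g x)\<^sup>2)" by simp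
      ultimately show ?thesis using \<epsilon> by simp
    qed
    then show "\<exists>no. \<forall>n\<ge>no. norm ((LINT x|lborel. (f n x - g x)\<^sup>2) - 0) < \<epsilon>" by blast
  qed
  then show ?thesis using g by blast
qed

quotient_type l2 = "real \<Rightarrow> real" / partial: "\<lambda>f g. f \<in> L2 UNIV \<and> g \<in> L2 UNIV \<and> (AE x in lborel. f x = g x)"
proof (rule part_equivpI)
  show "\<exists>f. f \<in> L2 UNIV \<and> f \<in> L2 UNIV \<and> (AE x in lborel. f x = f x)"
    using L2_UNIV_0 by auto
  show "symp (\<lambda>f g. f \<in> L2 UNIV \<and> g \<in> L2 UNIV \<and> (AE x in lborel. f x = g x))"
    by (rule sympI) (auto simp: eq_commute)
  show "transp (\<lambda>f g. f \<in> L2 UNIV \<and> g \<in> L2 UNIV \<and> (AE x in lborel. f x = g x))"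
  proof (rule transpI, elim conjE, intro conjI)
    fix f g h :: "real \<Rightarrow> real"
    assume "AE x in lborel. f x = g x" "AE x in lborel. g x = h x"
    then show "AE x in lborel. f x = h x" by eventually_elim simp
  qed simp_all
qed

lemma integral_cong_ae_eq:
  assumes "f \<in> L2 UNIV" "f' \<in> L2 UNIV" "g \<in> L2 UNIV" "g' \<in> L2 UNIV" 
    "AE x in lborel. f x = f' x" "AE x in lborel. g x = g' x"
  shows "(LINT x|lborel. f x * g x) = (LINT x|lborel. f' x * g' x)"
  using assms by (intro integral_cong_AE) (auto simp: L2_UNIV_iff elim!: eventually_elim2)

lemma L2_integral_square_eq_0_iff:
  assumes f: "f \<in> L2 UNIV"
  shows "(LINT x|lborel. f x * f x) = 0 \<longleftrightarrow> (AE x in lborel. f x = 0)"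
  using integral_nonneg_eq_0_iff_AE[OF L2_UNIV_mult[OF f f]] by simp

instantiation l2 :: real_vector
begin

lift_definition zero_l2 :: l2 is "\<lambda>x. 0" using L2_UNIV_0 by simp
lift_definition plus_l2 :: "l2 \<Rightarrow> l2 \<Rightarrow> l2" is "\<lambda>f g x. f x + g x"
  by (auto intro: L2_UNIV_add elim!: eventually_elim2)
lift_definition minus_l2 :: "l2 \<Rightarrow> l2 \<Rightarrow> l2" is "\<lambda>f g x. f x - g x"
  by (auto intro: L2_UNIV_diff elim!: eventually_elim2)
lift_definition uminus_l2 :: "l2 \<Rightarrow> l2" is "\<lambda>f x. - f x"
  using L2_UNIV_cmult[of _ "- 1"] by (auto elim!: eventually_mono)
lift_definition scaleR_l2 :: "real \<Rightarrow> l2 \<Rightarrow> l2" is "\<lambda>c f x. c * f x"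
  by (auto intro: L2_UNIV_cmult elim!: eventually_mono)

instance
proof
  fix a b c :: l2 and r s :: real
  have neg: "f \<in> L2 UNIV \<Longrightarrow> (\<lambda>x. - f x) \<in> L2 UNIV" for f using L2_UNIV_cmult[of f "- 1"] by simp
  note i = L2_UNIV_add L2_UNIV_diff neg L2_UNIV_cmult L2_UNIV_0
  show "a + b + c = a + (b + c)" by transfer (auto intro!: i simp: algebra_simps)
  show "a + b = b + a" by transfer (auto intro!: i simp: algebra_simps)
  show "0 + a = a" by transfer auto
  show "- a + a = 0" by transfer (auto intro!: i)
  show "a - b = a + - b" by transfer (auto intro!: i)
  show "r *\<^sub>R (a + b) = r *\<^sub>R a + r *\<^sub>R b" by transfer (auto intro!: i simp: algebra_simps)
  show "(r + s) *\<^sub>R a = r *\<^sub>R a + s *\<^sub>R a" by transfer (auto intro!: i simp: algebra_simps)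
  show "r *\<^sub>R s *\<^sub>R a = (r * s) *\<^sub>R a" by transfer (auto intro!: i simp: algebra_simps)
  show "1 *\<^sub>R a = a" by transfer auto
qed

end

instantiation l2 :: real_inner
begin

lift_definition inner_l2 :: "l2 \<Rightarrow> l2 \<Rightarrow> real" is "\<lambda>f g. LINT x|lborel. f x * g x"
  using integral_cong_ae_eq by blast

definition norm_l2 :: "l2 \<Rightarrow> real" where "norm_l2 a = sqrt (inner a a)"
definition dist_l2 :: "l2 \<Rightarrow> l2 \<Rightarrow> real" where "dist_l2 a b = norm (a - b)"
definition sgn_l2 :: "l2 \<Rightarrow> l2" where "sgn_l2 a = a /\<^sub>R norm a"
definition uniformity_l2 :: "(l2 \<times> l2) filter" where 
  "uniformity_l2 = (INF e\<in>{0<..}. principal {(x, y). dist x y < e})"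
definition open_l2 :: "l2 set \<Rightarrow> bool" where
  "open_l2 U \<longleftrightarrow> (\<forall>x\<in>U. \<forall>\<^sub>F (x', y) in uniformity. x' = x \<longrightarrow> y \<in> U)"

instance
proof
  fix a b c :: l2 and r :: real and U :: "l2 set"
  show "dist a b = norm (a - b)" by (rule dist_l2_def)
  show "sgn a = a /\<^sub>R norm a" by (rule sgn_l2_def)
  show "uniformity = (INF e\<in>{0<..}. principal {(x, y). dist x (y::l2) < e})" by (rule uniformity_l2_def)
  show "open U \<longleftrightarrow> (\<forall>x\<in>U. \<forall>\<^sub>F (x', y) in uniformity. x' = x \<longrightarrow> y \<in> U)" by (rule open_l2_def)
  show "inner a b = inner b a" by transfer (simp add: mult.commute)
  show "inner (a + b) c = inner a c + inner b c"
    by transfer (simp add: distrib_right L2_UNIV_mult)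
  show "inner (r *\<^sub>R a) b = r * inner a b" by transfer (simp add: mult.assoc)
  show "0 \<le> inner a a" by transfer simp
  show "inner a a = 0 \<longleftrightarrow> a = 0"
    by transfer (simp add: L2_integral_square_eq_0_iff L2_UNIV_0)
  show "norm a = sqrt (inner a a)" by (rule norm_l2_def)
qed

end

definition fun_of :: "l2 \<Rightarrow> real \<Rightarrow> real" where "fun_of = rep_l2"
definition class_of :: "(real \<Rightarrow> real) \<Rightarrow> l2" where "class_of = abs_l2"

lemma fun_of_L2 [simp]: "fun_of a \<in> L2 UNIV"
  using Quotient3_rep_reflp[OF Quotient3_l2, of a] by (simp add: fun_of_def)

lemma class_of_fun_of [simp]: "class_of (fun_of a) = a"
  using Quotient3_abs_rep[OF Quotient3_l2] by (simp add: fun_of_def class_of_def)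

lemma class_of_eq_iff: "f \<in> L2 UNIV \<Longrightarrow> g \<in> L2 UNIV \<Longrightarrow> class_of f = class_of g \<longleftrightarrow> (AE x in lborel. f x = g x)"
  using Quotient3_rel[OF Quotient3_l2, of f g] by (auto simp: class_of_def)

lemma fun_of_class_of: "f \<in> L2 UNIV \<Longrightarrow> AE x in lborel. fun_of (class_of f) x = f x"
  using class_of_eq_iff[of "fun_of (class_of f)" f] by simp

lemma class_of_arith:
  assumes "f \<in> L2 UNIV" "g \<in> L2 UNIV"
  shows "class_of f + class_of g = class_of (\<lambda>x. f x + g x)"
    "class_of f - class_of g = class_of (\<lambda>x. f x - g x)"
    "c *\<^sub>R class_of f = class_of (\<lambda>x. c * f x)"
    "inner (class_of f) (class_of g) = (LINT x|lborel. f x * g x)"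
  using assms plus_l2.abs_eq[of f g] minus_l2.abs_eq[of f g] scaleR_l2.abs_eq[of f c] inner_l2.abs_eq[of f g]
  by (simp_all add: class_of_def eq_onp_def)

lemma norm_class_of: "f \<in> L2 UNIV \<Longrightarrow> norm (class_of f) = L2_norm_on UNIV f"
  by (simp add: norm_l2_def class_of_arith L2_norm_on_def set_lebesgue_integral_def power2_eq_square)

instance l2 :: banach
proof
  fix X :: "nat \<Rightarrow> l2" assume X: "Cauchy X"
  define f where "f n = fun_of (X n)" for n
  have f: "f n \<in> L2 UNIV" "class_of (f n) = X n" for n by (simp_all add: f_def)
  have norm_sq: "(norm (class_of h))\<^sup>2 = (LINT x|lborel. (h x)\<^sup>2)" if "h \<in> L2 UNIV" for h
    using that by (simp only: power2_norm_eq_inner class_of_arith) (simp only: power2_eq_square)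
  have "\<exists>g\<in>L2 UNIV. (\<lambda>n. LINT x|lborel. (f n x - g x)\<^sup>2) \<longlonglongrightarrow> 0"
  proof (rule L2_complete[OF f(1)])
    fix \<epsilon> :: real assume "0 < \<epsilon>"
    then obtain N where N: "\<And>m n. N \<le> m \<Longrightarrow> N \<le> n \<Longrightarrow> norm (X m - X n) < sqrt \<epsilon>"
      using X unfolding Cauchy_iff by (metis real_sqrt_gt_0_iff)
    have "(LINT x|lborel. (f m x - f n x)\<^sup>2) < \<epsilon>" if "N \<le> m" "N \<le> n" for m n
    proof -
      have "(LINT x|lborel. (f m x - f n x)\<^sup>2) = (norm (X m - X n))\<^sup>2"
        using f by (simp add: norm_sq[symmetric] L2_UNIV_diff class_of_arith(2)[symmetric])
      also have "\<dots> < (sqrt \<epsilon>)\<^sup>2" using N[OF that] by (intro power_strict_mono) auto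
      finally show ?thesis using \<open>0 < \<epsilon>\<close> by simp
    qed
    then show "\<exists>N. \<forall>m\<ge>N. \<forall>n\<ge>N. (LINT x|lborel. (f m x - f n x)\<^sup>2) < \<epsilon>" by blast
  qed
  then obtain g where g: "g \<in> L2 UNIV" "(\<lambda>n. LINT x|lborel. (f n x - g x)\<^sup>2) \<longlonglongrightarrow> 0" by blast
  have "(LINT x|lborel. (f n x - g x)\<^sup>2) = (norm (X n - class_of g))\<^sup>2" for n
    using f g(1) by (simp add: norm_sq[symmetric] L2_UNIV_diff class_of_arith(2)[symmetric])
  then have "(\<lambda>n. sqrt ((norm (X n - class_of g))\<^sup>2)) \<longlonglongrightarrow> sqrt 0"
    using g(2) by (intro tendsto_real_sqrt) simp
  then have "X \<longlonglongrightarrow> class_of g"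
    by (simp add: tendsto_norm_zero_iff LIM_zero_iff)
  then show "convergent X" by (rule convergentI)
qed

section \<open>Smooth functions\<close>

definition smooth :: "(real \<Rightarrow> real) \<Rightarrow> bool" where
  "smooth f \<longleftrightarrow> (\<forall>k x. (deriv ^^ k) f field_differentiable at x)"

text \<open>
  All closure properties of \<open>smooth\<close> are obtained by a suitable choice of \<open>X\<close>.
\<close>

lemma smooth_coinduct:
  assumes "f \<in> X" and step: "\<And>f. f \<in> X \<Longrightarrow> (\<forall>x. f field_differentiable at x) \<and> deriv f \<in> X"
  shows "smooth f"
proof -
  have "(deriv ^^ k) f \<in> X" for k
    by (induction k) (use assms in auto)
  then show ?thesis using step unfolding smooth_def by blast
qed

lemma smooth_differentiable: "smooth f \<Longrightarrow> f field_differentiable at x"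
  unfolding smooth_def by (metis funpow_0)

lemma smooth_DERIV: "smooth f \<Longrightarrow> (f has_real_derivative deriv f x) (at x)"
  using smooth_differentiable field_differentiable_derivI by blast

lemma smooth_deriv: "smooth f \<Longrightarrow> smooth (deriv f)"
  unfolding smooth_def by (metis funpow_Suc_right o_apply)

lemma smooth_continuous: "smooth f \<Longrightarrow> continuous_on A f"
  using smooth_DERIV by (meson DERIV_isCont continuous_at_imp_continuous_on)

lemma smoothI:
  assumes "\<And>x. (f has_real_derivative f' x) (at x)" "smooth f'"
  shows "smooth f"
proof (rule smooth_coinduct[of f "insert f {g. smooth g}"])
  have d: "deriv f = f'" using assms(1) DERIV_imp_deriv by blast
  fix g assume "g \<in> insert f {g. smooth g}"
  then show "(\<forall>x. g field_differentiable at x) \<and> deriv g \<in> insert f {g. smooth g}"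
    using assms d smooth_differentiable smooth_deriv by (auto simp: field_differentiable_def)
qed simp

lemma smooth_const: "smooth (\<lambda>x. c)"
  by (rule smooth_coinduct[of _ "range (\<lambda>c x. c)"]) (auto simp: field_differentiable_const)

text \<open>
  Products alone are not closed under \<open>deriv\<close>, but their sums are, by the Leibniz rule; so
  \<open>smooth_coinduct\<close> applies to them.
\<close>

inductive_set products :: "(real \<Rightarrow> real) set" where
  mult: "smooth f \<Longrightarrow> smooth g \<Longrightarrow> (\<lambda>x. f x * g x) \<in> products"
| add: "f \<in> products \<Longrightarrow> g \<in> products \<Longrightarrow> (\<lambda>x. f x + g x) \<in> products"

lemma smooth_products: "f \<in> products \<Longrightarrow> smooth f"
proof (erule smooth_coinduct)
  fix f assume "f \<in> products"
  then have "\<exists>f'\<in>products. \<forall>x. (f has_real_derivative f' x) (at x)"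
  proof induction
    case (mult f g)
    show ?case
    proof (intro bexI allI)
      show "((\<lambda>x. f x * g x) has_real_derivative deriv f x * g x + f x * deriv g x) (at x)" for x
        using DERIV_mult[OF smooth_DERIV smooth_DERIV, OF mult, of x] by (simp add: algebra_simps)
      show "(\<lambda>x. deriv f x * g x + f x * deriv g x) \<in> products"
        by (intro products.intros smooth_deriv mult)
    qed
  next
    case (add f g)
    then obtain f' g' where "f' \<in> products" "g' \<in> products" "\<And>x. (f has_real_derivative f' x) (at x)" "\<And>x. (g has_real_derivative g' x) (at x)"
      by blast
    then show ?case by (intro bexI[of _ "\<lambda>x. f' x + g' x"]) (auto intro: DERIV_add products.intros)
  qed
  then obtain f' where f': "f' \<in> products" "\<And>x. (f has_real_derivative f' x) (at x)" by blast
  then have "deriv f = f'" using DERIV_imp_deriv by blast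
  then show "(\<forall>x. f field_differentiable at x) \<and> deriv f \<in> products"
    using f' by (auto simp: field_differentiable_def)
qed

lemma smooth_mult: "smooth f \<Longrightarrow> smooth g \<Longrightarrow> smooth (\<lambda>x. f x * g x)"
  by (rule smooth_products, rule products.mult)

lemma smooth_add: "smooth f \<Longrightarrow> smooth g \<Longrightarrow> smooth (\<lambda>x. f x + g x)"
proof -
  assume "smooth f" "smooth g"
  then have "(\<lambda>x. f x * 1 + g x * 1) \<in> products"
    by (intro products.add products.mult smooth_const)
  then show ?thesis using smooth_products by fastforce
qed

lemma smooth_diff: "smooth f \<Longrightarrow> smooth g \<Longrightarrow> smooth (\<lambda>x. f x - g x)"
  using smooth_add[of f "\<lambda>x. - 1 * g x"] smooth_mult[OF smooth_const, of g "- 1"] by simp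

lemma smooth_affine:
  assumes "smooth f" shows "smooth (\<lambda>x. f (a * x + b))"
proof -
  have "smooth (\<lambda>x. 1 * f (a * x + b))"
  proof (rule smooth_coinduct)
    show "(\<lambda>x. 1 * f (a * x + b)) \<in> {g. \<exists>f c. smooth f \<and> g = (\<lambda>x. c * f (a * x + b))}"
      using assms by blast
    fix g assume "g \<in> {g. \<exists>f c. smooth f \<and> g = (\<lambda>x. c * f (a * x + b))}"
    then obtain f c where f: "smooth f" and g: "g = (\<lambda>x. c * f (a * x + b))" by blast
    have d: "(g has_real_derivative (c * a) * deriv f (a * x + b)) (at x)" for x
      unfolding g by (rule derivative_eq_intros DERIV_chain2[OF smooth_DERIV[OF f]] refl | simp)+
    then have "deriv g = (\<lambda>x. (c * a) * deriv f (a * x + b))"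
      using DERIV_imp_deriv by blast
    then show "(\<forall>x. g field_differentiable at x) \<and> deriv g \<in> {g. \<exists>f c. smooth f \<and> g = (\<lambda>x. c * f (a * x + b))}"
      using d smooth_deriv[OF f] by (auto simp: field_differentiable_def)
  qed
  then show ?thesis by simp
qed

text \<open>
  The usual building block of functions with compact support; its polynomial factors make the
  family closed under derivatives.
\<close>

definition flat_exp :: "real poly \<Rightarrow> real \<Rightarrow> real" where
  "flat_exp p x = (if 0 < x then poly p (1 / x) * exp (- (1 / x)) else 0)"

lemma poly_exp_tendsto_0: "((\<lambda>y. poly p y * exp (- y)) \<longlongrightarrow> 0) at_top" for p :: "real poly"
proof -
  have "((\<lambda>y. \<Sum>i\<le>degree p. coeff p i * (y ^ i / exp y)) \<longlongrightarrow> (\<Sum>i\<le>degree p. coeff p i * 0)) at_top"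
    by (intro tendsto_intros tendsto_power_div_exp_0)
  then show ?thesis
    by (simp add: poly_altdef sum_distrib_right exp_minus divide_inverse mult.assoc)
qed

lemma flat_exp_DERIV: "(flat_exp p has_real_derivative flat_exp ([:0, 0, 1:] * (p - pderiv p)) x) (at x)"
proof -
  consider "0 < x" | "x < 0" | "x = 0" by linarith
  then show ?thesis
  proof cases
    case 1
    have "((\<lambda>x. poly p (1 / x) * exp (- (1 / x))) has_real_derivative flat_exp ([:0, 0, 1:] * (p - pderiv p)) x) (at x)"
      using 1 by (auto intro!: derivative_eq_intros DERIV_chain2[OF poly_DERIV] simp: flat_exp_def field_simps power2_eq_square)
    moreover have "\<forall>\<^sub>F y in nhds x. poly p (1 / y) * exp (- (1 / y)) = flat_exp p y"
      using eventually_nhds_in_open[of "{0<..}" x] 1 by (auto simp: flat_exp_def elim!: eventually_mono)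
    ultimately show ?thesis by (simp add: DERIV_cong_ev)
  next
    case 2
    have "\<forall>\<^sub>F y in nhds x. 0 = flat_exp p y"
      using eventually_nhds_in_open[of "{..<0}" x] 2 by (auto simp: flat_exp_def elim!: eventually_mono)
    then have "((\<lambda>y. 0) has_real_derivative 0) (at x) = (flat_exp p has_real_derivative 0) (at x)"
      by (rule DERIV_cong_ev[OF refl _ refl])
    then show ?thesis using 2 by (simp add: flat_exp_def)
  next
    case 3
    have left: "((\<lambda>h. flat_exp p h / h) \<longlongrightarrow> 0) (at_left 0)"
      by (rule Lim_transform_eventually[OF tendsto_const]) (auto simp: flat_exp_def eventually_at_filter)
    have right: "((\<lambda>h. flat_exp p h / h) \<longlongrightarrow> 0) (at_right 0)"
    proof (rule Lim_transform_eventually)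
      show "((\<lambda>h. poly (pCons 0 p) (inverse h) * exp (- inverse h)) \<longlongrightarrow> 0) (at_right 0)"
        by (rule filterlim_compose[OF poly_exp_tendsto_0 filterlim_inverse_at_top_right])
      show "\<forall>\<^sub>F h in at_right 0. poly (pCons 0 p) (inverse h) * exp (- inverse h) = flat_exp p h / h"
        by (auto simp: flat_exp_def eventually_at_filter field_simps)
    qed
    have "((\<lambda>h. flat_exp p h / h) \<longlongrightarrow> 0) (at 0)"
      using left right by (simp add: filterlim_split_at)
    then show ?thesis using 3 by (simp add: has_field_derivative_iff flat_exp_def)
  qed
qed

lemma smooth_flat_exp: "smooth (flat_exp p)"
proof (rule smooth_coinduct[of _ "range flat_exp"])
  fix f assume "f \<in> range flat_exp"
  then obtain p where "f = flat_exp p" by blast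
  moreover have "deriv (flat_exp p) = flat_exp ([:0, 0, 1:] * (p - pderiv p))"
    using flat_exp_DERIV DERIV_imp_deriv by blast
  ultimately show "(\<forall>x. f field_differentiable at x) \<and> deriv f \<in> range flat_exp"
    using flat_exp_DERIV by (auto simp: field_differentiable_def)
qed simp

lemma smooth_antiderivative:
  assumes "smooth f"
  obtains F where "\<And>x. (F has_real_derivative f x) (at x)" "smooth F"
proof -
  have "\<exists>F. \<forall>x. - \<infinity> < ereal x \<longrightarrow> ereal x < \<infinity> \<longrightarrow> (F has_vector_derivative f x) (at x)"
    by (rule einterval_antiderivative) (use smooth_DERIV[OF assms] in \<open>auto intro: DERIV_isCont\<close>)
  then obtain F where F: "\<And>x. (F has_real_derivative f x) (at x)"
    by (auto simp: has_real_derivative_iff_has_vector_derivative)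
  then show thesis using that smoothI[OF F assms] by blast
qed

lemma smooth_step_exists:
  "\<exists>\<sigma>. smooth \<sigma> \<and> (\<forall>x\<le>0. \<sigma> x = 0) \<and> (\<forall>x\<ge>1. \<sigma> x = 1) \<and> (\<forall>x. 0 \<le> \<sigma> x \<and> \<sigma> x \<le> (1::real))"
proof -
  define \<beta> where "\<beta> x = flat_exp 1 x * flat_exp 1 ((- 1) * x + 1)" for x
  have "smooth \<beta>" unfolding \<beta>_def[abs_def] by (intro smooth_mult smooth_affine smooth_flat_exp)
  then obtain F where F: "\<And>x. (F has_real_derivative \<beta> x) (at x)" "smooth F"
    using smooth_antiderivative by blast
  have \<beta>: "\<beta> x = 0" if "x \<le> 0 \<or> 1 \<le> x" for x using that by (auto simp: \<beta>_def flat_exp_def)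
  have \<beta>_pos: "0 < \<beta> x" if "0 < x" "x < 1" for x using that by (auto simp: \<beta>_def flat_exp_def)
  have \<beta>_nonneg: "0 \<le> \<beta> x" for x by (auto simp: \<beta>_def flat_exp_def)
  have mono: "F x \<le> F y" if "x \<le> y" for x y
    using DERIV_nonneg_imp_nondecreasing[OF that] F(1) \<beta>_nonneg by blast
  have low: "F x = F 0" if "x \<le> 0" for x
  proof -
    have "F 0 \<le> F x"
      by (rule DERIV_nonpos_imp_nonincreasing[OF that]) (use F(1) \<beta> in fastforce)
    then show ?thesis using mono[OF that] by simp
  qed
  have high: "F x = F 1" if "1 \<le> x" for x
  proof -
    have "F x \<le> F 1"
      by (rule DERIV_nonpos_imp_nonincreasing[OF that]) (use F(1) \<beta> in fastforce)
    then show ?thesis using mono[OF that] by simp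
  qed
  have lt: "F 0 < F 1"
  proof (rule DERIV_pos_imp_increasing_open[of 0 1 F])
    show "\<exists>y. (F has_real_derivative y) (at x) \<and> 0 < y" if "0 < x" "x < 1" for x
      using F(1)[of x] \<beta>_pos[OF that] by blast
    show "continuous_on {0..1} F" by (rule smooth_continuous[OF F(2)])
  qed simp
  define \<sigma> where "\<sigma> x = (F x - F 0) * inverse (F 1 - F 0)" for x
  have "smooth \<sigma>" unfolding \<sigma>_def[abs_def] by (intro smooth_mult smooth_diff smooth_const F)
  moreover have "\<sigma> x = 0" if "x \<le> 0" for x using low[OF that] by (simp add: \<sigma>_def)
  moreover have "\<sigma> x = 1" if "1 \<le> x" for x using high[OF that] lt by (simp add: \<sigma>_def)
  moreover have "0 \<le> \<sigma> x \<and> \<sigma> x \<le> 1" for x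
  proof -
    have "F 0 \<le> F x" "F x \<le> F 1" using low[of x] high[of x] mono[of 0 x] mono[of x 1] by linarith+
    then show ?thesis using lt by (auto simp: \<sigma>_def field_simps)
  qed
  ultimately show ?thesis by blast
qed

lemma test_functions_iff: "\<phi> \<in> test_functions \<Omega> \<longleftrightarrow> smooth \<phi> \<and> (\<exists>K. compact K \<and> K \<subseteq> \<Omega> \<and> (\<forall>x. x \<notin> K \<longrightarrow> \<phi> x = 0))"
  by (simp add: test_functions_def smooth_def)

lemma deriv_eq_0_outside:
  assumes "closed K" "\<forall>x. x \<notin> K \<longrightarrow> \<phi> x = 0" "x \<notin> K"
  shows "deriv \<phi> x = (0::real)"
proof -
  have "\<forall>\<^sub>F y in nhds x. \<phi> y = (\<lambda>y. 0) y"
    by (rule eventually_mono[OF eventually_nhds_in_open[of "- K" x]]) (use assms in auto)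
  then have "deriv \<phi> x = deriv (\<lambda>y. 0) x" by (rule deriv_cong_ev) simp
  then show ?thesis by simp
qed

section \<open>Indefinite integrals\<close>

text \<open>
  For an interval \<open>I\<close>, this is local absolute continuity of \<open>F\<close> with derivative \<open>d\<close>.
\<close>

definition primitive_on :: "real set \<Rightarrow> (real \<Rightarrow> real) \<Rightarrow> (real \<Rightarrow> real) \<Rightarrow> bool" where
  "primitive_on I F d \<longleftrightarrow> (\<forall>x\<in>I. \<forall>y\<in>I. x \<le> y \<longrightarrow>
     set_integrable lborel {x..y} d \<and> F y - F x = (LINT s:{x..y}|lborel. d s))"

lemma primitive_onD:
  assumes "primitive_on I F d" "x \<in> I" "y \<in> I" "x \<le> y"
  shows "set_integrable lborel {x..y} d" "F y - F x = (LINT s:{x..y}|lborel. d s)" "F y - F x = integral {x..y} d"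
  using assms set_borel_integral_eq_integral(2)[of "{x..y}" d] by (auto simp: primitive_on_def)

lemma primitive_on_subset: "primitive_on I F d \<Longrightarrow> J \<subseteq> I \<Longrightarrow> primitive_on J F d"
  unfolding primitive_on_def by blast

lemma primitive_on_exists:
  assumes I: "is_interval I" and int: "\<And>x y. x \<in> I \<Longrightarrow> y \<in> I \<Longrightarrow> set_integrable lborel {x..y} d"
  shows "\<exists>F. primitive_on I F d"
proof (cases "I = {}")
  case False
  then obtain c where c: "c \<in> I" by blast
  have on: "d integrable_on {x..y}" if "x \<in> I" "y \<in> I" for x y
    using set_borel_integral_eq_integral(1)[OF int[OF that]] .
  have empty: "integral {b..a} d = 0" if "a \<le> b" for a b
    by (cases "a = b") (use that in auto)
  let ?F = "\<lambda>x. integral {c..x} d - integral {x..c} d"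
  have "?F y - ?F x = integral {x..y} d" if xy: "x \<in> I" "y \<in> I" "x \<le> y" for x y
  proof -
    consider "c \<le> x" | "x < c" "c \<le> y" | "y < c" by linarith
    then show ?thesis
    proof cases
      case 1
      then show ?thesis
        using Henstock_Kurzweil_Integration.integral_combine[of c x y d] on[OF c xy(2)] xy
        by (simp add: empty)
    next
      case 2
      then show ?thesis
        using Henstock_Kurzweil_Integration.integral_combine[of x c y d] on[OF xy(1,2)] xy
        by (simp add: empty)
    next
      case 3
      then show ?thesis
        using Henstock_Kurzweil_Integration.integral_combine[of x y c d] on[OF xy(1) c] xy
        by (simp add: empty)
    qed
  qed
  then have "primitive_on I ?F d"
    using int set_borel_integral_eq_integral(2)[OF int] by (simp add: primitive_on_def)
  then show ?thesis by blast
qed (simp add: primitive_on_def)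

lemma Icc_subset_interval: "is_interval I \<Longrightarrow> a \<in> I \<Longrightarrow> b \<in> I \<Longrightarrow> {a..b} \<subseteq> (I :: real set)"
  unfolding is_interval_1 by (meson atLeastAtMost_iff subsetI)

lemma primitive_on_continuous_Icc:
  assumes F: "primitive_on I F d" and ab: "a \<in> I" "b \<in> I" and I: "is_interval I"
  shows "continuous_on {a..b} F"
proof (cases "a \<le> b")
  case True
  have sub: "{a..b} \<subseteq> I" using Icc_subset_interval[OF I ab] .
  have "continuous_on {a..b} (\<lambda>x. integral {a..x} d)"
    using set_borel_integral_eq_integral(1)[OF primitive_onD(1)[OF F ab True]] by (rule indefinite_integral_continuous_1)
  then have "continuous_on {a..b} (\<lambda>x. F a + integral {a..x} d)" by (intro continuous_intros)
  then show ?thesis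
  proof (rule continuous_on_eq)
    fix x assume "x \<in> {a..b}"
    then have "F x - F a = integral {a..x} d" using sub by (intro primitive_onD(3)[OF F ab(1)]) auto
    then show "F a + integral {a..x} d = F x" by simp
  qed
qed simp

lemma primitive_on_continuous:
  assumes F: "primitive_on I F d" and I: "is_interval I" "open I"
  shows "continuous_on I F"
proof (rule continuous_at_imp_continuous_on, rule ballI)
  fix x assume "x \<in> I"
  then obtain e where e: "0 < e" "cball x e \<subseteq> I" using I(2) open_contains_cball by blast
  have "continuous_on {x - e..x + e} F"
    by (rule primitive_on_continuous_Icc[OF F _ _ I(1)]) (use e in \<open>auto simp: subset_iff dist_real_def\<close>)
  then show "isCont F x" by (rule continuous_on_interior) (use e in auto)
qed

lemma set_integrable_continuous_mult:
  fixes F d :: "real \<Rightarrow> real"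
  assumes F: "continuous_on {a..b} F" and d: "set_integrable lborel {a..b} d"
  shows "set_integrable lborel {a..b} (\<lambda>s. F s * d s)"
proof -
  have "compact (F ` {a..b})" using F by (intro compact_continuous_image) auto
  then obtain C where C: "\<And>s. s \<in> {a..b} \<Longrightarrow> norm (F s) \<le> C" 
    using compact_imp_bounded by (fastforce simp: bounded_iff)
  have m: "(\<lambda>s. indicator {a..b} s *\<^sub>R F s) \<in> borel_measurable borel"
    by (rule borel_measurable_continuous_on_indicator[OF _ F]) simp
  have d': "integrable lborel (\<lambda>s. indicator {a..b} s *\<^sub>R d s)" using d by (simp add: set_integrable_def)
  show ?thesis
    unfolding set_integrable_def
  proof (rule Bochner_Integration.integrable_bound)
    show "integrable lborel (\<lambda>s. C * (indicator {a..b} s *\<^sub>R d s))" using d' by simp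
    have "(\<lambda>s. (indicator {a..b} s *\<^sub>R F s) * (indicator {a..b} s *\<^sub>R d s)) \<in> borel_measurable lborel"
      using m borel_measurable_integrable[OF d'] by (intro borel_measurable_times) auto
    then show "(\<lambda>s. indicator {a..b} s *\<^sub>R (F s * d s)) \<in> borel_measurable lborel"
      by (rule measurable_cong[THEN iffD1, rotated]) (auto simp: indicator_def)
    have "norm (indicator {a..b} s *\<^sub>R (F s * d s)) \<le> norm (C * (indicator {a..b} s *\<^sub>R d s))" for s
      using C[of s] by (auto simp: indicator_def abs_mult intro!: mult_right_mono)
    then show "AE s in lborel. norm (indicator {a..b} s *\<^sub>R (F s * d s)) \<le> norm (C * (indicator {a..b} s *\<^sub>R d s))" by simp
  qed
qed

text \<open>
  Fubini's theorem for \<open>u s * v t\<close>, the plane being split along the diagonal. This replaces the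
  product rule, since an indefinite integral need not be differentiable everywhere.
\<close>

lemma product_of_indefinite_integrals:
  fixes u v :: "real \<Rightarrow> real"
  assumes u: "integrable lborel u" and v: "integrable lborel v"
  shows "(LINT s|lborel. u s * (LINT t|lborel. indicator {..s} t * v t)) + (LINT t|lborel. v t * (LINT s|lborel. indicator {..t} s * u s))
     = (LINT s|lborel. u s) * (LINT t|lborel. v t)"
proof -
  have [measurable]: "u \<in> borel_measurable borel" "v \<in> borel_measurable borel"
    using borel_measurable_integrable[OF u] borel_measurable_integrable[OF v] by simp_all
  have prod: "integrable (lborel \<Otimes>\<^sub>M lborel) (\<lambda>(s, t). u s * v t)"
    by (rule lborel_pair.Fubini_integrable) (use u v in \<open>auto simp: abs_mult\<close>)
  have I: "integrable (lborel \<Otimes>\<^sub>M lborel) (\<lambda>(s, t). indicator {..t} s * (u s * v t))"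
    by (rule Bochner_Integration.integrable_bound[OF prod]) (auto simp: indicator_def split: prod.split)
  have vi: "integrable lborel (\<lambda>t. indicator A t * v t)" if "A \<in> sets borel" for A
    using integrable_mult_indicator[of A lborel v] v that by simp
  have "(LINT t|lborel. v t * (LINT s|lborel. indicator {..t} s * u s)) = (LINT t|lborel. LINT s|lborel. indicator {..t} s * (u s * v t))"
  proof (rule Bochner_Integration.integral_cong[OF refl])
    fix t
    have "(LINT s|lborel. indicator {..t} s * (u s * v t)) = (LINT s|lborel. v t * (indicator {..t} s * u s))"
      by (simp add: ac_simps)
    then show "v t * (LINT s|lborel. indicator {..t} s * u s) = (LINT s|lborel. indicator {..t} s * (u s * v t))"
      by simp
  qed
  also have "\<dots> = (LINT s|lborel. LINT t|lborel. indicator {..t} s * (u s * v t))"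
    using lborel_pair.Fubini_integral[OF I] by simp
  also have "\<dots> = (LINT s|lborel. u s * (LINT t|lborel. v t) - u s * (LINT t|lborel. indicator {..s} t * v t))"
  proof (rule Bochner_Integration.integral_cong[OF refl])
    fix s
    have "(LINT t|lborel. indicator {..t} s * (u s * v t)) = (LINT t|lborel. u s * v t - u s * (indicator {..s} t * v t))"
      using AE_lborel_singleton[of s]
      by (intro integral_cong_AE) (auto simp: indicator_def elim!: eventually_mono)
    also have "\<dots> = u s * (LINT t|lborel. v t) - u s * (LINT t|lborel. indicator {..s} t * v t)"
      using v vi[of "{..s}"] by (subst Bochner_Integration.integral_diff) auto
    finally show "(LINT t|lborel. indicator {..t} s * (u s * v t)) = u s * (LINT t|lborel. v t) - u s * (LINT t|lborel. indicator {..s} t * v t)" .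
  qed
  also have "\<dots> = (LINT s|lborel. u s * (LINT t|lborel. v t)) - (LINT s|lborel. u s * (LINT t|lborel. indicator {..s} t * v t))"
  proof (rule Bochner_Integration.integral_diff)
    show "integrable lborel (\<lambda>s. u s * (LINT t|lborel. v t))" using u by simp
    have I2: "integrable (lborel \<Otimes>\<^sub>M lborel) (\<lambda>(s, t). indicator {..s} t * (u s * v t))"
      by (rule Bochner_Integration.integrable_bound[OF prod]) (auto simp: indicator_def split: prod.split)
    have "integrable lborel (\<lambda>s. LINT t|lborel. indicator {..s} t * (u s * v t))"
      using lborel_pair.integrable_fst[OF I2] by simp
    moreover have "(LINT t|lborel. indicator {..s} t * (u s * v t)) = u s * (LINT t|lborel. indicator {..s} t * v t)" for s
    proof -
      have "(LINT t|lborel. indicator {..s} t * (u s * v t)) = (LINT t|lborel. u s * (indicator {..s} t * v t))"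
        by (simp add: ac_simps)
      then show ?thesis by simp
    qed
    ultimately show "integrable lborel (\<lambda>s. u s * (LINT t|lborel. indicator {..s} t * v t))" by simp
  qed
  finally show ?thesis by simp
qed

lemma primitive_on_mult:
  assumes F: "primitive_on I F d" and G: "primitive_on I G d'" and I: "is_interval I"
  shows "primitive_on I (\<lambda>x. F x * G x) (\<lambda>x. F x * d' x + G x * d x)"
  unfolding primitive_on_def
proof (intro ballI impI)
  fix x y assume xy: "x \<in> I" "y \<in> I" "x \<le> y"
  let ?A = "{x..y}"
  have sub: "?A \<subseteq> I" using Icc_subset_interval[OF I xy(1,2)] .
  have Fd': "set_integrable lborel ?A (\<lambda>s. F s * d' s)" and Gd: "set_integrable lborel ?A (\<lambda>s. G s * d s)"
    using xy by (auto intro!: set_integrable_continuous_mult primitive_on_continuous_Icc[OF F _ _ I] primitive_on_continuous_Icc[OF G _ _ I]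
        primitive_onD(1)[OF F] primitive_onD(1)[OF G])
  define u v where "u s = indicator ?A s * d s" and "v s = indicator ?A s * d' s" for s
  have uv: "integrable lborel u" "integrable lborel v"
    using primitive_onD(1)[OF F xy] primitive_onD(1)[OF G xy] by (simp_all add: set_integrable_def u_def[abs_def] v_def[abs_def])
  have U: "(LINT s|lborel. indicator {..t} s * u s) = F t - F x" if t: "t \<in> ?A" for t
  proof -
    have "(LINT s|lborel. indicator {..t} s * u s) = (LINT s:{x..t}|lborel. d s)"
      unfolding set_lebesgue_integral_def using t
      by (intro Bochner_Integration.integral_cong) (auto simp: u_def indicator_def)
    then show ?thesis using primitive_onD(2)[OF F xy(1), of t] t sub by auto
  qed
  have V: "(LINT s|lborel. indicator {..t} s * v s) = G t - G x" if t: "t \<in> ?A" for t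
  proof -
    have "(LINT s|lborel. indicator {..t} s * v s) = (LINT s:{x..t}|lborel. d' s)"
      unfolding set_lebesgue_integral_def using t
      by (intro Bochner_Integration.integral_cong) (auto simp: v_def indicator_def)
    then show ?thesis using primitive_onD(2)[OF G xy(1), of t] t sub by auto
  qed
  have d: "set_integrable lborel ?A d" "set_integrable lborel ?A d'" 
    using primitive_onD(1)[OF F xy] primitive_onD(1)[OF G xy] by auto
  have 1: "(LINT s|lborel. u s * (LINT t|lborel. indicator {..s} t * v t)) = (LINT s:?A|lborel. G s * d s) - G x * (F y - F x)"
  proof -
    have "(LINT s|lborel. u s * (LINT t|lborel. indicator {..s} t * v t)) = (LINT s:?A|lborel. G s * d s - G x * d s)"
      unfolding set_lebesgue_integral_def
    proof (rule Bochner_Integration.integral_cong[OF refl])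
      fix s show "u s * (LINT t|lborel. indicator {..s} t * v t) = indicator ?A s *\<^sub>R (G s * d s - G x * d s)"
        by (cases "s \<in> ?A") (simp_all only: V u_def indicator_simps scaleR_conv_of_real of_real_eq_id id_apply, simp_all add: algebra_simps)
    qed
    also have "\<dots> = (LINT s:?A|lborel. G s * d s) - (LINT s:?A|lborel. G x * d s)"
      using d by (intro set_integral_diff Gd) auto
    finally show ?thesis using primitive_onD(2)[OF F xy] by simp
  qed
  have 2: "(LINT s|lborel. v s * (LINT t|lborel. indicator {..s} t * u t)) = (LINT s:?A|lborel. F s * d' s) - F x * (G y - G x)"
  proof -
    have "(LINT s|lborel. v s * (LINT t|lborel. indicator {..s} t * u t)) = (LINT s:?A|lborel. F s * d' s - F x * d' s)"
      unfolding set_lebesgue_integral_def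
    proof (rule Bochner_Integration.integral_cong[OF refl])
      fix s show "v s * (LINT t|lborel. indicator {..s} t * u t) = indicator ?A s *\<^sub>R (F s * d' s - F x * d' s)"
        by (cases "s \<in> ?A") (simp_all only: U v_def indicator_simps scaleR_conv_of_real of_real_eq_id id_apply, simp_all add: algebra_simps)
    qed
    also have "\<dots> = (LINT s:?A|lborel. F s * d' s) - (LINT s:?A|lborel. F x * d' s)"
      using d by (intro set_integral_diff Fd') auto
    finally show ?thesis using primitive_onD(2)[OF G xy] by simp
  qed
  have 3: "(LINT s|lborel. u s) = F y - F x" "(LINT s|lborel. v s) = G y - G x"
    using primitive_onD(2)[OF F xy] primitive_onD(2)[OF G xy] by (simp_all add: set_lebesgue_integral_def u_def v_def)
  have "(LINT s:?A|lborel. F s * d' s + G s * d s) = (LINT s:?A|lborel. F s * d' s) + (LINT s:?A|lborel. G s * d s)"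
    using Fd' Gd by (rule set_integral_add)
  also have "\<dots> = F y * G y - F x * G x"
    using product_of_indefinite_integrals[OF uv] unfolding 1 2 3 by (simp add: algebra_simps)
  finally show "set_integrable lborel ?A (\<lambda>s. F s * d' s + G s * d s) \<and> F y * G y - F x * G x = (LINT s:?A|lborel. F s * d' s + G s * d s)"
    using set_integral_add(1)[OF Fd' Gd] by simp
qed

lemma primitive_on_C1:
  assumes "\<And>x. (F has_real_derivative d x) (at x)" "continuous_on UNIV d"
  shows "primitive_on I F d"
  unfolding primitive_on_def
proof (intro ballI impI)
  fix x y :: real assume "x \<le> y"
  have c: "continuous_on {x..y} d" using assms(2) continuous_on_subset by blast
  have i: "set_integrable lborel {x..y} d"
    using borel_integrable_atLeastAtMost'[OF c] .
  have "integral {x..y} d = F y - F x"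
    by (rule integral_unique, rule fundamental_theorem_of_calculus[OF \<open>x \<le> y\<close>])
       (use assms(1) has_real_derivative_iff_has_vector_derivative has_vector_derivative_at_within in blast)
  then show "set_integrable lborel {x..y} d \<and> F y - F x = (LINT s:{x..y}|lborel. d s)"
    using i set_borel_integral_eq_integral(2)[OF i] by simp
qed

lemma primitive_on_reflect:
  assumes F: "primitive_on I F d"
  shows "primitive_on (uminus ` I) (\<lambda>x. F (- x)) (\<lambda>x. - d (- x))"
  unfolding primitive_on_def
proof (intro ballI impI)
  fix x y :: real assume xy: "x \<in> uminus ` I" "y \<in> uminus ` I" "x \<le> y"
  then have i: "integrable lborel (\<lambda>s. indicator {- y..- x} s *\<^sub>R d s)" and eq: "F (- x) - F (- y) = (LINT s:{- y..- x}|lborel. d s)"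
    using primitive_onD[OF F, of "- y" "- x"] by (auto simp: set_integrable_def)
  have ind: "indicator {- y..- x} (0 + (- 1) * s) = (indicator {x..y} s :: real)" for s by (auto simp: indicator_def)
  have "integrable lborel (\<lambda>s. indicator {x..y} s *\<^sub>R d (- s))"
    using lborel_integrable_real_affine[OF i, of "- 1" 0] unfolding ind by simp
  moreover have "(LINT s:{- y..- x}|lborel. d s) = (LINT s:{x..y}|lborel. d (- s))"
    unfolding set_lebesgue_integral_def using lborel_integral_real_affine[of "- 1" "\<lambda>s. indicator {- y..- x} s *\<^sub>R d s" 0]
    unfolding ind by simp
  ultimately show "set_integrable lborel {x..y} (\<lambda>s. - d (- s)) \<and> F (- y) - F (- x) = (LINT s:{x..y}|lborel. - d (- s))"
    using eq by (simp add: set_integrable_def set_lebesgue_integral_def)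
qed

text \<open>
  \<open>h\<close> has a limit at infinity because \<open>k\<close> is integrable, and the limit is \<open>0\<close> because \<open>h\<close> is.
\<close>

lemma primitive_on_half_line_integral:
  assumes h: "primitive_on {a..} h k" and int_h: "set_integrable lborel {a..} h" and int_k: "set_integrable lborel {a..} k"
  shows "(LINT x:{a..}|lborel. k x) = - h a"
proof -
  define L where "L = h a + (LINT x:{a..}|lborel. k x)"
  have lim: "(h \<longlongrightarrow> L) at_top"
  proof (rule Lim_transform_eventually)
    have "((\<lambda>b. set_lebesgue_integral lborel {a..b} k) \<longlongrightarrow> set_lebesgue_integral lborel {a..} k) at_top"
      by (rule tendsto_set_lebesgue_integral_at_top) (use int_k in auto)
    then show "((\<lambda>b. h a + set_lebesgue_integral lborel {a..b} k) \<longlongrightarrow> L) at_top"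
      unfolding L_def by (intro tendsto_intros)
    show "\<forall>\<^sub>F b in at_top. h a + set_lebesgue_integral lborel {a..b} k = h b"
      using eventually_ge_at_top[of a] by eventually_elim (use primitive_onD(2)[OF h, of a] in force)
  qed
  have "L = 0"
  proof (rule ccontr)
    assume L: "L \<noteq> 0"
    define c where "c = \<bar>L\<bar> / 2"
    have c: "0 < c" using L by (simp add: c_def)
    have "\<forall>\<^sub>F b in at_top. dist (h b) L < c" using lim c by (rule tendstoD)
    then obtain b where b: "\<And>x. b \<le> x \<Longrightarrow> dist (h x) L < c" by (auto simp: eventually_at_top_linorder)
    define b' where "b' = max a b"
    have hc: "c \<le> \<bar>h x\<bar>" if "b' \<le> x" for x
      using b[of x] that unfolding b'_def c_def dist_real_def by (simp add: abs_if split: if_splits)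
    have "integrable lborel (\<lambda>x. indicator {b'..} x * c)"
    proof (rule Bochner_Integration.integrable_bound)
      show "integrable lborel (\<lambda>x. indicator {a..} x *\<^sub>R h x)" using int_h by (simp add: set_integrable_def)
      have "norm (indicator {b'..} x * c) \<le> norm (indicator {a..} x *\<^sub>R h x)" for x
        using hc[of x] c by (auto simp: indicator_def b'_def)
      then show "AE x in lborel. norm (indicator {b'..} x * c) \<le> norm (indicator {a..} x *\<^sub>R h x)" by simp
    qed simp
    then have "integrable lborel (\<lambda>x. c * (indicator {b'..} x :: real))" by (simp add: mult.commute)
    then have "integrable lborel (indicator {b'..} :: real \<Rightarrow> real)" using c by (simp add: integrable_mult_left_iff)
    then have fin: "emeasure lborel {b'..} < \<infinity>" by (simp add: integrable_indicator_iff)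
    have "ennreal (real n) \<le> emeasure lborel {b'..}" for n
    proof -
      have "emeasure lborel {b'..b' + real n} \<le> emeasure lborel {b'..}" by (rule emeasure_mono) auto
      then show ?thesis by simp
    qed
    then have "of_nat n \<le> emeasure lborel {b'..}" for n
      by (simp add: ennreal_of_nat_eq_real_of_nat)
    moreover obtain n where "emeasure lborel {b'..} < of_nat n"
      using ennreal_Ex_less_of_nat[of "emeasure lborel {b'..}"] fin by (auto simp: top_unique)
    ultimately show False using leD by blast
  qed
  then show ?thesis by (simp add: L_def)
qed

section \<open>The lemma of du Bois-Reymond\<close>

text \<open>
  The intervals generate the Borel sets and are stable under intersections, so the integral of
  \<open>f\<close> vanishes over every Borel set.
\<close>

lemma AE_0_if_interval_integrals_0:
  fixes f :: "real \<Rightarrow> real"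
  assumes f: "integrable lborel f" and zero: "\<And>a b. a \<le> b \<Longrightarrow> (LINT x:{a<..b}|lborel. f x) = 0"
  shows "AE x in lborel. f x = 0"
proof (rule density_unique_real[OF f])
  show "integrable lborel (\<lambda>x::real. 0::real)" by simp
  have si: "set_integrable lborel A f" if "A \<in> sets borel" for A
    using f that unfolding set_integrable_def by (intro integrable_mult_indicator) auto
  have all: "(LINT x|lborel. f x) = 0"
  proof -
    have "(\<lambda>n. LINT x:{- real n<..real n}|lborel. f x) \<longlonglongrightarrow> (LINT x|lborel. f x)"
      unfolding set_lebesgue_integral_def
    proof (rule integral_dominated_convergence)
      show "integrable lborel (\<lambda>x. \<bar>f x\<bar>)" using f by (rule integrable_abs)
      show "AE x in lborel. (\<lambda>n. indicator {- real n<..real n} x *\<^sub>R f x) \<longlonglongrightarrow> f x"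
      proof (rule AE_I2)
        fix x :: real
        obtain N :: nat where N: "\<bar>x\<bar> < real N" using reals_Archimedean2 by blast
        have "\<forall>\<^sub>F n in sequentially. f x = indicator {- real n<..real n} x *\<^sub>R f x"
          by (rule eventually_sequentiallyI[of N]) (use N in \<open>auto simp: indicator_def\<close>)
        then show "(\<lambda>n. indicator {- real n<..real n} x *\<^sub>R f x) \<longlonglongrightarrow> f x"
          by (rule Lim_transform_eventually[OF tendsto_const])
      qed
      show "AE x in lborel. norm (indicator {- real n<..real n} x *\<^sub>R f x) \<le> \<bar>f x\<bar>" for n
        by (auto simp: indicator_def)
    qed (use f in auto)
    moreover have "(LINT x:{- real n<..real n}|lborel. f x) = 0" for n by (rule zero) simp
    ultimately show ?thesis by (simp add: LIMSEQ_const_iff)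
  qed
  fix A :: "real set" assume "A \<in> sets lborel"
  then have A: "A \<in> sigma_sets UNIV (range (\<lambda>(a, b). {a<..b::real}))"
    using borel_sigma_sets_Ioc by (metis sets_lborel sets_measure_of top_greatest Pow_UNIV)
  have stable: "Int_stable (range (\<lambda>(a, b). {a<..b::real}))"
  proof (rule Int_stableI)
    fix A B assume "A \<in> range (\<lambda>(a, b). {a<..b::real})" "B \<in> range (\<lambda>(a, b). {a<..b::real})"
    then obtain a b c d where "A = {a<..b}" "B = {c<..d}" by auto
    then have "A \<inter> B = {max a c<..min b d}" by auto
    then show "A \<inter> B \<in> range (\<lambda>(a, b). {a<..b::real})" by auto
  qed
  have "range (\<lambda>(a, b). {a<..b::real}) \<subseteq> Pow UNIV" by simp
  from stable this A have "(LINT x:A|lborel. f x) = 0"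
  proof (induction rule: sigma_sets_induct_disjoint)
    case (basic A)
    then obtain a b where "A = {a<..b}" by auto
    then show ?case using zero[of a b] by (cases "a \<le> b") (auto simp: set_lebesgue_integral_def)
  next
    case empty
    then show ?case by (simp add: set_lebesgue_integral_def)
  next
    case (compl A)
    have A: "A \<in> sets borel" using compl.hyps borel_sigma_sets_Ioc by (metis sets_measure_of top_greatest Pow_UNIV)
    have "(LINT x:A \<union> (UNIV - A)|lborel. f x) = (LINT x:A|lborel. f x) + (LINT x:UNIV - A|lborel. f x)"
      by (rule set_integral_Un) (use A in \<open>auto intro!: si\<close>)
    then show ?case using all compl.IH by (simp add: set_lebesgue_integral_def)
  next
    case (union A)
    have A: "A i \<in> sets borel" for i using union.hyps borel_sigma_sets_Ioc
      by (metis sets_measure_of top_greatest Pow_UNIV range_subsetD)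
    have "(LINT x:(\<Union>i. A i)|lborel. f x) = (\<Sum>i. LINT x:A i|lborel. f x)"
      by (rule lebesgue_integral_countable_add) (use A union.hyps in \<open>auto intro!: si simp: disjoint_family_on_def\<close>)
    then show ?case using union.IH by simp
  qed
  then show "(LINT x:A|lborel. f x) = (LINT x:A|lborel. 0)" by simp
qed

lemma integrable_indicator_Icc: "integrable lborel (indicator {a..b::real} :: real \<Rightarrow> real)"
  by (rule integrable_real_indicator) (auto simp: emeasure_lborel_Icc_eq)

lemma set_integral_restrict:
  assumes "{a..b} \<subseteq> \<Omega>" "\<And>x. x \<notin> {a..b} \<Longrightarrow> g x = (0::real)"
  shows "(LINT x:\<Omega>|lborel. g x) = (LINT x:{a..b}|lborel. g x)"
  unfolding set_lebesgue_integral_def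
  by (intro Bochner_Integration.integral_cong) (use assms in \<open>auto simp: indicator_def\<close>)

lemma open_interval_subinterval:
  fixes I :: "real set" assumes "open I" "x \<in> I" 
  obtains a b where "a \<in> I" "b \<in> I" "a < x" "x < b"
proof -
  obtain e where e: "0 < e" "cball x e \<subseteq> I" using assms open_contains_cball by blast
  then have "x - e \<in> I" "x + e \<in> I" by (auto simp: subset_iff dist_real_def)
  then show thesis using that e by force
qed

lemma test_function_support:
  assumes \<phi>: "\<phi> \<in> test_functions I" and I: "open I" "I \<noteq> {}"
  obtains a b where "a \<in> I" "b \<in> I" "a < b" "\<And>x. x \<notin> {a<..<b} \<Longrightarrow> \<phi> x = 0 \<and> deriv \<phi> x = 0"
proof -
  obtain K where K: "compact K" "K \<subseteq> I" "\<forall>x. x \<notin> K \<longrightarrow> \<phi> x = 0"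
    using \<phi> by (auto simp: test_functions_iff)
  have d: "deriv \<phi> x = 0" if "x \<notin> K" for x
    using deriv_eq_0_outside[OF compact_imp_closed[OF K(1)] K(3) that] .
  obtain l u where lu: "l \<in> I" "u \<in> I" "K \<subseteq> {l..u}" "l \<le> u"
  proof (cases "K = {}")
    case True
    then show ?thesis using that I by blast
  next
    case False
    then obtain l u where "l \<in> K" "\<forall>x\<in>K. l \<le> x" "u \<in> K" "\<forall>x\<in>K. x \<le> u"
      using compact_attains_inf[OF K(1)] compact_attains_sup[OF K(1)] by metis
    then show ?thesis using that[of l u] K(2) by (auto simp: subset_iff)
  qed
  obtain a where a: "a \<in> I" "a < l" using open_interval_subinterval[OF I(1) lu(1)] by blast
  obtain b where b: "b \<in> I" "u < b" using open_interval_subinterval[OF I(1) lu(2)] by blast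
  have "x \<notin> K" if "x \<notin> {a<..<b}" for x using that lu a b by (auto simp: subset_iff)
  then show thesis using that[of a b] a b lu d K(3) by force
qed

lemma integrable_compact_support:
  fixes \<psi> h :: "real \<Rightarrow> real"
  assumes "continuous_on UNIV \<psi>" "set_integrable lborel {a..b} h" "\<And>x. x \<notin> {a..b} \<Longrightarrow> \<psi> x = 0"
  shows "integrable lborel (\<lambda>x. \<psi> x * h x)"
proof -
  have "integrable lborel (\<lambda>x. indicator {a..b} x *\<^sub>R (\<psi> x * h x))"
    using set_integrable_continuous_mult[OF continuous_on_subset[OF assms(1)] assms(2)] by (simp add: set_integrable_def)
  moreover have "(\<lambda>x. indicator {a..b} x *\<^sub>R (\<psi> x * h x)) = (\<lambda>x. \<psi> x * h x)"
  proof
    fix x show "indicator {a..b} x *\<^sub>R (\<psi> x * h x) = \<psi> x * h x"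
      by (cases "x \<in> {a..b}") (simp_all add: assms(3) del: atLeastAtMost_iff)
  qed
  ultimately show ?thesis by metis
qed

lemma test_function_antiderivative:
  assumes \<xi>: "smooth \<xi>" "\<And>x. x \<notin> {c<..<d} \<Longrightarrow> \<xi> x = 0" and cd: "c < d" "{c..d} \<subseteq> I"
    and zero: "(LINT x|lborel. \<xi> x) = 0"
  obtains \<phi> where "\<phi> \<in> test_functions I" "deriv \<phi> = \<xi>"
proof -
  obtain F where F: "\<And>x. (F has_real_derivative \<xi> x) (at x)" "smooth F"
    using smooth_antiderivative[OF \<xi>(1)] by blast
  define \<phi> where "\<phi> x = F x - F c" for x
  have smooth: "smooth \<phi>" unfolding \<phi>_def[abs_def] by (intro smooth_diff F smooth_const)
  have D: "(\<phi> has_real_derivative \<xi> x) (at x)" for x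
    unfolding \<phi>_def[abs_def] using F(1)[of x] by (auto intro!: derivative_eq_intros)
  have prim: "primitive_on UNIV F \<xi>"
    by (rule primitive_on_C1[OF F(1) smooth_continuous[OF \<xi>(1)]])
  have low: "\<phi> x = 0" if "x \<le> c" for x
  proof -
    have "F c - F x = (LINT s:{x..c}|lborel. \<xi> s)" using primitive_onD(2)[OF prim _ _ that] by simp
    also have "\<dots> = (LINT s:{x..c}|lborel. 0)"
      unfolding set_lebesgue_integral_def using \<xi>(2) by (intro Bochner_Integration.integral_cong) (auto simp: indicator_def)
    finally show ?thesis by (simp add: \<phi>_def)
  qed
  have high: "\<phi> x = 0" if "d \<le> x" for x
  proof -
    have "F x - F c = (LINT s:{c..x}|lborel. \<xi> s)" using primitive_onD(2)[OF prim, of c x] that cd by simp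
    also have "\<dots> = (LINT s:UNIV|lborel. \<xi> s)"
      by (rule set_integral_restrict[symmetric]) (use \<xi>(2) that in auto)
    also have "\<dots> = 0" using zero by (simp add: set_lebesgue_integral_def)
    finally show ?thesis by (simp add: \<phi>_def)
  qed
  have "\<phi> \<in> test_functions I"
    unfolding test_functions_iff using smooth cd low high by (intro conjI exI[of _ "{c..d}"]) force+
  moreover have "deriv \<phi> = \<xi>" using D DERIV_imp_deriv by blast
  ultimately show thesis by (rule that)
qed

text \<open>
  The product of two smooth steps of slope proportional to \<open>n\<close>, one rising to the right of \<open>a\<close>
  and one falling to the left of \<open>b\<close>.
\<close>

lemma smooth_cutoffs:
  fixes a b :: real assumes "a < b"
  obtains \<psi> :: "nat \<Rightarrow> real \<Rightarrow> real" where "\<And>n. smooth (\<psi> n)" "\<And>n x. 0 \<le> \<psi> n x \<and> \<psi> n x \<le> 1"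
    "\<And>n x. x \<notin> {a<..<b} \<Longrightarrow> \<psi> n x = 0" "\<And>x. x \<in> {a<..<b} \<Longrightarrow> (\<lambda>n. \<psi> n x) \<longlonglongrightarrow> 1"
proof -
  obtain \<sigma> :: "real \<Rightarrow> real" where \<sigma>: "smooth \<sigma>" "\<And>x. x \<le> 0 \<Longrightarrow> \<sigma> x = 0" "\<And>x. 1 \<le> x \<Longrightarrow> \<sigma> x = 1" "\<And>x. 0 \<le> \<sigma> x" "\<And>x. \<sigma> x \<le> 1"
    using smooth_step_exists by blast
  define \<psi> where "\<psi> n x = \<sigma> (real (Suc n) * x + - real (Suc n) * a) * \<sigma> (- real (Suc n) * x + real (Suc n) * b)" for n x
  have eq: "\<psi> n x = \<sigma> (real (Suc n) * (x - a)) * \<sigma> (real (Suc n) * (b - x))" for n x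
    by (simp add: \<psi>_def algebra_simps)
  show thesis
  proof (rule that[of \<psi>])
    show "smooth (\<psi> n)" for n unfolding \<psi>_def by (intro smooth_mult smooth_affine \<sigma>(1))
    show "0 \<le> \<psi> n x \<and> \<psi> n x \<le> 1" for n x unfolding \<psi>_def using \<sigma>(4,5) by (auto intro: mult_le_one)
    show "\<psi> n x = 0" if "x \<notin> {a<..<b}" for n x
    proof -
      have "real (Suc n) * (x - a) \<le> 0 \<or> real (Suc n) * (b - x) \<le> 0"
        using that by (auto simp: mult_le_0_iff)
      then show ?thesis unfolding eq using \<sigma>(2) by auto
    qed
    fix x assume x: "x \<in> {a<..<b}"
    define m where "m = min (x - a) (b - x)"
    have m: "0 < m" using x by (simp add: m_def)
    obtain N where N: "1 / m < real N" using reals_Archimedean2 by blast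
    have "\<forall>\<^sub>F n in sequentially. 1 = \<psi> n x"
    proof (rule eventually_sequentiallyI[of N])
      fix n assume "N \<le> n"
      then have "1 / m \<le> real (Suc n)" using N by linarith
      then have *: "1 \<le> real (Suc n) * m" using m by (simp add: field_simps)
      have "real (Suc n) * m \<le> real (Suc n) * (x - a)" "real (Suc n) * m \<le> real (Suc n) * (b - x)"
        by (intro mult_left_mono; simp add: m_def)+
      then show "1 = \<psi> n x" unfolding eq using * \<sigma>(3) by (metis mult_1 order_trans)
    qed
    then show "(\<lambda>n. \<psi> n x) \<longlonglongrightarrow> 1" by (rule Lim_transform_eventually[OF tendsto_const])
  qed
qed

lemma cutoff_integral_tendsto:
  fixes h :: "real \<Rightarrow> real"
  assumes h: "set_integrable lborel {a..b} h" 
    and \<psi>: "\<And>n. smooth (\<psi> n)" "\<And>n x. 0 \<le> \<psi> n x \<and> \<psi> n x \<le> 1"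
    "\<And>n x. x \<notin> {a<..<b} \<Longrightarrow> \<psi> n x = 0" "\<And>x. x \<in> {a<..<b} \<Longrightarrow> (\<lambda>n. \<psi> n x) \<longlonglongrightarrow> 1"
  shows "(\<lambda>n. LINT x|lborel. \<psi> n x * h x) \<longlonglongrightarrow> (LINT x:{a<..<b}|lborel. h x)"
  unfolding set_lebesgue_integral_def
proof (rule integral_dominated_convergence)
  have i: "integrable lborel (\<lambda>x. indicator {a..b} x *\<^sub>R h x)" using h by (simp add: set_integrable_def)
  show "integrable lborel (\<lambda>x. \<bar>indicator {a..b} x *\<^sub>R h x\<bar>)" using i by (rule integrable_abs)
  have "set_integrable lborel {a<..<b} h" by (rule set_integrable_subset[OF h]) auto
  then show "(\<lambda>x. indicator {a<..<b} x *\<^sub>R h x) \<in> borel_measurable lborel"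
    unfolding set_integrable_def by (rule borel_measurable_integrable)
  show "(\<lambda>x. \<psi> n x * h x) \<in> borel_measurable lborel" for n
    using \<psi>(3) by (intro borel_measurable_integrable integrable_compact_support[OF smooth_continuous[OF \<psi>(1)] h]) auto
  show "AE x in lborel. norm (\<psi> n x * h x) \<le> \<bar>indicator {a..b} x *\<^sub>R h x\<bar>" for n
  proof (rule AE_I2)
    fix x show "norm (\<psi> n x * h x) \<le> \<bar>indicator {a..b} x *\<^sub>R h x\<bar>"
      using \<psi>(2)[of n x] \<psi>(3)[of x n] by (cases "x \<in> {a<..<b}") (auto simp: abs_mult mult_left_le_one_le)
  qed
  show "AE x in lborel. (\<lambda>n. \<psi> n x * h x) \<longlonglongrightarrow> indicator {a<..<b} x *\<^sub>R h x"
  proof (rule AE_I2)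
    fix x show "(\<lambda>n. \<psi> n x * h x) \<longlonglongrightarrow> indicator {a<..<b} x *\<^sub>R h x"
      using tendsto_mult[OF \<psi>(4)[of x] tendsto_const[of "h x"]] \<psi>(3)[of x] by (cases "x \<in> {a<..<b}") auto
  qed
qed

text \<open>
  A combination of two cutoff functions with integral \<open>0\<close> is the derivative of a test function.
  In the limit the integrals of \<open>h\<close> over two intervals have the ratio of their lengths, so \<open>h\<close>
  has the same mean over every interval.
\<close>

lemma du_Bois_Reymond:
  assumes I: "open I" "is_interval I" and h: "\<And>x y. x \<in> I \<Longrightarrow> y \<in> I \<Longrightarrow> set_integrable lborel {x..y} h"
    and zero: "\<And>\<phi>. \<phi> \<in> test_functions I \<Longrightarrow> (LINT x:I|lborel. h x * deriv \<phi> x) = 0"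
  shows "\<exists>k. AE x in lborel. x \<in> I \<longrightarrow> h x = k"
proof (cases "I = {}")
  case False
  then obtain x0 where x0: "x0 \<in> I" by blast
  then obtain a0 b0 where a0: "a0 \<in> I" "b0 \<in> I" "a0 < x0" "x0 < b0" using open_interval_subinterval[OF I(1)] by metis
  have one: "set_integrable lborel {a..b} (\<lambda>x. 1::real)" for a b :: real
    by (simp add: set_integrable_def integrable_indicator_Icc)
  have proportional: "(LINT x:{a<..<b}|lborel. h x) * (b0 - a0) = (LINT x:{a0<..<b0}|lborel. h x) * (b - a)"
    if ab: "a \<in> I" "b \<in> I" "a < b" for a b
  proof -
    have ab0: "a0 < b0" using a0 by simp
    obtain \<psi> :: "nat \<Rightarrow> real \<Rightarrow> real" where \<psi>: "\<And>n. smooth (\<psi> n)" "\<And>n x. 0 \<le> \<psi> n x \<and> \<psi> n x \<le> 1"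
      "\<And>n x. x \<notin> {a<..<b} \<Longrightarrow> \<psi> n x = 0" "\<And>x. x \<in> {a<..<b} \<Longrightarrow> (\<lambda>n. \<psi> n x) \<longlonglongrightarrow> 1"
      using smooth_cutoffs[OF ab(3)] by blast
    obtain \<theta> :: "nat \<Rightarrow> real \<Rightarrow> real" where \<theta>: "\<And>n. smooth (\<theta> n)" "\<And>n x. 0 \<le> \<theta> n x \<and> \<theta> n x \<le> 1"
      "\<And>n x. x \<notin> {a0<..<b0} \<Longrightarrow> \<theta> n x = 0" "\<And>x. x \<in> {a0<..<b0} \<Longrightarrow> (\<lambda>n. \<theta> n x) \<longlonglongrightarrow> 1"
      using smooth_cutoffs[OF ab0] by blast
    define m m0 where "m n = (LINT x|lborel. \<psi> n x * 1)" and "m0 n = (LINT x|lborel. \<theta> n x * 1)" for n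
    have int: "integrable lborel (\<lambda>x. \<psi> n x * f x)" if "set_integrable lborel {a..b} f" for n f
      using \<psi>(3) by (intro integrable_compact_support[OF smooth_continuous[OF \<psi>(1)] that]) auto
    have int0: "integrable lborel (\<lambda>x. \<theta> n x * f x)" if "set_integrable lborel {a0..b0} f" for n f
      using \<theta>(3) by (intro integrable_compact_support[OF smooth_continuous[OF \<theta>(1)] that]) auto
    have eq: "m0 n * (LINT x|lborel. \<psi> n x * h x) = m n * (LINT x|lborel. \<theta> n x * h x)" for n
    proof -
      define \<xi> where "\<xi> x = m0 n * \<psi> n x - m n * \<theta> n x" for x
      define c d where "c = min a a0" and "d = max b b0"
      have cd: "c \<in> I" "d \<in> I" "c < d" "{c..d} \<subseteq> I"
        using ab a0 Icc_subset_interval[OF I(2), of c d] by (auto simp: c_def d_def min_def max_def)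
      have out: "\<xi> x = 0" if "x \<notin> {c<..<d}" for x
      proof -
        have "x \<notin> {a<..<b}" "x \<notin> {a0<..<b0}" using that by (auto simp: c_def d_def)
        then show ?thesis by (simp add: \<xi>_def \<psi>(3) \<theta>(3))
      qed
      have "(LINT x|lborel. \<xi> x) = m0 n * (LINT x|lborel. \<psi> n x) - m n * (LINT x|lborel. \<theta> n x)"
        unfolding \<xi>_def using int[OF one] int0[OF one] by (subst Bochner_Integration.integral_diff) auto
      then have "(LINT x|lborel. \<xi> x) = 0" by (simp add: m_def m0_def)
      moreover have "smooth \<xi>" unfolding \<xi>_def[abs_def] by (intro smooth_diff smooth_mult smooth_const \<psi> \<theta>)
      ultimately obtain \<phi> where \<phi>: "\<phi> \<in> test_functions I" "deriv \<phi> = \<xi>"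
        using test_function_antiderivative[of \<xi> c d I] out cd by blast
      have "0 = (LINT x:I|lborel. h x * \<xi> x)" using zero[OF \<phi>(1)] \<phi>(2) by simp
      also have "\<dots> = (LINT x|lborel. m0 n * (\<psi> n x * h x) - m n * (\<theta> n x * h x))"
        unfolding set_lebesgue_integral_def
      proof (rule Bochner_Integration.integral_cong[OF refl])
        fix x show "indicator I x *\<^sub>R (h x * \<xi> x) = m0 n * (\<psi> n x * h x) - m n * (\<theta> n x * h x)"
        proof (cases "x \<in> I")
          case False
          have "x \<notin> {a<..<b}" using False Icc_subset_interval[OF I(2) ab(1,2)] by (auto simp: subset_iff)
          moreover have "x \<notin> {a0<..<b0}" using False Icc_subset_interval[OF I(2) a0(1,2)] by (auto simp: subset_iff)
          ultimately
          show ?thesis using False \<psi>(3) \<theta>(3) by simp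
        qed (simp add: \<xi>_def algebra_simps)
      qed
      also have "\<dots> = m0 n * (LINT x|lborel. \<psi> n x * h x) - m n * (LINT x|lborel. \<theta> n x * h x)"
        using int[OF h[OF ab(1,2)]] int0[OF h[OF a0(1,2)]] by (subst Bochner_Integration.integral_diff) auto
      finally show ?thesis by simp
    qed
    have "(\<lambda>n. m0 n * (LINT x|lborel. \<psi> n x * h x)) \<longlonglongrightarrow> (LINT x:{a0<..<b0}|lborel. 1) * (LINT x:{a<..<b}|lborel. h x)"
      unfolding m0_def by (intro tendsto_mult cutoff_integral_tendsto one h ab \<psi> \<theta>) 
    moreover have "(\<lambda>n. m0 n * (LINT x|lborel. \<psi> n x * h x)) \<longlonglongrightarrow> (LINT x:{a<..<b}|lborel. 1) * (LINT x:{a0<..<b0}|lborel. h x)"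
      unfolding eq m_def by (intro tendsto_mult cutoff_integral_tendsto one h a0 \<psi> \<theta>)
    ultimately have "(LINT x:{a0<..<b0}|lborel. 1) * (LINT x:{a<..<b}|lborel. h x) = (LINT x:{a<..<b}|lborel. 1) * (LINT x:{a0<..<b0}|lborel. h x)"
      by (rule LIMSEQ_unique)
    then show ?thesis using ab ab0 by (simp add: set_lebesgue_integral_def mult.commute)
  qed
  define k where "k = (LINT x:{a0<..<b0}|lborel. h x) / (b0 - a0)"
  have mean: "(LINT x:{a<..<b}|lborel. h x) = k * (b - a)" if ab: "a \<in> I" "b \<in> I" "a < b" for a b
    using proportional[OF ab] a0 by (simp add: k_def field_simps)
  have loc: "AE x in lborel. x \<in> {c..d} \<longrightarrow> h x = k" if cd: "c \<in> I" "d \<in> I" for c d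
  proof -
    let ?f = "\<lambda>x. indicator {c..d} x * (h x - k)"
    have hk: "set_integrable lborel {x..y} (\<lambda>x. h x - k)" if "x \<in> I" "y \<in> I" for x y
      using h[OF that] by (intro set_integral_diff(1)) (auto simp: set_integrable_def integrable_indicator_Icc)
    have "AE x in lborel. ?f x = 0"
    proof (rule AE_0_if_interval_integrals_0)
      show "integrable lborel ?f" using hk[OF cd] by (simp add: set_integrable_def)
      fix a b :: real
      define l u where "l = max a c" and "u = min b d"
      have "(LINT x:{a<..b}|lborel. ?f x) = (LINT x:{l<..<u}|lborel. h x - k)"
      proof -
        have "AE x in lborel. indicator {a<..b} x *\<^sub>R ?f x = indicator {l<..<u} x *\<^sub>R (h x - k)"
          using AE_lborel_singleton[of l] AE_lborel_singleton[of u]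
          by eventually_elim (auto simp: indicator_def l_def u_def min_def max_def split: if_splits)
        moreover have "(\<lambda>x. indicator {a<..b} x *\<^sub>R ?f x) \<in> borel_measurable lborel"
          using borel_measurable_integrable[of lborel ?f] hk[OF cd] by (auto simp: set_integrable_def)
        moreover have "(\<lambda>x. indicator {l<..<u} x *\<^sub>R (h x - k)) \<in> borel_measurable lborel"
        proof -
          have "set_integrable lborel {l<..<u} (\<lambda>x. h x - k)"
            by (rule set_integrable_subset[OF hk[OF cd]]) (auto simp: l_def u_def)
          then show ?thesis unfolding set_integrable_def by (rule borel_measurable_integrable)
        qed
        ultimately show ?thesis unfolding set_lebesgue_integral_def by (intro integral_cong_AE)
      qed
      also have "\<dots> = 0"
      proof (cases "l < u")
        case True
        have lu: "l \<in> I" "u \<in> I" using Icc_subset_interval[OF I(2) cd] True by (auto simp: l_def u_def)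
        have "(LINT x:{l<..<u}|lborel. h x - k) = (LINT x:{l<..<u}|lborel. h x) - (LINT x:{l<..<u}|lborel. k)"
        proof (rule set_integral_diff)
          show "set_integrable lborel {l<..<u} h" by (rule set_integrable_subset[OF h[OF lu]]) auto
          show "set_integrable lborel {l<..<u} (\<lambda>x. k)"
            by (rule set_integrable_subset[of lborel "{l..u}"]) (auto simp: set_integrable_def integrable_indicator_Icc)
        qed
        also have "\<dots> = 0" using mean[OF lu True] True by (simp add: set_lebesgue_integral_def)
        finally show ?thesis .
      qed (simp add: set_lebesgue_integral_def)
      finally show "(LINT x:{a<..b}|lborel. ?f x) = 0" .
    qed
    then show ?thesis by eventually_elim (auto simp: indicator_def)
  qed
  have "AE x in lborel. \<forall>q r::rat. of_rat q \<in> I \<longrightarrow> of_rat r \<in> I \<longrightarrow> x \<in> {of_rat q..of_rat r} \<longrightarrow> h x = k"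
    unfolding AE_all_countable using loc by (auto intro: AE_I2)
  then have "AE x in lborel. x \<in> I \<longrightarrow> h x = k"
  proof eventually_elim
    case (elim x)
    show ?case
    proof
      assume "x \<in> I"
      then obtain a b where ab: "a \<in> I" "b \<in> I" "a < x" "x < b" using open_interval_subinterval[OF I(1)] by metis
      obtain q where q: "a < of_rat q" "of_rat q < x" using of_rat_dense[OF ab(3)] by blast
      obtain r where r: "x < of_rat r" "of_rat r < b" using of_rat_dense[OF ab(4)] by blast
      have "of_rat q \<in> I" "of_rat r \<in> I" using Icc_subset_interval[OF I(2) ab(1,2)] q r by auto
      then show "h x = k" using elim q r by auto
    qed
  qed
  then show ?thesis by blast
qed simp

section \<open>Weak derivatives as densities\<close>

lemma L2_iff: "f \<in> L2 \<Omega> \<longleftrightarrow> (\<lambda>x. indicator \<Omega> x * f x) \<in> L2 UNIV"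
proof -
  have "(indicator \<Omega> x * f x)\<^sup>2 = indicator \<Omega> x * (f x)\<^sup>2" for x :: real
    by (auto simp: indicator_def)
  then show ?thesis by (simp add: L2_def set_borel_measurable_def set_integrable_def)
qed

lemma indicator_Icc_L2: "(indicator {a..b} :: real \<Rightarrow> real) \<in> L2 UNIV"
proof -
  have "(indicator {a..b} x)\<^sup>2 = (indicator {a..b} x :: real)" for x :: real by (auto simp: indicator_def)
  then show ?thesis by (simp add: L2_UNIV_iff integrable_indicator_Icc)
qed

lemma L2_set_integrable_Icc:
  assumes f: "f \<in> L2 \<Omega>" and sub: "{a..b} \<subseteq> \<Omega>"
  shows "set_integrable lborel {a..b} f"
proof -
  have "integrable lborel (\<lambda>x. indicator {a..b} x * (indicator \<Omega> x * f x))"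
    by (rule L2_UNIV_mult[OF indicator_Icc_L2]) (use f L2_iff in auto)
  moreover have "indicator {a..b} x * (indicator \<Omega> x * f x) = indicator {a..b} x *\<^sub>R f x" for x
    using sub by (auto simp: indicator_def)
  ultimately show ?thesis by (simp add: set_integrable_def)
qed

lemma primitive_test_by_parts:
  assumes F: "primitive_on I F d" and I: "open I" "is_interval I" and \<phi>: "\<phi> \<in> test_functions I" and sub: "I \<subseteq> \<Omega>"
  shows "(LINT x:\<Omega>|lborel. F x * deriv \<phi> x) = - (LINT x:\<Omega>|lborel. d x * \<phi> x)"
proof (cases "I = {}")
  case True
  then have "\<phi> x = 0" for x using \<phi> by (auto simp: test_functions_iff)
  then have "\<phi> = (\<lambda>x. 0)" by auto
  then show ?thesis by simp
next
  case False
  obtain a b where ab: "a \<in> I" "b \<in> I" "a < b" "\<And>x. x \<notin> {a<..<b} \<Longrightarrow> \<phi> x = 0 \<and> deriv \<phi> x = 0"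
    using test_function_support[OF \<phi> I(1) False] by blast
  have s: "smooth \<phi>" using \<phi> by (simp add: test_functions_iff)
  have P: "primitive_on I \<phi> (deriv \<phi>)"
    by (rule primitive_on_C1[OF smooth_DERIV[OF s] smooth_continuous[OF smooth_deriv[OF s]]])
  note prod = primitive_onD(2)[OF primitive_on_mult[OF F P I(2)] ab(1,2)]
  have abI: "{a..b} \<subseteq> \<Omega>" using Icc_subset_interval[OF I(2) ab(1,2)] sub by blast
  have i1: "set_integrable lborel {a..b} (\<lambda>x. F x * deriv \<phi> x)"
    by (rule set_integrable_continuous_mult[OF primitive_on_continuous_Icc[OF F ab(1,2) I(2)]])
       (use primitive_onD(1)[OF P ab(1,2)] ab in auto)
  have i2: "set_integrable lborel {a..b} (\<lambda>x. \<phi> x * d x)"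
    by (rule set_integrable_continuous_mult[OF smooth_continuous[OF s]]) (use primitive_onD(1)[OF F ab(1,2)] ab in auto)
  have "(LINT x:{a..b}|lborel. F x * deriv \<phi> x) + (LINT x:{a..b}|lborel. \<phi> x * d x) = F b * \<phi> b - F a * \<phi> a"
    using prod ab set_integral_add(2)[OF i1 i2] by simp
  moreover have "\<phi> a = 0" "\<phi> b = 0" using ab(4) by auto
  moreover have "(LINT x:\<Omega>|lborel. F x * deriv \<phi> x) = (LINT x:{a..b}|lborel. F x * deriv \<phi> x)"
    by (rule set_integral_restrict[OF abI]) (use ab(4) in auto)
  moreover have "(LINT x:\<Omega>|lborel. d x * \<phi> x) = (LINT x:{a..b}|lborel. \<phi> x * d x)"
    by (subst set_integral_restrict[OF abI]) (use ab(4) in \<open>auto simp: mult.commute\<close>)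
  ultimately show ?thesis by simp
qed

lemma test_functions_mono: "I \<subseteq> \<Omega> \<Longrightarrow> test_functions I \<subseteq> test_functions \<Omega>"
  unfolding test_functions_iff subset_iff by blast

text \<open>
  The indefinite integral of \<open>d\<close> has the same weak derivative as \<open>f\<close>, so the difference of the two is
  constant by \<open>du_Bois_Reymond\<close>.
\<close>

lemma weak_deriv_primitive:
  assumes f: "f \<in> L2 \<Omega>" and d: "d \<in> L2 \<Omega>" and wd: "has_weak_deriv \<Omega> f d"
    and I: "open I" "is_interval I" "I \<subseteq> \<Omega>"
  shows "\<exists>F. primitive_on I F d \<and> (AE x in lborel. x \<in> I \<longrightarrow> F x = f x)"
proof -
  have sub: "{x..y} \<subseteq> \<Omega>" if "x \<in> I" "y \<in> I" for x y using Icc_subset_interval[OF I(2) that] I(3) by blast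
  obtain F where F: "primitive_on I F d"
    using primitive_on_exists[OF I(2), of d] L2_set_integrable_Icc[OF d sub] by blast
  have Fi: "set_integrable lborel {x..y} F" if "x \<in> I" "y \<in> I" for x y
    using borel_integrable_atLeastAtMost'[OF primitive_on_continuous_Icc[OF F that I(2)]] .
  have "\<exists>k. AE x in lborel. x \<in> I \<longrightarrow> f x - F x = k"
  proof (rule du_Bois_Reymond[OF I(1,2)])
    show "set_integrable lborel {x..y} (\<lambda>x. f x - F x)" if "x \<in> I" "y \<in> I" for x y
      by (intro set_integral_diff(1) L2_set_integrable_Icc[OF f sub] Fi that)
    fix \<phi> assume \<phi>: "\<phi> \<in> test_functions I"
    show "(LINT x:I|lborel. (f x - F x) * deriv \<phi> x) = 0"
    proof (cases "I = {}")
      case False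
      obtain a b where ab: "a \<in> I" "b \<in> I" "a < b" "\<And>x. x \<notin> {a<..<b} \<Longrightarrow> \<phi> x = 0 \<and> deriv \<phi> x = 0"
        using test_function_support[OF \<phi> I(1) False] by blast
      have s: "smooth \<phi>" using \<phi> by (simp add: test_functions_iff)
      have abI: "{a..b} \<subseteq> I" using Icc_subset_interval[OF I(2) ab(1,2)] .
      have i: "set_integrable lborel {a..b} (\<lambda>x. deriv \<phi> x * f x)" "set_integrable lborel {a..b} (\<lambda>x. deriv \<phi> x * F x)"
        by (intro set_integrable_continuous_mult smooth_continuous smooth_deriv s L2_set_integrable_Icc[OF f sub] Fi ab)+
      have "(LINT x:I|lborel. (f x - F x) * deriv \<phi> x) = (LINT x:{a..b}|lborel. (f x - F x) * deriv \<phi> x)"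
        by (rule set_integral_restrict[OF abI]) (use ab(4) in auto)
      also have "\<dots> = (LINT x:{a..b}|lborel. deriv \<phi> x * f x) - (LINT x:{a..b}|lborel. deriv \<phi> x * F x)"
        using set_integral_diff(2)[OF i] by (simp add: algebra_simps)
      also have "(LINT x:{a..b}|lborel. deriv \<phi> x * f x) = (LINT x:\<Omega>|lborel. f x * deriv \<phi> x)"
        by (subst set_integral_restrict[OF sub[OF ab(1,2)]]) (use ab(4) in \<open>auto simp: mult.commute\<close>)
      also have "(LINT x:{a..b}|lborel. deriv \<phi> x * F x) = (LINT x:\<Omega>|lborel. F x * deriv \<phi> x)"
        by (subst set_integral_restrict[OF sub[OF ab(1,2)]]) (use ab(4) in \<open>auto simp: mult.commute\<close>)
      also have "(LINT x:\<Omega>|lborel. f x * deriv \<phi> x) = - (LINT x:\<Omega>|lborel. d x * \<phi> x)"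
        using wd \<phi> test_functions_mono[OF I(3)] by (auto simp: has_weak_deriv_def)
      also have "(LINT x:\<Omega>|lborel. F x * deriv \<phi> x) = - (LINT x:\<Omega>|lborel. d x * \<phi> x)"
        by (rule primitive_test_by_parts[OF F I(1,2) \<phi> I(3)])
      finally show ?thesis by simp
    qed (simp add: set_lebesgue_integral_def)
  qed
  then obtain k where k: "AE x in lborel. x \<in> I \<longrightarrow> f x - F x = k" by blast
  have "primitive_on I (\<lambda>x. F x + k) d" using F by (simp add: primitive_on_def)
  moreover have "AE x in lborel. x \<in> I \<longrightarrow> F x + k = f x" using k by eventually_elim auto
  ultimately show ?thesis by blast
qed

section \<open>Continuous representatives and Sobolev functions\<close>

lemma AE_eq_continuous_imp_eq:
  fixes F G :: "real \<Rightarrow> real"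
  assumes "open \<Omega>" "continuous_on \<Omega> F" "continuous_on \<Omega> G" "AE x in lborel. x \<in> \<Omega> \<longrightarrow> F x = G x" "x \<in> \<Omega>"
  shows "F x = G x"
proof (rule ccontr)
  assume ne: "F x \<noteq> G x"
  have "open {y \<in> \<Omega>. F y - G y \<in> - {0}}"
    using continuous_open_preimage[OF continuous_on_diff[OF assms(2,3)] assms(1), of "- {0}"]
    by (simp add: vimage_def Int_def Collect_conj_eq[symmetric] open_Compl)
  moreover have "x \<in> {y \<in> \<Omega>. F y - G y \<in> - {0}}" using ne assms(5) by simp
  ultimately obtain e where e: "0 < e" "cball x e \<subseteq> {y \<in> \<Omega>. F y - G y \<in> - {0}}"
    using open_contains_cball by blast
  have "AE y in lborel. y \<notin> cball x e"
    using assms(4) by eventually_elim (use e(2) in auto)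
  then have "emeasure lborel (cball x e) = 0"
    by (subst (asm) AE_iff_measurable[of "cball x e"]) auto
  moreover have "cball x e = {x - e..x + e}" by (auto simp: dist_real_def)
  ultimately show False using e(1) by simp
qed

lemma cont_rep_eq:
  assumes "open \<Omega>" "continuous_on \<Omega> F" "AE x in lborel. x \<in> \<Omega> \<longrightarrow> F x = f x" "x \<in> \<Omega>"
  shows "cont_rep \<Omega> f x = F x"
proof -
  have "continuous_on \<Omega> (cont_rep \<Omega> f) \<and> (AE x in lborel. x \<in> \<Omega> \<longrightarrow> cont_rep \<Omega> f x = f x)"
    unfolding cont_rep_def by (rule someI[of _ F]) (use assms in auto)
  then have "continuous_on \<Omega> (cont_rep \<Omega> f)" "AE x in lborel. x \<in> \<Omega> \<longrightarrow> cont_rep \<Omega> f x = F x"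
    using assms(3) by (auto elim!: eventually_elim2)
  then show ?thesis using AE_eq_continuous_imp_eq[OF assms(1) _ assms(2) _ assms(4)] by blast
qed

lemma test_deriv: "\<phi> \<in> test_functions \<Omega> \<Longrightarrow> deriv \<phi> \<in> test_functions \<Omega>"
  unfolding test_functions_iff using smooth_deriv deriv_eq_0_outside compact_imp_closed by meson

lemma test_L2:
  assumes \<phi>: "\<phi> \<in> test_functions UNIV" shows "\<phi> \<in> L2 UNIV"
proof -
  have s: "smooth \<phi>" using \<phi> by (simp add: test_functions_iff)
  obtain a b where ab: "\<And>x. x \<notin> {a<..<b} \<Longrightarrow> \<phi> x = 0"
    using test_function_support[OF \<phi>] by (metis UNIV_I empty_not_UNIV open_UNIV)
  have c: "continuous_on UNIV \<phi>" by (rule smooth_continuous[OF s])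
  have "integrable lborel (\<lambda>x. \<phi> x * \<phi> x)"
    by (rule integrable_compact_support[OF c _ ab, of a b])
       (auto intro!: borel_integrable_atLeastAtMost' continuous_on_subset[OF c])
  moreover have "\<phi> \<in> borel_measurable borel" using c by (rule borel_measurable_continuous_onI)
  ultimately show ?thesis by (simp add: L2_UNIV_iff power2_eq_square)
qed

lemma L2_constant_zero:
  assumes h: "h \<in> L2 I" and k: "AE x in lborel. x \<in> I \<longrightarrow> h x = k" and I: "I \<in> sets borel" "emeasure lborel I = \<infinity>"
  shows "k = 0"
proof (rule ccontr)
  assume k0: "k \<noteq> 0"
  have i: "integrable lborel (\<lambda>x. (indicator I x * h x)\<^sup>2)"
    using h L2_iff L2_UNIV_square by blast
  have ae: "AE x in lborel. (indicator I x * h x)\<^sup>2 = k\<^sup>2 * (indicator I x :: real)"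
    using k by eventually_elim (auto simp: indicator_def)
  have "integrable lborel (\<lambda>x. k\<^sup>2 * indicator I x :: real)"
    by (rule integrable_cong_AE_imp[OF i _ ae]) (use I(1) in simp)
  then have "integrable lborel (indicator I :: real \<Rightarrow> real)" using k0 by (simp add: integrable_mult_left_iff)
  then show False using I by (simp add: integrable_indicator_iff)
qed

text \<open>
  Derivatives of test functions are test functions, so \<open>h\<close> is constant by \<open>du_Bois_Reymond\<close>; a
  nonzero constant is not square integrable on a set of infinite measure.
\<close>

lemma AE_0_if_orthogonal_to_tests:
  assumes I: "open I" "is_interval I" "emeasure lborel I = \<infinity>" and h: "h \<in> L2 I"
    and zero: "\<And>\<phi>. \<phi> \<in> test_functions I \<Longrightarrow> (LINT x:I|lborel. h x * \<phi> x) = 0"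
  shows "AE x in lborel. x \<in> I \<longrightarrow> h x = 0"
proof -
  obtain k where k: "AE x in lborel. x \<in> I \<longrightarrow> h x = k"
    using du_Bois_Reymond[OF I(1,2) L2_set_integrable_Icc[OF h Icc_subset_interval[OF I(2)]] zero[OF test_deriv]] by blast
  have "k = 0" by (rule L2_constant_zero[OF h k _ I(3)]) (use I(1) in auto)
  then show ?thesis using k by simp
qed

lemma emeasure_half_lines: "emeasure lborel {0::real<..} = \<infinity>" "emeasure lborel {..<(0::real)} = \<infinity>"
proof -
  have "of_nat n \<le> emeasure lborel {0::real<..}" for n
  proof -
    have "emeasure lborel {0<..real n} \<le> emeasure lborel {0::real<..}" by (rule emeasure_mono) auto
    then show ?thesis by (simp add: ennreal_of_nat_eq_real_of_nat)
  qed
  then show "emeasure lborel {0::real<..} = \<infinity>"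
    using ennreal_Ex_less_of_nat[of "emeasure lborel {0::real<..}"] by (metis infinity_ennreal_def leD top.not_eq_extremum)
  have "of_nat n \<le> emeasure lborel {..<(0::real)}" for n
  proof -
    have "emeasure lborel {- real n..<0} \<le> emeasure lborel {..<(0::real)}" by (rule emeasure_mono) auto
    then show ?thesis by (simp add: ennreal_of_nat_eq_real_of_nat)
  qed
  then show "emeasure lborel {..<(0::real)} = \<infinity>"
    using ennreal_Ex_less_of_nat[of "emeasure lborel {..<(0::real)}"] by (metis infinity_ennreal_def leD top.not_eq_extremum)
qed

section \<open>The Sobolev space as a subspace of the Hilbert space\<close>

text \<open>
  The weak derivative on the line as a relation between almost-everywhere classes. It is
  closed, since it consists of identities between inner products.
\<close>

definition is_l2_deriv :: "l2 \<Rightarrow> l2 \<Rightarrow> bool" where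
  "is_l2_deriv a b \<longleftrightarrow> (\<forall>\<phi>\<in>test_functions UNIV. inner a (class_of (deriv \<phi>)) = - inner b (class_of \<phi>))"

lemma class_of_inner: "f \<in> L2 UNIV \<Longrightarrow> g \<in> L2 UNIV \<Longrightarrow> inner (class_of f) (class_of g) = (LINT x|lborel. f x * g x)"
  by (rule class_of_arith(4))

lemma is_l2_deriv_iff:
  assumes "f \<in> L2 UNIV" "d \<in> L2 UNIV"
  shows "is_l2_deriv (class_of f) (class_of d) \<longleftrightarrow> has_weak_deriv UNIV f d"
  unfolding is_l2_deriv_def has_weak_deriv_def set_lebesgue_integral_def
  by (intro ball_cong refl) (simp add: class_of_inner assms test_L2 test_deriv)

lemma l2_total:
  assumes "\<And>\<phi>. \<phi> \<in> test_functions UNIV \<Longrightarrow> inner h (class_of \<phi>) = 0"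
  shows "h = 0"
proof -
  have "AE x in lborel. x \<in> UNIV \<longrightarrow> fun_of h x = 0"
  proof (rule AE_0_if_orthogonal_to_tests)
    show "emeasure lborel (UNIV :: real set) = \<infinity>" by simp
    fix \<phi> assume "\<phi> \<in> test_functions UNIV"
    then show "(LINT x:UNIV|lborel. fun_of h x * \<phi> x) = 0"
      using assms[of \<phi>] class_of_inner[OF fun_of_L2[of h] test_L2[of \<phi>]] by (simp add: set_lebesgue_integral_def)
  qed auto
  then have "class_of (fun_of h) = class_of (\<lambda>x. 0)"
    by (subst class_of_eq_iff) (auto simp: L2_UNIV_0)
  moreover have "class_of (\<lambda>x. 0) = 0" by (simp add: class_of_def zero_l2.abs_eq)
  ultimately show ?thesis by simp
qed

lemma is_l2_deriv_unique: "is_l2_deriv a b \<Longrightarrow> is_l2_deriv a b' \<Longrightarrow> b = b'"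
  using l2_total[of "b - b'"] by (simp add: is_l2_deriv_def inner_diff_left)

definition V\<^sub>1 :: "l2 set" where "V\<^sub>1 = {a. \<exists>b. is_l2_deriv a b}"

definition l2_deriv :: "l2 \<Rightarrow> l2" where "l2_deriv a = (THE b. is_l2_deriv a b)"

lemma D_eqI: "is_l2_deriv a b \<Longrightarrow> a \<in> V\<^sub>1 \<and> l2_deriv a = b"
  unfolding V\<^sub>1_def l2_deriv_def using is_l2_deriv_unique by blast

lemma D_rel: "a \<in> V\<^sub>1 \<Longrightarrow> is_l2_deriv a (l2_deriv a)"
  unfolding V\<^sub>1_def using D_eqI by auto

lemma is_l2_deriv_add: "is_l2_deriv a b \<Longrightarrow> is_l2_deriv a' b' \<Longrightarrow> is_l2_deriv (a + a') (b + b')"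
  and is_l2_deriv_scale: "is_l2_deriv a b \<Longrightarrow> is_l2_deriv (c *\<^sub>R a) (c *\<^sub>R b)"
  by (simp_all add: is_l2_deriv_def inner_add_left)

lemma V\<^sub>1_add: "a \<in> V\<^sub>1 \<Longrightarrow> b \<in> V\<^sub>1 \<Longrightarrow> a + b \<in> V\<^sub>1 \<and> l2_deriv (a + b) = l2_deriv a + l2_deriv b"
  using D_eqI[OF is_l2_deriv_add[OF D_rel D_rel]] .

lemma V\<^sub>1_scale: "a \<in> V\<^sub>1 \<Longrightarrow> c *\<^sub>R a \<in> V\<^sub>1 \<and> l2_deriv (c *\<^sub>R a) = c *\<^sub>R l2_deriv a"
  using D_eqI[OF is_l2_deriv_scale[OF D_rel]] .

lemma V\<^sub>1_diff: "a \<in> V\<^sub>1 \<Longrightarrow> b \<in> V\<^sub>1 \<Longrightarrow> a - b \<in> V\<^sub>1 \<and> l2_deriv (a - b) = l2_deriv a - l2_deriv b"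
  using V\<^sub>1_add[of a "- 1 *\<^sub>R b"] V\<^sub>1_scale[of b "- 1"] by simp

lemma subspace_V\<^sub>1: "subspace V\<^sub>1"
proof -
  have "is_l2_deriv 0 0" by (simp add: is_l2_deriv_def)
  then show ?thesis using V\<^sub>1_add V\<^sub>1_scale D_eqI by (simp add: subspace_def)
qed

lemma H1_iff: "f \<in> H1 \<longleftrightarrow> f \<in> L2 UNIV \<and> (\<exists>d\<in>L2 UNIV. has_weak_deriv UNIV f d)"
  by (simp add: numeral_eq_Suc)

lemma weak_deriv_spec:
  assumes "d \<in> L2 \<Omega>" "has_weak_deriv \<Omega> f d"
  shows "weak_deriv \<Omega> f \<in> L2 \<Omega>" "has_weak_deriv \<Omega> f (weak_deriv \<Omega> f)"
  using someI[of "\<lambda>f'. f' \<in> L2 \<Omega> \<and> has_weak_deriv \<Omega> f f'" d] assms unfolding weak_deriv_def by auto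

lemma H1_class:
  assumes "f \<in> H1"
  shows "f \<in> L2 UNIV" "class_of f \<in> V\<^sub>1" "l2_deriv (class_of f) = class_of (weak_deriv UNIV f)" 
    "weak_deriv UNIV f \<in> L2 UNIV" "has_weak_deriv UNIV f (weak_deriv UNIV f)"
proof -
  show f: "f \<in> L2 UNIV" using assms H1_iff by blast
  show d: "weak_deriv UNIV f \<in> L2 UNIV" and wd: "has_weak_deriv UNIV f (weak_deriv UNIV f)"
    using assms H1_iff weak_deriv_spec by blast+
  show "class_of f \<in> V\<^sub>1" "l2_deriv (class_of f) = class_of (weak_deriv UNIV f)"
    using D_eqI[OF is_l2_deriv_iff[OF f d, THEN iffD2, OF wd]] by auto
qed

lemma H1I: "f \<in> L2 UNIV \<Longrightarrow> class_of f \<in> V\<^sub>1 \<Longrightarrow> f \<in> H1"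
  using is_l2_deriv_iff[of f "fun_of (l2_deriv (class_of f))"] D_rel[of "class_of f"] unfolding H1_iff by force

lemma H1_norm_class:
  assumes "f \<in> H1" shows "H1_norm f = sqrt ((norm (class_of f))\<^sup>2 + (norm (l2_deriv (class_of f)))\<^sup>2)"
  using H1_class[OF assms] by (simp add: H1_norm_def norm_class_of)

lemma test_V\<^sub>1:
  assumes \<phi>: "\<phi> \<in> test_functions UNIV"
  shows "class_of \<phi> \<in> V\<^sub>1" "l2_deriv (class_of \<phi>) = class_of (deriv \<phi>)"
proof -
  have s: "smooth \<phi>" using \<phi> by (simp add: test_functions_iff)
  have P: "primitive_on UNIV \<phi> (deriv \<phi>)"
    by (rule primitive_on_C1[OF smooth_DERIV[OF s] smooth_continuous[OF smooth_deriv[OF s]]])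
  have "has_weak_deriv UNIV \<phi> (deriv \<phi>)"
    unfolding has_weak_deriv_def using primitive_test_by_parts[OF P _ _ _ order.refl] by simp
  then have "is_l2_deriv (class_of \<phi>) (class_of (deriv \<phi>))"
    using is_l2_deriv_iff test_L2 test_deriv \<phi> by blast
  then show "class_of \<phi> \<in> V\<^sub>1" "l2_deriv (class_of \<phi>) = class_of (deriv \<phi>)" using D_eqI by auto
qed

definition cont :: "l2 \<Rightarrow> real \<Rightarrow> real" where "cont a = cont_rep UNIV (fun_of a)"

lemma cont_eqI:
  assumes "continuous_on UNIV F" "AE x in lborel. F x = fun_of a x"
  shows "cont a = F"
  using cont_rep_eq[of UNIV F "fun_of a"] assms by (auto simp: cont_def)

lemma cont:
  assumes a: "a \<in> V\<^sub>1"
  shows "primitive_on UNIV (cont a) (fun_of (l2_deriv a))" "AE x in lborel. cont a x = fun_of a x" 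
    "continuous_on UNIV (cont a)" "cont a \<in> L2 UNIV" "class_of (cont a) = a"
proof -
  have "has_weak_deriv UNIV (fun_of a) (fun_of (l2_deriv a))"
    using is_l2_deriv_iff[of "fun_of a" "fun_of (l2_deriv a)"] D_rel[OF a] by simp
  then obtain F where F: "primitive_on UNIV F (fun_of (l2_deriv a))" "AE x in lborel. F x = fun_of a x"
    using weak_deriv_primitive[of "fun_of a" UNIV "fun_of (l2_deriv a)" UNIV] by auto
  have c: "continuous_on UNIV F" by (rule primitive_on_continuous[OF F(1)]) auto
  have "cont a = F" by (rule cont_eqI[OF c F(2)])
  then show 1: "primitive_on UNIV (cont a) (fun_of (l2_deriv a))" "AE x in lborel. cont a x = fun_of a x" "continuous_on UNIV (cont a)"
    using F c by auto
  have m: "cont a \<in> borel_measurable borel" using 1(3) by (rule borel_measurable_continuous_onI)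
  have fm: "fun_of a \<in> borel_measurable borel" using fun_of_L2 by (rule L2_UNIV_measurable)
  have "integrable lborel (\<lambda>x. (cont a x)\<^sup>2)"
  proof (rule integrable_cong_AE_imp[OF L2_UNIV_square[OF fun_of_L2[of a]]])
    show "AE x in lborel. (fun_of a x)\<^sup>2 = (cont a x)\<^sup>2" using 1(2) by eventually_elim simp
  qed (use m in simp)
  then show L: "cont a \<in> L2 UNIV" using m by (simp add: L2_UNIV_iff)
  show "class_of (cont a) = a"
    using class_of_eq_iff[OF L fun_of_L2[of a]] 1(2) by simp
qed

lemma cont_unique: 
  assumes "continuous_on UNIV F" "F \<in> L2 UNIV" "class_of F = a" shows "cont a = F"
  using fun_of_class_of[OF assms(2)] assms(3) by (intro cont_eqI[OF assms(1)]) (auto simp: eq_commute)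

lemma cont_add: "a \<in> V\<^sub>1 \<Longrightarrow> b \<in> V\<^sub>1 \<Longrightarrow> cont (a + b) = (\<lambda>x. cont a x + cont b x)"
  using cont[of a] cont[of b] by (intro cont_unique continuous_on_add L2_UNIV_add) (auto simp: class_of_arith(1)[symmetric])

lemma cont_scale: "a \<in> V\<^sub>1 \<Longrightarrow> cont (c *\<^sub>R a) = (\<lambda>x. c * cont a x)"
  using cont[of a] by (intro cont_unique continuous_intros L2_UNIV_cmult) (auto simp: class_of_arith(3)[symmetric])

lemma cont_class_of:
  assumes "f \<in> H1" shows "AE x in lborel. cont (class_of f) x = f x" "cont (class_of f) = cont_rep UNIV f"
proof -
  show ae: "AE x in lborel. cont (class_of f) x = f x"
    using cont(2)[OF H1_class(2)[OF assms]] fun_of_class_of[OF H1_class(1)[OF assms]] by eventually_elim simp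
  show "cont (class_of f) = cont_rep UNIV f"
    using cont_rep_eq[of UNIV "cont (class_of f)" f] cont(3)[OF H1_class(2)[OF assms]] ae by auto
qed

text \<open>
  The reflection of \<open>primitive_on_half_line_integral\<close>.
\<close>

lemma left_half_line_integral:
  assumes h: "primitive_on {..a} h k" and int_h: "set_integrable lborel {..a} h" and int_k: "set_integrable lborel {..a} k"
  shows "(LINT x:{..a}|lborel. k x) = h a"
proof -
  have refl: "set_integrable lborel {- a..} (\<lambda>x. f (- x)) \<and> (LINT x:{- a..}|lborel. f (- x)) = (LINT x:{..a}|lborel. f x)"
    if "set_integrable lborel {..a} f" for f :: "real \<Rightarrow> real"
  proof -
    have i: "integrable lborel (\<lambda>x. indicator {..a} x *\<^sub>R f x)" using that by (simp add: set_integrable_def)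
    have ind: "indicator {..a} (0 + (- 1) * s) = (indicator {- a..} s :: real)" for s by (auto simp: indicator_def)
    show ?thesis
      using lborel_integrable_real_affine[OF i, of "- 1" 0] lborel_integral_real_affine[of "- 1" "\<lambda>x. indicator {..a} x *\<^sub>R f x" 0]
      unfolding ind by (simp add: set_integrable_def set_lebesgue_integral_def)
  qed
  have "uminus ` {..a} = {- a..}" by (auto intro: image_eqI[of _ uminus "- _"])
  then have "primitive_on {- a..} (\<lambda>x. h (- x)) (\<lambda>x. - k (- x))" using primitive_on_reflect[OF h] by simp
  then have "(LINT x:{- a..}|lborel. - k (- x)) = - h (- (- a))"
    by (rule primitive_on_half_line_integral) (use refl[OF int_h] refl[OF int_k] in \<open>auto simp: set_integrable_def\<close>)
  then show ?thesis using refl[OF int_k] by (simp add: set_lebesgue_integral_def)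
qed

text \<open>
  \<open>u(x)\<^sup>2\<close> is the integral of \<open>2 u u'\<close> over the left half-line at \<open>x\<close> and minus the integral over the
  right one. Adding both halves the constant; the factor \<open>1\<close> reached in this way is what the
  condition \<open>Z\<^sup>2 / 4 < - w\<close> requires.
\<close>

lemma cont_square_le:
  assumes a: "a \<in> V\<^sub>1"
  shows "(cont a x)\<^sup>2 \<le> norm a * norm (l2_deriv a)"
proof -
  let ?F = "cont a" and ?d = "fun_of (l2_deriv a)"
  define k where "k = (\<lambda>x. ?F x * ?d x + ?F x * ?d x)"
  have P: "primitive_on UNIV (\<lambda>x. ?F x * ?F x) k"
    unfolding k_def by (rule primitive_on_mult[OF cont(1)[OF a] cont(1)[OF a]]) simp
  have iF: "integrable lborel (\<lambda>x. ?F x * ?F x)" by (intro L2_UNIV_mult cont a)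
  have ik: "integrable lborel k" unfolding k_def by (intro Bochner_Integration.integrable_add L2_UNIV_mult[OF cont(4)[OF a] fun_of_L2])
  have si: "set_integrable lborel A f" if "integrable lborel f" "A \<in> sets borel" for A and f :: "real \<Rightarrow> real"
    using that unfolding set_integrable_def by (intro integrable_mult_indicator) auto
  have r: "(LINT x:{x..}|lborel. k x) = - (?F x * ?F x)"
    by (rule primitive_on_half_line_integral[OF primitive_on_subset[OF P] si[OF iF] si[OF ik]]) auto
  have l: "(LINT x:{..x}|lborel. k x) = ?F x * ?F x"
    by (rule left_half_line_integral[OF primitive_on_subset[OF P] si[OF iF] si[OF ik]]) auto
  have i: "set_integrable lborel {x..} k" "set_integrable lborel {..x} k" by (rule si[OF ik], simp)+
  have "2 * (?F x * ?F x) = (LINT y|lborel. indicator {..x} y *\<^sub>R k y - indicator {x..} y *\<^sub>R k y)"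
    using l r i by (subst Bochner_Integration.integral_diff) (auto simp: set_integrable_def set_lebesgue_integral_def)
  also have "\<dots> \<le> (LINT y|lborel. 2 * (\<bar>?F y\<bar> * \<bar>?d y\<bar>))"
  proof (rule integral_mono_AE)
    show "integrable lborel (\<lambda>y. indicator {..x} y *\<^sub>R k y - indicator {x..} y *\<^sub>R k y)"
      using i by (auto simp: set_integrable_def)
    have "integrable lborel (\<lambda>y. \<bar>?F y * ?d y\<bar>)" by (intro integrable_abs L2_UNIV_mult[OF cont(4)[OF a] fun_of_L2])
    then show "integrable lborel (\<lambda>y. 2 * (\<bar>?F y\<bar> * \<bar>?d y\<bar>))" by (simp add: abs_mult)
    have "indicator {..x} y *\<^sub>R k y - indicator {x..} y *\<^sub>R k y \<le> 2 * \<bar>?F y * ?d y\<bar>" for y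
      by (auto simp: indicator_def abs_if k_def)
    then show "AE y in lborel. indicator {..x} y *\<^sub>R k y - indicator {x..} y *\<^sub>R k y \<le> 2 * (\<bar>?F y\<bar> * \<bar>?d y\<bar>)"
      by (simp add: abs_mult)
  qed
  also have "\<dots> = 2 * inner (class_of (\<lambda>y. \<bar>?F y\<bar>)) (class_of (\<lambda>y. \<bar>?d y\<bar>))"
  proof -
    have absL: "(\<lambda>y. \<bar>f y\<bar>) \<in> L2 UNIV" if "f \<in> L2 UNIV" for f
      using that by (intro L2_UNIV_bound[OF that]) (auto dest: L2_UNIV_measurable)
    show ?thesis using absL[OF cont(4)[OF a]] absL[OF fun_of_L2[of "l2_deriv a"]] by (simp add: class_of_inner)
  qed
  also have "\<dots> \<le> 2 * (norm (class_of (\<lambda>y. \<bar>?F y\<bar>)) * norm (class_of (\<lambda>y. \<bar>?d y\<bar>)))"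
    using norm_cauchy_schwarz by (intro mult_left_mono) auto
  also have "\<dots> = 2 * (norm a * norm (l2_deriv a))"
  proof -
    have n: "norm (class_of (\<lambda>y. \<bar>f y\<bar>)) = norm (class_of f)" if "f \<in> L2 UNIV" for f
    proof -
      have "(\<lambda>y. \<bar>f y\<bar>) \<in> L2 UNIV" using that by (intro L2_UNIV_bound[OF that]) (auto dest: L2_UNIV_measurable)
      then show ?thesis using that by (simp add: norm_class_of L2_norm_on_def)
    qed
    show ?thesis using n[OF cont(4)[OF a]] n[OF fun_of_L2[of "l2_deriv a"]] cont(5)[OF a] by simp
  qed
  finally show ?thesis by (simp add: power2_eq_square)
qed

definition form :: "real \<Rightarrow> real \<Rightarrow> l2 \<Rightarrow> l2 \<Rightarrow> real" where
  "form Z w a b = inner (l2_deriv a) (l2_deriv b) - Z * cont a 0 * cont b 0 - w * inner a b"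

lemma form_upper:
  assumes a: "a \<in> V\<^sub>1"
  shows "form Z w a a \<le> (1 + \<bar>Z\<bar> + \<bar>w\<bar>) * ((norm a)\<^sup>2 + (norm (l2_deriv a))\<^sup>2)"
proof -
  let ?x = "norm (l2_deriv a)" and ?y = "norm a"
  have c: "(cont a 0)\<^sup>2 \<le> ?y\<^sup>2 + ?x\<^sup>2"
  proof -
    have "0 \<le> ?y * ?x" by simp
    then show ?thesis using cont_square_le[OF a, of 0] sum_squares_bound[of ?y ?x] by linarith
  qed
  have "form Z w a a = ?x\<^sup>2 - Z * (cont a 0)\<^sup>2 - w * ?y\<^sup>2"
    unfolding form_def power2_norm_eq_inner by (simp add: power2_eq_square)
  moreover have "- Z * (cont a 0)\<^sup>2 \<le> \<bar>Z\<bar> * (?y\<^sup>2 + ?x\<^sup>2)"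
    using mult_mono[OF abs_ge_minus_self[of Z] c] by simp
  moreover have "- w * ?y\<^sup>2 \<le> \<bar>w\<bar> * ?y\<^sup>2" by (intro mult_right_mono) auto
  moreover have "0 \<le> \<bar>w\<bar> * ?x\<^sup>2" "0 \<le> ?y\<^sup>2" by (simp_all only: mult_nonneg_nonneg abs_ge_zero zero_le_power2)
  ultimately show ?thesis by (simp only: distrib_left distrib_right mult_1_left mult_minus_left)
qed

text \<open>
  With \<open>x = \<parallel>u'\<parallel>\<close> and \<open>y = \<parallel>u\<parallel>\<close> the form is at least \<open>x\<^sup>2 - max Z 0 * x y - w y\<^sup>2\<close>. The value of \<open>\<theta>\<close>
  solves the discriminant condition \<open>(max Z 0)\<^sup>2 = 4 (1 - \<theta>) (- w - \<theta>)\<close> up to its term \<open>4 \<theta>\<^sup>2\<close>, which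
  has the favourable sign.
\<close>

lemma form_coercive:
  assumes a: "a \<in> V\<^sub>1" and Z: "(max Z 0)\<^sup>2 / 4 < - w"
  defines "\<theta> \<equiv> (- 4 * w - (max Z 0)\<^sup>2) / (4 * (1 - w))"
  shows "\<theta> * ((norm a)\<^sup>2 + (norm (l2_deriv a))\<^sup>2) \<le> form Z w a a" "0 < \<theta>"
proof -
  let ?x = "norm (l2_deriv a)" and ?y = "norm a" and ?Z = "max Z 0"
  have w: "0 < - w" using Z zero_le_power2[of ?Z] by linarith
  show pos: "0 < \<theta>" unfolding \<theta>_def using Z w by (intro divide_pos_pos) auto
  have "\<theta> * (4 * (1 - w)) = - 4 * w - ?Z\<^sup>2" unfolding \<theta>_def using w by (subst nonzero_eq_divide_eq[symmetric]) auto
  then have th: "4 * \<theta> * (1 - w) = - 4 * w - ?Z\<^sup>2" by (simp only: ac_simps)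
  have th1: "\<theta> < 1"
  proof -
    have "4 * \<theta> * (1 - w) < 4 * 1 * (1 - w)" unfolding th using zero_le_power2[of ?Z] by (simp only: right_diff_distrib)
    then have "\<theta> * (4 * (1 - w)) < 1 * (4 * (1 - w))" by (simp only: ac_simps)
    then show ?thesis by (rule mult_right_less_imp_less) (use w in simp)
  qed
  have "form Z w a a = ?x\<^sup>2 - Z * (cont a 0)\<^sup>2 - w * ?y\<^sup>2"
    unfolding form_def power2_norm_eq_inner by (simp add: power2_eq_square)
  moreover have "Z * (cont a 0)\<^sup>2 \<le> ?Z * (?y * ?x)"
    using mult_mono[of Z ?Z "(cont a 0)\<^sup>2" "?y * ?x"] cont_square_le[OF a, of 0] by simp
  ultimately have low: "?x\<^sup>2 - ?Z * (?y * ?x) - w * ?y\<^sup>2 \<le> form Z w a a" by simp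
  have "0 \<le> (2 * (1 - \<theta>) * ?x - ?Z * ?y)\<^sup>2 + 4 * \<theta>\<^sup>2 * ?y\<^sup>2" by (intro add_nonneg_nonneg) auto
  also have "\<dots> = 4 * (1 - \<theta>) * ((1 - \<theta>) * ?x\<^sup>2 - ?Z * (?y * ?x)) + (?Z\<^sup>2 + 4 * \<theta>\<^sup>2) * ?y\<^sup>2"
    by (simp add: power2_eq_square algebra_simps)
  also have "?Z\<^sup>2 + 4 * \<theta>\<^sup>2 = 4 * (1 - \<theta>) * (- w - \<theta>)"
    using th by (simp add: power2_eq_square algebra_simps)
  finally have "0 \<le> 4 * (1 - \<theta>) * ((1 - \<theta>) * ?x\<^sup>2 - ?Z * (?y * ?x) + (- w - \<theta>) * ?y\<^sup>2)"
    by (simp add: algebra_simps)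
  then have "0 \<le> (1 - \<theta>) * ?x\<^sup>2 - ?Z * (?y * ?x) + (- w - \<theta>) * ?y\<^sup>2"
    using th1 by (simp add: zero_le_mult_iff)
  then show "\<theta> * (?y\<^sup>2 + ?x\<^sup>2) \<le> form Z w a a" using low by (simp add: algebra_simps)
qed

text \<open>
  Completeness: a Cauchy sequence for the form converges in \<open>L\<^sup>2\<close> together with its derivatives,
  and the relation \<open>is_l2_deriv\<close> is closed.
\<close>

lemma coercive_form_form:
  assumes Z: "(max Z 0)\<^sup>2 / 4 < - w"
  shows "coercive_form V\<^sub>1 (form Z w) ((- 4 * w - (max Z 0)\<^sup>2) / (4 * (1 - w)))"
proof -
  define \<theta> where "\<theta> = (- 4 * w - (max Z 0)\<^sup>2) / (4 * (1 - w))"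
  have co: "\<theta> * ((norm a)\<^sup>2 + (norm (l2_deriv a))\<^sup>2) \<le> form Z w a a" if "a \<in> V\<^sub>1" for a
    using form_coercive(1)[OF that Z] by (simp add: \<theta>_def)
  have zero: "0 \<in> V\<^sub>1" using subspace_V\<^sub>1 by (rule subspace_0)
  have \<theta>: "0 < \<theta>" using form_coercive(2)[OF zero Z] by (simp add: \<theta>_def)
  have "coercive_form V\<^sub>1 (form Z w) \<theta>"
  proof (rule coercive_form.intro)
    show "0 < \<theta>" by (rule \<theta>)
    show "subspace V\<^sub>1" by (rule subspace_V\<^sub>1)
    show "form Z w u v = form Z w v u" for u v by (simp add: form_def inner_commute)
    show "form Z w (u + u') v = form Z w u v + form Z w u' v" if "u \<in> V\<^sub>1" "u' \<in> V\<^sub>1" "v \<in> V\<^sub>1" for u u' v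
      using that by (simp add: form_def V\<^sub>1_add cont_add inner_add_left algebra_simps)
    show "form Z w (c *\<^sub>R u) v = c * form Z w u v" if "u \<in> V\<^sub>1" "v \<in> V\<^sub>1" for u v c
      using that by (simp add: form_def V\<^sub>1_scale cont_scale algebra_simps)
    show "\<theta> * (norm v)\<^sup>2 \<le> form Z w v v" if "v \<in> V\<^sub>1" for v
    proof -
      have "\<theta> * (norm v)\<^sup>2 \<le> \<theta> * ((norm v)\<^sup>2 + (norm (l2_deriv v))\<^sup>2)" using \<theta> by (intro mult_left_mono) auto
      then show ?thesis using co[OF that] by linarith
    qed
    show "h = 0" if "\<And>v. v \<in> V\<^sub>1 \<Longrightarrow> inner h v = 0" for h
      using l2_total[of h] that test_V\<^sub>1(1) by blast
    fix x :: "nat \<Rightarrow> l2" assume x: "\<And>n. x n \<in> V\<^sub>1"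
      and C: "\<And>\<epsilon>. 0 < \<epsilon> \<Longrightarrow> \<exists>N. \<forall>m\<ge>N. \<forall>n\<ge>N. form Z w (x m - x n) (x m - x n) < \<epsilon>"
    have small: "(norm (x m - x n))\<^sup>2 + (norm (l2_deriv (x m) - l2_deriv (x n)))\<^sup>2 \<le> form Z w (x m - x n) (x m - x n) / \<theta>" for m n
      using co[of "x m - x n"] V\<^sub>1_diff[OF x x, of m n] \<theta> by (simp add: field_simps)
    have "Cauchy x \<and> Cauchy (\<lambda>n. l2_deriv (x n))"
    proof -
      have "\<exists>N. \<forall>m\<ge>N. \<forall>n\<ge>N. norm (x m - x n) < e \<and> norm (l2_deriv (x m) - l2_deriv (x n)) < e" if e: "0 < e" for e
      proof -
        have "0 < \<theta> * e\<^sup>2" using \<theta> e by simp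
        then obtain N where N: "\<And>m n. N \<le> m \<Longrightarrow> N \<le> n \<Longrightarrow> form Z w (x m - x n) (x m - x n) < \<theta> * e\<^sup>2" using C by meson
        have "norm (x m - x n) < e \<and> norm (l2_deriv (x m) - l2_deriv (x n)) < e" if "N \<le> m" "N \<le> n" for m n
        proof -
          have "form Z w (x m - x n) (x m - x n) / \<theta> < e\<^sup>2" using N[OF that] \<theta> by (simp add: field_simps)
          then have "(norm (x m - x n))\<^sup>2 + (norm (l2_deriv (x m) - l2_deriv (x n)))\<^sup>2 < e\<^sup>2" using small[of m n] by linarith
          then have "(norm (x m - x n))\<^sup>2 < e\<^sup>2" "(norm (l2_deriv (x m) - l2_deriv (x n)))\<^sup>2 < e\<^sup>2"
            using zero_le_power2[of "norm (x m - x n)"] zero_le_power2[of "norm (l2_deriv (x m) - l2_deriv (x n))"] by linarith+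
          then show ?thesis using e by (auto intro: power_less_imp_less_base)
        qed
        then show ?thesis by blast
      qed
      then show ?thesis unfolding Cauchy_iff by meson
    qed
    then obtain a b where ab: "x \<longlonglongrightarrow> a" "(\<lambda>n. l2_deriv (x n)) \<longlonglongrightarrow> b"
      by (auto simp: Cauchy_convergent_iff convergent_def)
    have "is_l2_deriv a b"
      unfolding is_l2_deriv_def
    proof
      fix \<phi> assume "\<phi> \<in> test_functions UNIV"
      then have "inner (x n) (class_of (deriv \<phi>)) = - inner (l2_deriv (x n)) (class_of \<phi>)" for n
        using D_rel[OF x] by (simp add: is_l2_deriv_def)
      moreover have "(\<lambda>n. inner (x n) (class_of (deriv \<phi>))) \<longlonglongrightarrow> inner a (class_of (deriv \<phi>))"
        by (intro tendsto_intros ab)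
      moreover have "(\<lambda>n. - inner (l2_deriv (x n)) (class_of \<phi>)) \<longlonglongrightarrow> - inner b (class_of \<phi>)"
        by (intro tendsto_intros ab)
      ultimately show "inner a (class_of (deriv \<phi>)) = - inner b (class_of \<phi>)"
        using LIMSEQ_unique by auto
    qed
    then have a: "a \<in> V\<^sub>1" "l2_deriv a = b" using D_eqI by auto
    have "(\<lambda>n. form Z w (x n - a) (x n - a)) \<longlonglongrightarrow> 0"
    proof (rule Lim_null_comparison)
      show "\<forall>\<^sub>F n in sequentially. norm (form Z w (x n - a) (x n - a)) \<le> (1 + \<bar>Z\<bar> + \<bar>w\<bar>) * ((norm (x n - a))\<^sup>2 + (norm (l2_deriv (x n) - b))\<^sup>2)"
      proof (rule always_eventually, rule allI)
        fix n
        have "0 \<le> \<theta> * ((norm (x n - a))\<^sup>2 + (norm (l2_deriv (x n - a)))\<^sup>2)" using \<theta> by simp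
        then have "0 \<le> form Z w (x n - a) (x n - a)" using co[of "x n - a"] V\<^sub>1_diff[OF x a(1)] by (meson order_trans)
        then show "norm (form Z w (x n - a) (x n - a)) \<le> (1 + \<bar>Z\<bar> + \<bar>w\<bar>) * ((norm (x n - a))\<^sup>2 + (norm (l2_deriv (x n) - b))\<^sup>2)"
          using form_upper[of "x n - a" Z w] V\<^sub>1_diff[OF x a(1), of n] a(2) by simp
      qed
      have "(\<lambda>n. (1 + \<bar>Z\<bar> + \<bar>w\<bar>) * ((norm (x n - a))\<^sup>2 + (norm (l2_deriv (x n) - b))\<^sup>2)) \<longlonglongrightarrow> (1 + \<bar>Z\<bar> + \<bar>w\<bar>) * ((norm (a - a))\<^sup>2 + (norm (b - b))\<^sup>2)"
        by (intro tendsto_intros ab)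
      then show "(\<lambda>n. (1 + \<bar>Z\<bar> + \<bar>w\<bar>) * ((norm (x n - a))\<^sup>2 + (norm (l2_deriv (x n) - b))\<^sup>2)) \<longlonglongrightarrow> 0" by simp
    qed
    then show "\<exists>v\<in>V\<^sub>1. (\<lambda>n. form Z w (x n - v) (x n - v)) \<longlonglongrightarrow> 0" using a by blast
  qed
  then show ?thesis by (simp add: \<theta>_def)
qed

section \<open>The domain of the point interaction\<close>

text \<open>
  \<open>F\<close> is extended to \<open>0\<close> by its limit \<open>l\<close>; then the product of \<open>F\<close> and \<open>G\<close> is an indefinite integral on
  the closed half-line.
\<close>

lemma half_line_parts:
  assumes F: "primitive_on {0<..} F r" "F \<in> L2 {0<..}" "r \<in> L2 {0<..}"
    and G: "primitive_on UNIV G d" "G \<in> L2 UNIV" "d \<in> L2 UNIV"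
  shows "\<exists>l. (F \<longlongrightarrow> l) (at_right 0) \<and> (LINT x:{0<..}|lborel. F x * d x + G x * r x) = - l * G 0"
proof -
  define r' where "r' x = indicator {0<..} x * r x" for x
  have r': "r' \<in> L2 UNIV" unfolding r'_def[abs_def] using F(3) L2_iff by blast
  have ri: "set_integrable lborel {0<..b} r" for b
  proof -
    have "set_integrable lborel {0..b} r'" using L2_set_integrable_Icc[OF r'] by simp
    moreover have "indicator {0..b} x *\<^sub>R r' x = indicator {0<..b} x *\<^sub>R r x" for x by (auto simp: r'_def indicator_def)
    ultimately show ?thesis by (simp add: set_integrable_def)
  qed
  have lim: "((\<lambda>a. LINT s:{a..b}|lborel. r s) \<longlongrightarrow> (LINT s:{0<..b}|lborel. r s)) (at_right 0)" if "0 < b" for b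
    by (rule tendsto_set_lebesgue_integral_at_right) (use that ri in auto)
  define l where "l = F 1 - (LINT s:{0<..1}|lborel. r s)"
  have Fl: "(F \<longlongrightarrow> l) (at_right 0)"
  proof (rule Lim_transform_eventually)
    show "((\<lambda>a. F 1 - (LINT s:{a..1}|lborel. r s)) \<longlongrightarrow> l) (at_right 0)"
      unfolding l_def by (intro tendsto_intros lim) simp
    have "\<forall>\<^sub>F a in at_right 0. a \<in> {0<..<1::real}" by (rule eventually_at_right_real) simp
    then show "\<forall>\<^sub>F a in at_right 0. F 1 - (LINT s:{a..1}|lborel. r s) = F a"
      by eventually_elim (use primitive_onD(2)[OF F(1), of _ 1] in force)
  qed
  have Fy: "F y - l = (LINT s:{0<..y}|lborel. r s)" if y: "0 < y" for y
  proof (rule tendsto_unique[OF _ _ lim[OF y]])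
    show "((\<lambda>a. LINT s:{a..y}|lborel. r s) \<longlongrightarrow> F y - l) (at_right 0)"
    proof (rule Lim_transform_eventually)
      show "((\<lambda>a. F y - F a) \<longlongrightarrow> F y - l) (at_right 0)" by (intro tendsto_intros Fl)
      have "\<forall>\<^sub>F a in at_right 0. a \<in> {0<..<y}" by (rule eventually_at_right_real[OF y])
      then show "\<forall>\<^sub>F a in at_right 0. F y - F a = (LINT s:{a..y}|lborel. r s)"
        by eventually_elim (use primitive_onD(2)[OF F(1), of _ y] in force)
    qed
  qed simp
  \<comment> \<open>Changes at the single point \<open>0\<close> do not affect the integrals; \<open>pt\<close> below accounts for them.\<close>
  define F' where "F' x = (if 0 < x then F x else l)" for x
  have P: "primitive_on {0..} F' r'"
    unfolding primitive_on_def
  proof (intro ballI impI conjI)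
    fix x y :: real assume xy: "x \<in> {0..}" "y \<in> {0..}" "x \<le> y"
    show "set_integrable lborel {x..y} r'" using L2_set_integrable_Icc[OF r'] by simp
    show "F' y - F' x = (LINT s:{x..y}|lborel. r' s)"
    proof (cases "x = 0")
      case True
      have "(LINT s:{x..y}|lborel. r' s) = (LINT s:{0<..y}|lborel. r s)"
        unfolding set_lebesgue_integral_def True
        by (intro Bochner_Integration.integral_cong) (auto simp: r'_def indicator_def)
      then show ?thesis using Fy[of y] True xy by (cases "y = 0") (auto simp: F'_def set_lebesgue_integral_def)
    next
      case False
      then have x: "0 < x" using xy by simp
      have "(LINT s:{x..y}|lborel. r' s) = (LINT s:{x..y}|lborel. r s)"
        unfolding set_lebesgue_integral_def
        by (intro Bochner_Integration.integral_cong) (use x in \<open>auto simp: r'_def indicator_def\<close>)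
      then show ?thesis using primitive_onD(2)[OF F(1), of x y] x xy by (simp add: F'_def)
    qed
  qed
  define Fi where "Fi x = indicator {0<..} x * F x" for x
  have Fi: "Fi \<in> L2 UNIV" unfolding Fi_def[abs_def] using F(2) L2_iff by blast
  have prodP: "primitive_on {0..} (\<lambda>x. F' x * G x) (\<lambda>x. F' x * d x + G x * r' x)"
    by (rule primitive_on_mult[OF P primitive_on_subset[OF G(1)]]) auto
  have pt: "integrable lborel (\<lambda>x. c * indicator {0::real} x :: real)" "(LINT x|lborel. c * indicator {0::real} x :: real) = 0" for c :: real
  proof -
    have "integrable lborel (indicator {0::real} :: real \<Rightarrow> real)" by (rule integrable_real_indicator) auto
    then show "integrable lborel (\<lambda>x. c * indicator {0::real} x :: real)" by simp
    show "(LINT x|lborel. c * indicator {0::real} x :: real) = 0"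
    proof (rule integral_eq_zero_AE)
      show "AE x in lborel. c * indicator {0::real} x = (0::real)"
        by (rule eventually_mono[OF AE_lborel_singleton[of "0::real"]]) simp
    qed
  qed
  have "integrable lborel (\<lambda>x. Fi x * G x + (l * G 0) * indicator {0} x)"
    by (intro Bochner_Integration.integrable_add L2_UNIV_mult Fi G pt)
  moreover have "(\<lambda>x. Fi x * G x + (l * G 0) * indicator {0} x) = (\<lambda>x. indicator {0..} x *\<^sub>R (F' x * G x))"
    by (auto simp: Fi_def F'_def indicator_def)
  ultimately have i1: "set_integrable lborel {0..} (\<lambda>x. F' x * G x)" by (simp add: set_integrable_def)
  have A: "integrable lborel (\<lambda>x. Fi x * d x + G x * r' x)"
    by (intro Bochner_Integration.integrable_add L2_UNIV_mult Fi G r')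
  have eq: "(\<lambda>x. (Fi x * d x + G x * r' x) + (l * d 0) * indicator {0} x) = (\<lambda>x. indicator {0..} x *\<^sub>R (F' x * d x + G x * r' x))"
    by (auto simp: Fi_def F'_def r'_def indicator_def)
  have "integrable lborel (\<lambda>x. (Fi x * d x + G x * r' x) + (l * d 0) * indicator {0} x)"
    by (intro Bochner_Integration.integrable_add A pt)
  then have i2: "set_integrable lborel {0..} (\<lambda>x. F' x * d x + G x * r' x)"
    unfolding eq by (simp add: set_integrable_def)
  have "(LINT x:{0<..}|lborel. F x * d x + G x * r x) = (LINT x|lborel. Fi x * d x + G x * r' x)"
    unfolding set_lebesgue_integral_def by (intro Bochner_Integration.integral_cong) (auto simp: Fi_def r'_def indicator_def)
  also have "\<dots> = (LINT x|lborel. (Fi x * d x + G x * r' x) + (l * d 0) * indicator {0} x)"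
    by (subst Bochner_Integration.integral_add[OF A pt(1)]) (simp add: pt(2))
  also have "\<dots> = (LINT x:{0..}|lborel. F' x * d x + G x * r' x)"
    unfolding eq set_lebesgue_integral_def ..
  also have "\<dots> = - (F' 0 * G 0)"
    by (rule primitive_on_half_line_integral[OF prodP i1 i2])
  finally show ?thesis using Fl by (intro exI[of _ l]) (simp add: F'_def)
qed

lemma L2_reflect:
  assumes "f \<in> L2 (uminus ` \<Omega>)" shows "(\<lambda>x. f (- x)) \<in> L2 \<Omega>"
proof -
  let ?g = "\<lambda>x. indicator (uminus ` \<Omega>) x * f x"
  have g: "?g \<in> L2 UNIV" using assms L2_iff by blast
  have m[measurable]: "?g \<in> borel_measurable borel" using g by (rule L2_UNIV_measurable)
  have "(\<lambda>x. ?g (- x)) \<in> borel_measurable borel"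
    by (rule measurable_compose[OF _ m]) simp
  moreover have "integrable lborel (\<lambda>x. (?g (- x))\<^sup>2)"
    using lborel_integrable_real_affine[OF L2_UNIV_square[OF g], of "- 1" 0] by simp
  moreover have "indicator (uminus ` \<Omega>) (- x) = (indicator \<Omega> x :: real)" for x :: real
    by (auto simp: indicator_def)
  ultimately show ?thesis unfolding L2_iff[of _ \<Omega>] by (simp add: L2_UNIV_iff)
qed

lemma left_half_line_parts:
  assumes F: "primitive_on {..<0} F r" "F \<in> L2 {..<0}" "r \<in> L2 {..<0}"
    and G: "primitive_on UNIV G d" "G \<in> L2 UNIV" "d \<in> L2 UNIV"
  shows "\<exists>l. (F \<longlongrightarrow> l) (at_left 0) \<and> (LINT x:{..<0}|lborel. F x * d x + G x * r x) = l * G 0"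
proof -
  have im: "uminus ` {..<0::real} = {0<..}" "uminus ` {0<..} = {..<0::real}" "uminus ` (UNIV :: real set) = UNIV"
    by (auto intro: image_eqI[of _ uminus "- _"])
  have neg: "(\<lambda>x. - f x) \<in> L2 \<Omega>" if "f \<in> L2 \<Omega>" for f \<Omega>
    using L2_UNIV_cmult[of "\<lambda>x. indicator \<Omega> x * f x" "- 1"] that L2_iff[of f] L2_iff[of "\<lambda>x. - f x"] by simp
  obtain l where l: "((\<lambda>x. F (- x)) \<longlongrightarrow> l) (at_right 0)"
    "(LINT x:{0<..}|lborel. F (- x) * - d (- x) + G (- x) * - r (- x)) = - l * G (- 0)"
    using half_line_parts[of "\<lambda>x. F (- x)" "\<lambda>x. - r (- x)" "\<lambda>x. G (- x)" "\<lambda>x. - d (- x)"]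
      primitive_on_reflect[OF F(1)] primitive_on_reflect[OF G(1)]
      L2_reflect[of F "{0<..}"] neg[OF L2_reflect[of r "{0<..}"]] L2_reflect[of G UNIV] neg[OF L2_reflect[of d UNIV]] F G
    unfolding im by blast
  have "(F \<longlongrightarrow> l) (at_left 0)"
    using l(1) by (simp add: filterlim_at_left_to_right)
  moreover have "(LINT x:{..<0}|lborel. F x * d x + G x * r x) = l * G 0"
  proof -
    have ind: "indicator {..<0} (0 + (- 1) * s) = (indicator {0<..} s :: real)" for s :: real by (auto simp: indicator_def)
    have "(LINT x:{..<0}|lborel. F x * d x + G x * r x) = (LINT x:{0<..}|lborel. F (- x) * d (- x) + G (- x) * r (- x))"
      unfolding set_lebesgue_integral_def
      using lborel_integral_real_affine[of "- 1" "\<lambda>x. indicator {..<0} x *\<^sub>R (F x * d x + G x * r x)" 0]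
      unfolding ind by simp
    also have "\<dots> = - (LINT x:{0<..}|lborel. F (- x) * - d (- x) + G (- x) * - r (- x))"
    proof -
      have "(LINT x:{0<..}|lborel. F (- x) * - d (- x) + G (- x) * - r (- x)) = (LINT x:{0<..}|lborel. - (F (- x) * d (- x) + G (- x) * r (- x)))"
        by simp
      then show ?thesis by (simp only: set_lebesgue_integral_def scaleR_minus_right Bochner_Integration.integral_minus minus_minus)
    qed
    finally show ?thesis using l(2) by simp
  qed
  ultimately show ?thesis by blast
qed

abbreviation off0 :: "(real \<Rightarrow> real) \<Rightarrow> l2" where
  "off0 f \<equiv> class_of (\<lambda>x. indicator (- {0}) x * f x)"

lemma off0_L2: "f \<in> L2 (- {0}) \<Longrightarrow> (\<lambda>x. indicator (- {0}) x * f x) \<in> L2 UNIV"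
  using L2_iff by blast

lemma L2_indicator_measurable: "f \<in> L2 \<Omega> \<Longrightarrow> (\<lambda>x. indicator \<Omega> x * f x) \<in> borel_measurable borel"
  using L2_iff L2_UNIV_measurable by blast

lemma L2_subset: 
  assumes "f \<in> L2 \<Omega>" "I \<subseteq> \<Omega>" "I \<in> sets borel" shows "f \<in> L2 I"
proof -
  have "(\<lambda>x. indicator I x * (indicator \<Omega> x * f x)) \<in> L2 UNIV"
  proof (rule L2_UNIV_bound)
    show L: "(\<lambda>x. indicator \<Omega> x * f x) \<in> L2 UNIV" using assms(1) L2_iff by blast
    show "(\<lambda>x. indicator I x * (indicator \<Omega> x * f x)) \<in> borel_measurable borel"
      by (rule borel_measurable_times[OF _ L2_UNIV_measurable[OF L]]) (use assms(3) in simp)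
  qed (auto simp: indicator_def)
  moreover have "(\<lambda>x. indicator I x * (indicator \<Omega> x * f x)) = (\<lambda>x. indicator I x * f x)"
  proof
    fix x show "indicator I x * (indicator \<Omega> x * f x) = indicator I x * f x"
      using assms(2) by (cases "x \<in> I") auto
  qed
  ultimately show ?thesis using L2_iff by simp
qed

text \<open>
  Integration by parts on both half-lines. The two boundary terms at \<open>0\<close> combine to the jump of
  \<open>p\<close>, since \<open>v\<close> is continuous there.
\<close>

lemma weak_deriv_jump:
  assumes p: "p \<in> L2 (- {0})" and r: "r \<in> L2 (- {0})" and wd: "has_weak_deriv (- {0}) p r"
  shows "\<exists>lp lm. (cont_rep (- {0}) p \<longlongrightarrow> lp) (at_right 0) \<and> (cont_rep (- {0}) p \<longlongrightarrow> lm) (at_left 0) \<and>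
    (\<forall>v\<in>V\<^sub>1. inner (off0 p) (l2_deriv v) + inner (off0 r) v = - (lp - lm) * cont v 0)"
proof -
  have subs: "{0<..} \<subseteq> - {0::real}" "{..<0} \<subseteq> - {0::real}" by auto
  obtain F1 where F1: "primitive_on {0<..} F1 r" "AE x in lborel. x \<in> {0<..} \<longrightarrow> F1 x = p x"
    using weak_deriv_primitive[OF p r wd, of "{0<..}"] subs by (auto simp: is_interval_1)
  obtain F2 where F2: "primitive_on {..<0} F2 r" "AE x in lborel. x \<in> {..<0} \<longrightarrow> F2 x = p x"
    using weak_deriv_primitive[OF p r wd, of "{..<0}"] subs by (auto simp: is_interval_1)
  have c1: "continuous_on {0<..} F1" by (rule primitive_on_continuous[OF F1(1)]) (auto simp: is_interval_1)
  have c2: "continuous_on {..<0} F2" by (rule primitive_on_continuous[OF F2(1)]) (auto simp: is_interval_1)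
  define P where "P x = (if 0 < x then F1 x else F2 x)" for x
  have cP: "continuous_on (- {0}) P"
  proof -
    have "continuous_on ({0<..} \<union> {..<0}) (\<lambda>x. if 0 < x then F1 x else F2 x)"
      by (rule continuous_on_open_Un) (use c1 c2 in \<open>auto elim: continuous_on_eq\<close>)
    moreover have "{0<..} \<union> {..<0} = - {0::real}" by auto
    ultimately show ?thesis by (simp add: P_def[abs_def])
  qed
  have aeP: "AE x in lborel. x \<in> - {0} \<longrightarrow> P x = p x"
    using F1(2) F2(2) by eventually_elim (auto simp: P_def)
  have rep: "cont_rep (- {0}) p x = P x" if "x \<noteq> 0" for x
    by (rule cont_rep_eq[OF _ cP aeP]) (use that in auto)
  have L1: "F1 \<in> L2 {0<..}" and L2: "F2 \<in> L2 {..<0}"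
  proof -
    have gen: "F \<in> L2 I" if F: "continuous_on I F" "AE x in lborel. x \<in> I \<longrightarrow> F x = p x" and I: "I \<in> sets borel" "I \<subseteq> - {0}" for F I
    proof -
      have pI: "(\<lambda>x. indicator I x * p x) \<in> L2 UNIV" using L2_subset[OF p I(2,1)] L2_iff by blast
      have m: "(\<lambda>x. indicator I x * F x) \<in> borel_measurable borel"
        using borel_measurable_continuous_on_indicator[OF I(1) F(1)] by simp
      have "integrable lborel (\<lambda>x. (indicator I x * F x)\<^sup>2)"
      proof (rule integrable_cong_AE_imp[OF L2_UNIV_square[OF pI]])
        show "AE x in lborel. (indicator I x * p x)\<^sup>2 = (indicator I x * F x)\<^sup>2"
          using F(2) by eventually_elim (auto simp: indicator_def)
      qed (use m in simp)
      then show ?thesis unfolding L2_iff[of F] using m by (simp add: L2_UNIV_iff)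
    qed
    show "F1 \<in> L2 {0<..}" by (rule gen[OF c1 F1(2)]) auto
    show "F2 \<in> L2 {..<0}" by (rule gen[OF c2 F2(2)]) auto
  qed
  have r12: "r \<in> L2 {0<..}" "r \<in> L2 {..<0}" using L2_subset[OF r] subs by auto
  have one: "(\<lambda>x. 0) \<in> L2 UNIV" by (rule L2_UNIV_0)
  have zeroP: "primitive_on UNIV (\<lambda>x. 0) (\<lambda>x. 0)" by (simp add: primitive_on_def set_integrable_def set_lebesgue_integral_def)
  obtain lp where lp: "(F1 \<longlongrightarrow> lp) (at_right 0)" using half_line_parts[OF F1(1) L1 r12(1) zeroP one one] by blast
  obtain lm where lm: "(F2 \<longlongrightarrow> lm) (at_left 0)" using left_half_line_parts[OF F2(1) L2 r12(2) zeroP one one] by blast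
  have "inner (off0 p) (l2_deriv v) + inner (off0 r) v = - (lp - lm) * cont v 0" if v: "v \<in> V\<^sub>1" for v
  proof -
    note cv = cont(1)[OF v] cont(4)[OF v] fun_of_L2[of "l2_deriv v"]
    have right: "(LINT x:{0<..}|lborel. F1 x * fun_of (l2_deriv v) x + cont v x * r x) = - lp * cont v 0"
      using half_line_parts[OF F1(1) L1 r12(1) cv] tendsto_unique[OF _ lp] by fastforce
    have left: "(LINT x:{..<0}|lborel. F2 x * fun_of (l2_deriv v) x + cont v x * r x) = lm * cont v 0"
      using left_half_line_parts[OF F2(1) L2 r12(2) cv] tendsto_unique[OF _ lm] by fastforce
    let ?g = "\<lambda>x. indicator (- {0}) x * p x * fun_of (l2_deriv v) x + indicator (- {0}) x * r x * cont v x"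
    have ig: "integrable lborel ?g"
      by (intro Bochner_Integration.integrable_add L2_UNIV_mult off0_L2 p r cv)
    have gm: "?g \<in> borel_measurable lborel" using ig by (rule borel_measurable_integrable)
    have "inner (off0 p) (l2_deriv v) = (LINT x|lborel. indicator (- {0}) x * p x * fun_of (l2_deriv v) x)"
      using class_of_inner[OF off0_L2[OF p] fun_of_L2[of "l2_deriv v"]] by simp
    moreover have "inner (off0 r) v = (LINT x|lborel. indicator (- {0}) x * r x * cont v x)"
      using class_of_inner[OF off0_L2[OF r] cont(4)[OF v]] cont(5)[OF v] by simp
    ultimately have "inner (off0 p) (l2_deriv v) + inner (off0 r) v = (LINT x|lborel. ?g x)"
      using L2_UNIV_mult[OF off0_L2[OF p] fun_of_L2[of "l2_deriv v"]] L2_UNIV_mult[OF off0_L2[OF r] cont(4)[OF v]]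
      by (simp only: Bochner_Integration.integral_add)
    also have "\<dots> = (LINT x|lborel. indicator {0<..} x *\<^sub>R ?g x + indicator {..<0} x *\<^sub>R ?g x)"
      by (intro Bochner_Integration.integral_cong) (auto simp: indicator_def)
    also have "\<dots> = (LINT x:{0<..}|lborel. ?g x) + (LINT x:{..<0}|lborel. ?g x)"
      unfolding set_lebesgue_integral_def using ig
      by (intro Bochner_Integration.integral_add integrable_mult_indicator) auto
    also have "(LINT x:{0<..}|lborel. ?g x) = (LINT x:{0<..}|lborel. F1 x * fun_of (l2_deriv v) x + cont v x * r x)"
      unfolding set_lebesgue_integral_def
    proof (rule integral_cong_AE)
      show "AE x in lborel. indicator {0<..} x *\<^sub>R ?g x = indicator {0<..} x *\<^sub>R (F1 x * fun_of (l2_deriv v) x + cont v x * r x)"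
        using F1(2) by eventually_elim (auto simp: indicator_def)
      show "(\<lambda>x. indicator {0<..} x *\<^sub>R ?g x) \<in> borel_measurable lborel" using gm by (intro borel_measurable_scaleR) auto
      have "(\<lambda>x. (indicator {0<..} x * F1 x) * fun_of (l2_deriv v) x + cont v x * (indicator {0<..} x * r x)) \<in> borel_measurable borel"
        by (rule borel_measurable_add[OF borel_measurable_times[OF L2_indicator_measurable[OF L1] L2_UNIV_measurable[OF fun_of_L2]]
            borel_measurable_times[OF L2_UNIV_measurable[OF cont(4)[OF v]] L2_indicator_measurable[OF r12(1)]]])
      moreover have "(\<lambda>x. (indicator {0<..} x * F1 x) * fun_of (l2_deriv v) x + cont v x * (indicator {0<..} x * r x)) = (\<lambda>x. indicator {0<..} x *\<^sub>R (F1 x * fun_of (l2_deriv v) x + cont v x * r x))"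
        by (auto simp: algebra_simps)
      ultimately show "(\<lambda>x. indicator {0<..} x *\<^sub>R (F1 x * fun_of (l2_deriv v) x + cont v x * r x)) \<in> borel_measurable lborel" by simp
    qed
    also have "(LINT x:{..<0}|lborel. ?g x) = (LINT x:{..<0}|lborel. F2 x * fun_of (l2_deriv v) x + cont v x * r x)"
      unfolding set_lebesgue_integral_def
    proof (rule integral_cong_AE)
      show "AE x in lborel. indicator {..<0} x *\<^sub>R ?g x = indicator {..<0} x *\<^sub>R (F2 x * fun_of (l2_deriv v) x + cont v x * r x)"
        using F2(2) by eventually_elim (auto simp: indicator_def)
      show "(\<lambda>x. indicator {..<0} x *\<^sub>R ?g x) \<in> borel_measurable lborel" using gm by (intro borel_measurable_scaleR) auto
      have "(\<lambda>x. (indicator {..<0} x * F2 x) * fun_of (l2_deriv v) x + cont v x * (indicator {..<0} x * r x)) \<in> borel_measurable borel"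
        by (rule borel_measurable_add[OF borel_measurable_times[OF L2_indicator_measurable[OF L2] L2_UNIV_measurable[OF fun_of_L2]]
            borel_measurable_times[OF L2_UNIV_measurable[OF cont(4)[OF v]] L2_indicator_measurable[OF r12(2)]]])
      moreover have "(\<lambda>x. (indicator {..<0} x * F2 x) * fun_of (l2_deriv v) x + cont v x * (indicator {..<0} x * r x)) = (\<lambda>x. indicator {..<0} x *\<^sub>R (F2 x * fun_of (l2_deriv v) x + cont v x * r x))"
        by (auto simp: algebra_simps)
      ultimately show "(\<lambda>x. indicator {..<0} x *\<^sub>R (F2 x * fun_of (l2_deriv v) x + cont v x * r x)) \<in> borel_measurable lborel" by simp
    qed
    finally show ?thesis unfolding left right by (simp add: algebra_simps)
  qed
  moreover have "(cont_rep (- {0}) p \<longlongrightarrow> lp) (at_right 0)"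
    by (rule Lim_transform_eventually[OF lp]) (auto simp: eventually_at_filter rep P_def)
  moreover have "(cont_rep (- {0}) p \<longlongrightarrow> lm) (at_left 0)"
    by (rule Lim_transform_eventually[OF lm]) (auto simp: eventually_at_filter rep P_def)
  ultimately show ?thesis by blast
qed

lemma weak_deriv_off0_unique:
  assumes d: "d1 \<in> L2 (- {0})" "d2 \<in> L2 (- {0})" and wd: "has_weak_deriv (- {0}) f d1" "has_weak_deriv (- {0}) f d2"
  shows "AE x in lborel. d1 x = d2 x"
proof -
  have half: "AE x in lborel. x \<in> I \<longrightarrow> d1 x - d2 x = 0" if I: "I \<subseteq> - {0}" "open I" "is_interval I" "emeasure lborel I = \<infinity>" for I
  proof (rule AE_0_if_orthogonal_to_tests[OF I(2-4)])
    have dI: "d1 \<in> L2 I" "d2 \<in> L2 I" using L2_subset[OF _ I(1)] d I(2) by auto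
    then show "(\<lambda>x. d1 x - d2 x) \<in> L2 I"
      using L2_UNIV_diff[of "\<lambda>x. indicator I x * d1 x" "\<lambda>x. indicator I x * d2 x"] L2_iff[of d1 I] L2_iff[of d2 I] L2_iff[of "\<lambda>x. d1 x - d2 x" I]
      by (simp add: right_diff_distrib)
    fix \<phi> assume \<phi>: "\<phi> \<in> test_functions I"
    have \<phi>U: "\<phi> \<in> test_functions UNIV" "\<phi> \<in> test_functions (- {0})" using \<phi> test_functions_mono I(1) by blast+
    have out: "\<phi> x = 0" if "x \<notin> I" for x using \<phi> that by (auto simp: test_functions_iff)
    have i: "integrable lborel (\<lambda>x. indicator (- {0}) x * d x * \<phi> x)" if "d \<in> L2 (- {0})" for d
      by (intro L2_UNIV_mult off0_L2 that test_L2 \<phi>U)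
    have "(LINT x:I|lborel. (d1 x - d2 x) * \<phi> x) = (LINT x|lborel. indicator (- {0}) x * d1 x * \<phi> x - indicator (- {0}) x * d2 x * \<phi> x)"
      unfolding set_lebesgue_integral_def
    proof (rule Bochner_Integration.integral_cong[OF refl])
      fix x show "indicator I x *\<^sub>R ((d1 x - d2 x) * \<phi> x) = indicator (- {0}) x * d1 x * \<phi> x - indicator (- {0}) x * d2 x * \<phi> x"
      proof (cases "x \<in> I")
        case True
        then have "x \<noteq> 0" using I(1) by auto
        then show ?thesis using True by (simp add: algebra_simps)
      qed (simp add: out)
    qed
    also have "\<dots> = (LINT x:- {0}|lborel. d1 x * \<phi> x) - (LINT x:- {0}|lborel. d2 x * \<phi> x)"
      using i[OF d(1)] i[OF d(2)] by (subst Bochner_Integration.integral_diff) (auto simp: set_lebesgue_integral_def mult.assoc)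
    also have "\<dots> = 0" using wd \<phi>U(2) by (auto simp: has_weak_deriv_def)
    finally show "(LINT x:I|lborel. (d1 x - d2 x) * \<phi> x) = 0" .
  qed
  have "AE x in lborel. x \<in> {0<..} \<longrightarrow> d1 x - d2 x = 0" "AE x in lborel. x \<in> {..<0} \<longrightarrow> d1 x - d2 x = 0"
    by (rule half; auto simp: is_interval_1 emeasure_half_lines)+
  then show ?thesis using AE_lborel_singleton[of "0::real"] 
    by eventually_elim (metis eq_iff_diff_eq_0 greaterThan_iff lessThan_iff linorder_neqE_linordered_idom)
qed

lemma set_integral_off0: "(LINT x:- {0}|lborel. f x) = (LINT x:UNIV|lborel. f x)" if "f \<in> borel_measurable borel" for f :: "real \<Rightarrow> real"
  unfolding set_lebesgue_integral_def
  using AE_lborel_singleton[of "0::real"] that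
  by (intro integral_cong_AE) (auto simp: indicator_def elim!: eventually_mono)

lemma has_weak_deriv_off0:
  assumes "has_weak_deriv UNIV f d" "f \<in> L2 UNIV" "d \<in> L2 UNIV"
  shows "has_weak_deriv (- {0}) f d"
  unfolding has_weak_deriv_def
proof
  fix \<phi> assume "\<phi> \<in> test_functions (- {0})"
  then have \<phi>: "\<phi> \<in> test_functions UNIV" using test_functions_mono by blast
  have "(\<lambda>x. f x * deriv \<phi> x) \<in> borel_measurable borel" "(\<lambda>x. d x * \<phi> x) \<in> borel_measurable borel"
    using assms test_L2[OF \<phi>] test_L2[OF test_deriv[OF \<phi>]] L2_UNIV_measurable by (auto intro!: borel_measurable_times)
  then show "(LINT x:- {0}|lborel. f x * deriv \<phi> x) = - (LINT x:- {0}|lborel. d x * \<phi> x)"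
    using assms(1) \<phi> by (simp add: set_integral_off0 has_weak_deriv_def)
qed

lemma off0_class: 
  assumes "f \<in> L2 (- {0})" "g \<in> L2 UNIV" "AE x in lborel. f x = g x" 
  shows "off0 f = class_of g"
  using assms(3) AE_lborel_singleton[of "0::real"]
  by (subst class_of_eq_iff[OF off0_L2[OF assms(1)] assms(2)], eventually_elim) (simp add: indicator_def)

lemma L2_off0: "f \<in> L2 UNIV \<Longrightarrow> f \<in> L2 (- {0})"
  by (rule L2_subset) auto

lemma has_weak_deriv_cong:
  assumes "AE x in lborel. f x = f' x" "f \<in> L2 (- {0})" "f' \<in> L2 (- {0})" "has_weak_deriv (- {0}) f d"
  shows "has_weak_deriv (- {0}) f' d"
  unfolding has_weak_deriv_def
proof
  fix \<phi> assume \<phi>: "\<phi> \<in> test_functions (- {0})"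
  then have "\<phi> \<in> test_functions UNIV" using test_functions_mono by blast
  then have m: "deriv \<phi> \<in> borel_measurable borel" using test_L2[OF test_deriv] L2_UNIV_measurable by blast
  have "(LINT x:- {0}|lborel. f x * deriv \<phi> x) = (LINT x:- {0}|lborel. f' x * deriv \<phi> x)"
    unfolding set_lebesgue_integral_def
  proof (rule integral_cong_AE)
    have "(\<lambda>x. (indicator (- {0}) x * g x) * deriv \<phi> x) \<in> borel_measurable borel" if "g \<in> L2 (- {0})" for g
      by (rule borel_measurable_times[OF L2_indicator_measurable[OF that] m])
    then show "(\<lambda>x. indicator (- {0}) x *\<^sub>R (f x * deriv \<phi> x)) \<in> borel_measurable lborel"
      "(\<lambda>x. indicator (- {0}) x *\<^sub>R (f' x * deriv \<phi> x)) \<in> borel_measurable lborel"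
      using assms(2,3) by (simp_all add: mult.assoc)
    show "AE x in lborel. indicator (- {0}) x *\<^sub>R (f x * deriv \<phi> x) = indicator (- {0}) x *\<^sub>R (f' x * deriv \<phi> x)"
      using assms(1) by eventually_elim simp
  qed
  then show "(LINT x:- {0}|lborel. f' x * deriv \<phi> x) = - (LINT x:- {0}|lborel. d x * \<phi> x)"
    using assms(4) \<phi> by (simp add: has_weak_deriv_def)
qed

lemma sobolev2_iff: "f \<in> sobolev 2 \<Omega> \<longleftrightarrow> f \<in> L2 \<Omega> \<and> 
    (\<exists>f'. f' \<in> L2 \<Omega> \<and> (\<exists>f''\<in>L2 \<Omega>. has_weak_deriv \<Omega> f' f'') \<and> has_weak_deriv \<Omega> f f')"
  by (auto simp: numeral_2_eq_2)

lemma H1_weak_deriv_off0: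
  assumes f: "f \<in> H1"
  shows "weak_deriv (- {0}) f \<in> L2 (- {0})" "has_weak_deriv (- {0}) f (weak_deriv (- {0}) f)"
    "AE x in lborel. weak_deriv (- {0}) f x = weak_deriv UNIV f x" "off0 (weak_deriv (- {0}) f) = l2_deriv (class_of f)"
proof -
  note F = H1_class[OF f]
  have wd: "has_weak_deriv (- {0}) f (weak_deriv UNIV f)" by (rule has_weak_deriv_off0[OF F(5,1,4)])
  show 1: "weak_deriv (- {0}) f \<in> L2 (- {0})" "has_weak_deriv (- {0}) f (weak_deriv (- {0}) f)"
    using weak_deriv_spec[OF L2_off0[OF F(4)] wd] .
  show ae: "AE x in lborel. weak_deriv (- {0}) f x = weak_deriv UNIV f x"
    by (rule weak_deriv_off0_unique[OF 1(1) L2_off0[OF F(4)] 1(2) wd])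
  show "off0 (weak_deriv (- {0}) f) = l2_deriv (class_of f)"
    using off0_class[OF 1(1) F(4) ae] F(3) by simp
qed

text \<open>
  The jump condition turns the boundary term of \<open>weak_deriv_jump\<close> into the point interaction
  \<open>Z u(0) v(0)\<close> of the form.
\<close>

lemma dom_A_imp_form:
  assumes g: "g \<in> dom_A Z"
  shows "g \<in> H1" "op_A g \<in> L2 (- {0})" 
    "v \<in> V\<^sub>1 \<Longrightarrow> form Z w (class_of g) v = inner (off0 (op_A g) - w *\<^sub>R class_of g) v"
proof -
  show H: "g \<in> H1" using g by (simp add: dom_A_def)
  note G = H1_weak_deriv_off0[OF H]
  let ?p = "weak_deriv (- {0}) g"
  have "g \<in> sobolev 2 (- {0})" using g by (simp add: dom_A_def)
  then obtain f' f'' where f': "f' \<in> L2 (- {0})" "f'' \<in> L2 (- {0})" "has_weak_deriv (- {0}) f' f''" "has_weak_deriv (- {0}) g f'"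
    unfolding sobolev2_iff by blast
  have "has_weak_deriv (- {0}) ?p f''"
    by (rule has_weak_deriv_cong[OF weak_deriv_off0_unique[OF f'(1) G(1) f'(4) G(2)] f'(1) G(1) f'(3)])
  then have q: "weak_deriv (- {0}) ?p \<in> L2 (- {0})" "has_weak_deriv (- {0}) ?p (weak_deriv (- {0}) ?p)"
    using weak_deriv_spec[OF f'(2)] by blast+
  let ?q = "weak_deriv (- {0}) ?p"
  obtain lp lm where l: "(cont_rep (- {0}) ?p \<longlongrightarrow> lp) (at_right 0)" "(cont_rep (- {0}) ?p \<longlongrightarrow> lm) (at_left 0)"
    "\<And>v. v \<in> V\<^sub>1 \<Longrightarrow> inner (off0 ?p) (l2_deriv v) + inner (off0 ?q) v = - (lp - lm) * cont v 0"
    using weak_deriv_jump[OF G(1) q] by blast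
  have jump: "lp - lm = - Z * cont (class_of g) 0"
    using g tendsto_Lim[OF _ l(1)] tendsto_Lim[OF _ l(2)] cont_class_of(2)[OF H] by (simp add: dom_A_def)
  have opA: "op_A g = (\<lambda>x. - ?q x)" by (simp add: op_A_def)
  have "(\<lambda>x. - 1 * (indicator (- {0}) x * ?q x)) \<in> L2 UNIV" by (intro L2_UNIV_cmult off0_L2 q)
  then have "(\<lambda>x. indicator (- {0}) x * (- ?q x)) \<in> L2 UNIV" by simp
  then show "op_A g \<in> L2 (- {0})" unfolding opA by (rule L2_iff[THEN iffD2])
  have off: "off0 (op_A g) = - off0 ?q"
    using class_of_arith(3)[OF off0_L2[OF q(1)] off0_L2[OF q(1)], of "- 1"] by (simp add: opA)
  show "form Z w (class_of g) v = inner (off0 (op_A g) - w *\<^sub>R class_of g) v" if v: "v \<in> V\<^sub>1"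
  proof -
    have "- (lp - lm) * cont v 0 = Z * cont (class_of g) 0 * cont v 0" unfolding jump by simp
    then have "inner (l2_deriv (class_of g)) (l2_deriv v) - Z * cont (class_of g) 0 * cont v 0 = - inner (off0 ?q) v"
      using l(3)[OF v] unfolding G(4) by linarith
    then show ?thesis by (simp add: form_def off inner_diff_left)
  qed
qed

text \<open>
  Test functions that vanish near \<open>0\<close> give the second weak derivative off the origin. Comparing
  the form with \<open>weak_deriv_jump\<close> for a function that does not vanish at \<open>0\<close> gives the jump.
\<close>

lemma form_imp_dom_A:
  assumes f: "f \<in> L2 UNIV" and V: "class_of f \<in> V\<^sub>1" 
    and form: "\<And>v. v \<in> V\<^sub>1 \<Longrightarrow> form Z w (class_of f) v = inner h v"
  shows "f \<in> dom_A Z" "AE x in lborel. op_A f x = fun_of (h + w *\<^sub>R class_of f) x"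
proof -
  have H: "f \<in> H1" by (rule H1I[OF f V])
  note G = H1_weak_deriv_off0[OF H]
  note F = H1_class[OF H]
  let ?p = "weak_deriv (- {0}) f" and ?k = "h + w *\<^sub>R class_of f"
  define r where "r x = - 1 * fun_of ?k x" for x
  have rL: "r \<in> L2 UNIV" unfolding r_def[abs_def] by (intro L2_UNIV_cmult fun_of_L2)
  have rc: "class_of r = - ?k" unfolding r_def[abs_def] using class_of_arith(3)[OF fun_of_L2 fun_of_L2, of "- 1" ?k] by simp
  have wr: "has_weak_deriv (- {0}) ?p r"
  proof (rule has_weak_deriv_cong)
    show "AE x in lborel. weak_deriv UNIV f x = ?p x" using G(3) by eventually_elim simp
    show "has_weak_deriv (- {0}) (weak_deriv UNIV f) r"
      unfolding has_weak_deriv_def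
    proof
      fix \<phi> assume \<phi>0: "\<phi> \<in> test_functions (- {0})"
      then have \<phi>: "\<phi> \<in> test_functions UNIV" using test_functions_mono by blast
      note T = test_V\<^sub>1[OF \<phi>] test_L2[OF \<phi>] test_L2[OF test_deriv[OF \<phi>]]
      have s: "smooth \<phi>" using \<phi> by (simp add: test_functions_iff)
      have "cont (class_of \<phi>) = \<phi>" by (rule cont_unique[OF smooth_continuous[OF s] T(3) refl])
      moreover have "\<phi> 0 = 0" using \<phi>0 by (auto simp: test_functions_iff)
      ultimately have "inner (l2_deriv (class_of f)) (l2_deriv (class_of \<phi>)) = inner ?k (class_of \<phi>)"
        using form[OF T(1)] by (simp add: form_def inner_add_left)
      then have "(LINT x|lborel. weak_deriv UNIV f x * deriv \<phi> x) = - (LINT x|lborel. r x * \<phi> x)"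
        using F T rc class_of_inner[OF F(4) T(4)] class_of_inner[OF rL T(3)] by (simp add: inner_diff_left inner_add_left)
      moreover have "(\<lambda>x. weak_deriv UNIV f x * deriv \<phi> x) \<in> borel_measurable borel" "(\<lambda>x. r x * \<phi> x) \<in> borel_measurable borel"
        using F T rL L2_UNIV_measurable by (auto intro!: borel_measurable_times)
      ultimately show "(LINT x:- {0}|lborel. weak_deriv UNIV f x * deriv \<phi> x) = - (LINT x:- {0}|lborel. r x * \<phi> x)"
        by (simp add: set_integral_off0) (simp add: set_lebesgue_integral_def)
    qed
  qed (use G F L2_off0 in auto)
  let ?q = "weak_deriv (- {0}) ?p"
  have q: "?q \<in> L2 (- {0})" "has_weak_deriv (- {0}) ?p ?q"
    using weak_deriv_spec[OF L2_off0[OF rL] wr] .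
  have qr: "AE x in lborel. ?q x = r x" by (rule weak_deriv_off0_unique[OF q(1) L2_off0[OF rL] q(2) wr])
  then show "AE x in lborel. op_A f x = fun_of ?k x"
    by eventually_elim (simp add: op_A_def r_def)
  obtain lp lm where l: "(cont_rep (- {0}) ?p \<longlongrightarrow> lp) (at_right 0)" "(cont_rep (- {0}) ?p \<longlongrightarrow> lm) (at_left 0)"
    "\<And>v. v \<in> V\<^sub>1 \<Longrightarrow> inner (off0 ?p) (l2_deriv v) + inner (off0 ?q) v = - (lp - lm) * cont v 0"
    using weak_deriv_jump[OF G(1) q] by blast
  have offq: "off0 ?q = - ?k" using off0_class[OF q(1) rL qr] rc by simp
  obtain v where v: "v \<in> V\<^sub>1" "cont v 0 \<noteq> 0"
  proof -
    have "(- 1::real) < 1" by simp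
    then obtain \<psi> :: "nat \<Rightarrow> real \<Rightarrow> real" where \<psi>: "\<And>n. smooth (\<psi> n)" "\<And>n x. 0 \<le> \<psi> n x \<and> \<psi> n x \<le> 1"
      "\<And>n x. x \<notin> {-1<..<1} \<Longrightarrow> \<psi> n x = 0" "\<And>x. x \<in> {-1<..<1} \<Longrightarrow> (\<lambda>n. \<psi> n x) \<longlonglongrightarrow> 1"
      by (rule smooth_cutoffs) blast
    obtain n where n: "\<psi> n 0 \<noteq> 0"
    proof -
      have "\<forall>\<^sub>F n in sequentially. 0 < \<psi> n 0" using order_tendstoD(1)[OF \<psi>(4)[of 0], of 0] by simp
      then obtain n where "0 < \<psi> n 0" using eventually_happens'[OF sequentially_bot] by blast
      then show thesis using that[of n] by simp
    qed
    have t: "\<psi> n \<in> test_functions UNIV"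
      unfolding test_functions_iff using \<psi>(1,3) by (intro conjI exI[of _ "{-1..1}"]) auto
    have "cont (class_of (\<psi> n)) = \<psi> n" by (rule cont_unique[OF smooth_continuous[OF \<psi>(1)] test_L2[OF t] refl])
    then show thesis using that[OF test_V\<^sub>1(1)[OF t]] n by simp
  qed
  have "- (lp - lm) * cont v 0 = Z * cont (class_of f) 0 * cont v 0"
    using l(3)[OF v(1)] form[OF v(1)] unfolding G(4) offq form_def
    by (simp only: inner_minus_left inner_add_left inner_scaleR_left)
  then have "(- (lp - lm) - Z * cont (class_of f) 0) * cont v 0 = 0" by (simp only: left_diff_distrib)
  then have jump: "lp - lm = - Z * cont (class_of f) 0" using v(2) by simp
  have "f \<in> sobolev 2 (- {0})"
    unfolding sobolev2_iff using L2_off0[OF f] G(1,2) L2_off0[OF rL] wr by blast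
  then show "f \<in> dom_A Z"
    using H jump tendsto_Lim[OF _ l(1)] tendsto_Lim[OF _ l(2)] cont_class_of(2)[OF H] by (simp add: dom_A_def)
qed

section \<open>The nonlinearity\<close>

text \<open>
  On one side of \<open>0\<close> this is the mean value theorem. Between arguments of opposite sign it
  follows from \<open>P 0 = 0\<close> or from the symmetry, for the even and for the odd extension alike.
\<close>

lemma real_power_Lipschitz:
  assumes P: "is_real_power q P" and q: "1 < q" and st: "\<bar>s\<bar> \<le> R" "\<bar>t\<bar> \<le> R"
  shows "\<bar>P s - P t\<bar> \<le> q * R powr (q - 1) * \<bar>s - t\<bar>"
proof -
  define C where "C = q * R powr (q - 1)"
  have C0: "0 \<le> C" using q by (simp add: C_def)
  have nn: "P s = s powr q" if "0 \<le> s" for s using P that by (simp add: is_real_power_def)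
  have le: "s powr q \<le> C * s" if s: "0 \<le> s" "s \<le> R" for s
  proof (cases "s = 0")
    case False
    have "s powr q = s powr (q - 1) * s"
      using powr_add[of s "q - 1" 1] s by simp
    also have "\<dots> \<le> R powr (q - 1) * s" using s q by (intro mult_right_mono powr_mono2) auto
    also have "\<dots> \<le> C * s" using s q unfolding C_def by (intro mult_right_mono) (auto simp: mult_le_cancel_right1)
    finally show ?thesis .
  qed simp
  have pos: "\<bar>s powr q - t powr q\<bar> \<le> C * \<bar>s - t\<bar>" if nn: "0 \<le> s" "0 \<le> t" "s \<le> R" "t \<le> R" for s t
  proof -
    consider "s = 0" | "t = 0" | "0 < s" "0 < t" using nn by linarith
    then show ?thesis
    proof cases
      case 3
      have "norm (s powr q - t powr q) \<le> C * norm (s - t)"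
      proof (rule field_differentiable_bound[of "{0<..R}" "\<lambda>x. x powr q" "\<lambda>x. q * x powr (q - 1)"])
        show "((\<lambda>x. x powr q) has_field_derivative q * x powr (q - 1)) (at x within {0<..R})" if "x \<in> {0<..R}" for x
          using that by (intro has_field_derivative_at_within[OF has_real_derivative_powr]) auto
        show "norm (q * x powr (q - 1)) \<le> C" if "x \<in> {0<..R}" for x
          using that q unfolding C_def by (auto simp: abs_mult intro!: mult_left_mono powr_mono2)
      qed (use 3 nn in auto)
      then show ?thesis by simp
    qed (use le[of s] le[of t] nn in auto)
  qed
  have opp: "\<bar>P s - P t\<bar> \<le> C * \<bar>s - t\<bar>" if "0 \<le> s" "t \<le> 0" "s \<le> R" "- t \<le> R" for s t
  proof -
    consider "P t = P (- t)" | "P t = - P (- t)" using P unfolding is_real_power_def by (metis minus_minus)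
    then show ?thesis
    proof cases
      case 1
      have "\<bar>P s - P t\<bar> \<le> C * \<bar>s - - t\<bar>" using pos[of s "- t"] nn[of s] nn[of "- t"] that 1 by simp
      also have "\<dots> \<le> C * \<bar>s - t\<bar>" using that C0 by (intro mult_left_mono) auto
      finally show ?thesis .
    next
      case 2
      have "\<bar>P s - P t\<bar> = s powr q + (- t) powr q" using nn[of s] nn[of "- t"] that 2 by simp
      also have "\<dots> \<le> C * s + C * - t" using le[of s] le[of "- t"] that by simp
      also have "\<dots> = C * \<bar>s - t\<bar>" using that by (simp add: algebra_simps)
      finally show ?thesis .
    qed
  qed
  have "\<bar>P s - P t\<bar> \<le> C * \<bar>s - t\<bar>"
  proof -
    consider "0 \<le> s" "0 \<le> t" | "0 \<le> s" "t \<le> 0" | "s \<le> 0" "0 \<le> t" | "s \<le> 0" "t \<le> 0" by linarith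
    then show ?thesis
    proof cases
      case 1 then show ?thesis using pos[of s t] nn st by simp
    next
      case 2 then show ?thesis using opp[of s t] st by simp
    next
      case 3 then show ?thesis using opp[of t s] st by (simp add: abs_minus_commute)
    next
      case 4
      have "\<bar>P s - P t\<bar> = \<bar>P (- s) - P (- t)\<bar>"
        using P unfolding is_real_power_def by (elim conjE disjE) (simp_all add: abs_minus_commute)
      then show ?thesis using pos[of "- s" "- t"] nn[of "- s"] nn[of "- t"] 4 st by (simp add: abs_minus_commute)
    qed
  qed
  then show ?thesis by (simp add: C_def)
qed

lemma fun_of_arith:
  "AE x in lborel. fun_of (a + b) x = fun_of a x + fun_of b x"
  "AE x in lborel. fun_of (a - b) x = fun_of a x - fun_of b x"
  "AE x in lborel. fun_of (c *\<^sub>R a) x = c * fun_of a x"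
  using fun_of_class_of[OF L2_UNIV_add[OF fun_of_L2[of a] fun_of_L2[of b]]] class_of_arith(1)[OF fun_of_L2[of a] fun_of_L2[of b]]
    fun_of_class_of[OF L2_UNIV_diff[OF fun_of_L2[of a] fun_of_L2[of b]]] class_of_arith(2)[OF fun_of_L2[of a] fun_of_L2[of b]]
    fun_of_class_of[OF L2_UNIV_cmult[OF fun_of_L2[of a], of c]] class_of_arith(3)[OF fun_of_L2[of a] fun_of_L2[of a], of c]
  by simp_all

lemma norm_le_pointwise:
  assumes ae: "AE x in lborel. \<bar>fun_of a x\<bar> \<le> L * \<bar>fun_of b x\<bar>" and L: "0 \<le> L"
  shows "norm a \<le> L * norm b"
proof -
  have n: "(norm c)\<^sup>2 = (LINT x|lborel. (fun_of c x)\<^sup>2)" for c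
    using class_of_arith(4)[OF fun_of_L2[of c] fun_of_L2[of c]] by (simp only: power2_norm_eq_inner class_of_fun_of) (simp only: power2_eq_square)
  have "(norm a)\<^sup>2 \<le> (LINT x|lborel. L\<^sup>2 * (fun_of b x)\<^sup>2)"
    unfolding n[of a]
  proof (rule integral_mono_AE)
    show "AE x in lborel. (fun_of a x)\<^sup>2 \<le> L\<^sup>2 * (fun_of b x)\<^sup>2"
      using ae
    proof eventually_elim
      case (elim x)
      then have "\<bar>fun_of a x\<bar>\<^sup>2 \<le> (L * \<bar>fun_of b x\<bar>)\<^sup>2" by (intro power_mono) auto
      then show ?case by (simp add: power_mult_distrib)
    qed
  qed (use L2_UNIV_square[OF fun_of_L2] in auto)
  also have "\<dots> = (L * norm b)\<^sup>2" by (simp add: n[of b, symmetric] power_mult_distrib)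
  finally show ?thesis using L by (auto intro: power2_le_imp_le)
qed

definition superposition :: "(real \<Rightarrow> real) \<Rightarrow> l2 \<Rightarrow> l2" where
  "superposition f a = class_of (\<lambda>x. f (fun_of a x))"

lemma superposition_Lipschitz:
  assumes lip: "\<And>s t. \<bar>f s - f t\<bar> \<le> L * \<bar>s - t\<bar>" and L: "0 \<le> L" and f0: "f 0 = 0"
  shows "AE x in lborel. fun_of (superposition f a) x = f (fun_of a x)"
    "norm (superposition f a - superposition f b) \<le> L * norm (a - b)" "superposition f 0 = 0"
proof -
  have cont: "continuous_on UNIV f"
    by (rule lipschitz_on_continuous_on[of L]) (use lip L in \<open>auto simp: lipschitz_on_def dist_real_def\<close>)
  have L2: "(\<lambda>x. f (fun_of a x)) \<in> L2 UNIV" for a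
  proof (rule L2_UNIV_bound[OF L2_UNIV_cmult[OF fun_of_L2[of a], of L]])
    show "(\<lambda>x. f (fun_of a x)) \<in> borel_measurable borel"
      by (rule measurable_compose[OF L2_UNIV_measurable[OF fun_of_L2] borel_measurable_continuous_onI[OF cont]])
    show "\<bar>f (fun_of a x)\<bar> \<le> \<bar>L * fun_of a x\<bar>" for x using lip[of "fun_of a x" 0] f0 L by (simp add: abs_mult)
  qed
  show ae: "AE x in lborel. fun_of (superposition f a) x = f (fun_of a x)" for a
    unfolding superposition_def by (rule fun_of_class_of[OF L2])
  show le: "norm (superposition f a - superposition f b) \<le> L * norm (a - b)" for a b
  proof (rule norm_le_pointwise[OF _ L])
    show "AE x in lborel. \<bar>fun_of (superposition f a - superposition f b) x\<bar> \<le> L * \<bar>fun_of (a - b) x\<bar>"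
      using ae[of a] ae[of b] fun_of_arith(2)[of "superposition f a" "superposition f b"] fun_of_arith(2)[of a b]
      by eventually_elim (use lip in simp)
  qed
  have "AE x in lborel. fun_of (superposition f 0) x = 0"
  proof -
    have "(0::l2) = class_of (\<lambda>x. 0)" by (simp add: class_of_def zero_l2.abs_eq)
    then have "AE x in lborel. fun_of 0 x = 0" using fun_of_class_of[OF L2_UNIV_0] by simp
    then show ?thesis using ae[of 0] by eventually_elim (simp add: f0)
  qed
  then have "norm (superposition f 0) \<le> 0 * norm (0::l2)"
    by (intro norm_le_pointwise) auto
  then show "superposition f 0 = 0" by simp
qed

section \<open>Small data\<close>

lemma has_vector_derivative_iff_quotient:
  "(u has_vector_derivative z) (at t) \<longleftrightarrow> ((\<lambda>h. norm ((u (t + h) - u t) /\<^sub>R h - z)) \<longlongrightarrow> 0) (at 0)"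
proof -
  have "\<forall>\<^sub>F h in at 0. norm (u (t + h) - u t - h *\<^sub>R z) / norm h = norm ((u (t + h) - u t) /\<^sub>R h - z)"
    unfolding eventually_at_filter
  proof (intro always_eventually allI impI)
    fix h :: real assume h: "h \<noteq> 0"
    then have "(u (t + h) - u t) /\<^sub>R h - z = (u (t + h) - u t - h *\<^sub>R z) /\<^sub>R h"
      by (simp add: scaleR_diff_right)
    then show "norm (u (t + h) - u t - h *\<^sub>R z) / norm h = norm ((u (t + h) - u t) /\<^sub>R h - z)"
      by (simp add: divide_inverse mult.commute)
  qed
  from tendsto_cong[OF this, of 0] show ?thesis
    by (simp add: has_vector_derivative_def has_derivative_at bounded_linear_scaleR_left)
qed

text \<open>
  \<open>exp(- 2 L t) \<parallel>U - V\<parallel>\<^sup>2\<close> is nonincreasing, as the form contributes with a favourable sign.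
\<close>

lemma strong_solutions_unique:
  assumes form: "coercive_form V\<^sub>1 (form Z w) \<theta>" and T: "0 < T"
    and cont: "continuous_on {0..T} U" "continuous_on {0..T} V" and init: "U 0 = V 0"
    and mem: "\<And>t. 0 < t \<Longrightarrow> t < T \<Longrightarrow> U t \<in> V\<^sub>1 \<and> V t \<in> V\<^sub>1"
    and dU: "\<And>t. 0 < t \<Longrightarrow> t < T \<Longrightarrow> (U has_vector_derivative (k t - h t)) (at t)"
    and dV: "\<And>t. 0 < t \<Longrightarrow> t < T \<Longrightarrow> (V has_vector_derivative (k' t - h' t)) (at t)"
    and hU: "\<And>t v. 0 < t \<Longrightarrow> t < T \<Longrightarrow> v \<in> V\<^sub>1 \<Longrightarrow> form Z w (U t) v = inner (h t) v"
    and hV: "\<And>t v. 0 < t \<Longrightarrow> t < T \<Longrightarrow> v \<in> V\<^sub>1 \<Longrightarrow> form Z w (V t) v = inner (h' t) v"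
    and lip: "\<And>t. 0 < t \<Longrightarrow> t < T \<Longrightarrow> norm (k t - k' t) \<le> L * norm (U t - V t)"
  shows "U T = V T"
proof -
  interpret coercive_form V\<^sub>1 "form Z w" \<theta> by (rule form)
  define E where "E t = exp (- (2 * L) * t) * inner (U t - V t) (U t - V t)" for t
  have "E T \<le> E 0"
  proof (rule DERIV_nonpos_imp_decreasing_open[OF less_imp_le[OF T]])
    show "continuous_on {0..T} E" unfolding E_def[abs_def] by (intro continuous_intros cont)
    fix t assume t: "0 < t" "t < T"
    let ?z = "U t - V t" and ?d = "(k t - h t) - (k' t - h' t)"
    have "((\<lambda>t. U t - V t) has_vector_derivative ?d) (at t)"
      by (rule has_vector_derivative_diff[OF dU[OF t] dV[OF t]])
    then have "((\<lambda>t. inner (U t - V t) (U t - V t)) has_derivative (\<lambda>s. inner ?z (s *\<^sub>R ?d) + inner (s *\<^sub>R ?d) ?z)) (at t)"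
      unfolding has_vector_derivative_def by (intro has_derivative_inner)
    moreover have "(\<lambda>s. inner ?z (s *\<^sub>R ?d) + inner (s *\<^sub>R ?d) ?z) = (*) (2 * inner ?z ?d)"
      by (simp add: fun_eq_iff inner_commute)
    ultimately have Di: "((\<lambda>t. inner (U t - V t) (U t - V t)) has_real_derivative 2 * inner ?z ?d) (at t)"
      unfolding has_field_derivative_def by simp
    have De: "((\<lambda>t. exp (- (2 * L) * t)) has_real_derivative exp (- (2 * L) * t) * - (2 * L)) (at t)"
      by (auto intro!: derivative_eq_intros)
    have D: "(E has_real_derivative exp (- (2 * L) * t) * (2 * inner ?z ?d - 2 * L * inner ?z ?z)) (at t)"
      unfolding E_def[abs_def] by (rule DERIV_cong[OF DERIV_mult'[OF De Di]]) (simp add: right_diff_distrib)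
    have zV: "?z \<in> V\<^sub>1" using mem[OF t] by auto
    have "inner (h t - h' t) ?z = form Z w ?z ?z"
      using hU[OF t zV] hV[OF t zV] mem[OF t] zV by (simp add: e_diff inner_diff_left)
    then have "0 \<le> inner (h t - h' t) ?z" using e_nonneg[OF zV] by simp
    moreover have "inner ?z ?d = inner (k t - k' t) ?z - inner (h t - h' t) ?z"
      by (simp add: inner_diff_left inner_diff_right inner_commute)
    moreover have "inner (k t - k' t) ?z \<le> L * inner ?z ?z"
    proof -
      have "inner (k t - k' t) ?z \<le> norm (k t - k' t) * norm ?z" by (rule norm_cauchy_schwarz)
      also have "\<dots> \<le> L * norm ?z * norm ?z" by (intro mult_right_mono lip t) auto
      finally show ?thesis by (simp add: dot_square_norm power2_eq_square)
    qed
    ultimately have "2 * inner ?z ?d - 2 * L * inner ?z ?z \<le> 0" by simp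
    then have "exp (- (2 * L) * t) * (2 * inner ?z ?d - 2 * L * inner ?z ?z) \<le> 0"
      by (simp add: mult_le_0_iff)
    then show "\<exists>y. (E has_real_derivative y) (at t) \<and> y \<le> 0" using D by blast
  qed
  also have "E 0 = 0" using init by (simp add: E_def)
  finally have "inner (U T - V T) (U T - V T) \<le> 0" by (simp add: E_def mult_le_0_iff)
  then have "inner (U T - V T) (U T - V T) = 0" using inner_ge_zero[of "U T - V T"] by linarith
  then show ?thesis by (simp only: inner_eq_zero_iff right_minus_eq)
qed

lemma H1_diff:
  assumes "f \<in> H1" "g \<in> H1"
  shows "(\<lambda>x. f x - g x) \<in> H1" "class_of (\<lambda>x. f x - g x) = class_of f - class_of g"
    "H1_norm (\<lambda>x. f x - g x) = sqrt ((norm (class_of f - class_of g))\<^sup>2 + (norm (l2_deriv (class_of f) - l2_deriv (class_of g)))\<^sup>2)"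
proof -
  note F = H1_class[OF assms(1)] and G = H1_class[OF assms(2)]
  show c: "class_of (\<lambda>x. f x - g x) = class_of f - class_of g" using class_of_arith(2)[OF F(1) G(1)] by simp
  show H: "(\<lambda>x. f x - g x) \<in> H1"
    by (rule H1I[OF L2_UNIV_diff[OF F(1) G(1)]]) (use c V\<^sub>1_diff[OF F(2) G(2)] in simp)
  show "H1_norm (\<lambda>x. f x - g x) = sqrt ((norm (class_of f - class_of g))\<^sup>2 + (norm (l2_deriv (class_of f) - l2_deriv (class_of g)))\<^sup>2)"
    using H1_norm_class[OF H] c V\<^sub>1_diff[OF F(2) G(2)] by simp
qed

text \<open>
  \<open>k\<close> is the class of \<open>f (v t)\<close>. That this function is square integrable is read off from the
  equation.
\<close>

lemma cauchy_solution_class: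
  assumes sol: "cauchy_solution Z w f g I v" and g: "g \<in> L2 UNIV" and I: "I = {0..<T}" "0 < T"
  defines "U \<equiv> \<lambda>t. class_of (v t)"
  shows "\<And>t. t \<in> I \<Longrightarrow> U t \<in> V\<^sub>1" "continuous_on I U" "continuous_on I (\<lambda>t. l2_deriv (U t))" "U 0 = class_of g"
    "\<And>t. t \<in> I \<Longrightarrow> 0 < t \<Longrightarrow> \<exists>h k. (\<forall>x\<in>V\<^sub>1. form Z w (U t) x = inner h x) \<and>
        (U has_vector_derivative (k - h)) (at t) \<and> (AE x in lborel. fun_of k x = f (fun_of (U t) x))"
proof -
  have H: "v t \<in> H1" if "t \<in> I" for t using sol that by (simp add: cauchy_solution_def)
  show V: "U t \<in> V\<^sub>1" if "t \<in> I" for t unfolding U_def using H1_class(2)[OF H[OF that]] .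
  have lim: "((\<lambda>s. H1_norm (\<lambda>x. v s x - v t x)) \<longlongrightarrow> 0) (at t within I)" if "t \<in> I" for t
    using sol that by (simp add: cauchy_solution_def)
  have le: "norm (U s - U t) \<le> H1_norm (\<lambda>x. v s x - v t x)" "norm (l2_deriv (U s) - l2_deriv (U t)) \<le> H1_norm (\<lambda>x. v s x - v t x)"
    if "s \<in> I" "t \<in> I" for s t
    unfolding H1_diff(3)[OF H[OF that(1)] H[OF that(2)]] U_def by (auto intro!: real_le_rsqrt)
  show "continuous_on I U" "continuous_on I (\<lambda>t. l2_deriv (U t))"
    unfolding continuous_on_def
  proof safe
    fix t assume t: "t \<in> I"
    show "(U \<longlongrightarrow> U t) (at t within I)"
      by (rule LIM_zero_cancel, rule Lim_null_comparison[OF _ lim[OF t]])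
         (use le(1)[OF _ t] in \<open>auto simp: eventually_at_filter\<close>)
    show "((\<lambda>t. l2_deriv (U t)) \<longlongrightarrow> l2_deriv (U t)) (at t within I)"
      by (rule LIM_zero_cancel, rule Lim_null_comparison[OF _ lim[OF t]])
         (use le(2)[OF _ t] in \<open>auto simp: eventually_at_filter\<close>)
  qed
  have "0 \<in> I" using I by simp
  then have "v 0 \<in> L2 UNIV" using H1_class(1)[OF H] by blast
  moreover have "AE x in lborel. v 0 x = g x" using sol by (simp add: cauchy_solution_def)
  ultimately show "U 0 = class_of g" unfolding U_def using class_of_eq_iff g by blast
  fix t assume t: "t \<in> I" "0 < t"
  have "v t \<in> dom_A Z \<and>
        (\<exists>ut \<in> L2 UNIV.
           ((\<lambda>h. L2_norm_on UNIV (\<lambda>x. (v (t + h) x - v t x) / h - ut x)) \<longlongrightarrow> 0) (at 0) \<and>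
           (AE x in lborel. ut x + (op_A (v t) x - w * v t x) = f (v t x)))"
    using sol t unfolding cauchy_solution_def by blast
  then obtain ut where dom: "v t \<in> dom_A Z" and ut: "ut \<in> L2 UNIV"
    and qlim: "((\<lambda>h. L2_norm_on UNIV (\<lambda>x. (v (t + h) x - v t x) / h - ut x)) \<longlongrightarrow> 0) (at 0)"
    and eqn: "AE x in lborel. ut x + (op_A (v t) x - w * v t x) = f (v t x)" by blast
  note A = dom_A_imp_form[OF dom]
  define h where "h = off0 (op_A (v t)) - w *\<^sub>R U t"
  \<comment> \<open>By the equation this is the class of \<open>f (v t)\<close>.\<close>
  define k where "k = class_of ut + h"
  have "\<forall>x\<in>V\<^sub>1. form Z w (U t) x = inner h x" using A(3) by (simp add: h_def U_def)
  moreover have "(U has_vector_derivative (k - h)) (at t)"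
    unfolding has_vector_derivative_iff_quotient
  proof (rule Lim_transform_eventually[OF qlim])
    have "\<forall>\<^sub>F h in at 0. t + h \<in> {0<..<T}"
    proof -
      have "((\<lambda>h. t + h) \<longlongrightarrow> t + 0) (at 0)" by (intro tendsto_intros)
      then show ?thesis using t I by (intro topological_tendstoD) auto
    qed
    then show "\<forall>\<^sub>F h' in at 0. L2_norm_on UNIV (\<lambda>x. (v (t + h') x - v t x) / h' - ut x) = norm ((U (t + h') - U t) /\<^sub>R h' - (k - h))"
    proof eventually_elim
      case (elim h')
      have a: "v (t + h') \<in> L2 UNIV" "v t \<in> L2 UNIV" using H1_class(1)[OF H] elim t I by auto
      note d = L2_UNIV_diff[OF a]
      note q = L2_UNIV_cmult[OF d, of "inverse h'"]
      have "(U (t + h') - U t) /\<^sub>R h' - (k - h) = class_of (\<lambda>x. inverse h' * (v (t + h') x - v t x) - ut x)"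
        unfolding U_def k_def by (simp add: class_of_arith(2)[OF a] class_of_arith(3)[OF d d] class_of_arith(2)[OF q ut])
      then have "norm ((U (t + h') - U t) /\<^sub>R h' - (k - h)) = L2_norm_on UNIV (\<lambda>x. inverse h' * (v (t + h') x - v t x) - ut x)"
        by (simp add: norm_class_of[OF L2_UNIV_diff[OF q ut]])
      then show ?case by (simp add: divide_inverse mult.commute)
    qed
  qed
  moreover have "AE x in lborel. fun_of k x = f (fun_of (U t) x)"
    using fun_of_arith(1)[of "class_of ut" h] fun_of_arith(2)[of "off0 (op_A (v t))" "w *\<^sub>R U t"] fun_of_arith(3)[of w "U t"]
      fun_of_class_of[OF ut] fun_of_class_of[OF off0_L2[OF A(2)]] fun_of_class_of[OF H1_class(1)[OF H[OF t(1)]]] eqn AE_lborel_singleton[of "0::real"]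
    by eventually_elim (simp add: k_def h_def U_def)
  ultimately show "\<exists>h k. (\<forall>x\<in>V\<^sub>1. form Z w (U t) x = inner h x) \<and>
        (U has_vector_derivative (k - h)) (at t) \<and> (AE x in lborel. fun_of k x = f (fun_of (U t) x))" by blast
qed

lemma cauchy_solutionI:
  assumes form: "\<And>v. v \<in> V\<^sub>1 \<Longrightarrow> (norm v)\<^sup>2 + (norm (l2_deriv v))\<^sup>2 \<le> form Z w v v / \<theta>" and \<theta>: "0 < \<theta>"
    and g: "g \<in> L2 UNIV" and init: "U 0 = class_of g" and mem: "\<And>t. 0 \<le> t \<Longrightarrow> U t \<in> V\<^sub>1"
    and cont: "\<And>t. 0 \<le> t \<Longrightarrow> ((\<lambda>s. form Z w (U s - U t) (U s - U t)) \<longlongrightarrow> 0) (at t within {0..})"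
    and eqn: "\<And>t. 0 < t \<Longrightarrow> \<exists>h k. (\<forall>v\<in>V\<^sub>1. form Z w (U t) v = inner h v) \<and> (U has_vector_derivative (k - h)) (at t) \<and>
        (AE x in lborel. fun_of k x = f (fun_of (U t) x))"
  shows "cauchy_solution Z w f g {0..} (\<lambda>t. fun_of (U t))"
  unfolding cauchy_solution_def
proof (intro conjI ballI impI)
  have H: "fun_of (U t) \<in> H1" if "0 \<le> t" for t by (rule H1I) (use mem that in auto)
  then show "fun_of (U t) \<in> H1" if "t \<in> {0..}" for t using that by simp
  show "AE x in lborel. fun_of (U 0) x = g x" unfolding init by (rule fun_of_class_of[OF g])
  show "((\<lambda>s. H1_norm (\<lambda>x. fun_of (U s) x - fun_of (U t) x)) \<longlongrightarrow> 0) (at t within {0..})" if t: "t \<in> {0..}" for t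
  proof (rule Lim_null_comparison)
    have "((\<lambda>s. sqrt (form Z w (U s - U t) (U s - U t) / \<theta>)) \<longlongrightarrow> sqrt (0 / \<theta>)) (at t within {0..})"
      using \<theta> t by (intro tendsto_intros cont) auto
    then show "((\<lambda>s. sqrt (form Z w (U s - U t) (U s - U t) / \<theta>)) \<longlongrightarrow> 0) (at t within {0..})" by simp
    show "\<forall>\<^sub>F s in at t within {0..}. norm (H1_norm (\<lambda>x. fun_of (U s) x - fun_of (U t) x)) \<le> sqrt (form Z w (U s - U t) (U s - U t) / \<theta>)"
      unfolding eventually_at_filter
    proof (intro always_eventually allI impI)
      fix s assume "s \<noteq> t" "s \<in> {0..}"
      then have s: "0 \<le> s" by simp
      have "H1_norm (\<lambda>x. fun_of (U s) x - fun_of (U t) x) \<le> sqrt (form Z w (U s - U t) (U s - U t) / \<theta>)"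
        using H1_diff(3)[OF H[OF s] H[of t]] form[of "U s - U t"] V\<^sub>1_diff[OF mem[OF s] mem[of t]] t
        by (simp add: real_sqrt_le_mono)
      moreover have "0 \<le> H1_norm (\<lambda>x. fun_of (U s) x - fun_of (U t) x)" by (simp add: H1_norm_def)
      ultimately show "norm (H1_norm (\<lambda>x. fun_of (U s) x - fun_of (U t) x)) \<le> sqrt (form Z w (U s - U t) (U s - U t) / \<theta>)" by simp
    qed
  qed
  fix t :: real assume t: "t \<in> {0..}" "0 < t"
  obtain h k where h: "\<And>v. v \<in> V\<^sub>1 \<Longrightarrow> form Z w (U t) v = inner h v" and d: "(U has_vector_derivative (k - h)) (at t)"
    and k: "AE x in lborel. fun_of k x = f (fun_of (U t) x)" using eqn[OF t(2)] by blast
  have A: "fun_of (U t) \<in> dom_A Z" "AE x in lborel. op_A (fun_of (U t)) x = fun_of (h + w *\<^sub>R U t) x"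
    using form_imp_dom_A[OF fun_of_L2, of "U t" Z w h] mem h t by auto
  show "fun_of (U t) \<in> dom_A Z" by (rule A(1))
  show "\<exists>ut\<in>L2 UNIV.
       ((\<lambda>h. L2_norm_on UNIV (\<lambda>x. (fun_of (U (t + h)) x - fun_of (U t) x) / h - ut x)) \<longlongrightarrow> 0) (at 0) \<and>
       (AE x in lborel. ut x + (op_A (fun_of (U t)) x - w * fun_of (U t) x) = f (fun_of (U t) x))"
  proof (intro bexI conjI)
    show "fun_of (k - h) \<in> L2 UNIV" by simp
    have "L2_norm_on UNIV (\<lambda>x. (fun_of (U (t + h')) x - fun_of (U t) x) / h' - fun_of (k - h) x) = norm ((U (t + h') - U t) /\<^sub>R h' - (k - h))" for h'
    proof -
      note d = L2_UNIV_diff[OF fun_of_L2[of "U (t + h')"] fun_of_L2[of "U t"]]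
      note q = L2_UNIV_cmult[OF d, of "inverse h'"]
      have "class_of (\<lambda>x. inverse h' * (fun_of (U (t + h')) x - fun_of (U t) x) - fun_of (k - h) x) = (U (t + h') - U t) /\<^sub>R h' - (k - h)"
        by (simp add: class_of_arith(2)[OF q fun_of_L2, symmetric] class_of_arith(3)[OF d d, symmetric] class_of_arith(2)[OF fun_of_L2 fun_of_L2, symmetric])
      then show ?thesis
        using norm_class_of[OF L2_UNIV_diff[OF q fun_of_L2[of "k - h"]]] by (simp add: divide_inverse mult.commute)
    qed
    then show "((\<lambda>h'. L2_norm_on UNIV (\<lambda>x. (fun_of (U (t + h')) x - fun_of (U t) x) / h' - fun_of (k - h) x)) \<longlongrightarrow> 0) (at 0)"
      using d unfolding has_vector_derivative_iff_quotient by simp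
    show "AE x in lborel. fun_of (k - h) x + (op_A (fun_of (U t)) x - w * fun_of (U t) x) = f (fun_of (U t) x)"
      using A(2) k fun_of_arith(2)[of k h] fun_of_arith(1)[of h "w *\<^sub>R U t"] fun_of_arith(3)[of w "U t"]
      by eventually_elim simp
  qed
qed

lemma sup_bound: 
  assumes a: "a \<in> V\<^sub>1" and R: "0 \<le> R" "(norm a)\<^sup>2 + (norm (l2_deriv a))\<^sup>2 \<le> R\<^sup>2"
  shows "AE x in lborel. \<bar>fun_of a x\<bar> \<le> R"
  using cont(2)[OF a]
proof eventually_elim
  case (elim x)
  have "0 \<le> norm a * norm (l2_deriv a)" by simp
  then have "(cont a x)\<^sup>2 \<le> R\<^sup>2"
    using cont_square_le[OF a, of x] sum_squares_bound[of "norm a" "norm (l2_deriv a)"] R(2) by linarith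
  then show ?case using elim R(1) by (metis abs_le_square_iff abs_of_nonneg)
qed

definition truncation :: "real \<Rightarrow> real \<Rightarrow> real" where "truncation R s = max (- R) (min R s)"

lemma truncation_le: "0 \<le> R \<Longrightarrow> \<bar>truncation R s\<bar> \<le> R"
  by (auto simp: truncation_def max_def min_def abs_if)

lemma truncation_Lipschitz: "\<bar>truncation R s - truncation R t\<bar> \<le> \<bar>s - t\<bar>"
  by (auto simp: truncation_def max_def min_def abs_if)

lemma truncation_id: "\<bar>s\<bar> \<le> R \<Longrightarrow> truncation R s = s"
  by (auto simp: truncation_def max_def min_def abs_le_iff)

lemma choice_pair:
  assumes "\<And>s. A s \<Longrightarrow> \<exists>h k. Q s h k" shows "\<exists>h k. \<forall>s. A s \<longrightarrow> Q s (h s) (k s)"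
  using assms by metis

text \<open>
  The solution of the truncated equation keeps its form below the initial value, hence its
  \<open>H\<^sup>1\<close> norm below \<open>R\<close>, and then \<open>sup_bound\<close> removes the truncation.
\<close>

theorem small_data_global:
  fixes f :: "real \<Rightarrow> real" and L :: "real \<Rightarrow> real"
  assumes Z: "(max Z 0)\<^sup>2 / 4 < - w" and f0: "f 0 = 0"
    and lip: "\<And>R s t. 0 < R \<Longrightarrow> \<bar>s\<bar> \<le> R \<Longrightarrow> \<bar>t\<bar> \<le> R \<Longrightarrow> \<bar>f s - f t\<bar> \<le> L R * \<bar>s - t\<bar>"
    and L: "(L \<longlongrightarrow> 0) (at_right 0)"
  shows "\<exists>\<epsilon>>0. \<forall>g\<in>H1. H1_norm g < \<epsilon> \<longrightarrow> globally_well_defined Z w f g"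
proof -
  define \<theta> where "\<theta> = (- 4 * w - (max Z 0)\<^sup>2) / (4 * (1 - w))"
  have cf: "coercive_form V\<^sub>1 (form Z w) \<theta>" using coercive_form_form[OF Z] by (simp add: \<theta>_def)
  interpret coercive_form V\<^sub>1 "form Z w" \<theta> by (rule cf)
  have \<theta>: "0 < \<theta>" by (rule \<mu>_pos)
  have low: "(norm v)\<^sup>2 + (norm (l2_deriv v))\<^sup>2 \<le> form Z w v v / \<theta>" if "v \<in> V\<^sub>1" for v
    using form_coercive(1)[OF that Z] \<theta> unfolding \<theta>_def[symmetric] by (simp add: pos_le_divide_eq mult.commute)
  have Lnn: "0 \<le> L R" if "0 < R" for R using lip[OF that, of R 0] that by (auto simp: zero_le_mult_iff dest: order_trans[OF abs_ge_zero])
  have "\<forall>\<^sub>F R in at_right 0. L R < \<theta> \<and> 0 < R"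
    using order_tendstoD(2)[OF L \<theta>] eventually_at_right_less[of "0::real"] by (rule eventually_conj)
  then obtain R where R: "L R < \<theta>" "0 < R" using eventually_happens'[OF trivial_limit_at_right_real] by blast
  define fR where "fR s = f (truncation R s)" for s
  have fR_lip: "\<bar>fR s - fR t\<bar> \<le> L R * \<bar>s - t\<bar>" for s t
  proof -
    have "\<bar>fR s - fR t\<bar> \<le> L R * \<bar>truncation R s - truncation R t\<bar>"
      unfolding fR_def using R by (intro lip truncation_le) auto
    also have "\<dots> \<le> L R * \<bar>s - t\<bar>" using Lnn[OF R(2)] by (intro mult_left_mono truncation_Lipschitz)
    finally show ?thesis .
  qed
  have fR0: "fR 0 = 0" using R f0 by (simp add: fR_def truncation_id)
  note N = superposition_Lipschitz[OF fR_lip Lnn[OF R(2)] fR0]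
  define C where "C = 1 + \<bar>Z\<bar> + \<bar>w\<bar>"
  have C: "0 < C" by (simp add: C_def add_pos_nonneg)
  \<comment> \<open>Between \<open>\<theta>\<close> and \<open>C\<close> times the squared \<open>H\<^sup>1\<close> norm, the form loses at most the factor \<open>C / \<theta>\<close>.\<close>
  define \<epsilon> where "\<epsilon> = R * sqrt (\<theta> / C)"
  have \<epsilon>: "0 < \<epsilon>" using R \<theta> C by (simp add: \<epsilon>_def)
  have "globally_well_defined Z w f g" if g: "g \<in> H1" "H1_norm g < \<epsilon>" for g
  proof -
    note G = H1_class[OF g(1)]
    have "(H1_norm g)\<^sup>2 \<le> \<epsilon>\<^sup>2" using g(2) by (intro power_mono) (auto simp: H1_norm_def)
    moreover have "(H1_norm g)\<^sup>2 = (norm (class_of g))\<^sup>2 + (norm (l2_deriv (class_of g)))\<^sup>2"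
      using H1_norm_class[OF g(1)] by simp
    moreover have "\<epsilon>\<^sup>2 = R\<^sup>2 * (\<theta> / C)" using \<theta> C by (simp add: \<epsilon>_def power_mult_distrib)
    ultimately have "(norm (class_of g))\<^sup>2 + (norm (l2_deriv (class_of g)))\<^sup>2 \<le> R\<^sup>2 * (\<theta> / C)" by simp
    then have "C * ((norm (class_of g))\<^sup>2 + (norm (l2_deriv (class_of g)))\<^sup>2) \<le> C * (R\<^sup>2 * (\<theta> / C))"
      using C by (intro mult_left_mono) auto
    then have small: "form Z w (class_of g) (class_of g) \<le> R\<^sup>2 * \<theta>"
      using form_upper[OF G(2), of Z w] C by (simp add: C_def[symmetric])
    obtain U where U0: "U 0 = class_of g" 
      and UV: "\<And>t. 0 \<le> t \<Longrightarrow> U t \<in> V\<^sub>1" "\<And>t. 0 \<le> t \<Longrightarrow> form Z w (U t) (U t) \<le> form Z w (class_of g) (class_of g)"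
      and Uc: "\<And>t. 0 \<le> t \<Longrightarrow> ((\<lambda>s. form Z w (U s - U t) (U s - U t)) \<longlongrightarrow> 0) (at t within {0..})"
      and Ud: "\<And>t. 0 < t \<Longrightarrow> \<exists>h. (\<forall>v\<in>V\<^sub>1. form Z w (U t) v = inner h v) \<and> (U has_vector_derivative (superposition fR (U t) - h)) (at t)"
      using semilinear_global_solution[OF N(2) Lnn[OF R(2)] R(1) N(3) G(2)] by blast
    have Usup: "(norm (U t))\<^sup>2 + (norm (l2_deriv (U t)))\<^sup>2 \<le> R\<^sup>2" if "0 \<le> t" for t
    proof -
      have "form Z w (U t) (U t) / \<theta> \<le> R\<^sup>2 * \<theta> / \<theta>"
        using UV(2)[OF that] small \<theta> by (intro divide_right_mono) auto
      then show ?thesis using low[OF UV(1)[OF that]] \<theta> by simp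
    qed
    have Ueq: "\<exists>h k. (\<forall>v\<in>V\<^sub>1. form Z w (U t) v = inner h v) \<and> (U has_vector_derivative (k - h)) (at t) \<and>
        (AE x in lborel. fun_of k x = f (fun_of (U t) x))" if t: "0 < t" for t
    proof -
      obtain h where h: "\<forall>v\<in>V\<^sub>1. form Z w (U t) v = inner h v" "(U has_vector_derivative (superposition fR (U t) - h)) (at t)"
        using Ud[OF t] by blast
      moreover have "AE x in lborel. fun_of (superposition fR (U t)) x = f (fun_of (U t) x)"
      proof -
        have "AE x in lborel. \<bar>fun_of (U t) x\<bar> \<le> R" by (rule sup_bound[OF UV(1) _ Usup]) (use t R in auto)
        then show ?thesis using N(1)[of "U t"]
        proof eventually_elim
          case (elim x)
          have "fR (fun_of (U t) x) = f (fun_of (U t) x)" using elim(1) by (simp add: fR_def truncation_id)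
          then show ?case using elim(2) by simp
        qed
      qed
      ultimately show ?thesis by blast
    qed
    have sol: "cauchy_solution Z w f g {0..} (\<lambda>t. fun_of (U t))"
      by (rule cauchy_solutionI[OF low \<theta> G(1) U0 UV(1) Uc Ueq])
    have contU: "continuous_on {0..} U"
      unfolding continuous_on_def
    proof
      fix t :: real assume t: "t \<in> {0..}"
      have "((\<lambda>s. sqrt (form Z w (U s - U t) (U s - U t) / \<theta>)) \<longlongrightarrow> sqrt (0 / \<theta>)) (at t within {0..})"
        using \<theta> t by (intro tendsto_intros Uc) auto
      then have "((\<lambda>s. U s - U t) \<longlongrightarrow> 0) (at t within {0..})"
      proof (intro Lim_null_comparison[of "\<lambda>s. U s - U t"])
        show "\<forall>\<^sub>F s in at t within {0..}. norm (U s - U t) \<le> sqrt (form Z w (U s - U t) (U s - U t) / \<theta>)"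
          unfolding eventually_at_filter
        proof (intro always_eventually allI impI)
          fix s assume "s \<noteq> t" "s \<in> {0..}"
          then have "U s - U t \<in> V\<^sub>1" using UV(1) t by auto
          from low[OF this] show "norm (U s - U t) \<le> sqrt (form Z w (U s - U t) (U s - U t) / \<theta>)"
            using zero_le_power2[of "norm (l2_deriv (U s - U t))"] by (intro real_le_rsqrt) linarith
        qed
      qed simp
      then show "(U \<longlongrightarrow> U t) (at t within {0..})" by (rule LIM_zero_cancel)
    qed
    have unique: "AE x in lborel. v t x = fun_of (U t) x"
      if v: "cauchy_solution Z w f g {0..<T} v" and T: "0 < T" "t \<in> {0..<T}" for T v t
    proof -
      define V where "V t = class_of (v t)" for t
      note vc = cauchy_solution_class[OF v G(1) refl T(1), folded V_def]
      have "V t = U t"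
      proof (cases "t = 0")
        case True
        then show ?thesis using vc(4) U0 by simp
      next
        case False
        then have t: "0 < t" "t < T" using T by auto
        have sub: "{0..t} \<subseteq> {0..<T}" using t by auto
        have "compact ((\<lambda>s. (norm (V s))\<^sup>2 + (norm (l2_deriv (V s)))\<^sup>2) ` {0..t})"
          by (intro compact_continuous_image continuous_intros continuous_on_subset[OF vc(2) sub] continuous_on_subset[OF vc(3) sub]) auto
        then obtain B where B: "\<And>s. s \<in> {0..t} \<Longrightarrow> norm ((norm (V s))\<^sup>2 + (norm (l2_deriv (V s)))\<^sup>2) \<le> B"
          using compact_imp_bounded by (fastforce simp: bounded_iff)
        \<comment> \<open>A common pointwise bound of both solutions up to time \<open>t\<close>.\<close>
        define M where "M = max R (sqrt (max 0 B))"
        have M: "0 < M" "R \<le> M" using R by (auto simp: M_def)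
        have Vsup: "AE x in lborel. \<bar>fun_of (V s) x\<bar> \<le> M" if s: "s \<in> {0..t}" for s
        proof (rule sup_bound[OF vc(1)])
          have "(norm (V s))\<^sup>2 + (norm (l2_deriv (V s)))\<^sup>2 \<le> (sqrt (max 0 B))\<^sup>2" using B[OF s] by simp
          also have "\<dots> \<le> M\<^sup>2" by (intro power_mono) (auto simp: M_def)
          finally show "(norm (V s))\<^sup>2 + (norm (l2_deriv (V s)))\<^sup>2 \<le> M\<^sup>2" .
        qed (use s sub M in auto)
        have "\<exists>h k. (\<forall>x\<in>V\<^sub>1. form Z w (V s) x = inner h x) \<and> (V has_vector_derivative (k - h)) (at s) \<and>
            (AE x in lborel. fun_of k x = f (fun_of (V s) x))" if "0 < s" "s < t" for s
          by (rule vc(5)) (use that t in auto)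
        then have "\<exists>h' k'. \<forall>s. 0 < s \<and> s < t \<longrightarrow> (\<forall>x\<in>V\<^sub>1. form Z w (V s) x = inner (h' s) x) \<and>
            (V has_vector_derivative (k' s - h' s)) (at s) \<and> (AE x in lborel. fun_of (k' s) x = f (fun_of (V s) x))"
          by (intro choice_pair[where A = "\<lambda>s. 0 < s \<and> s < t"]) (erule conjE)
        then obtain h' k' where V': "\<And>s x. 0 < s \<Longrightarrow> s < t \<Longrightarrow> x \<in> V\<^sub>1 \<Longrightarrow> form Z w (V s) x = inner (h' s) x"
          "\<And>s. 0 < s \<Longrightarrow> s < t \<Longrightarrow> (V has_vector_derivative (k' s - h' s)) (at s)"
          "\<And>s. 0 < s \<Longrightarrow> s < t \<Longrightarrow> AE x in lborel. fun_of (k' s) x = f (fun_of (V s) x)"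
          by blast
        have "\<exists>h k. \<forall>s. 0 < s \<longrightarrow> (\<forall>x\<in>V\<^sub>1. form Z w (U s) x = inner (h s) x) \<and>
            (U has_vector_derivative (k s - h s)) (at s) \<and> (AE x in lborel. fun_of (k s) x = f (fun_of (U s) x))"
          by (rule choice_pair[OF Ueq])
        then obtain h k where U': "\<And>s x. 0 < s \<Longrightarrow> x \<in> V\<^sub>1 \<Longrightarrow> form Z w (U s) x = inner (h s) x"
          "\<And>s. 0 < s \<Longrightarrow> (U has_vector_derivative (k s - h s)) (at s)"
          "\<And>s. 0 < s \<Longrightarrow> AE x in lborel. fun_of (k s) x = f (fun_of (U s) x)"
          by blast
        show ?thesis
        proof (rule strong_solutions_unique[OF cf t(1), where L = "L M"])
          show "continuous_on {0..t} V" by (rule continuous_on_subset[OF vc(2) sub])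
          show "continuous_on {0..t} U" by (rule continuous_on_subset[OF contU]) auto
          show "V 0 = U 0" using vc(4) U0 by simp
          show "V s \<in> V\<^sub>1 \<and> U s \<in> V\<^sub>1" if "0 < s" "s < t" for s using vc(1)[of s] UV(1)[of s] that t by simp
          show "norm (k' s - k s) \<le> L M * norm (V s - U s)" if s: "0 < s" "s < t" for s
          proof (rule norm_le_pointwise)
            show "AE x in lborel. \<bar>fun_of (k' s - k s) x\<bar> \<le> L M * \<bar>fun_of (V s - U s) x\<bar>"
            proof -
              have "AE x in lborel. \<bar>fun_of (V s) x\<bar> \<le> M" using Vsup s by simp
              moreover have "AE x in lborel. \<bar>fun_of (U s) x\<bar> \<le> R"
                by (rule sup_bound[OF UV(1) _ Usup]) (use s R in auto)
              ultimately show ?thesis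
                using V'(3)[OF s] U'(3)[OF s(1)] fun_of_arith(2)[of "k' s" "k s"] fun_of_arith(2)[of "V s" "U s"]
              proof eventually_elim
                case (elim x)
                have "\<bar>f (fun_of (V s) x) - f (fun_of (U s) x)\<bar> \<le> L M * \<bar>fun_of (V s) x - fun_of (U s) x\<bar>"
                  by (rule lip[OF M(1)]) (use elim M in auto)
                then show ?case using elim by simp
              qed
            qed
          qed (rule Lnn[OF M(1)])
        qed (use V' U' in auto)
      qed
      moreover have "v t \<in> H1" using v T(2) by (simp add: cauchy_solution_def)
      ultimately show ?thesis
        using fun_of_class_of[OF H1_class(1)[of "v t"]] by (simp add: V_def eq_commute)
    qed
    show ?thesis unfolding globally_well_defined_def using sol unique by blast
  qed
  then show ?thesis using \<epsilon> by blast
qed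

theorem theorem3:
  fixes a b p w Z :: real and P Q :: "real \<Rightarrow> real"
  assumes "p > 1"
    and "is_real_power p P" and "is_real_power (2 * p - 1) Q"
  shows "(Z > 0 \<and> Z\<^sup>2 / 4 < - w \<longrightarrow>
           (\<exists>\<epsilon>>0. \<forall>g\<in>H1. H1_norm g < \<epsilon> \<longrightarrow>
             globally_well_defined Z w (\<lambda>s. a * P s + b * Q s) g)) \<and>
         (Z \<le> 0 \<and> 0 < - w \<longrightarrow>
           (\<exists>\<epsilon>>0. \<forall>g\<in>H1. H1_norm g < \<epsilon> \<longrightarrow>
             globally_well_defined Z w (\<lambda>s. a * P s + b * Q s) g))"
proof -
  let ?f = "\<lambda>s. a * P s + b * Q s"
  define L where "L R = \<bar>a\<bar> * (p * R powr (p - 1)) + \<bar>b\<bar> * ((2 * p - 1) * R powr (2 * p - 1 - 1))" for R :: real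
  have f0: "?f 0 = 0" using assms(2,3) by (simp add: is_real_power_def)
  have lip: "\<bar>?f s - ?f t\<bar> \<le> L R * \<bar>s - t\<bar>" if "\<bar>s\<bar> \<le> R" "\<bar>t\<bar> \<le> R" for R s t
  proof -
    have "?f s - ?f t = a * (P s - P t) + b * (Q s - Q t)" by (simp add: algebra_simps)
    then have "\<bar>?f s - ?f t\<bar> \<le> \<bar>a\<bar> * \<bar>P s - P t\<bar> + \<bar>b\<bar> * \<bar>Q s - Q t\<bar>"
      using abs_triangle_ineq[of "a * (P s - P t)" "b * (Q s - Q t)"] by (simp add: abs_mult)
    also have "\<dots> \<le> \<bar>a\<bar> * (p * R powr (p - 1) * \<bar>s - t\<bar>) + \<bar>b\<bar> * ((2 * p - 1) * R powr (2 * p - 1 - 1) * \<bar>s - t\<bar>)"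
      using assms that by (intro add_mono mult_left_mono real_power_Lipschitz) auto
    finally show ?thesis by (simp add: L_def algebra_simps)
  qed
  have L: "(L \<longlongrightarrow> 0) (at_right 0)"
  proof -
    have pw: "((\<lambda>R::real. R powr q) \<longlongrightarrow> 0) (at_right 0)" if "0 < q" for q
      by (rule tendsto_zero_powrI[OF tendsto_ident_at tendsto_const _ that])
         (auto simp: eventually_at_filter)
    have "(L \<longlongrightarrow> \<bar>a\<bar> * (p * 0) + \<bar>b\<bar> * ((2 * p - 1) * 0)) (at_right 0)"
      unfolding L_def[abs_def] using assms(1) by (intro tendsto_intros pw) auto
    then show ?thesis by simp
  qed
  show ?thesis
    using small_data_global[of Z w ?f L, OF _ f0 lip L] by (auto simp: max_def)
qed

end
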